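(* Suppose $c^2<1$, $\beta<\beta_*=2\sqrt{1-c^2}$, $\varphi\in\mathscr G(\beta,c)$ and $\vec\varphi=(\varphi,-c\varphi)$. Then the orbit $\mathcal O_{\vec\varphi}$ is $\mathscr X$-unstable in each of the following cases: (i) $c^2<\frac{p-1}{p+3}c_*^2$; (ii) $p\ge9$ and $\beta<\dfrac{(p-1)(p-9)}{(p-1)^2+16}\,\beta_*$.
   Context: Setting: - $p\ge2$, $f\in C^2$ homogeneous of degree $p$ (i.e. $f(\lambda s)=\lambda^pf(s)$ for $\lambda>0$), and $F=\int_0^sf$, taking a positive value somewhere. - $\mathscr X=H^2\times L^2$. - Evolution system: $u_t=v_x$, $v_t=(u+\beta u_{xx}+u_{xxxx}-f(u))_x$. - $c_*=\sqrt{1-\beta_+^2/4}$, where $\beta_+=\max\{\beta,0\}$. Ground states: - $I(u)=\int u_{xx}^2-\beta u_x^2+(1-c^2)u^2$ and $K(u)=(p+1)\int F(u)$. - $m(\beta,c)=\inf\{I/K^{2/(p+1)}:K>0\}$. - $\mathscr G(\beta,c)=\{\varphi\in H^2:I(\varphi)=K(\varphi)=m^{(p+1)/(p-1)}\}$. Orbits and instability: - $\mathcal O_{\vec\varphi}=\{\vec\varphi(\cdot+r):r\in\mathbb R\}$. - A set $S\subseteq\mathscr X$ is $\mathscr X$-stable if for every $\epsilon>0$ there is $\delta>0$ such that solutions with initial data within $\mathscr X$-distance $\delta$ of $S$ exist for all $t>0$ and remain within distance $\epsilon$ of $S$. - $S$ is $\mathscr X$-unstable otherwise. *)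

theory Defs
  imports "HOL-Analysis.Analysis"
begin

definition L2 :: "(real \<Rightarrow> real) \<Rightarrow> bool" where
  "L2 u \<longleftrightarrow> u \<in> borel_measurable lborel \<and> integrable lborel (\<lambda>x. (u x)\<^sup>2)"

definition loc_int :: "(real \<Rightarrow> real) \<Rightarrow> bool" where
  "loc_int u \<longleftrightarrow> (\<forall>a b. set_integrable lborel {a..b} u)"

definition test_fun :: "(real \<Rightarrow> real) \<Rightarrow> bool" where
  "test_fun \<phi> \<longleftrightarrow> (\<forall>k x. ((deriv ^^ k) \<phi>) differentiable (at x))
      \<and> (\<exists>R. \<forall>x. R < \<bar>x\<bar> \<longrightarrow> \<phi> x = 0)"

definition weak_deriv :: "(real \<Rightarrow> real) \<Rightarrow> (real \<Rightarrow> real) \<Rightarrow> bool" where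
  "weak_deriv u g \<longleftrightarrow> loc_int u \<and> loc_int g \<and>
     (\<forall>\<phi>. test_fun \<phi> \<longrightarrow>
        (LINT x|lborel. u x * deriv \<phi> x) = - (LINT x|lborel. g x * \<phi> x))"

definition H2 :: "(real \<Rightarrow> real) \<Rightarrow> bool" where
  "H2 u \<longleftrightarrow> L2 u \<and> (\<exists>u1 u2. weak_deriv u u1 \<and> weak_deriv u1 u2 \<and> L2 u1 \<and> L2 u2)"

definition d1 :: "(real \<Rightarrow> real) \<Rightarrow> real \<Rightarrow> real" where
  "d1 u = (SOME u1. \<exists>u2. weak_deriv u u1 \<and> weak_deriv u1 u2 \<and> L2 u1 \<and> L2 u2)"

definition d2 :: "(real \<Rightarrow> real) \<Rightarrow> real \<Rightarrow> real" where
  "d2 u = (SOME u2. weak_deriv (d1 u) u2 \<and> L2 u2)"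

type_synonym state = "(real \<Rightarrow> real) \<times> (real \<Rightarrow> real)"

definition in_X :: "state \<Rightarrow> bool" where
  "in_X U \<longleftrightarrow> H2 (fst U) \<and> L2 (snd U)"

definition X_norm :: "state \<Rightarrow> real" where
  "X_norm U = sqrt ((LINT x|lborel. (fst U x)\<^sup>2) + (LINT x|lborel. (d1 (fst U) x)\<^sup>2)
      + (LINT x|lborel. (d2 (fst U) x)\<^sup>2) + (LINT x|lborel. (snd U x)\<^sup>2))"

definition X_dist :: "state \<Rightarrow> state \<Rightarrow> real" where
  "X_dist U W = X_norm (\<lambda>x. fst U x - fst W x, \<lambda>x. snd U x - snd W x)"

definition X_dist_set :: "state \<Rightarrow> state set \<Rightarrow> real" where
  "X_dist_set U S = Inf (X_dist U ` S)"

definition Fprim :: "(real \<Rightarrow> real) \<Rightarrow> real \<Rightarrow> real" where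
  "Fprim f s = (LBINT y=ereal 0..ereal s. f y)"

definition I_fun :: "real \<Rightarrow> real \<Rightarrow> (real \<Rightarrow> real) \<Rightarrow> real" where
  "I_fun \<beta> c u = (LINT x|lborel. (d2 u x)\<^sup>2 - \<beta> * (d1 u x)\<^sup>2 + (1 - c\<^sup>2) * (u x)\<^sup>2)"

definition K_fun :: "real \<Rightarrow> (real \<Rightarrow> real) \<Rightarrow> (real \<Rightarrow> real) \<Rightarrow> real" where
  "K_fun p f u = (p + 1) * (LINT x|lborel. Fprim f (u x))"

definition m_val :: "real \<Rightarrow> (real \<Rightarrow> real) \<Rightarrow> real \<Rightarrow> real \<Rightarrow> real" where
  "m_val p f \<beta> c = Inf {I_fun \<beta> c u / (K_fun p f u) powr (2 / (p + 1)) | u. H2 u \<and> K_fun p f u > 0}"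

definition ground_states :: "real \<Rightarrow> (real \<Rightarrow> real) \<Rightarrow> real \<Rightarrow> real \<Rightarrow> (real \<Rightarrow> real) set" where
  "ground_states p f \<beta> c = {\<phi>. H2 \<phi> \<and> I_fun \<beta> c \<phi> = m_val p f \<beta> c powr ((p + 1) / (p - 1))
                              \<and> K_fun p f \<phi> = m_val p f \<beta> c powr ((p + 1) / (p - 1))}"

definition orbit :: "state \<Rightarrow> state set" where
  "orbit \<Phi> = {(\<lambda>x. fst \<Phi> (x + r), \<lambda>x. snd \<Phi> (x + r)) | r. True}"

definition pt :: "(real \<Rightarrow> real \<Rightarrow> real) \<Rightarrow> real \<Rightarrow> real \<Rightarrow> real" where
  "pt \<psi> = (\<lambda>t x. deriv (\<lambda>s. \<psi> s x) t)"

definition px :: "(real \<Rightarrow> real \<Rightarrow> real) \<Rightarrow> real \<Rightarrow> real \<Rightarrow> real" where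
  "px \<psi> = (\<lambda>t x. deriv (\<lambda>y. \<psi> t y) x)"

definition pder :: "bool list \<Rightarrow> (real \<Rightarrow> real \<Rightarrow> real) \<Rightarrow> real \<Rightarrow> real \<Rightarrow> real" where
  "pder w \<psi> = foldr (\<lambda>b g. if b then pt g else px g) w \<psi>"

definition st_test :: "ereal \<Rightarrow> (real \<Rightarrow> real \<Rightarrow> real) \<Rightarrow> bool" where
  "st_test T \<psi> \<longleftrightarrow>
     (\<forall>w. continuous_on UNIV (\<lambda>z. pder w \<psi> (fst z) (snd z))
        \<and> (\<forall>t x. (\<lambda>s. pder w \<psi> s x) differentiable (at t)
                \<and> (\<lambda>y. pder w \<psi> t y) differentiable (at x)))
     \<and> (\<exists>a b R. 0 < a \<and> ereal b < T \<and>
           (\<forall>t x. (t < a \<or> b < t \<or> R < \<bar>x\<bar>) \<longrightarrow> \<psi> t x = 0))"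

text \<open>U solves u_t = v_x, v_t = (u + beta u_xx + u_xxxx - f(u))_x on [0,T).\<close>
definition is_solution :: "real \<Rightarrow> (real \<Rightarrow> real) \<Rightarrow> ereal \<Rightarrow> (real \<Rightarrow> state) \<Rightarrow> bool" where
  "is_solution \<beta> f T U \<longleftrightarrow> 0 < T \<and>
     (\<forall>t. 0 \<le> t \<and> ereal t < T \<longrightarrow> in_X (U t)) \<and>
     (\<forall>t. 0 \<le> t \<and> ereal t < T \<longrightarrow>
         ((\<lambda>s. X_dist (U s) (U t)) \<longlongrightarrow> 0) (at t within {s. 0 \<le> s \<and> ereal s < T})) \<and>
     (\<forall>\<psi>. st_test T \<psi> \<longrightarrow>
        (LINT t|lborel. LINT x|lborel.
            fst (U t) x * pt \<psi> t x - snd (U t) x * px \<psi> t x) = 0 \<and>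
        (LINT t|lborel. LINT x|lborel. snd (U t) x * pt \<psi> t x) =
        (LINT t|lborel. LINT x|lborel.
            fst (U t) x * px \<psi> t x
          + \<beta> * fst (U t) x * pder [False, False, False] \<psi> t x
          + fst (U t) x * pder [False, False, False, False, False] \<psi> t x
          - f (fst (U t) x) * px \<psi> t x))"

definition X_stable :: "real \<Rightarrow> (real \<Rightarrow> real) \<Rightarrow> state set \<Rightarrow> bool" where
  "X_stable \<beta> f S \<longleftrightarrow>
     (\<forall>\<epsilon>>0. \<exists>\<delta>>0. \<forall>U0. in_X U0 \<and> X_dist_set U0 S < \<delta> \<longrightarrow>
        (\<exists>U. is_solution \<beta> f \<infinity> U \<and> X_dist (U 0) U0 = 0) \<and>
        (\<forall>T U. is_solution \<beta> f T U \<and> X_dist (U 0) U0 = 0 \<longrightarrow>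
           (\<forall>t. 0 \<le> t \<and> ereal t < T \<longrightarrow> X_dist_set (U t) S < \<epsilon>)))"

definition X_unstable :: "real \<Rightarrow> (real \<Rightarrow> real) \<Rightarrow> state set \<Rightarrow> bool" where
  "X_unstable \<beta> f S \<longleftrightarrow> \<not> X_stable \<beta> f S"

end

(*
  Put S = E + cQ.  The ground state pair Phi is a critical point of S and, by scaling, S >= S(Phi)
  on the Nehari set N = I - K = 0.  In both cases there is a direction psi = (g', h') with g, h
  test functions which is tangent to the level set of the momentum Q at Phi, along which S'' is
  negative, and which crosses N = 0 transversally.  In case (i) psi is close to (phi, c phi); in
  case (ii) it is close to a finite difference of phi under the L2-unitary dilations, whose second
  variation is computed from the Pohozaev identity.  Finite differences avoid any regularity theory
  for phi; they only need x phi' in L2, a weighted energy estimate.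

  If the orbit were stable, start from a multiple of Phi with S < S(Phi).  With the primitive pair
  (h, g) of psi, the function A(t) = max over translations y near the orbit position of
  <u(t), h(. - y)> + <v(t), g(. - y)> is bounded.  At the maximising y one has
  dA/dt = - <S'(U), T_y psi>, and concavity of S along psi, S >= S(Phi) on N = 0 and conservation of
  S bound this from below by a positive constant: a contradiction.
*)
theory Submission
 imports Defs
begin

text \<open>Why primitives: the system is Hamiltonian with skew operator d/dx, so pairing U with (h,
  g) has time derivative -E'(U) psi when psi = (g', h'). For this pairing to be finite and bounded,
  psi must have square integrable primitives; hence every candidate direction is rebuilt from
  derivatives of test functions, which are dense in H2. Why a maximum: the derivative of the pairing
  in the translation is, up to sign, Q'(U) on the translated psi. At a maximiser it vanishes, and E'
  may be replaced by S' = E' + cQ'. Comparing maxima at two times needs no regularity of the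
  position. The maximum must be isolated, so strict concavity in the translation is a clause of
  \<open>direction\<close>, arranged by a small perturbation and a change of sign. Main obstacle:
  solutions are weak, with values in H2 x L2 only. Conservation of S is proved by mollifying in
  space, where the equations hold pointwise, and showing that the commutator with f disappears in
  the limit. Since \<open>d1\<close>, \<open>d2\<close> are arbitrary representatives, estimates
  carry explicit triples (u, u1, u2).\<close>

abbreviation lint :: "(real => real) => real" (binder "LI " 60) where "lint f \<equiv> integral\<^sup>L lborel f"

section \<open>Smooth functions and bump functions\<close>

text \<open>Differentiability to finite order, peeled off one derivative at a time: sums, products
  and affine substitutions are then treated by induction on the order.\<close>

primrec dn :: "nat => (real => real) => bool" where
 "dn 0 f = True"
| "dn (Suc n) f = ((\<forall>x. f differentiable (at x)) \<and> dn n (deriv f))"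

definition smooth :: "(real => real) => bool" where
 "smooth f \<longleftrightarrow> (\<forall>k x. ((deriv ^^ k) f) differentiable (at x))"

lemma dn_iff: "dn n f \<longleftrightarrow> (\<forall>k<n. \<forall>x. ((deriv ^^ k) f) differentiable (at x))"
proof (induction n arbitrary: f)
 case (Suc n)
 have "(\<forall>k<Suc n. \<forall>x. ((deriv ^^ k) f) differentiable (at x)) \<longleftrightarrow>
   (\<forall>x. f differentiable (at x)) \<and> (\<forall>k<n. \<forall>x. ((deriv ^^ k) (deriv f)) differentiable (at x))"
  by (auto simp: All_less_Suc2 funpow_swap1)
 then show ?case using Suc by simp
qed simp

lemma smooth_dn: "smooth f \<longleftrightarrow> (\<forall>n. dn n f)"
 unfolding smooth_def dn_iff by auto

lemma smooth_rec: "smooth f \<longleftrightarrow> (\<forall>x. f differentiable (at x)) \<and> smooth (deriv f)"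
 unfolding smooth_dn by (metis dn.simps old.nat.exhaust)

lemma smooth_DERIV: "smooth f ==> (f has_real_derivative deriv f x) (at x)"
 using smooth_rec DERIV_deriv_iff_real_differentiable by blast

lemma smooth_deriv: "smooth f ==> smooth (deriv f)"
 using smooth_rec by blast

text \<open>Meant for families stable under differentiation: \<open>flat_exp P\<close> with varying
  \<open>P\<close> and \<open>conv k w\<close> with varying \<open>k\<close>. Each use of the
  hypothesis supplies one more derivative, so all orders follow by induction.\<close>

lemma smooth_coinduct:
 assumes "P f" "\<And>f. P f ==> \<exists>f'. (\<forall>x. (f has_real_derivative f' x) (at x)) \<and> P f'"
 shows "smooth f"
proof -
 have "dn n f" for n using assms(1)
 proof (induction n arbitrary: f)
  case (Suc n)
  obtain f' where f': "\<forall>x. (f has_real_derivative f' x) (at x)" "P f'" using assms(2) Suc.prems by blast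
  have "deriv f = f'" using f' by (auto intro!: DERIV_imp_deriv)
  then show ?case using Suc.IH f' by (auto simp: real_differentiable_def)
 qed simp
 then show ?thesis by (simp add: smooth_dn)
qed

lemma dn_Suc: "dn (Suc n) f ==> dn n f"
 by (simp add: dn_iff)

lemma dn_add: "dn n f ==> dn n g ==> dn n (%x. f x + g x)"
proof (induction n arbitrary: f g)
 case (Suc n)
 have "deriv (%x. f x + g x) = (%x. deriv f x + deriv g x)"
  using Suc.prems by (auto intro!: DERIV_imp_deriv DERIV_add simp: DERIV_deriv_iff_real_differentiable)
 then show ?case using Suc by auto
qed simp

lemma dn_mult: "dn n f ==> dn n g ==> dn n (%x. f x * g x)"
proof (induction n arbitrary: f g)
 case (Suc n)
 have "deriv (%x. f x * g x) = (%x. deriv f x * g x + f x * deriv g x)"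
 proof
  fix x
  have "(f has_real_derivative deriv f x) (at x)" "(g has_real_derivative deriv g x) (at x)"
   using Suc.prems by (auto simp: DERIV_deriv_iff_real_differentiable)
  then show "deriv (%x. f x * g x) x = deriv f x * g x + f x * deriv g x"
   by (auto intro!: DERIV_imp_deriv derivative_eq_intros)
 qed
 then show ?case using Suc dn_Suc[OF Suc.prems(1)] dn_Suc[OF Suc.prems(2)] by (auto intro!: dn_add)
qed simp

lemma dn_const: "dn n (%x. c)"
 by (induction n arbitrary: c) auto

lemma DERIV_affine:
 assumes "(f has_real_derivative D) (at (a * x + b))"
 shows "((%x. f (a * x + b)) has_real_derivative a * D) (at x)"
proof -
 have "((%x. a * x + b) has_real_derivative a) (at x)" by (auto intro!: derivative_eq_intros)
 from DERIV_chain2[OF assms this] show ?thesis by (simp add: mult.commute)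
qed

lemma dn_affine: "dn n f ==> dn n (%x. f (a * x + b))"
proof (induction n arbitrary: f)
 case (Suc n)
 have d: "((%x. f (a * x + b)) has_real_derivative a * deriv f (a * x + b)) (at x)" for x
  by (rule DERIV_affine) (use Suc.prems in \<open>auto simp: DERIV_deriv_iff_real_differentiable\<close>)
 then have "deriv (%x. f (a * x + b)) = (%x. a * deriv f (a * x + b))"
  by (auto intro!: DERIV_imp_deriv)
 then show ?case using Suc d by (auto intro!: dn_mult dn_const simp: real_differentiable_def)
qed simp

lemma smooth_add: "smooth f ==> smooth g ==> smooth (%x. f x + g x)"
 and smooth_mult: "smooth f ==> smooth g ==> smooth (%x. f x * g x)"
 and smooth_const: "smooth (%x. c)"
 and smooth_affine: "smooth f ==> smooth (%x. f (a * x + b))"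
 by (auto simp: smooth_dn dn_add dn_mult dn_const dn_affine)

lemma deriv_affine:
 assumes "smooth f" shows "deriv (%x. f (a * x + b)) = (%x. a * deriv f (a * x + b))"
 using assms smooth_DERIV by (auto intro!: DERIV_imp_deriv DERIV_affine)

lemma smooth_cont: "smooth f ==> continuous_on A f"
 by (meson DERIV_isCont continuous_at_imp_continuous_on smooth_DERIV)

lemma deriv_add': "smooth f ==> smooth g ==> deriv (%x. f x + g x) = (%x. deriv f x + deriv g x)"
 by (auto intro!: DERIV_imp_deriv DERIV_add smooth_DERIV)

lemma deriv_mult': "smooth f ==> smooth g ==> deriv (%x. f x * g x) = (%x. deriv f x * g x + f x * deriv g x)"
proof (intro ext DERIV_imp_deriv)
 fix x assume "smooth f" "smooth g"
 then show "((%x. f x * g x) has_real_derivative deriv f x * g x + f x * deriv g x) (at x)"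
  using smooth_DERIV[of f x] smooth_DERIV[of g x] by (auto intro!: derivative_eq_intros)
qed

lemma deriv_cmult': "smooth f ==> deriv (%x. c * f x) = (%x. c * deriv f x)"
 using smooth_DERIV by (auto intro!: DERIV_imp_deriv DERIV_cmult)

text \<open>The function exp(-1/x), flat at 0, with a polynomial factor in 1/x: differentiation only
  changes the polynomial, so the family is closed under it.\<close>

definition flat_exp :: "real poly => real => real" where
 "flat_exp P x = (if x > 0 then poly P (1/x) * exp (- (1/x)) else 0)"

lemma poly_exp_tendsto_0: "((%y. poly P y * exp (- y)) \<longlongrightarrow> (0::real)) at_top"
proof -
 have "((%y. \<Sum>i\<le>degree P. coeff P i * (y ^ i / exp y)) \<longlongrightarrow> (\<Sum>i\<le>degree P. coeff P i * 0)) at_top"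
  by (intro tendsto_sum tendsto_mult tendsto_const tendsto_power_div_exp_0)
 then show ?thesis
  by (simp add: poly_altdef sum_distrib_right exp_minus divide_inverse mult.assoc)
qed

text \<open>For y = 1/x the x-derivative of P(y) exp(-y) is y^2 (P - P')(y) exp(-y), and
  \<open>[:0,0,1:]\<close> is y^2. Only the origin needs a limit.\<close>

lemma flat_exp_deriv:
 "(flat_exp P has_real_derivative flat_exp ([:0,0,1:] * (P - pderiv P)) x) (at x)"
proof (cases "x = 0")
 case False
 consider "x > 0" | "x < 0" using False by linarith
 then show ?thesis
 proof cases
  case 1
  have "((%x. poly P (1/x) * exp (- (1/x))) has_real_derivative flat_exp ([:0,0,1:] * (P - pderiv P)) x) (at x)"
   using 1 by (auto intro!: derivative_eq_intros DERIV_chain2[OF poly_DERIV] simp: flat_exp_def field_simps power2_eq_square)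
  then show ?thesis
   by (rule has_field_derivative_transform_within_open[where S="{0<..}"]) (use 1 in \<open>auto simp: flat_exp_def\<close>)
 next
  case 2
  have "((%x. 0) has_real_derivative flat_exp ([:0,0,1:] * (P - pderiv P)) x) (at x)"
   using 2 by (auto simp: flat_exp_def)
  then show ?thesis
   by (rule has_field_derivative_transform_within_open[where S="{..<0}"]) (use 2 in \<open>auto simp: flat_exp_def\<close>)
 qed
next
 case True
 \<comment> \<open>The difference quotient at 0 carries one more factor 1/h, which
   \<open>pCons 0 P\<close> absorbs into the polynomial.\<close>
 have "((%h. poly (pCons 0 P) (inverse h) * exp (- (inverse h))) \<longlongrightarrow> 0) (at_right 0)"
  using filterlim_compose[OF poly_exp_tendsto_0[of "pCons 0 P"] filterlim_inverse_at_top_right] .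
 then have r: "((%h. flat_exp P h / h) \<longlongrightarrow> 0) (at_right 0)"
  by (rule Lim_transform_eventually)
    (auto simp: eventually_at_right_field flat_exp_def field_simps intro!: exI[of _ 1])
 have l: "((%h. flat_exp P h / h) \<longlongrightarrow> 0) (at_left 0)"
  by (rule Lim_transform_eventually[OF tendsto_const])
    (auto simp: eventually_at_left_field flat_exp_def intro!: exI[of _ "-1"])
 have "((%h. flat_exp P h / h) \<longlongrightarrow> 0) (at 0)"
  using l r by (simp add: filterlim_at_split)
 then show ?thesis using True by (simp add: DERIV_def) (simp add: flat_exp_def)
qed

lemma smooth_flat_exp: "smooth (flat_exp P)"
 by (rule smooth_coinduct[where P="%f. \<exists>P. f = flat_exp P"]) (use flat_exp_deriv in blast)+

definition bump :: "real => real" where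
 "bump x = flat_exp 1 (1 - x) * flat_exp 1 (1 + x)"

lemma smooth_bump: "smooth bump"
 using smooth_mult[OF smooth_affine[OF smooth_flat_exp, of 1 "-1" 1] smooth_affine[OF smooth_flat_exp, of 1 1 1]]
 unfolding bump_def[abs_def] by (simp add: add.commute)

lemma bump_nonneg: "bump x \<ge> 0" and bump_support: "\<bar>x\<bar> \<ge> 1 ==> bump x = 0"
 and bump_pos: "\<bar>x\<bar> < 1 ==> bump x > 0" and bump_even: "bump (-x) = bump x"
 by (auto simp: bump_def flat_exp_def)

section \<open>Closure properties of test functions\<close>

lemma test_fun_iff: "test_fun k \<longleftrightarrow> smooth k \<and> (\<exists>R. \<forall>x. R < \<bar>x\<bar> --> k x = 0)"
 unfolding test_fun_def smooth_def by simp

lemma test_smooth: "test_fun k ==> smooth k" by (simp add: test_fun_iff)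

lemma test_supp:
 assumes "test_fun k" obtains R where "R > 0" "\<And>x. R \<le> \<bar>x\<bar> ==> k x = 0"
proof -
 obtain R where R: "\<forall>x. R < \<bar>x\<bar> --> k x = 0" using assms test_fun_iff by auto
 show ?thesis by (rule that[of "max R 0 + 1"]) (use R in auto)
qed

lemma supp_deriv_zero:
 assumes "\<And>x. R < \<bar>x\<bar> ==> k x = 0" and "R < \<bar>x\<bar>" shows "deriv k x = (0::real)"
proof (rule DERIV_imp_deriv)
 have "((%x. 0) has_real_derivative 0) (at x)" by simp
 then show "(k has_real_derivative 0) (at x)"
  by (rule has_field_derivative_transform_within_open[where S="{x. R < \<bar>x\<bar>}"])
    (use assms in \<open>auto intro!: open_Collect_less continuous_intros\<close>)
qed

lemma test_deriv: "test_fun k ==> test_fun (deriv k)"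
 using supp_deriv_zero smooth_deriv by (metis test_fun_iff)

lemma test_derivs: "test_fun k ==> test_fun ((deriv ^^ j) k)"
 by (induction j) (auto simp: test_deriv)

lemma test_add: "test_fun k ==> test_fun l ==> test_fun (%x. k x + l x)"
proof -
 assume k: "test_fun k" and l: "test_fun l"
 obtain R where R: "\<And>x. R \<le> \<bar>x\<bar> ==> k x = 0" using test_supp[OF k] by metis
 obtain R' where R': "\<And>x. R' \<le> \<bar>x\<bar> ==> l x = 0" using test_supp[OF l] by metis
 show ?thesis unfolding test_fun_iff
  using smooth_add[OF test_smooth[OF k] test_smooth[OF l]] R R' by (auto intro!: exI[of _ "max R R'"])
qed

lemma test_mult_smooth: "smooth s ==> test_fun k ==> test_fun (%x. s x * k x)"
 unfolding test_fun_iff using smooth_mult by (metis mult_zero_right)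

lemma test_cmult: "test_fun k ==> test_fun (%x. c * k x)"
 using test_mult_smooth[OF smooth_const] by simp

lemma test_affine:
 assumes "test_fun k" "a \<noteq> 0" shows "test_fun (%x. k (a * x + b))"
proof -
 obtain R where R: "R > 0" "\<And>x. R \<le> \<bar>x\<bar> ==> k x = 0" using test_supp assms by metis
 have "k (a * x + b) = 0" if "(R + \<bar>b\<bar>) / \<bar>a\<bar> < \<bar>x\<bar>" for x
 proof (rule R)
  have "R + \<bar>b\<bar> < \<bar>a * x\<bar>" using that assms by (simp add: abs_mult field_simps)
  then show "R \<le> \<bar>a * x + b\<bar>" by linarith
 qed
 then show ?thesis unfolding test_fun_iff using assms smooth_affine test_smooth by blast
qed

lemma test_bump: "test_fun bump"
 unfolding test_fun_iff using smooth_bump bump_support by (auto intro!: exI[of _ 1])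

lemma test_bounded:
 assumes "test_fun k" obtains C where "C > 0" "\<And>x. \<bar>k x\<bar> \<le> C"
proof -
 obtain R where R: "R > 0" "\<And>x. R \<le> \<bar>x\<bar> ==> k x = 0" using test_supp assms by metis
 have "compact (k ` {-R..R})"
  using assms by (intro compact_continuous_image smooth_cont) (auto simp: test_smooth)
 then have "bounded (k ` {-R..R})" by (rule compact_imp_bounded)
 then obtain C where C: "\<And>x. x \<in> {-R..R} ==> \<bar>k x\<bar> \<le> C" unfolding bounded_iff by fastforce
 have "\<bar>k x\<bar> \<le> max C 1" for x
  using C[of x] R(2)[of x] by (cases "\<bar>x\<bar> \<le> R") (auto simp: abs_le_iff)
 then show ?thesis by (intro that[of "max C 1"]) auto
qed

lemma integrable_compact_supp:
 assumes "continuous_on UNIV (g :: real => real)" "\<And>x. R < \<bar>x\<bar> ==> g x = 0"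
 shows "integrable lborel g"
proof -
 have "set_integrable lborel {-R..R} g"
  by (intro borel_integrable_atLeastAtMost') (use assms continuous_on_subset in blast)
 then have "integrable lborel (%x. indicator {-R..R} x * g x)" by (simp add: set_integrable_def)
 moreover have "(%x. indicator {-R..R} x * g x) = g"
 proof
  fix x show "indicator {-R..R} x * g x = g x"
   using assms(2)[of x] by (cases "R < \<bar>x\<bar>") (auto simp: indicator_def)
 qed
 ultimately show ?thesis by simp
qed

lemma test_integrable: "test_fun k ==> integrable lborel k"
 using integrable_compact_supp test_fun_iff smooth_cont by metis

section \<open>The space of square integrable functions\<close>

text \<open>A seminorm on functions rather than a norm on classes, so that weak derivatives remain
  plain functions; null sets are dealt with by \<open>nrm_zero_AE\<close> and
  \<open>nrm_cong_AE\<close>.\<close>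

definition nrm :: "(real => real) => real" where
 "nrm u = sqrt (LI x. (u x)\<^sup>2)"

abbreviation "ndist u w \<equiv> nrm (%x. u x - w x)"

lemma L2_meas[measurable_dest]: "L2 u ==> u \<in> borel_measurable borel"
 and L2_sq: "L2 u ==> integrable lborel (%x. (u x)\<^sup>2)"
 by (auto simp: L2_def)

lemma L2I: "u \<in> borel_measurable borel ==> integrable lborel (%x. (u x)\<^sup>2) ==> L2 u"
 by (auto simp: L2_def)

lemma L2_bound:
 assumes "u \<in> borel_measurable borel" "integrable lborel g" "AE x in lborel. (u x)\<^sup>2 \<le> g x"
 shows "L2 u"
 by (rule L2I[OF assms(1)], rule Bochner_Integration.integrable_bound[OF assms(2)])
   (use assms(1,3) in auto)

lemma nrm_nonneg[simp]: "0 \<le> nrm u" by (simp add: nrm_def)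

lemma nrm_sq: "(nrm u)\<^sup>2 = (LI x. (u x)\<^sup>2)"
 by (simp add: nrm_def)

lemma L2_mult: assumes "L2 u" "L2 v" shows "integrable lborel (%x. u x * v x)"
proof (rule Bochner_Integration.integrable_bound)
 show "integrable lborel (%x. (u x)\<^sup>2 + (v x)\<^sup>2)" using assms L2_sq by auto
 show "AE x in lborel. norm (u x * v x) \<le> norm ((u x)\<^sup>2 + (v x)\<^sup>2)"
 proof (rule AE_I2)
  fix x
  have "2 * \<bar>u x\<bar> * \<bar>v x\<bar> \<le> \<bar>u x\<bar>\<^sup>2 + \<bar>v x\<bar>\<^sup>2" by (rule sum_squares_bound)
  then have "\<bar>u x\<bar> * \<bar>v x\<bar> \<le> (u x)\<^sup>2 + (v x)\<^sup>2"
   using mult_nonneg_nonneg[OF abs_ge_zero[of "u x"] abs_ge_zero[of "v x"]] by (simp only: power2_abs)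
  then show "norm (u x * v x) \<le> norm ((u x)\<^sup>2 + (v x)\<^sup>2)" by (simp add: abs_mult)
 qed
qed (use assms in measurable)

lemma L2_cmult: "L2 u ==> L2 (%x. c * u x)"
 by (rule L2I) (auto dest: L2_meas L2_sq simp: power_mult_distrib)

lemma L2_add: assumes "L2 u" "L2 v" shows "L2 (%x. u x + v x)"
proof (rule L2I)
 show "integrable lborel (%x. (u x + v x)\<^sup>2)"
  using L2_sq[OF assms(1)] L2_sq[OF assms(2)] L2_mult[OF assms]
  by (auto simp: power2_sum mult.assoc)
qed (use assms in measurable)

lemma L2_diff: "L2 u ==> L2 v ==> L2 (%x. u x - v x)"
 using L2_add[of u "%x. (-1) * v x"] L2_cmult[of v "-1"] by simp

lemma L2_zero[simp]: "L2 (%x. 0)" by (rule L2I) auto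

lemma L2_abs: "L2 u ==> L2 (%x. \<bar>u x\<bar>)"
 by (rule L2I) (auto dest: L2_meas L2_sq)

lemma nrm_abs[simp]: "nrm (%x. \<bar>u x\<bar>) = nrm u" by (simp add: nrm_def)

lemma nrm_cmult: "nrm (%x. c * u x) = \<bar>c\<bar> * nrm u"
 by (simp add: nrm_def power_mult_distrib real_sqrt_mult)

lemma nrm_minus_commute: "ndist u v = ndist v u"
 by (simp add: nrm_def power2_commute)

lemma nrm_cong_AE: "AE x in lborel. u x = v x ==> u \<in> borel_measurable borel ==> v \<in> borel_measurable borel ==> nrm u = nrm v"
 unfolding nrm_def by (intro arg_cong[where f=sqrt] integral_cong_AE) auto

lemma L2_cong_AE: assumes "L2 u" "AE x in lborel. u x = v x" "v \<in> borel_measurable borel" shows "L2 v"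
 by (rule L2_bound[OF assms(3) L2_sq[OF assms(1)]]) (use assms(2) in auto)

text \<open>The quadratic t -> ||u + t v||^2 is nonnegative, so its discriminant is not positive.
  When v has norm zero it degenerates to an affine function, which stays nonnegative only if its
  slope vanishes.\<close>

lemma CS_ineq: assumes "L2 u" "L2 v" shows "\<bar>LI x. u x * v x\<bar> \<le> nrm u * nrm v"
proof -
 define I where "I = (LI x. u x * v x)"
 have q: "0 \<le> (nrm u)\<^sup>2 + 2 * t * I + t\<^sup>2 * (nrm v)\<^sup>2" for t
 proof -
  have "0 \<le> (LI x. (u x + t * v x)\<^sup>2)" by simp
  also have "\<dots> = (LI x. (u x)\<^sup>2 + (2 * t) * (u x * v x) + t\<^sup>2 * (v x)\<^sup>2)"
   by (intro Bochner_Integration.integral_cong) (auto simp: power2_eq_square algebra_simps)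
  also have "\<dots> = (nrm u)\<^sup>2 + 2 * t * I + t\<^sup>2 * (nrm v)\<^sup>2"
   using L2_sq[OF assms(1)] L2_sq[OF assms(2)] L2_mult[OF assms] by (simp add: nrm_sq I_def)
  finally show ?thesis .
 qed
 have "I\<^sup>2 \<le> (nrm u * nrm v)\<^sup>2"
 proof (cases "nrm v = 0")
  case True
  have "I = 0"
  proof (rule ccontr)
   assume "I \<noteq> 0"
   then have "2 * (- ((nrm u)\<^sup>2 + 1) / (2 * I)) * I = - ((nrm u)\<^sup>2 + 1)" by simp
   then show False using q[of "- ((nrm u)\<^sup>2 + 1) / (2 * I)"] True by simp
  qed
  then show ?thesis using True by simp
 next
  case False
  then have n: "(nrm v)\<^sup>2 > 0" by simp
  define N where "N = (nrm v)\<^sup>2"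
  have "0 \<le> ((nrm u)\<^sup>2 + 2 * (- I / N) * I + (- I / N)\<^sup>2 * N) * N"
   using q[of "- I / N"] n unfolding N_def[symmetric] by simp
  also have "\<dots> = (nrm u)\<^sup>2 * N - I\<^sup>2"
   using n unfolding N_def[symmetric] by (simp add: field_simps power2_eq_square)
  finally show ?thesis by (simp add: N_def power_mult_distrib)
 qed
 then show ?thesis unfolding I_def[symmetric]
  by (metis abs_le_square_iff abs_of_nonneg mult_nonneg_nonneg nrm_nonneg)
qed

lemma nrm_triangle: assumes "L2 u" "L2 v" shows "nrm (%x. u x + v x) \<le> nrm u + nrm v"
proof (rule power2_le_imp_le)
 have "(nrm (%x. u x + v x))\<^sup>2 = (LI x. (u x)\<^sup>2 + 2 * (u x * v x) + (v x)\<^sup>2)"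
  unfolding nrm_sq by (intro Bochner_Integration.integral_cong) (auto simp: power2_eq_square algebra_simps)
 also have "\<dots> = (nrm u)\<^sup>2 + 2 * (LI x. u x * v x) + (nrm v)\<^sup>2"
  using L2_sq[OF assms(1)] L2_sq[OF assms(2)] L2_mult[OF assms] by (simp add: nrm_sq)
 also have "\<dots> \<le> (nrm u + nrm v)\<^sup>2"
  using CS_ineq[OF assms] by (simp add: power2_sum)
 finally show "(nrm (%x. u x + v x))\<^sup>2 \<le> (nrm u + nrm v)\<^sup>2" .
qed simp

lemma nrm_triangle_diff: assumes "L2 u" "L2 v" shows "ndist u v \<le> nrm u + nrm v"
 using nrm_triangle[OF assms(1) L2_cmult[OF assms(2), of "-1"]] nrm_cmult[of "-1" v] by simp

lemma nrm_triangle3: assumes "L2 u" "L2 v" "L2 w"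
 shows "ndist u w \<le> ndist u v + ndist v w"
 using nrm_triangle[OF L2_diff[OF assms(1,2)] L2_diff[OF assms(2,3)]] by simp

lemma nrm_diff_ge: assumes "L2 u" "L2 v" shows "\<bar>nrm u - nrm v\<bar> \<le> ndist u v"
 using nrm_triangle[OF L2_diff[OF assms] assms(2)] nrm_triangle[OF L2_diff[OF assms(2,1)] assms(1)]
  nrm_minus_commute[of u v] by simp

lemma nrm_mono: assumes "L2 v" "u \<in> borel_measurable borel" "AE x in lborel. \<bar>u x\<bar> \<le> \<bar>v x\<bar>"
 shows "L2 u" "nrm u \<le> nrm v"
proof -
 have a: "AE x in lborel. (u x)\<^sup>2 \<le> (v x)\<^sup>2" using assms(3) by (simp add: abs_le_square_iff)
 show "L2 u" by (rule L2_bound[OF assms(2) L2_sq[OF assms(1)] a])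
 then show "nrm u \<le> nrm v" unfolding nrm_def
  by (intro real_sqrt_le_mono integral_mono_AE L2_sq assms a)
qed

lemma nrm_zero_AE: assumes "L2 u" "nrm u = 0" shows "AE x in lborel. u x = 0"
proof -
 have "(LI x. (u x)\<^sup>2) = 0" using assms nrm_sq[of u] by simp
 then show ?thesis using integral_nonneg_eq_0_iff_AE[OF L2_sq[OF assms(1)]] by simp
qed

lemma L2_shift: "L2 u ==> L2 (%x. u (x + h))"
 using lborel_integrable_real_affine[of "%x. (u x)\<^sup>2" 1 h]
 by (intro L2I) (auto dest: L2_meas L2_sq simp: add.commute)

lemma LINT_shift: fixes u :: "real => real" shows "(LI x. u (x + h)) = (LI x. (u x::real))"
 using lborel_integral_real_affine[of 1 u h] by (simp add: add.commute)

lemma LINT_reflect: fixes u :: "real => real" shows "(LI y. u (x - y)) = (LI x. (u x::real))"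
 using lborel_integral_real_affine[of "-1" u x] by simp

lemma integrable_reflect: fixes u :: "real => real" shows "integrable lborel u ==> integrable lborel (%y. u (x - y) :: real)"
 using lborel_integrable_real_affine[of u "-1" x] by simp

lemma nrm_shift: "nrm (%x. u (x + h)) = nrm u"
 unfolding nrm_def using LINT_shift[of "%x. (u x)\<^sup>2" h] by simp

subsection \<open>Continuity of translations\<close>

definition tcont :: "(real => real) => bool" where
 "tcont w \<longleftrightarrow> (\<forall>e>0. \<exists>d>0. \<forall>h. \<bar>h\<bar> < d --> nrm (%x. w (x + h) - w x) < e)"

lemma tcontD:
 assumes "tcont w" "e > 0"
 obtains d where "d > 0" "\<And>h. \<bar>h\<bar> < d ==> nrm (%x. w (x + h) - w x) < e"
 using assms unfolding tcont_def by blast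

text \<open>Translations are isometries, so the translation modulus of \<open>w\<close> differs from
  that of \<open>U i\<close> by at most twice the approximation error: an epsilon/3
  argument.\<close>

lemma tcont_limit:
 assumes "L2 w" "\<And>i. L2 (U i)" "\<And>i. tcont (U i)" "(%i. ndist (U i) w) \<longlonglongrightarrow> 0"
 shows "tcont w"
 unfolding tcont_def
proof (intro allI impI)
 fix e :: real assume "e > 0"
 then have "\<forall>\<^sub>F i in sequentially. ndist (U i) w < e / 3"
  using order_tendstoD(2)[OF assms(4), of "e/3"] by simp
 then obtain i where i: "ndist (U i) w < e / 3" by (auto simp: eventually_sequentially)
 obtain d where d: "d > 0" "\<And>h. \<bar>h\<bar> < d ==> nrm (%x. U i (x + h) - U i x) < e / 3"
  using assms(3)[of i] \<open>e > 0\<close> unfolding tcont_def by (meson divide_pos_pos zero_less_numeral)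
 show "\<exists>d>0. \<forall>h. \<bar>h\<bar> < d --> nrm (%x. w (x + h) - w x) < e"
 proof (intro exI[of _ d] conjI allI impI d(1))
  fix h assume h: "\<bar>h\<bar> < d"
  have "nrm (%x. w (x + h) - w x) \<le> nrm (%x. w (x + h) - U i (x + h)) + nrm (%x. U i (x + h) - w x)"
   by (intro nrm_triangle3 L2_shift assms)
  also have "nrm (%x. U i (x + h) - w x) \<le> nrm (%x. U i (x + h) - U i x) + ndist (U i) w"
   by (intro nrm_triangle3 L2_shift assms)
  also have "nrm (%x. w (x + h) - U i (x + h)) = ndist (U i) w"
   using nrm_shift[of "%x. w x - U i x" h] nrm_minus_commute[of w "U i"] by simp
  finally show "nrm (%x. w (x + h) - w x) < e" using i d(2)[OF h] by linarith
 qed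
qed

lemma L2_dominated_tendsto:
 assumes "\<And>i. U i \<in> borel_measurable borel" "L2 g" "w \<in> borel_measurable borel"
  "\<And>i x. \<bar>U i x - w x\<bar> \<le> \<bar>g x\<bar>" "\<And>x. (%i. U i x) \<longlonglongrightarrow> w x"
 shows "(%i. ndist (U i) w) \<longlonglongrightarrow> 0"
proof -
 have "(%i. LI x. (U i x - w x)\<^sup>2) \<longlonglongrightarrow> (LINT x::real|lborel. (0::real))"
 proof (rule integral_dominated_convergence[where w="%x. (g x)\<^sup>2"])
  show "integrable lborel (%x. (g x)\<^sup>2)" using assms L2_sq by auto
  show "AE x in lborel. (%i. (U i x - w x)\<^sup>2) \<longlonglongrightarrow> 0"
  proof (rule AE_I2)
   fix x
   have "(%i. (U i x - w x)\<^sup>2) \<longlonglongrightarrow> (w x - w x)\<^sup>2" by (intro tendsto_intros assms)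
   then show "(%i. (U i x - w x)\<^sup>2) \<longlonglongrightarrow> 0" by simp
  qed
  show "AE x in lborel. norm ((U i x - w x)\<^sup>2) \<le> (g x)\<^sup>2" for i
   using assms(4) by (simp add: abs_le_square_iff[symmetric])
 qed (use assms(1,3) in measurable)
 then show ?thesis unfolding nrm_def using tendsto_real_sqrt by fastforce
qed

text \<open>Squeeze \<open>A\<close> between a compact \<open>T\<close> and an open
  \<open>O1\<close> with \<open>O1 - T\<close> small. A shift shorter than the distance from
  \<open>T\<close> to the complement of \<open>O1\<close> changes the indicator only inside
  \<open>O1 - T\<close> or its translate.\<close>

lemma tcont_indicator_bounded:
 assumes A: "A \<in> sets borel" "A \<subseteq> {-R..R}"
 shows "tcont (indicator A)"
 unfolding tcont_def
proof (intro allI impI)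
 fix e0 :: real assume "e0 > 0"
 \<comment> \<open>The squared norm will be at most twice the measure of \<open>D\<close>, hence at
   most 4e, which is half of the square of \<open>e0\<close>.\<close>
 define e where "e = e0\<^sup>2 / 8"
 have e: "e > 0" using \<open>e0 > 0\<close> by (simp add: e_def)
 obtain O1 where O1: "open O1" "A \<subseteq> O1" "emeasure lborel (O1 - A) < ennreal e"
  using outer_regular_lborel[OF A(1) e] by blast
 obtain V where V: "open V" "- A \<subseteq> V" "emeasure lborel (V - (- A)) < ennreal e"
  using outer_regular_lborel[of "- A" e] A(1) e by (metis sets.compl_sets space_borel Compl_eq_Diff_UNIV)
 define T where "T = - V"
 have T: "T \<subseteq> A" "closed T" using V by (auto simp: T_def)
 then have "compact T" using A(2) by (meson bounded_closed_interval bounded_subset compact_eq_bounded_closed order_trans)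
 then obtain d where d: "d > 0" "(\<Union>x\<in>T. ball x d) \<subseteq> O1"
  using compact_subset_open_imp_ball_epsilon_subset[of T O1] O1 T by auto
 have [measurable]: "O1 \<in> sets borel" "T \<in> sets borel" "A \<in> sets borel" using O1 T A by auto
 define D where "D = O1 - T"
 have [measurable]: "D \<in> sets borel" by (simp add: D_def)
 have "emeasure lborel D \<le> emeasure lborel (O1 - A) + emeasure lborel (V - (- A))"
 proof -
  have "D \<subseteq> (O1 - A) \<union> (V - (- A))" by (auto simp: D_def T_def)
  then have "emeasure lborel D \<le> emeasure lborel ((O1 - A) \<union> (V - (- A)))"
   using V by (intro emeasure_mono) auto
  also have "\<dots> \<le> emeasure lborel (O1 - A) + emeasure lborel (V - (- A))"
   using V by (intro emeasure_subadditive) auto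
  finally show ?thesis .
 qed
 also have "\<dots> \<le> ennreal e + ennreal e" using O1 V by (intro add_mono) auto
 also have "\<dots> = ennreal (2 * e)" using e by (simp add: ennreal_plus[symmetric] del: ennreal_plus)
 finally have De: "emeasure lborel D \<le> ennreal (2 * e)" .
 then have Dfin: "emeasure lborel D < \<infinity>" by (metis ennreal_less_top infinity_ennreal_def le_less_trans)
 have Dm: "measure lborel D \<le> 2 * e" using De e by (simp add: measure_def enn2real_leI)
 have iD: "integrable lborel (indicat_real D)" using Dfin by simp
 have iD': "integrable lborel (%x. indicat_real D (x + h))" for h
  using lborel_integrable_real_affine[OF iD, of 1 h] by (simp add: add.commute)
 show "\<exists>d>0. \<forall>h. \<bar>h\<bar> < d --> nrm (%x. indicator A (x + h) - indicator A x) < e0"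
 proof (intro exI[of _ d] conjI allI impI d(1))
  fix h :: real assume h: "\<bar>h\<bar> < d"
  have pt: "(indicat_real A (x + h) - indicat_real A x)\<^sup>2 \<le> indicat_real D x + indicat_real D (x + h)" for x
  proof -
   have 1: "x \<in> O1" if "x + h \<in> T" using that d h by (force simp: dist_real_def)
   have 2: "x + h \<in> O1" if "x \<in> T" using that d h by (force simp: dist_real_def)
   show ?thesis using 1 2 T(1) O1(2) by (auto simp: indicator_def D_def)
  qed
  have "(nrm (%x. indicat_real A (x + h) - indicat_real A x))\<^sup>2
    \<le> (LI x. indicat_real D x + indicat_real D (x + h))"
   unfolding nrm_sq
  proof (rule integral_mono)
   show i: "integrable lborel (%x. indicat_real D x + indicat_real D (x + h))" using iD iD' by simp
   show "integrable lborel (%x. (indicat_real A (x + h) - indicat_real A x)\<^sup>2)"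
    by (rule Bochner_Integration.integrable_bound[OF i])
      (simp, rule AE_I2, use pt in \<open>simp add: order_trans[OF _ abs_ge_self]\<close>)
  qed (rule pt)
  also have "\<dots> = 2 * measure lborel D"
   using iD iD' LINT_shift[of "indicat_real D" h] by simp
  also have "\<dots> < e0\<^sup>2" using Dm e by (simp add: e_def) (smt (verit, best) zero_less_power2 \<open>e0 > 0\<close>)
  finally show "nrm (%x. indicator A (x + h) - indicator A x) < e0"
   using \<open>e0 > 0\<close> by (meson less_imp_le power_less_imp_less_base)
 qed
qed

lemma tcont_nonneg:
 assumes "w \<in> borel_measurable borel" "\<And>x. 0 \<le> w x" "L2 w"
 shows "tcont w"
proof -
 \<comment> \<open>Square integrability sits inside the induction statement because each stage has
   to pass it on to its summands and approximants.\<close>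
 have "L2 w --> tcont w" using assms(1,2)
 proof (induct rule: borel_measurable_induct_real)
  case (set A)
  show ?case
  proof
   assume A2: "L2 (indicator A)"
   have [measurable]: "A \<in> sets borel" using set by simp
   show "tcont (indicator A)"
   proof (rule tcont_limit[OF A2])
    show "tcont (indicator (A \<inter> {- real i..real i}))" for i
     by (rule tcont_indicator_bounded[of _ "real i"]) auto
    show "L2 (indicator (A \<inter> {- real i..real i}))" for i
     by (rule nrm_mono(1)[OF A2]) (auto simp: indicator_def)
    show "(%i. nrm (%x. indicator (A \<inter> {- real i..real i}) x - indicator A x)) \<longlonglongrightarrow> 0"
    proof (rule L2_dominated_tendsto[OF _ A2])
     fix x :: real
     obtain N where N: "real N \<ge> \<bar>x\<bar>" using real_arch_simple by blast
     have "\<forall>\<^sub>F i in sequentially. indicat_real (A \<inter> {- real i..real i}) x = indicator A x"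
      unfolding eventually_sequentially
      by (rule exI[of _ N]) (use N in \<open>auto simp: indicator_def\<close>)
     then show "(%i. indicat_real (A \<inter> {- real i..real i}) x) \<longlonglongrightarrow> indicator A x"
      by (rule tendsto_eventually)
    qed (auto simp: indicator_def)
   qed
  qed
 next
  case (mult u c)
  show ?case
  proof (cases "c = 0")
   case True then show ?thesis by (auto simp: tcont_def nrm_def intro: exI[of _ 1])
  next
   case False
   show ?thesis
   proof
    assume "L2 (%x. c * u x)"
    then have "L2 u" using L2_cmult[of "%x. c * u x" "1/c"] False by simp
    then have t: "tcont u" using mult by simp
    show "tcont (%x. c * u x)" unfolding tcont_def
    proof (intro allI impI)
     fix e :: real assume "e > 0"
     then obtain d where d: "d > 0" "\<And>h. \<bar>h\<bar> < d ==> nrm (%x. u (x + h) - u x) < e / \<bar>c\<bar>"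
      using t False unfolding tcont_def by (meson divide_pos_pos zero_less_abs_iff)
     show "\<exists>d>0. \<forall>h. \<bar>h\<bar> < d --> nrm (%x. c * u (x + h) - c * u x) < e"
     proof (intro exI[of _ d] conjI allI impI d(1))
      fix h assume "\<bar>h\<bar> < d"
      then have "\<bar>c\<bar> * nrm (%x. u (x + h) - u x) < \<bar>c\<bar> * (e / \<bar>c\<bar>)"
       using d(2) False by (intro mult_strict_left_mono) auto
      then have "\<bar>c\<bar> * nrm (%x. u (x + h) - u x) < e" using False by simp
      then show "nrm (%x. c * u (x + h) - c * u x) < e"
       by (simp add: right_diff_distrib[symmetric] nrm_cmult)
     qed
    qed
   qed
  qed
 next
  case (add u v)
  show ?case
  proof
   assume a: "L2 (%x. v x + u x)"
   have [measurable]: "u \<in> borel_measurable borel" "v \<in> borel_measurable borel" using add by auto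
   have uv: "L2 u" "L2 v"
    by (rule nrm_mono(1)[OF a]; use add in simp)+
   then have t: "tcont u" "tcont v" using add by auto
   show "tcont (%x. v x + u x)" unfolding tcont_def
   proof (intro allI impI)
    fix e :: real assume "e > 0"
    then have e2: "e / 2 > 0" by simp
    obtain d where d1: "d > 0" "\<And>h. \<bar>h\<bar> < d ==> nrm (%x. u (x + h) - u x) < e/2"
     using tcontD[OF t(1) e2] by blast
    obtain d' where d2: "d' > 0" "\<And>h. \<bar>h\<bar> < d' ==> nrm (%x. v (x + h) - v x) < e/2"
     using tcontD[OF t(2) e2] by blast
    note d = d1 d2
    show "\<exists>d>0. \<forall>h. \<bar>h\<bar> < d --> nrm (%x. v (x + h) + u (x + h) - (v x + u x)) < e"
    proof (intro exI[of _ "min d d'"] conjI allI impI)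
     fix h assume h: "\<bar>h\<bar> < min d d'"
     have "nrm (%x. (v (x + h) - v x) + (u (x + h) - u x)) \<le> nrm (%x. v (x + h) - v x) + nrm (%x. u (x + h) - u x)"
      by (intro nrm_triangle L2_diff L2_shift uv)
     then show "nrm (%x. v (x + h) + u (x + h) - (v x + u x)) < e"
      using d(2)[of h] d(4)[of h] h by (simp add: algebra_simps)
    qed (use d in auto)
   qed
  qed
 next
  case (seq U)
  show ?case
  proof
   assume w2: "L2 w"
   have le: "U i x \<le> w x" for i x
    using seq(5)[of x] seq(4) by (intro incseq_le) (auto simp: incseq_def le_fun_def)
   have U2: "L2 (U i)" for i
    by (rule nrm_mono(1)[OF w2]) (use seq(1,2) le assms(2) in \<open>auto intro!: AE_I2\<close>)
   show "tcont w"
   proof (rule tcont_limit[OF w2 U2])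
    show "tcont (U i)" for i using seq(3) U2 by blast
    show "(%i. ndist (U i) w) \<longlonglongrightarrow> 0"
    proof (rule L2_dominated_tendsto[OF _ w2])
     show "\<bar>U i x - w x\<bar> \<le> \<bar>w x\<bar>" for i x using le[of i x] seq(2)[of i x] by auto
    qed (use seq(1,5) w2 in auto)
   qed
  qed
 qed
 then show ?thesis using assms by simp
qed

lemma L2_tcont: assumes "L2 w" shows "tcont w"
proof -
 define a where "a = (%x. max (w x) 0)"
 define b where "b = (%x. max (- w x) 0)"
 have ab: "w = (%x. a x - b x)" by (auto simp: a_def b_def max_def)
 have [measurable]: "w \<in> borel_measurable borel" using assms by measurable
 have L: "L2 a" "L2 b" unfolding a_def b_def
  by (rule nrm_mono(1)[OF assms], auto)+
 have t: "tcont a" "tcont b" using L by (auto intro!: tcont_nonneg L2_meas simp: a_def b_def)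
 show ?thesis unfolding tcont_def
 proof (intro allI impI)
  fix e :: real assume "e > 0"
  then have e2: "e / 2 > 0" by simp
  obtain d where d1: "d > 0" "\<And>h. \<bar>h\<bar> < d ==> nrm (%x. a (x + h) - a x) < e/2"
   using tcontD[OF t(1) e2] by blast
  obtain d' where d2: "d' > 0" "\<And>h. \<bar>h\<bar> < d' ==> nrm (%x. b (x + h) - b x) < e/2"
   using tcontD[OF t(2) e2] by blast
  note d = d1 d2
  show "\<exists>d>0. \<forall>h. \<bar>h\<bar> < d --> nrm (%x. w (x + h) - w x) < e"
  proof (intro exI[of _ "min d d'"] conjI allI impI)
   fix h assume h: "\<bar>h\<bar> < min d d'"
   have "nrm (%x. (a (x + h) - a x) - (b (x + h) - b x)) \<le> nrm (%x. a (x + h) - a x) + nrm (%x. b (x + h) - b x)"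
    by (intro nrm_triangle_diff L2_diff L2_shift L)
   then show "nrm (%x. w (x + h) - w x) < e"
    using d(2)[of h] d(4)[of h] h unfolding ab by (simp add: algebra_simps)
  qed (use d in auto)
 qed
qed

section \<open>Convolution and mollification\<close>

lemma LINT_abs_le:
 fixes f g :: "real => real"
 assumes "integrable lborel f" "integrable lborel g" "\<And>x. \<bar>f x\<bar> \<le> g x"
 shows "\<bar>LI x. f x\<bar> \<le> (LI x. g x)"
 by (rule order_trans[OF integral_abs_bound integral_mono]) (use assms in auto)

definition conv :: "(real => real) => (real => real) => real => real" where
 "conv k w x = (LI y. k (x - y) * w y)"

text \<open>Integrability of the kernel gives Young's inequality; boundedness puts it in L2 as well,
  so that convolution with an L2 function is defined at every point.\<close>

definition kern :: "(real => real) => bool" where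
 "kern k \<longleftrightarrow> k \<in> borel_measurable borel \<and> integrable lborel k \<and> (\<exists>C. \<forall>x. \<bar>k x\<bar> \<le> C)"

lemma test_meas: "test_fun k ==> k \<in> borel_measurable borel"
 by (intro borel_measurable_continuous_onI smooth_cont test_smooth)

lemma test_kern: "test_fun k ==> kern k"
 unfolding kern_def using test_integrable test_meas test_bounded by metis

lemma kern_meas[measurable_dest]: "kern k ==> k \<in> borel_measurable borel"
 by (simp add: kern_def)

lemma kern_L2: assumes "kern k" shows "L2 k"
proof -
 obtain C where C: "\<And>x. \<bar>k x\<bar> \<le> C" using assms by (auto simp: kern_def)
 have "(k x)\<^sup>2 \<le> C * \<bar>k x\<bar>" for x
  using mult_right_mono[OF C[of x] abs_ge_zero[of "k x"]] by (simp add: power2_eq_square flip: abs_mult)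
 then show ?thesis using assms by (intro L2_bound[where g="%x. C * \<bar>k x\<bar>"]) (auto simp: kern_def)
qed

lemma kern_abs: "kern k ==> kern (%x. \<bar>k x\<bar>)"
 unfolding kern_def by auto

lemma kern_reflect: assumes "kern k" shows "kern (%y. k (x - y))"
 using assms integrable_reflect[of k x] unfolding kern_def by auto

lemma test_L2: "test_fun k ==> L2 k" by (simp add: test_kern kern_L2)

lemma conv_int: "kern k ==> L2 w ==> integrable lborel (%y. k (x - y) * w y)"
 by (rule L2_mult[OF kern_L2[OF kern_reflect]])

lemma nrm_reflect: "nrm (%y. k (x - y)) = nrm k"
 unfolding nrm_def using LINT_reflect[of "%x. (k x)\<^sup>2" x] by simp

lemma conv_sup: "kern k ==> L2 w ==> \<bar>conv k w x\<bar> \<le> nrm k * nrm w"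
 unfolding conv_def using CS_ineq[of "%y. k (x - y)" w] kern_L2[OF kern_reflect, of k x] by (simp add: nrm_reflect)

lemma conv_meas[measurable]:
 assumes [measurable]: "k \<in> borel_measurable borel" "w \<in> borel_measurable borel"
 shows "conv k w \<in> borel_measurable borel"
 unfolding conv_def[abs_def] by measurable

lemma conv_diff: "kern k ==> L2 u ==> L2 w ==> conv k (%y. u y - w y) x = conv k u x - conv k w x"
 unfolding conv_def using conv_int by (simp add: right_diff_distrib)

lemma conv_L1:
 assumes k: "kern k" and g: "integrable lborel g"
 shows "integrable lborel (%x. conv k g x)" "(LI x. conv k g x) = (LI x. k x) * (LI x. g x)"
proof -
 have [measurable]: "k \<in> borel_measurable borel" "g \<in> borel_measurable borel" using assms by (auto simp: kern_def)
 have ik: "integrable lborel k" using k by (simp add: kern_def)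
 have sh: "integrable lborel (%x. k (x - y))" for y
  using lborel_integrable_real_affine[OF ik, of 1 "-y"] by simp
 have I: "integrable (lborel \<Otimes>\<^sub>M lborel) (%(y, x). k (x - y) * g y)"
 proof (rule lborel_pair.Fubini_integrable)
  have "(LI x. norm (k (x - y) * g y)) = (LI x. \<bar>k x\<bar>) * \<bar>g y\<bar>" for y
   using LINT_shift[of "%x. \<bar>k x\<bar>" "-y"] by (simp add: abs_mult)
  then show "integrable lborel (%y. LI x. norm (case (y, x) of (y, x) => k (x - y) * g y))"
   using g by simp
  show "AE y in lborel. integrable lborel (%x. case (y, x) of (y, x) => k (x - y) * g y)"
   using sh by auto
 qed measurable
 show "integrable lborel (%x. conv k g x)"
  using lborel_pair.integrable_snd[OF I] by (simp add: conv_def)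
 have "(LI x. conv k g x) = (LI y. (LI x. k (x - y) * g y))"
  unfolding conv_def using lborel_pair.Fubini_integral[OF I] by simp
 also have "\<dots> = (LI y. (LI x. k x) * g y)"
  using LINT_shift[of k "-y" for y] by simp
 finally show "(LI x. conv k g x) = (LI x. k x) * (LI x. g x)" by simp
qed

text \<open>Splitting |k| into two square roots and applying Cauchy-Schwarz in y bounds the squared
  convolution pointwise by the L1 norm of \<open>k\<close> times the convolution of |k| with w^2;
  \<open>conv_L1\<close> integrates this.\<close>

lemma conv_young:
 assumes k: "kern k" and w: "L2 w"
 shows "L2 (conv k w)" "nrm (conv k w) \<le> (LI x. \<bar>k x\<bar>) * nrm w"
proof -
 have [measurable]: "k \<in> borel_measurable borel" "w \<in> borel_measurable borel" using assms by (auto dest: L2_meas simp: kern_def)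
 define M where "M = (LI x. \<bar>k x\<bar>)"
 have M0: "M \<ge> 0" by (simp add: M_def)
 have ka: "kern (%x. \<bar>k x\<bar>)" using k by (rule kern_abs)
 obtain C where C: "\<And>x. \<bar>k x\<bar> \<le> C" using k by (auto simp: kern_def)
 have pt: "(conv k w x)\<^sup>2 \<le> M * conv (%x. \<bar>k x\<bar>) (%y. (w y)\<^sup>2) x" for x
 proof -
  define a where "a = (%y. sqrt \<bar>k (x - y)\<bar>)"
  define b where "b = (%y. sqrt \<bar>k (x - y)\<bar> * \<bar>w y\<bar>)"
  have [measurable]: "a \<in> borel_measurable borel" "b \<in> borel_measurable borel" by (auto simp: a_def b_def)
  have a: "L2 a" by (rule L2I) (use kern_reflect[OF ka, of x] in \<open>auto simp: a_def kern_def\<close>)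
  have b: "L2 b"
  proof (rule L2_bound)
   show "integrable lborel (%y. C * (w y)\<^sup>2)" using L2_sq[OF w] by simp
   show "AE y in lborel. (b y)\<^sup>2 \<le> C * (w y)\<^sup>2"
    using C by (auto simp: b_def power_mult_distrib intro!: mult_right_mono)
  qed measurable
  have "\<bar>conv k w x\<bar> \<le> (LI y. \<bar>k (x - y) * w y\<bar>)"
   unfolding conv_def by (rule integral_abs_bound)
  also have "\<dots> = (LI y. a y * b y)"
   by (intro Bochner_Integration.integral_cong)
     (auto simp: a_def b_def abs_mult mult.assoc[symmetric])
  also have "\<dots> \<le> nrm a * nrm b" using CS_ineq[OF a b] by simp
  finally have "\<bar>conv k w x\<bar>\<^sup>2 \<le> (nrm a * nrm b)\<^sup>2" by (intro power_mono) auto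
  also have "\<dots> = (LI y. \<bar>k (x - y)\<bar>) * (LI y. \<bar>k (x - y)\<bar> * (w y)\<^sup>2)"
   unfolding power_mult_distrib nrm_sq by (simp add: a_def b_def power_mult_distrib)
  also have "(LI y. \<bar>k (x - y)\<bar>) = M"
   using LINT_reflect[of "%x. \<bar>k x\<bar>" x] by (simp add: M_def)
  finally show ?thesis by (simp add: conv_def)
 qed
 note L = conv_L1[OF ka L2_sq[OF w]]
 show 1: "L2 (conv k w)"
  by (rule L2_bound[where g="%x. M * conv (%x. \<bar>k x\<bar>) (%y. (w y)\<^sup>2) x"]) (use pt L in auto)
 have "(nrm (conv k w))\<^sup>2 \<le> (LI x. M * conv (%x. \<bar>k x\<bar>) (%y. (w y)\<^sup>2) x)"
  unfolding nrm_sq by (intro integral_mono pt L2_sq[OF 1]) (use L in auto)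
 also have "\<dots> = (M * nrm w)\<^sup>2"
  using L by (simp add: M_def[symmetric] power_mult_distrib nrm_sq) (simp add: power2_eq_square)
 finally show "nrm (conv k w) \<le> (LI x. \<bar>k x\<bar>) * nrm w"
  unfolding M_def[symmetric] by (rule power2_le_imp_le) (simp add: M0)
qed

subsection \<open>Smoothness of convolutions\<close>

lemma L2_loc_int: assumes "L2 u" shows "loc_int u"
 unfolding loc_int_def set_integrable_def
proof (intro allI)
 fix a b :: real
 have "(%x. (indicat_real {a..b} x)\<^sup>2) = indicat_real {a..b}" by (auto simp: indicator_def)
 then have "L2 (indicat_real {a..b})"
  by (intro L2I) (auto simp: emeasure_lborel_Icc_eq)
 from L2_mult[OF this assms] show "integrable lborel (%x. indicat_real {a..b} x *\<^sub>R u x)" by simp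
qed

lemma cont_loc_int: "continuous_on UNIV u ==> loc_int u"
 unfolding loc_int_def by (metis borel_integrable_atLeastAtMost' continuous_on_subset subset_UNIV)

lemma loc_int_meas: assumes "loc_int u" shows "u \<in> borel_measurable borel"
proof -
 have m: "(%x. indicat_real {- real n..real n} x *\<^sub>R u x) \<in> borel_measurable borel" for n
  using borel_measurable_integrable[OF assms[unfolded loc_int_def set_integrable_def, rule_format, of "- real n" "real n"]] by simp
 have t: "(%n. indicat_real {- real n..real n} x *\<^sub>R u x) \<longlonglongrightarrow> u x" for x
 proof -
  obtain N where N: "real N \<ge> \<bar>x\<bar>" using real_arch_simple by blast
  have "\<forall>\<^sub>F n in sequentially. indicat_real {- real n..real n} x *\<^sub>R u x = u x"
   unfolding eventually_sequentially
   by (rule exI[of _ N]) (use N in \<open>auto simp: indicator_def\<close>)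
  then show ?thesis by (rule tendsto_eventually)
 qed
 show ?thesis by (rule borel_measurable_LIMSEQ_real[OF t m])
qed

lemma loc_int_ind: "loc_int w ==> integrable lborel (%y. indicat_real {a..b} y * \<bar>w y\<bar>)"
 unfolding loc_int_def set_integrable_def using integrable_abs by (fastforce simp: abs_mult)

lemma loc_int_test:
 assumes w: "loc_int w" and k: "test_fun k"
 shows "integrable lborel (%y. w y * k y)"
proof -
 obtain R where R: "\<And>x. R \<le> \<bar>x\<bar> ==> k x = 0" using test_supp[OF k] by metis
 obtain C where C: "C > 0" "\<And>x. \<bar>k x\<bar> \<le> C" using test_bounded[OF k] by metis
 have [measurable]: "k \<in> borel_measurable borel" "w \<in> borel_measurable borel" using assms test_meas loc_int_meas by auto
 show ?thesis
 proof (rule Bochner_Integration.integrable_bound)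
  show "integrable lborel (%y. C * (indicat_real {-R..R} y * \<bar>w y\<bar>))" using loc_int_ind[OF w] by simp
  show "AE y in lborel. norm (w y * k y) \<le> norm (C * (indicat_real {-R..R} y * \<bar>w y\<bar>))"
  proof (rule AE_I2)
   fix y show "norm (w y * k y) \<le> norm (C * (indicat_real {-R..R} y * \<bar>w y\<bar>))"
    using R[of y] mult_right_mono[OF C(2)[of y] abs_ge_zero[of "w y"]] C(1)
    by (auto simp: indicator_def abs_mult mult.commute)
  qed
 qed measurable
qed

lemma test_refl: "test_fun k ==> test_fun (%y. k (x - y))"
 using test_affine[of k "-1" x] by (simp add: add.commute)

lemma deriv_refl: "test_fun k ==> deriv (%y. k (x - y)) = (%y. - deriv k (x - y))"
 using deriv_affine[OF test_smooth, of k "-1" x] by (simp add: add.commute)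

lemma conv_int': "loc_int w ==> test_fun k ==> integrable lborel (%y. k (x - y) * w y)"
 using loc_int_test[OF _ test_refl] by (simp add: mult.commute)

lemma test_lipschitz:
 assumes "test_fun k" obtains L where "L > 0" "\<And>a b. \<bar>k a - k b\<bar> \<le> L * \<bar>a - b\<bar>"
proof -
 obtain C where C: "C > 0" "\<And>x. \<bar>deriv k x\<bar> \<le> C" using test_bounded[OF test_deriv[OF assms]] by metis
 have "norm (k a - k b) \<le> C * norm (a - b)" for a b
  by (rule field_differentiable_bound[of UNIV k "deriv k"])
    (use C smooth_DERIV[OF test_smooth[OF assms]] in auto)
 then show ?thesis using C that by auto
qed

lemma test_taylor1:
 assumes "test_fun k" obtains L where "L > 0" "\<And>z h. \<bar>k (z + h) - k z - h * deriv k z\<bar> \<le> L * h\<^sup>2"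
proof -
 obtain L where L: "L > 0" "\<And>a b. \<bar>deriv k a - deriv k b\<bar> \<le> L * \<bar>a - b\<bar>"
  using test_lipschitz[OF test_deriv[OF assms]] by metis
 have "\<bar>k (z + h) - k z - h * deriv k z\<bar> \<le> L * h\<^sup>2" for z h
 proof -
  have "norm ((k (z + h) - h * deriv k z) - (k (z + 0) - 0 * deriv k z)) \<le> (L * \<bar>h\<bar>) * norm (h - 0)"
  proof (rule field_differentiable_bound[of "cball 0 \<bar>h\<bar>" "%t. k (z + t) - t * deriv k z" "%t. deriv k (z + t) - deriv k z"])
   fix t :: real assume t: "t \<in> cball 0 \<bar>h\<bar>"
   have "((%t. k (1 * t + z)) has_real_derivative 1 * deriv k (1 * t + z)) (at t within cball 0 \<bar>h\<bar>)"
    by (rule has_field_derivative_at_within[OF DERIV_affine[OF smooth_DERIV[OF test_smooth[OF assms]]]])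
   then show "((%t. k (z + t) - t * deriv k z) has_real_derivative deriv k (z + t) - deriv k z) (at t within cball 0 \<bar>h\<bar>)"
    by (auto intro!: derivative_eq_intros simp: add.commute)
   have "\<bar>deriv k (z + t) - deriv k z\<bar> \<le> L * \<bar>t\<bar>" using L(2)[of "z + t" z] by simp
   also have "\<dots> \<le> L * \<bar>h\<bar>" using t L(1) by (auto simp: dist_real_def)
   finally show "norm (deriv k (z + t) - deriv k z) \<le> L * \<bar>h\<bar>" by simp
  qed (auto simp: dist_real_def)
  then show ?thesis by (simp add: power2_eq_square algebra_simps)
 qed
 then show ?thesis using L that by blast
qed

text \<open>For |h| at most 1 the integrand lives on a fixed window around x, and the Taylor
  remainder of \<open>k\<close> is uniformly O(h^2). Local integrability of \<open>w\<close> then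
  suffices to differentiate under the integral.\<close>

lemma conv_DERIV:
 assumes k: "test_fun k" and w: "loc_int w"
 shows "(conv k w has_real_derivative conv (deriv k) w x) (at x)"
proof -
 obtain L where L: "L > 0" "\<And>z h. \<bar>k (z + h) - k z - h * deriv k z\<bar> \<le> L * h\<^sup>2"
  using test_taylor1[OF k] by metis
 obtain R where R: "R > 0" "\<And>x. R \<le> \<bar>x\<bar> ==> k x = 0" using test_supp[OF k] by metis
 have R': "deriv k z = 0" if "R < \<bar>z\<bar>" for z using supp_deriv_zero[of R k z] R that by auto
 define G where "G = (LI y. indicat_real {x - R - 1..x + R + 1} y * \<bar>w y\<bar>)"
 have iG: "integrable lborel (%y. indicat_real {x - R - 1..x + R + 1} y * \<bar>w y\<bar>)"
  by (rule loc_int_ind[OF w])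
 have G0: "G \<ge> 0" unfolding G_def by (intro integral_nonneg_AE) auto
 have est: "\<bar>conv k w (x + h) - conv k w x - h * conv (deriv k) w x\<bar> \<le> L * h\<^sup>2 * G" if h: "\<bar>h\<bar> \<le> 1" for h
 proof -
  note i = conv_int'[OF w k] conv_int'[OF w test_deriv[OF k]]
  have eq: "conv k w (x + h) - conv k w x - h * conv (deriv k) w x
    = (LI y. (k (x + h - y) - k (x - y) - h * deriv k (x - y)) * w y)"
   unfolding conv_def using i by (simp add: left_diff_distrib mult.assoc)
  have "\<bar>LI y. (k (x + h - y) - k (x - y) - h * deriv k (x - y)) * w y\<bar> \<le> (LI y. L * h\<^sup>2 * (indicat_real {x - R - 1..x + R + 1} y * \<bar>w y\<bar>))"
  proof (rule LINT_abs_le)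
   show "integrable lborel (%y. (k (x + h - y) - k (x - y) - h * deriv k (x - y)) * w y)"
    using i by (simp add: left_diff_distrib mult.assoc)
   show "integrable lborel (%y. L * h\<^sup>2 * (indicat_real {x - R - 1..x + R + 1} y * \<bar>w y\<bar>))" using iG by simp
   fix y
   show "\<bar>(k (x + h - y) - k (x - y) - h * deriv k (x - y)) * w y\<bar> \<le> L * h\<^sup>2 * (indicat_real {x - R - 1..x + R + 1} y * \<bar>w y\<bar>)"
   proof (cases "\<bar>x - y\<bar> \<le> R + 1")
    case True
    then have "indicat_real {x - R - 1..x + R + 1} y = 1" by (auto simp: indicator_def)
    then show ?thesis using mult_right_mono[OF L(2)[of "x - y" h] abs_ge_zero[of "w y"]]
     by (simp only: abs_mult) (simp add: algebra_simps)
   next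
    case False
    then have "k (x + h - y) = 0" "k (x - y) = 0" "deriv k (x - y) = 0"
     using h by (auto intro!: R R')
    then show ?thesis using L(1) by simp
   qed
  qed
  also have "\<dots> = L * h\<^sup>2 * G" unfolding G_def by (rule integral_mult_right_zero)
  finally show ?thesis unfolding eq .
 qed
 show ?thesis unfolding DERIV_def
 proof (rule LIM_I)
  fix r :: real assume r: "r > 0"
  define s where "s = min 1 (r / (L * G + 1))"
  have LG: "L * G + 1 > 0" using L G0 by (simp add: add_nonneg_pos)
  show "\<exists>s>0. \<forall>h. h \<noteq> 0 \<and> norm (h - 0) < s -->
    norm ((conv k w (x + h) - conv k w x) / h - conv (deriv k) w x) < r"
  proof (intro exI[of _ s] conjI allI impI)
   show "s > 0" using r LG by (simp add: s_def)
   fix h :: real assume h: "h \<noteq> 0 \<and> norm (h - 0) < s"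
   then have h': "h \<noteq> 0" "\<bar>h\<bar> \<le> 1" "\<bar>h\<bar> < r / (L * G + 1)" by (auto simp: s_def)
   have "norm ((conv k w (x + h) - conv k w x) / h - conv (deriv k) w x)
     = \<bar>conv k w (x + h) - conv k w x - h * conv (deriv k) w x\<bar> / \<bar>h\<bar>"
    using h'(1) by (simp add: abs_divide[symmetric] diff_divide_distrib)
   also have "\<dots> \<le> L * h\<^sup>2 * G / \<bar>h\<bar>" using est[OF h'(2)] by (intro divide_right_mono) auto
   also have "\<dots> = (L * G) * \<bar>h\<bar>" using h'(1) by (simp add: power2_eq_square abs_if field_simps)
   also have "\<dots> \<le> (L * G + 1) * \<bar>h\<bar>" by (intro mult_right_mono) auto
   also have "\<dots> < r" using h'(3) LG by (simp add: field_simps)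
   finally show "norm ((conv k w (x + h) - conv k w x) / h - conv (deriv k) w x) < r" .
  qed
 qed
qed

lemma conv_smooth: assumes "test_fun k" "loc_int w" shows "smooth (conv k w)"
proof (rule smooth_coinduct[where P="%f. \<exists>k. test_fun k \<and> f = conv k w"])
 fix f assume "\<exists>k. test_fun k \<and> f = conv k w"
 then show "\<exists>f'. (\<forall>x. (f has_real_derivative f' x) (at x)) \<and> (\<exists>k. test_fun k \<and> f' = conv k w)"
  using conv_DERIV[OF _ assms(2)] test_deriv by blast
qed (use assms in auto)

lemma deriv_conv: "test_fun k ==> loc_int w ==> deriv (conv k w) = conv (deriv k) w"
 by (intro ext DERIV_imp_deriv conv_DERIV)

lemma conv_compact_supp:
 assumes "\<And>x. R \<le> \<bar>x\<bar> ==> w x = 0" "\<And>x. R' \<le> \<bar>x\<bar> ==> k x = 0" "R + R' \<le> \<bar>x\<bar>"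
 shows "conv k w x = 0"
proof -
 have "(%y. k (x - y) * w y) = (%y. 0)"
 proof
  fix y show "k (x - y) * w y = 0"
   using assms(1)[of y] assms(2)[of "x - y"] assms(3) by (cases "R \<le> \<bar>y\<bar>") auto
 qed
 then show ?thesis by (simp add: conv_def)
qed

text \<open>The reflected kernel y -> k(x - y) is a test function whose derivative carries a minus
  sign, which cancels the sign in the definition of the weak derivative. Derivatives of the kernel
  are traded for weak derivatives of the function in this way throughout.\<close>

lemma conv_weak: assumes "weak_deriv u g" "test_fun k" shows "conv (deriv k) u x = conv k g x"
proof -
 have "(LI y. u y * deriv (%y. k (x - y)) y) = - (LI y. g y * k (x - y))"
  using assms test_refl unfolding weak_deriv_def by blast
 then show ?thesis using assms by (simp add: deriv_refl conv_def mult.commute)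
qed

subsection \<open>Mollifiers\<close>

lemma bump_integral_pos: "(LI x. bump x) > 0"
proof -
 \<comment> \<open>For |x| at most 1/2 both 1 - x and 1 + x are at least 1/2, so each flat factor is
   at least exp(-2).\<close>
 have ge: "bump x \<ge> exp (-4) * indicat_real {-1/2..1/2} x" for x :: real
 proof (cases "x \<in> {-1/2..1/2}")
  case True
  have f: "flat_exp 1 t \<ge> exp (-2)" if "t \<ge> 1/2" for t :: real
   using that by (auto simp: flat_exp_def field_simps)
  have "exp (-2) * exp (-2) \<le> bump x"
   unfolding bump_def by (intro mult_mono f) (use True in \<open>auto simp: flat_exp_def\<close>)
  then show ?thesis using True by (simp flip: exp_add)
 qed (use bump_nonneg[of x] in auto)
 have "0 < (LINT x::real|lborel. exp (-4) * indicat_real {-1/2..1/2} x)" by simp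
 also have "\<dots> \<le> (LI x. bump x)"
  by (intro integral_mono ge test_integrable[OF test_bump]) simp
 finally show ?thesis .
qed

text \<open>The scale n + 1 keeps index 0 meaningful: \<open>moll 0\<close> is supported in [-1, 1],
  which the cutoff \<open>cut\<close> relies on.\<close>

definition moll :: "nat => real => real" where
 "moll n x = (real n + 1) / (LI x. bump x) * bump ((real n + 1) * x)"

lemma moll_test: "test_fun (moll n)"
proof -
 have "test_fun (%x. (real n + 1) / (LI x. bump x) * bump ((real n + 1) * x + 0))"
  by (intro test_cmult test_affine test_bump) simp
 then show ?thesis unfolding moll_def[abs_def] by simp
qed

lemma moll_nonneg: "moll n x \<ge> 0"
 using bump_integral_pos bump_nonneg by (simp add: moll_def)

lemma moll_supp: assumes "1 / (real n + 1) \<le> \<bar>x\<bar>" shows "moll n x = 0"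
proof -
 have "1 \<le> \<bar>(real n + 1) * x\<bar>" using assms by (simp add: abs_mult field_simps)
 then show ?thesis by (simp add: moll_def bump_support)
qed

lemma moll_integral: "(LI x. moll n x) = 1"
proof -
 have "(LI x. bump x) = (real n + 1) * (LI x. bump ((real n + 1) * x))"
  using lborel_integral_real_affine[of "real n + 1" bump 0] by simp
 then have "(LI x. bump x) / (LI x. bump x)
   = (real n + 1) / (LI x. bump x) * (LI x. bump ((real n + 1) * x))" by simp
 moreover have "(LI x. moll n x) = (real n + 1) / (LI x. bump x) * (LI x. bump ((real n + 1) * x))"
  unfolding moll_def by simp
 ultimately show ?thesis using bump_integral_pos by (metis divide_self less_irrefl)
qed

lemma moll_kern: "kern (moll n)" by (simp add: test_kern moll_test)

lemma moll_young: assumes "L2 w" shows "nrm (conv (moll n) w) \<le> nrm w"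
 using conv_young(2)[OF moll_kern assms, of n] moll_integral moll_nonneg by simp

lemma conv_swap: "conv k w x = (LI y. k y * w (x - y))"
 unfolding conv_def using LINT_reflect[of "%y. k y * w (x - y)" x] by simp

lemma moll_pointwise:
 assumes w: "loc_int w" and e: "\<And>y. \<bar>y\<bar> \<le> 1 / (real n + 1) ==> \<bar>w (x - y) - w x\<bar> \<le> e"
 shows "\<bar>conv (moll n) w x - w x\<bar> \<le> e"
proof -
 have i1: "integrable lborel (%y. moll n y * w (x - y))"
  using integrable_reflect[OF conv_int'[OF w moll_test[of n], of x], of x] by simp
 have i2: "integrable lborel (moll n)" by (simp add: test_integrable moll_test)
 have eq: "conv (moll n) w x - w x = (LI y. moll n y * (w (x - y) - w x))"
  using i1 i2 moll_integral[of n] by (simp add: conv_swap right_diff_distrib)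
 have "\<bar>LI y. moll n y * (w (x - y) - w x)\<bar> \<le> (LI y. e * moll n y)"
 proof (rule LINT_abs_le)
  show "integrable lborel (%y. moll n y * (w (x - y) - w x))" using i1 i2 by (simp add: right_diff_distrib)
  show "\<bar>moll n y * (w (x - y) - w x)\<bar> \<le> e * moll n y" for y
   using e[of y] moll_supp[of n y] mult_left_mono[OF e[of y] moll_nonneg[of n y]] moll_nonneg[of n y]
   by (cases "\<bar>y\<bar> \<le> 1 / (real n + 1)") (auto simp: abs_mult mult.commute)
 qed (use i2 in simp)
 also have "\<dots> = e" using moll_integral[of n] by simp
 finally show ?thesis unfolding eq .
qed

text \<open>Since \<open>moll n\<close> is a probability density, Cauchy-Schwarz bounds the squared
  error at x by the average of |w(x - y) - w(x)|^2. After Fubini this is an average of squared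
  translation moduli over shifts of size at most 1/(n+1), small by \<open>L2_tcont\<close>.\<close>

lemma moll_tendsto:
 assumes w: "L2 w" shows "(%n. nrm (%x. conv (moll n) w x - w x)) \<longlonglongrightarrow> 0"
proof (rule LIMSEQ_I)
 fix r :: real assume r: "r > 0"
 then have r2: "r / 2 > 0" by simp
 have [measurable]: "w \<in> borel_measurable borel" using w by measurable
 obtain d where d: "d > 0" "\<And>h. \<bar>h\<bar> < d ==> nrm (%x. w (x + h) - w x) < r/2"
  using tcontD[OF L2_tcont[OF w] r2] by blast
 obtain N where N: "1 / (real N + 1) < d" using d(1) by (metis add.commute nat_approx_posE of_nat_Suc)
 show "\<exists>no. \<forall>n\<ge>no. norm (nrm (%x. conv (moll n) w x - w x) - 0) < r"
 proof (intro exI[of _ N] allI impI)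
  fix n assume "N \<le> n"
  then have "1 / (real n + 1) \<le> 1 / (real N + 1)" by (intro divide_left_mono) auto
  then have n: "1 / (real n + 1) < d" using N by simp
  define k where "k = moll n"
  have [measurable]: "k \<in> borel_measurable borel" using moll_kern[of n] by (simp add: k_def kern_def)
  have k: "kern k" "\<And>x. k x \<ge> 0" "integrable lborel k" "(LI x. k x) = 1"
   using moll_kern[of n] moll_nonneg moll_integral by (auto simp: k_def kern_def)
  obtain C where C: "\<And>x. \<bar>k x\<bar> \<le> C" using k by (auto simp: kern_def)
  have C0: "C \<ge> 0" using C[of 0] by linarith
  have wr: "L2 (%y. w (x - y))" for x
  proof (rule L2I)
   show "integrable lborel (%y. (w (x - y))\<^sup>2)" using integrable_reflect[OF L2_sq[OF w]] by simp
  qed measurable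
  have iy: "integrable lborel (%y. k y * (w (x - y) - w x)\<^sup>2)" for x
  proof (rule Bochner_Integration.integrable_bound)
   show "integrable lborel (%y. 2 * C * (w (x - y))\<^sup>2 + 2 * (w x)\<^sup>2 * k y)"
    using L2_sq[OF wr] k(3) by auto
   show "AE y in lborel. norm (k y * (w (x - y) - w x)\<^sup>2) \<le> norm (2 * C * (w (x - y))\<^sup>2 + 2 * (w x)\<^sup>2 * k y)"
   proof (rule AE_I2)
    fix y
    have "(w (x - y) - w x)\<^sup>2 \<le> 2 * (w (x - y))\<^sup>2 + 2 * (w x)\<^sup>2"
     using sum_squares_bound[of "w (x - y)" "- w x"] by (simp add: power2_diff)
    then have "k y * (w (x - y) - w x)\<^sup>2 \<le> k y * (2 * (w (x - y))\<^sup>2 + 2 * (w x)\<^sup>2)"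
     using k(2)[of y] by (rule mult_left_mono)
    also have "\<dots> = 2 * (k y * (w (x - y))\<^sup>2) + 2 * (w x)\<^sup>2 * k y" by (simp add: algebra_simps)
    also have "\<dots> \<le> 2 * (C * (w (x - y))\<^sup>2) + 2 * (w x)\<^sup>2 * k y"
     using C[of y] by (intro add_right_mono mult_left_mono mult_right_mono) auto
    finally show "norm (k y * (w (x - y) - w x)\<^sup>2) \<le> norm (2 * C * (w (x - y))\<^sup>2 + 2 * (w x)\<^sup>2 * k y)"
     using k(2)[of y] by simp
   qed
  qed measurable
  have pt: "(conv k w x - w x)\<^sup>2 \<le> (LI y. k y * (w (x - y) - w x)\<^sup>2)" for x
  proof -
   define a where "a = (%y. sqrt (k y))"
   define b where "b = (%y. sqrt (k y) * (w (x - y) - w x))"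
   have [measurable]: "a \<in> borel_measurable borel" "b \<in> borel_measurable borel" by (auto simp: a_def b_def)
   have a: "L2 a" by (rule L2I) (use k in \<open>auto simp: a_def\<close>)
   have b: "L2 b" by (rule L2I) (use iy k in \<open>auto simp: b_def power_mult_distrib\<close>)
   have i1: "integrable lborel (%y. k y * w (x - y))"
    by (rule L2_mult[OF kern_L2[OF k(1)] wr])
   have "conv k w x - w x = (LI y. k y * (w (x - y) - w x))"
    using i1 k by (simp add: conv_swap right_diff_distrib)
   also have "\<dots> = (LI y. a y * b y)"
    by (intro Bochner_Integration.integral_cong) (use k(2) in \<open>auto simp: a_def b_def mult.assoc[symmetric]\<close>)
   finally have "\<bar>conv k w x - w x\<bar> \<le> nrm a * nrm b" using CS_ineq[OF a b] by simp
   then have "\<bar>conv k w x - w x\<bar>\<^sup>2 \<le> (nrm a * nrm b)\<^sup>2" by (intro power_mono) auto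
   also have "\<dots> = (LI y. k y) * (LI y. k y * (w (x - y) - w x)\<^sup>2)"
    unfolding power_mult_distrib nrm_sq using k(2) by (simp add: a_def b_def power_mult_distrib)
   finally show ?thesis using k(4) by simp
  qed
  define S where "S y = (nrm (%x. w (x + (- y)) - w x))\<^sup>2" for y
  have S: "(LI x. (w (x - y) - w x)\<^sup>2) = S y" for y by (simp add: S_def nrm_sq)
  have Sm: "S \<in> borel_measurable borel" unfolding S_def[abs_def] nrm_sq by measurable
  have S_nonneg: "0 \<le> S y" for y by (simp add: S_def)
  have Sb: "k y * S y \<le> (r/2)\<^sup>2 * k y" for y
  proof (cases "\<bar>y\<bar> < d")
   case True
   then have "S y \<le> (r/2)\<^sup>2" unfolding S_def using d(2)[of "- y"] by (intro power_mono) auto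
   then show ?thesis using mult_left_mono[OF _ k(2)[of y], of "S y" "(r/2)\<^sup>2"] by (simp add: mult.commute)
  next
   case False then show ?thesis using moll_supp[of n y] n by (simp add: k_def)
  qed
  have iS: "integrable lborel (%y. k y * S y)"
   by (rule Bochner_Integration.integrable_bound[of _ "%y. (r/2)\<^sup>2 * k y"])
     (use k Sm Sb in \<open>auto intro!: AE_I2 simp: S_nonneg\<close>)
  have ix: "integrable lborel (%x. (w (x - y) - w x)\<^sup>2)" for y
   using L2_sq[OF L2_diff[OF L2_shift[OF w, of "- y"] w]] by simp
  have I: "integrable (lborel \<Otimes>\<^sub>M lborel) (%(y, x). k y * (w (x - y) - w x)\<^sup>2)"
  proof (rule lborel_pair.Fubini_integrable)
   show "integrable lborel (%y. LI x. norm (case (y, x) of (y, x) => k y * (w (x - y) - w x)\<^sup>2))"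
    using iS k(2) by (simp add: S abs_mult)
   show "AE y in lborel. integrable lborel (%x. case (y, x) of (y, x) => k y * (w (x - y) - w x)\<^sup>2)"
    using ix by simp
  qed measurable
  have cL: "L2 (%x. conv k w x - w x)" by (intro L2_diff conv_young k w)
  have "(ndist (conv k w) w)\<^sup>2 \<le> (LI x. LI y. k y * (w (x - y) - w x)\<^sup>2)"
   unfolding nrm_sq by (intro integral_mono pt L2_sq[OF cL]) (use lborel_pair.integrable_snd[OF I] in simp)
  also have "\<dots> = (LI y. LI x. k y * (w (x - y) - w x)\<^sup>2)"
   using lborel_pair.Fubini_integral[OF I] by simp
  also have "\<dots> = (LI y. k y * S y)" by (simp add: S)
  also have "\<dots> \<le> (LI y. (r/2)\<^sup>2 * k y)"
   by (intro integral_mono iS Sb) (use k in simp)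
  also have "\<dots> = (r/2)\<^sup>2" using k by simp
  finally have "ndist (conv k w) w \<le> r/2" by (rule power2_le_imp_le) (use r in simp)
  then show "norm (nrm (%x. conv (moll n) w x - w x) - 0) < r" using r by (simp add: k_def)
 qed
qed

lemma LINT_tendsto_L2:
 assumes "L2 a" "L2 b" "\<And>n. L2 (A n)" "\<And>n. L2 (B n)"
  "(%n. ndist (A n) a) \<longlonglongrightarrow> 0" "(%n. ndist (B n) b) \<longlonglongrightarrow> 0"
 shows "(%n. LI x. A n x * B n x) \<longlonglongrightarrow> (LI x. a x * b x)"
proof (rule Lim_null[THEN iffD2], rule Lim_null_comparison)
 let ?p = "%n. ndist (A n) a" and ?q = "%n. ndist (B n) b"
 have eq: "(LI x. A n x * B n x) - (LI x. a x * b x)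
   = (LI x. (A n x - a x) * (B n x - b x)) + (LI x. (A n x - a x) * b x) + (LI x. a x * (B n x - b x))" for n
  using L2_mult assms(1-4) by (simp add: algebra_simps L2_mult)
 show "\<forall>\<^sub>F n in sequentially. norm ((LI x. A n x * B n x) - (LI x. a x * b x)) \<le> ?p n * ?q n + ?p n * nrm b + nrm a * ?q n"
 proof (intro always_eventually allI)
  fix n
  show "norm ((LI x. A n x * B n x) - (LI x. a x * b x)) \<le> ?p n * ?q n + ?p n * nrm b + nrm a * ?q n"
   unfolding eq real_norm_def using CS_ineq[OF L2_diff[OF assms(3,1)] L2_diff[OF assms(4,2)], of n n]
    CS_ineq[OF L2_diff[OF assms(3,1)] assms(2), of n] CS_ineq[OF assms(1) L2_diff[OF assms(4,2)], of n] by linarith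
 qed
 have "(%n. ?p n * ?q n + ?p n * nrm b + nrm a * ?q n) \<longlonglongrightarrow> 0 * 0 + 0 * nrm b + nrm a * 0"
  by (intro tendsto_intros assms)
 then show "(%n. ?p n * ?q n + ?p n * nrm b + nrm a * ?q n) \<longlonglongrightarrow> 0" by simp
qed

lemma nrm_tendsto_unique:
 assumes "L2 a" "L2 b" "\<And>n. L2 (A n)" "(%n. ndist (A n) a) \<longlonglongrightarrow> 0" "(%n. ndist (A n) b) \<longlonglongrightarrow> 0"
 shows "AE x in lborel. a x = b x"
proof -
 have "ndist a b \<le> 0 + 0"
 proof (rule LIMSEQ_le_const[OF tendsto_add[OF assms(4,5)]], intro exI allI impI)
  fix n show "ndist a b \<le> ndist (A n) a + ndist (A n) b"
   using nrm_triangle3[OF assms(1,3,2), of n] nrm_minus_commute[of a "A n"] by simp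
 qed
 then have "ndist a b = 0" using nrm_nonneg[of "%x. a x - b x"] by linarith
 from nrm_zero_AE[OF L2_diff[OF assms(1,2)] this] show ?thesis by simp
qed

text \<open>Both mollifications equal the convolution of \<open>u\<close> with the derivative of the
  mollifier; the common sequence converges in L2 to either candidate.\<close>

lemma weak_deriv_unique:
 assumes "weak_deriv u g" "weak_deriv u h" "L2 g" "L2 h"
 shows "AE x in lborel. g x = h x"
proof (rule nrm_tendsto_unique[OF assms(3,4)])
 have "conv (moll n) g = conv (moll n) h" for n
  using conv_weak[OF assms(1) moll_test] conv_weak[OF assms(2) moll_test] by (simp add: fun_eq_iff)
 then show "(%n. nrm (%x. conv (moll n) g x - h x)) \<longlonglongrightarrow> 0"
  using moll_tendsto[OF assms(4)] by simp
qed (use moll_tendsto[OF assms(3)] conv_young(1)[OF moll_kern assms(3)] in auto)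

section \<open>Sobolev functions\<close>

text \<open>A smooth plateau obtained by mollifying an indicator: the mollifier has radius 1, so the
  value is 1 on [-1, 1] and 0 outside [-3, 3].\<close>

definition cut :: "real => real" where
 "cut = conv (moll 0) (indicator {-2..2})"

lemma L2_indicator_Icc: "L2 (indicat_real {a..b})"
proof -
 have "(%x. (indicat_real {a..b} x)\<^sup>2) = indicat_real {a..b}" by (auto simp: indicator_def)
 then show ?thesis by (intro L2I) (auto simp: emeasure_lborel_Icc_eq)
qed

lemma cut_smooth: "smooth cut"
 unfolding cut_def by (intro conv_smooth moll_test L2_loc_int L2_indicator_Icc)

lemma cut_far: "3 \<le> \<bar>x\<bar> ==> cut x = 0"
proof -
 assume x: "3 \<le> \<bar>x\<bar>"
 have "(%y. moll 0 (x - y) * indicat_real {-2..2} y) = (%y. 0)"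
 proof
  fix y show "moll 0 (x - y) * indicat_real {-2..2} y = 0"
  proof (cases "y \<in> {-2..2}")
   case True
   then have "1 / (real 0 + 1) \<le> \<bar>x - y\<bar>" using x by auto
   then show ?thesis by (simp only: moll_supp mult_zero_left)
  qed simp
 qed
 then show "cut x = 0" by (simp add: cut_def conv_def)
qed

lemma cut_test: "test_fun cut"
 unfolding test_fun_iff using cut_smooth cut_far by (auto intro!: exI[of _ 3])

lemma cut_one: assumes "\<bar>x\<bar> \<le> 1" shows "cut x = 1"
proof -
 have "(%y. moll 0 y * indicat_real {-2..2} (x - y)) = moll 0"
 proof
  fix y show "moll 0 y * indicat_real {-2..2} (x - y) = moll 0 y"
  proof (cases "\<bar>y\<bar> \<le> 1")
   case True
   then have "x - y \<in> {-2..2}" using assms by auto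
   then show ?thesis by simp
  next
   case False
   then have "1 / (real 0 + 1) \<le> \<bar>y\<bar>" by simp
   then show ?thesis by (simp only: moll_supp mult_zero_left)
  qed
 qed
 then show ?thesis by (simp add: cut_def conv_swap moll_integral)
qed

lemma cut_bounds: "0 \<le> cut x" "cut x \<le> 1"
proof -
 show "0 \<le> cut x" unfolding cut_def conv_def by (intro integral_nonneg_AE) (auto intro!: AE_I2 mult_nonneg_nonneg moll_nonneg)
 have "cut x \<le> (LI y. moll 0 y)"
  unfolding cut_def conv_swap
 proof (rule integral_mono)
  show "integrable lborel (%y. moll 0 y * indicat_real {-2..2} (x - y))"
   using integrable_reflect[OF conv_int'[OF L2_loc_int[OF L2_indicator_Icc] moll_test[of 0], of x "-2" 2], of x] by simp
  show "integrable lborel (moll 0)" by (simp add: moll_test test_integrable)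
  show "moll 0 y * indicat_real {-2..2} (x - y) \<le> moll 0 y" for y
   using moll_nonneg[of 0 y] by (auto simp: indicator_def)
 qed
 then show "cut x \<le> 1" by (simp add: moll_integral)
qed

text \<open>Stretched plateau: 1 up to n + 1, gone beyond 3(n + 1), with j-th derivative of order (n
  + 1)^(-j).\<close>

definition chi :: "nat => real => real" where
 "chi n x = cut (x / (real n + 1))"

lemma chi_affine: "chi n = (%x. cut (1 / (real n + 1) * x + 0))"
 by (simp add: chi_def fun_eq_iff)

lemma chi_test: "test_fun (chi n)"
 unfolding chi_affine by (intro test_affine cut_test) simp

lemma chi_derivs: "(deriv ^^ j) (chi n) = (%x. (1 / (real n + 1)) ^ j * (deriv ^^ j) cut (1 / (real n + 1) * x + 0))"
proof (induction j)
 case (Suc j)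
 have s: "smooth ((deriv ^^ j) cut)" using cut_test test_derivs test_smooth by blast
 have "(deriv ^^ Suc j) (chi n) = deriv (%x. (1 / (real n + 1)) ^ j * (deriv ^^ j) cut (1 / (real n + 1) * x + 0))"
  by (simp only: funpow.simps o_apply Suc)
 also have "\<dots> = (%x. (1 / (real n + 1)) ^ j * (1 / (real n + 1) * deriv ((deriv ^^ j) cut) (1 / (real n + 1) * x + 0)))"
  by (simp only: deriv_cmult'[OF smooth_affine[OF s]] deriv_affine[OF s])
 finally show ?case by (simp add: mult_ac)
qed (simp add: chi_def)

lemma chi_deriv_bound:
 obtains C where "C > 0" "\<And>n x. \<bar>(deriv ^^ j) (chi n) x\<bar> \<le> C * (1 / (real n + 1)) ^ j"
proof -
 obtain C where C: "C > 0" "\<And>x. \<bar>(deriv ^^ j) cut x\<bar> \<le> C" using test_bounded[OF test_derivs[OF cut_test]] by metis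
 have "\<bar>(deriv ^^ j) (chi n) x\<bar> \<le> C * (1 / (real n + 1)) ^ j" for n x
 proof -
  have "\<bar>(deriv ^^ j) (chi n) x\<bar> = (1 / (real n + 1)) ^ j * \<bar>(deriv ^^ j) cut (1 / (real n + 1) * x + 0)\<bar>"
   unfolding chi_derivs by (simp add: abs_mult)
  also have "\<dots> \<le> (1 / (real n + 1)) ^ j * C" by (intro mult_left_mono C) simp
  finally show ?thesis by (simp add: mult.commute)
 qed
 then show ?thesis using C that by blast
qed

lemma chi_bounds: "0 \<le> chi n x" "chi n x \<le> 1"
 by (simp_all add: chi_def cut_bounds)

lemma chi_one: "\<bar>x\<bar> \<le> real n + 1 ==> chi n x = 1"
 unfolding chi_def by (rule cut_one) (simp add: field_simps)

lemma chi_far: "3 * (real n + 1) \<le> \<bar>x\<bar> ==> chi n x = 0"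
 unfolding chi_def by (rule cut_far) (simp add: field_simps)

lemma chi_deriv_far: assumes "3 * (real n + 1) < \<bar>x\<bar>" shows "(deriv ^^ j) (chi n) x = 0"
 using assms
proof (induction j arbitrary: x)
 case (Suc j) then show ?case using supp_deriv_zero[of "3 * (real n + 1)" "(deriv ^^ j) (chi n)" x] by simp
qed (auto intro: chi_far)

lemma chi_deriv_near: assumes "\<bar>x\<bar> < real n + 1" shows "(deriv ^^ Suc j) (chi n) x = 0"
proof -
 have "(deriv ^^ Suc j) (chi n) x = 0 \<and> (j = 0 --> True)" using assms
 proof (induction j arbitrary: x)
  case 0
  have "((%x. 1) has_real_derivative 0) (at x)" by simp
  then have "(chi n has_real_derivative 0) (at x)"
   by (rule has_field_derivative_transform_within_open[where S="{x. \<bar>x\<bar> < real n + 1}"])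
     (use 0 chi_one in \<open>auto intro!: open_Collect_less continuous_intros\<close>)
  then show ?case by (simp add: DERIV_imp_deriv)
 next
  case (Suc j)
  have "((%x. 0) has_real_derivative 0) (at x)" by simp
  then have "((deriv ^^ Suc j) (chi n) has_real_derivative 0) (at x)"
   by (rule has_field_derivative_transform_within_open[where S="{x. \<bar>x\<bar> < real n + 1}"])
     (use Suc in \<open>auto intro!: open_Collect_less continuous_intros\<close>)
  then show ?case by (simp add: DERIV_imp_deriv)
 qed
 then show ?thesis by simp
qed

lemma chi_tendsto: "(%n. chi n x) \<longlonglongrightarrow> 1"
proof (rule tendsto_eventually)
 obtain N where N: "real N \<ge> \<bar>x\<bar>" using real_arch_simple by blast
 show "\<forall>\<^sub>F n in sequentially. chi n x = 1"
  unfolding eventually_sequentially by (rule exI[of _ N]) (use N in \<open>auto intro!: chi_one\<close>)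
qed

lemma chi_derivs_tendsto: "(%n. (deriv ^^ Suc j) (chi n) x) \<longlonglongrightarrow> 0"
proof (rule tendsto_eventually)
 obtain N where N: "real N \<ge> \<bar>x\<bar>" using real_arch_simple by blast
 show "\<forall>\<^sub>F n in sequentially. (deriv ^^ Suc j) (chi n) x = 0"
  unfolding eventually_sequentially by (rule exI[of _ N]) (use N in \<open>auto intro!: chi_deriv_near simp del: funpow.simps\<close>)
qed

subsection \<open>Integration by parts\<close>

lemma integral_deriv_compact:
 assumes h: "\<And>x. (h has_real_derivative h' x) (at x)" "continuous_on UNIV h'" "\<And>x. R \<le> \<bar>x\<bar> ==> h x = 0"
 shows "integrable lborel h'" "(LI x. h' x) = 0"
proof -
 define M where "M = \<bar>R\<bar> + 1"
 have h'0: "h' x = 0" if "\<bar>R\<bar> < \<bar>x\<bar>" for x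
  using supp_deriv_zero[of "\<bar>R\<bar>" h x] h(3) that DERIV_imp_deriv[OF h(1)] by force
 then show "integrable lborel h'" by (rule integrable_compact_supp[OF h(2)])
 have "(LI x. h' x) = (LI x. h' x * indicator {-M..M} x)"
 proof (intro Bochner_Integration.integral_cong refl)
  fix x show "h' x = h' x * indicator {-M..M} x"
   using h'0[of x] by (cases "\<bar>x\<bar> \<le> \<bar>R\<bar>") (auto simp: M_def indicator_def)
 qed
 also have "\<dots> = h M - h (-M)"
  by (rule integral_FTC_Icc_real) (use h in \<open>auto simp: M_def continuous_on_eq_continuous_at\<close>)
 also have "\<dots> = 0" using h(3)[of M] h(3)[of "-M"] by (auto simp: M_def)
 finally show "(LI x. h' x) = 0" .
qed

text \<open>Boundary terms at infinity are avoided by multiplying with \<open>chi n\<close>: the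
  derivative falling on the cutoff costs O(1/(n+1)) times the L1 norm of \<open>g\<close>.\<close>

lemma integral_deriv_zero:
 assumes g: "\<And>x. (g has_real_derivative g' x) (at x)" "continuous_on UNIV g'"
  "integrable lborel g" "integrable lborel g'"
 shows "(LI x. g' x) = 0"
proof -
 have gc: "continuous_on UNIV g" using g(1) by (meson DERIV_isCont continuous_at_imp_continuous_on)
 have [measurable]: "g \<in> borel_measurable borel" "g' \<in> borel_measurable borel"
  using gc g(2) by (auto intro: borel_measurable_continuous_onI)
 obtain C where C: "C > 0" "\<And>n x. \<bar>(deriv ^^ 1) (chi n) x\<bar> \<le> C * (1 / (real n + 1)) ^ 1"
  using chi_deriv_bound[of 1] by metis
 have [measurable]: "chi n \<in> borel_measurable borel" "deriv (chi n) \<in> borel_measurable borel" for n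
  using chi_test test_meas test_deriv by auto
 have 1: "(%n. LI x. g' x * chi n x) \<longlonglongrightarrow> (LI x. g' x)"
 proof (rule integral_dominated_convergence[where w="%x. \<bar>g' x\<bar>"])
  show "AE x in lborel. (%n. g' x * chi n x) \<longlonglongrightarrow> g' x"
   using tendsto_mult[OF tendsto_const chi_tendsto] by fastforce
  show "AE x in lborel. norm (g' x * chi n x) \<le> \<bar>g' x\<bar>" for n
   using chi_bounds by (auto simp: abs_mult intro!: mult_left_le)
 qed (use g in auto)
 have i2: "integrable lborel (%x. g x * deriv (chi n) x)" for n
  by (rule loc_int_test[OF cont_loc_int[OF gc] test_deriv[OF chi_test]])
 have 2: "(%n. LI x. g x * deriv (chi n) x) \<longlonglongrightarrow> 0"
 proof (rule Lim_null_comparison)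
  show "\<forall>\<^sub>F n in sequentially. norm (LI x. g x * deriv (chi n) x) \<le> C * (LI x. \<bar>g x\<bar>) * (1 / (real n + 1))"
  proof (intro always_eventually allI)
   fix n
   have "\<bar>LI x. g x * deriv (chi n) x\<bar> \<le> (LI x. C * (1 / (real n + 1)) * \<bar>g x\<bar>)"
   proof (rule LINT_abs_le[OF i2])
    show "\<bar>g x * deriv (chi n) x\<bar> \<le> C * (1 / (real n + 1)) * \<bar>g x\<bar>" for x
     using mult_right_mono[OF C(2)[of n x] abs_ge_zero[of "g x"]] by (simp add: abs_mult mult.commute)
   qed (use g in simp)
   then show "norm (LI x. g x * deriv (chi n) x) \<le> C * (LI x. \<bar>g x\<bar>) * (1 / (real n + 1))" by simp
  qed
  have "(%n. C * (LI x. \<bar>g x\<bar>) * (1 / (real n + 1))) \<longlonglongrightarrow> C * (LI x. \<bar>g x\<bar>) * 0"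
   using LIMSEQ_inverse_real_of_nat by (intro tendsto_mult tendsto_const) (simp add: inverse_eq_divide add.commute)
  then show "(%n. C * (LI x. \<bar>g x\<bar>) * (1 / (real n + 1))) \<longlonglongrightarrow> 0" by simp
 qed
 have 3: "(LI x. g' x * chi n x) + (LI x. g x * deriv (chi n) x) = 0" for n
 proof -
  have d: "((%x. g x * chi n x) has_real_derivative (g' x * chi n x + g x * deriv (chi n) x)) (at x)" for x
   using DERIV_mult[OF g(1)[of x] smooth_DERIV[OF test_smooth[OF chi_test[of n]], of x]] by (simp add: mult.commute add.commute)
  have "(LI x. g' x * chi n x + g x * deriv (chi n) x) = 0"
   by (rule integral_deriv_compact(2)[OF d, of "3 * (real n + 1)"])
     (use chi_far in \<open>auto intro!: continuous_intros gc g(2) smooth_cont[OF test_smooth[OF chi_test]] smooth_cont[OF test_smooth[OF test_deriv[OF chi_test]]]\<close>)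
  then show ?thesis using i2 loc_int_test[OF cont_loc_int[OF g(2)] chi_test] by simp
 qed
 have "(LI x. g' x) + 0 = 0"
  by (rule LIMSEQ_unique[OF tendsto_add[OF 1 2]]) (simp add: 3)
 then show ?thesis by simp
qed

lemma classical_ibp:
 assumes "\<And>x. (a has_real_derivative a' x) (at x)" "continuous_on UNIV a'"
  "\<And>x. (b has_real_derivative b' x) (at x)" "continuous_on UNIV b'"
  "L2 a" "L2 a'" "L2 b" "L2 b'"
 shows "(LI x. a x * b' x) = - (LI x. a' x * b x)"
proof -
 have c: "continuous_on UNIV a" "continuous_on UNIV b"
  using assms(1,3) by (meson DERIV_isCont continuous_at_imp_continuous_on)+
 have "(LI x. a' x * b x + a x * b' x) = 0"
 proof (rule integral_deriv_zero)
  show "((%x. a x * b x) has_real_derivative a' x * b x + a x * b' x) (at x)" for x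
   using DERIV_mult[OF assms(1)[of x] assms(3)[of x]] by (simp add: mult.commute add.commute)
 qed (use assms c in \<open>auto intro!: continuous_intros L2_mult Bochner_Integration.integrable_add\<close>)
 then show ?thesis using L2_mult assms by simp
qed

lemma classical_weak:
 assumes "\<And>x. (u has_real_derivative u' x) (at x)" "continuous_on UNIV u'"
 shows "weak_deriv u u'"
proof -
 have c: "continuous_on UNIV u" using assms(1) by (meson DERIV_isCont continuous_at_imp_continuous_on)
 show ?thesis unfolding weak_deriv_def
 proof (intro conjI allI impI cont_loc_int c assms(2))
  fix t assume t: "test_fun t"
  obtain R where R: "\<And>x. R \<le> \<bar>x\<bar> ==> t x = 0" using test_supp[OF t] by metis
  have d: "((%x. u x * t x) has_real_derivative u' x * t x + u x * deriv t x) (at x)" for x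
   using DERIV_mult[OF assms(1)[of x] smooth_DERIV[OF test_smooth[OF t], of x]] by (simp add: mult.commute add.commute)
  have "(LI x. u' x * t x + u x * deriv t x) = 0"
   by (rule integral_deriv_compact(2)[OF d, of R])
     (use R in \<open>auto intro!: continuous_intros c assms(2) smooth_cont[OF test_smooth[OF t]] smooth_cont[OF test_smooth[OF test_deriv[OF t]]]\<close>)
  then show "(LI x. u x * deriv t x) = - (LI x. u' x * t x)"
   using loc_int_test[OF cont_loc_int[OF c] test_deriv[OF t]] loc_int_test[OF cont_loc_int[OF assms(2)] t] by simp
 qed
qed

lemma weak_moll:
 assumes "weak_deriv u u'" "L2 u" "L2 u'"
 shows "(conv (moll n) u has_real_derivative conv (moll n) u' x) (at x)" "continuous_on UNIV (conv (moll n) u')"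
 using conv_DERIV[OF moll_test L2_loc_int[OF assms(2)], of n x] conv_weak[OF assms(1) moll_test]
  smooth_cont[OF conv_smooth[OF moll_test L2_loc_int[OF assms(3)]]] by auto

text \<open>Mollification turns both factors into classical functions with matching derivatives,
  where \<open>classical_ibp\<close> applies; integrals of products pass to the L2 limit.\<close>

lemma weak_ibp:
 assumes a: "weak_deriv a a'" "L2 a" "L2 a'" and b: "weak_deriv b b'" "L2 b" "L2 b'"
 shows "(LI x. a x * b' x) = - (LI x. a' x * b x)"
proof -
 note Y = conv_young(1)[OF moll_kern]
 have 1: "(%n. LI x. conv (moll n) a x * conv (moll n) b' x) \<longlonglongrightarrow> (LI x. a x * b' x)"
  by (rule LINT_tendsto_L2) (use a b moll_tendsto Y in auto)
 have 2: "(%n. - (LI x. conv (moll n) a' x * conv (moll n) b x)) \<longlonglongrightarrow> - (LI x. a' x * b x)"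
  by (rule tendsto_minus, rule LINT_tendsto_L2) (use a b moll_tendsto Y in auto)
 have "(LI x. conv (moll n) a x * conv (moll n) b' x) = - (LI x. conv (moll n) a' x * conv (moll n) b x)" for n
  by (rule classical_ibp) (use weak_moll[OF a] weak_moll[OF b] Y a b in auto)
 then show ?thesis using LIMSEQ_unique[OF 1] 2 by simp
qed

subsection \<open>Sup bounds and continuous representatives\<close>

text \<open>For y to the left of x, g(x)^2 exceeds g(y)^2 by at most the squared H1 norm; averaging
  over y in [x - 1, x] replaces g(y)^2 by its integral.\<close>

lemma sup_bound:
 assumes g: "\<And>x. (g has_real_derivative g' x) (at x)" "continuous_on UNIV g'" "L2 g" "L2 g'"
 shows "\<bar>g x\<bar> \<le> 2 * (nrm g + nrm g')"
proof -
 define T where "T = (nrm g)\<^sup>2 + (nrm g')\<^sup>2"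
 have gc: "continuous_on UNIV g" using g(1) by (meson DERIV_isCont continuous_at_imp_continuous_on)
 have est: "(g x)\<^sup>2 \<le> (g y)\<^sup>2 + T" if y: "y \<le> x" for y
 proof -
  have "(g x)\<^sup>2 - (g y)\<^sup>2 = (LI z. (2 * g z * g' z) * indicator {y..x} z)"
  proof (rule integral_FTC_Icc_real[symmetric, OF y])
   show "((%x. (g x)\<^sup>2) has_real_derivative 2 * g z * g' z) (at z)" for z
    using DERIV_power[OF g(1), of 2 z] by (simp add: mult_ac)
   show "isCont (%z. 2 * g z * g' z) z" for z
    using gc g(2) by (auto intro!: continuous_intros simp: continuous_on_eq_continuous_at)
  qed
  also have "\<dots> \<le> (LI z. (g z)\<^sup>2 + (g' z)\<^sup>2)"
  proof (rule integral_mono)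
   show "integrable lborel (%z. 2 * g z * g' z * indicator {y..x} z)"
   proof (rule Bochner_Integration.integrable_bound)
    show "integrable lborel (%z. 2 * (g z * g' z))" using L2_mult[OF g(3,4)] by simp
   qed (use g in \<open>auto simp: indicator_def dest!: L2_meas\<close>)
   show "2 * g z * g' z * indicator {y..x} z \<le> (g z)\<^sup>2 + (g' z)\<^sup>2" for z
    using sum_squares_bound[of "g z" "g' z"] by (auto simp: indicator_def)
  qed (use L2_sq g in auto)
  also have "\<dots> = T" using L2_sq g by (simp add: T_def nrm_sq)
  finally show ?thesis by simp
 qed
 have "(g x)\<^sup>2 = (LI y. (g x)\<^sup>2 * indicator {x-1..x} y)" by simp
 also have "\<dots> \<le> (LI y. (g y)\<^sup>2 + T * indicator {x-1..x} y)"
 proof (rule integral_mono)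
  have "integrable lborel (indicat_real {x-1..x})" by (simp add: emeasure_lborel_Icc_eq)
  then show "integrable lborel (%y. (g x)\<^sup>2 * indicator {x-1..x} y)" "integrable lborel (%y. (g y)\<^sup>2 + T * indicator {x-1..x} y)"
   using L2_sq[OF g(3)] by auto
  show "(g x)\<^sup>2 * indicator {x-1..x} y \<le> (g y)\<^sup>2 + T * indicator {x-1..x} y" for y
   using est[of y] by (auto simp: indicator_def)
 qed
 also have "\<dots> = (nrm g)\<^sup>2 + T" using L2_sq g by (simp add: nrm_sq emeasure_lborel_Icc_eq)
 also have "\<dots> \<le> (2 * (nrm g + nrm g'))\<^sup>2"
 proof -
  have "0 \<le> nrm g * nrm g'" by simp
  then show ?thesis by (simp add: T_def power2_eq_square algebra_simps)
 qed
 finally have "\<bar>g x\<bar>\<^sup>2 \<le> (2 * (nrm g + nrm g'))\<^sup>2" by simp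
 then show ?thesis by (rule power2_le_imp_le) simp
qed

lemma deriv_uniform_limit:
 fixes f f' :: "nat => real => real"
 assumes S: "convex S" "open S" "x \<in> S"
  and d: "\<And>n x. x \<in> S ==> (f n has_real_derivative f' n x) (at x)"
  and u: "uniform_limit S f' g' sequentially" and p: "\<And>x. x \<in> S ==> (%n. f n x) \<longlonglongrightarrow> g x"
 shows "(g has_real_derivative g' x) (at x)"
proof -
 have "\<exists>h. \<forall>y\<in>S. (%n. f n y) \<longlonglongrightarrow> h y \<and> (h has_derivative (*) (g' y)) (at y within S)"
 proof (rule has_derivative_sequence[where f=f and f'="%n y h. f' n y * h", OF S(1) _ _ S(3) p[OF S(3)]])
  show "(f n has_derivative (*) (f' n y)) (at y within S)" if "y \<in> S" for n y
   using d[OF that] by (simp add: has_field_derivative_def has_derivative_at_withinI)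
  fix e :: real assume "e > 0"
  then have "\<forall>\<^sub>F n in sequentially. \<forall>y\<in>S. dist (f' n y) (g' y) < e" using u by (simp add: uniform_limit_iff)
  then show "\<forall>\<^sub>F n in sequentially. \<forall>y\<in>S. \<forall>h. norm (f' n y * h - g' y * h) \<le> e * norm h"
  proof eventually_elim
   case (elim n)
   show ?case
   proof (intro ballI allI)
    fix y h assume "y \<in> S"
    then have "\<bar>f' n y - g' y\<bar> \<le> e" using elim by (auto simp: dist_real_def)
    from mult_right_mono[OF this abs_ge_zero[of h]]
    show "norm (f' n y * h - g' y * h) \<le> e * norm h" by (simp add: abs_mult[symmetric] left_diff_distrib)
   qed
  qed
 qed
 then obtain h where h: "\<And>y. y \<in> S ==> (%n. f n y) \<longlonglongrightarrow> h y" "(h has_derivative (*) (g' x)) (at x within S)"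
  using S(3) by blast
 have "(h has_real_derivative g' x) (at x)" using h(2) unfolding has_field_derivative_def at_within_open[OF S(3,2)] .
 then show ?thesis
  by (rule has_field_derivative_transform_within_open[OF _ S(2,3)]) (use LIMSEQ_unique[OF h(1) p] in auto)
qed

text \<open>\<open>sup_bound\<close> applied to differences makes the mollifications uniformly
  Cauchy, so their limit is continuous. Uniform convergence gives L2 convergence only on bounded
  intervals, hence the identification with \<open>w\<close> is done interval by interval.\<close>

lemma H1_rep:
 assumes w: "weak_deriv w w1" "L2 w" "L2 w1"
 obtains W where "continuous_on UNIV W" "AE x in lborel. w x = W x"
  "uniform_limit UNIV (%n. conv (moll n) w) W sequentially" "\<And>x. \<bar>W x\<bar> \<le> 2 * (nrm w + nrm w1)"
proof -
 define f where "f n = conv (moll n) w" for n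
 define f1 where "f1 n = conv (moll n) w1" for n
 have fL: "L2 (f n)" "L2 (f1 n)" for n unfolding f_def f1_def by (auto intro!: conv_young moll_kern w)
 have fd: "(f n has_real_derivative f1 n x) (at x)" "continuous_on UNIV (f1 n)" for n x
  unfolding f_def f1_def using weak_moll[OF w] by auto
 have bd: "\<bar>f m x - f n x\<bar> \<le> 2 * (ndist (f m) (f n) + ndist (f1 m) (f1 n))" for m n x
  by (rule sup_bound) (use fd fL in \<open>auto intro!: DERIV_diff continuous_intros L2_diff\<close>)
 define p where "p n = ndist (f n) w + ndist (f1 n) w1" for n
 have p0: "p \<longlonglongrightarrow> 0" unfolding p_def[abs_def] f_def f1_def
  using tendsto_add[OF moll_tendsto[OF w(2)] moll_tendsto[OF w(3)]] by simp
 have bd2: "\<bar>f m x - f n x\<bar> \<le> 2 * (p m + p n)" for m n x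
 proof -
  have "ndist (f m) (f n) \<le> ndist (f m) w + ndist (f n) w"
   using nrm_triangle3[OF fL(1) w(2) fL(1), of m n] nrm_minus_commute[of w "f n"] by simp
  moreover have "ndist (f1 m) (f1 n) \<le> ndist (f1 m) w1 + ndist (f1 n) w1"
   using nrm_triangle3[OF fL(2) w(3) fL(2), of m n] nrm_minus_commute[of w1 "f1 n"] by simp
  ultimately have "ndist (f m) (f n) + ndist (f1 m) (f1 n) \<le> p m + p n" unfolding p_def by linarith
  then have "2 * (ndist (f m) (f n) + ndist (f1 m) (f1 n)) \<le> 2 * (p m + p n)" by simp
  then show ?thesis by (rule order_trans[OF bd])
 qed
 have "uniformly_Cauchy_on UNIV f"
 proof (rule uniformly_Cauchy_onI)
  fix e :: real assume "e > 0"
  then have "\<forall>\<^sub>F n in sequentially. p n < e / 4" using order_tendstoD(2)[OF p0, of "e/4"] by simp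
  then obtain M where M: "\<And>n. n \<ge> M ==> p n < e / 4" by (auto simp: eventually_sequentially)
  show "\<exists>M. \<forall>x\<in>UNIV. \<forall>m\<ge>M. \<forall>n\<ge>M. dist (f m x) (f n x) < e"
  proof (intro exI[of _ M] ballI allI impI)
   fix x m n assume "M \<le> m" "M \<le> n"
   then show "dist (f m x) (f n x) < e" using bd2[of m x n] M[of m] M[of n] by (simp add: dist_real_def)
  qed
 qed
 then obtain W where W: "uniform_limit UNIV f W sequentially"
  using Cauchy_uniformly_convergent uniformly_convergent_on_def by metis
 have Wc: "continuous_on UNIV W"
  by (rule uniform_limit_theorem[OF _ W])
    (use fd(1) in \<open>auto intro!: always_eventually continuous_at_imp_continuous_on DERIV_isCont\<close>)
 have Wp: "(%n. f n x) \<longlonglongrightarrow> W x" for x using tendsto_uniform_limitI[OF W] by simp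
 have Wb: "\<bar>W x\<bar> \<le> 2 * (nrm w + nrm w1)" for x
 proof (rule LIMSEQ_le_const2[OF tendsto_rabs[OF Wp]], intro exI allI impI)
  fix n
  show "\<bar>f n x\<bar> \<le> 2 * (nrm w + nrm w1)"
  proof (rule order_trans[OF sup_bound[OF fd fL]])
   have "nrm (f n) + nrm (f1 n) \<le> nrm w + nrm w1"
    unfolding f_def f1_def by (intro add_mono moll_young w)
   then show "2 * (nrm (f n) + nrm (f1 n)) \<le> 2 * (nrm w + nrm w1)" by simp
  qed
 qed
 have ae: "AE x in lborel. x \<in> {- real N..real N} --> w x = W x" for N
 proof -
  let ?I = "indicat_real {- real N..real N}"
  have Im: "?I \<in> borel_measurable borel" by simp
  have Lw: "L2 (%x. ?I x * w x)" by (rule nrm_mono(1)[OF w(2)]) (use w in \<open>auto simp: indicator_def dest: L2_meas\<close>)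
  have Lf: "L2 (%x. ?I x * f n x)" for n by (rule nrm_mono(1)[OF fL(1)[of n]]) (use L2_meas[OF fL(1)[of n]] in \<open>auto simp: indicator_def\<close>)
  have LW: "L2 (%x. ?I x * W x)"
  proof (rule nrm_mono(1)[OF L2_cmult[OF L2_indicator_Icc]])
   show "AE x in lborel. \<bar>?I x * W x\<bar> \<le> \<bar>(2 * (nrm w + nrm w1)) * ?I x\<bar>"
    using Wb by (auto simp: indicator_def intro: order_trans)
  qed (use borel_measurable_continuous_onI[OF Wc] in measurable)
  have "AE x in lborel. ?I x * w x = ?I x * W x"
  proof (rule nrm_tendsto_unique[OF Lw LW Lf])
   show "(%n. nrm (%x. ?I x * f n x - ?I x * w x)) \<longlonglongrightarrow> 0"
   proof (rule Lim_null_comparison)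
    show "\<forall>\<^sub>F n in sequentially. norm (nrm (%x. ?I x * f n x - ?I x * w x)) \<le> ndist (f n) w"
    proof (intro always_eventually allI)
     fix n
     have "nrm (%x. ?I x * f n x - ?I x * w x) \<le> ndist (f n) w"
      by (rule nrm_mono(2)[OF L2_diff[OF fL(1) w(2)] L2_meas[OF L2_diff[OF Lf Lw]]]) (auto simp: indicator_def)
     then show "norm (nrm (%x. ?I x * f n x - ?I x * w x)) \<le> ndist (f n) w" by simp
    qed
    show "(%n. ndist (f n) w) \<longlonglongrightarrow> 0" unfolding f_def by (rule moll_tendsto[OF w(2)])
   qed
   show "(%n. nrm (%x. ?I x * f n x - ?I x * W x)) \<longlonglongrightarrow> 0"
   proof (rule Lim_null_comparison)
    show "\<forall>\<^sub>F n in sequentially. norm (nrm (%x. ?I x * f n x - ?I x * W x)) \<le> 2 * (2 * p n) * nrm ?I"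
    proof (intro always_eventually allI)
     fix n
     have b: "\<bar>f n x - W x\<bar> \<le> 2 * (p n + 0)" for x
     proof (rule LIMSEQ_le)
      show "(%m. \<bar>f n x - f m x\<bar>) \<longlonglongrightarrow> \<bar>f n x - W x\<bar>" by (intro tendsto_intros Wp)
      show "(%m. 2 * (p n + p m)) \<longlonglongrightarrow> 2 * (p n + 0)" by (intro tendsto_intros p0)
     qed (use bd2 in auto)
     have p_nn: "p n \<ge> 0" by (simp add: p_def)
     have "nrm (%x. ?I x * f n x - ?I x * W x) \<le> nrm (%x. 2 * p n * ?I x)"
      by (rule nrm_mono(2)[OF L2_cmult[OF L2_indicator_Icc] L2_meas[OF L2_diff[OF Lf LW]]])
        (use b p_nn in \<open>auto simp: indicator_def\<close>)
     also have "\<dots> = 2 * p n * nrm ?I" using p_nn by (simp add: nrm_cmult)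
     also have "\<dots> \<le> 2 * (2 * p n) * nrm ?I" using p_nn by (intro mult_right_mono) auto
     finally show "norm (nrm (%x. ?I x * f n x - ?I x * W x)) \<le> 2 * (2 * p n) * nrm ?I" by simp
    qed
    have "(%n. 2 * (2 * p n) * nrm ?I) \<longlonglongrightarrow> 2 * (2 * 0) * nrm ?I" by (intro tendsto_intros p0)
    then show "(%n. 2 * (2 * p n) * nrm ?I) \<longlonglongrightarrow> 0" by simp
   qed
  qed
  then show ?thesis by (auto simp: indicator_def elim!: eventually_mono)
 qed
 have "AE x in lborel. \<forall>N. x \<in> {- real N..real N} --> w x = W x" using ae by (simp only: AE_all_countable simp_thms)
 then have "AE x in lborel. w x = W x"
 proof eventually_elim
  case (elim x)
  obtain N where "real N \<ge> \<bar>x\<bar>" using real_arch_simple by blast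
  then show ?case using elim by (auto simp: abs_le_iff)
 qed
 then show ?thesis by (rule that[OF Wc _ W[unfolded f_def] Wb])
qed

text \<open>The derivatives are explicit arguments. \<open>d1\<close> and \<open>d2\<close> are
  arbitrary choices among functions equal almost everywhere, so for them identities for sums, shifts
  or dilations hold only up to null sets.\<close>

definition W2 :: "(real => real) => (real => real) => (real => real) => bool" where
 "W2 u u1 u2 \<longleftrightarrow> L2 u \<and> L2 u1 \<and> L2 u2 \<and> weak_deriv u u1 \<and> weak_deriv u1 u2"

lemma W2D: assumes "W2 u u1 u2" shows "L2 u" "L2 u1" "L2 u2" "weak_deriv u u1" "weak_deriv u1 u2"
 using assms by (auto simp: W2_def)

lemma W2_rep:
 assumes "W2 u u1 u2"
 obtains U U1 where "\<And>x. (U has_real_derivative U1 x) (at x)" "continuous_on UNIV U1"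
  "AE x in lborel. u x = U x" "AE x in lborel. u1 x = U1 x"
  "\<And>x. \<bar>U x\<bar> \<le> 2 * (nrm u + nrm u1)" "\<And>x. \<bar>U1 x\<bar> \<le> 2 * (nrm u1 + nrm u2)"
  "uniform_limit UNIV (%n. conv (moll n) u) U sequentially"
  "uniform_limit UNIV (%n. conv (moll n) u1) U1 sequentially"
proof -
 note A = W2D[OF assms]
 obtain U where U: "continuous_on UNIV U" "AE x in lborel. u x = U x"
  "uniform_limit UNIV (%n. conv (moll n) u) U sequentially" "\<And>x. \<bar>U x\<bar> \<le> 2 * (nrm u + nrm u1)"
  by (rule H1_rep[OF A(4,1,2)], rule that)
 obtain U1 where U1: "continuous_on UNIV U1" "AE x in lborel. u1 x = U1 x"
  "uniform_limit UNIV (%n. conv (moll n) u1) U1 sequentially" "\<And>x. \<bar>U1 x\<bar> \<le> 2 * (nrm u1 + nrm u2)"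
  by (rule H1_rep[OF A(5,2,3)], rule that)
 have "(U has_real_derivative U1 x) (at x)" for x
 proof (rule deriv_uniform_limit[OF convex_UNIV open_UNIV UNIV_I _ U1(3)])
  show "(conv (moll n) u has_real_derivative conv (moll n) u1 y) (at y)" for n y
   by (rule weak_moll(1)[OF A(4,1,2)])
  show "(%n. conv (moll n) u y) \<longlonglongrightarrow> U y" for y
   by (rule tendsto_uniform_limitI[OF U(3) UNIV_I])
 qed
 then show ?thesis by (rule that[OF _ U1(1) U(2) U1(2) U(4) U1(4) U(3) U1(3)])
qed

lemma W2_H2: "W2 u u1 u2 ==> H2 u" unfolding W2_def H2_def by auto

lemma H2_W2: assumes "H2 u" shows "W2 u (d1 u) (d2 u)"
proof -
 obtain u1 u2 where u: "L2 u" "weak_deriv u u1" "weak_deriv u1 u2" "L2 u1" "L2 u2" using assms by (auto simp: H2_def)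
 have "\<exists>u2. weak_deriv u (d1 u) \<and> weak_deriv (d1 u) u2 \<and> L2 (d1 u) \<and> L2 u2"
  unfolding d1_def by (rule someI[of _ u1]) (use u in blast)
 then obtain v2 where v: "weak_deriv u (d1 u)" "weak_deriv (d1 u) v2" "L2 (d1 u)" "L2 v2" by blast
 have "weak_deriv (d1 u) (d2 u) \<and> L2 (d2 u)"
  unfolding d2_def by (rule someI[of _ v2]) (use v in blast)
 then show ?thesis using u v by (simp add: W2_def)
qed

lemma weak_deriv_cong:
 assumes "weak_deriv u g" "AE x in lborel. u x = u' x" "AE x in lborel. g x = g' x" "loc_int u'" "loc_int g'"
 shows "weak_deriv u' g'"
 unfolding weak_deriv_def
proof (intro conjI allI impI assms(4,5))
 fix t assume t: "test_fun t"
 have l: "loc_int u" "loc_int g" using assms(1) by (auto simp: weak_deriv_def)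
 note [measurable] = loc_int_meas[OF l(1)] loc_int_meas[OF l(2)] loc_int_meas[OF assms(4)] loc_int_meas[OF assms(5)]
  test_meas[OF t] test_meas[OF test_deriv[OF t]]
 have "(LI x. u' x * deriv t x) = (LI x. u x * deriv t x)"
  by (intro integral_cong_AE) (use assms(2) in auto)
 also have "\<dots> = - (LI x. g x * t x)" using assms(1) t by (simp add: weak_deriv_def)
 also have "(LI x. g x * t x) = (LI x. g' x * t x)"
  by (intro integral_cong_AE) (use assms(3) in auto)
 finally show "(LI x. u' x * deriv t x) = - (LI x. g' x * t x)" .
qed

lemma W2_unique:
 assumes "W2 u u1 u2" "W2 w w1 w2" "AE x in lborel. u x = w x"
 shows "AE x in lborel. u1 x = w1 x" "AE x in lborel. u2 x = w2 x"
proof -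
 note A = W2D[OF assms(1)] and B = W2D[OF assms(2)]
 have refl: "AE x in lborel. h x = h x" for h :: "real => real" by simp
 have "weak_deriv w u1" by (rule weak_deriv_cong[OF A(4) assms(3) refl]) (use A B L2_loc_int in auto)
 from weak_deriv_unique[OF this B(4) A(2) B(2)] show 1: "AE x in lborel. u1 x = w1 x" .
 have "weak_deriv w1 u2" by (rule weak_deriv_cong[OF A(5) 1 refl]) (use A B L2_loc_int in auto)
 from weak_deriv_unique[OF this B(5) A(3) B(3)] show "AE x in lborel. u2 x = w2 x" .
qed

lemma weak_deriv_lin:
 assumes "weak_deriv u g" "weak_deriv w h"
 shows "weak_deriv (%x. a * u x + b * w x) (%x. a * g x + b * h x)"
proof -
 have l: "loc_int u" "loc_int g" "loc_int w" "loc_int h" using assms by (auto simp: weak_deriv_def)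
 have ll: "loc_int (%x. a * u x + b * w x)" if "loc_int u" "loc_int w" for u w
  using that unfolding loc_int_def by (auto intro!: set_integral_add set_integrable_mult_right)
 show ?thesis unfolding weak_deriv_def
 proof (intro conjI allI impI ll l)
  fix t assume t: "test_fun t"
  note i = loc_int_test[OF l(1) test_deriv[OF t]] loc_int_test[OF l(3) test_deriv[OF t]]
   loc_int_test[OF l(2) t] loc_int_test[OF l(4) t]
  have "(LI x. (a * u x + b * w x) * deriv t x) = a * (LI x. u x * deriv t x) + b * (LI x. w x * deriv t x)"
   using i by (simp add: distrib_right mult.assoc)
  also have "\<dots> = - (a * (LI x. g x * t x) + b * (LI x. h x * t x))"
   using assms t by (simp add: weak_deriv_def)
  also have "\<dots> = - (LI x. (a * g x + b * h x) * t x)"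
   using i by (simp add: distrib_right mult.assoc)
  finally show "(LI x. (a * u x + b * w x) * deriv t x) = - (LI x. (a * g x + b * h x) * t x)" .
 qed
qed

lemma W2_lin:
 assumes "W2 u u1 u2" "W2 w w1 w2"
 shows "W2 (%x. a * u x + b * w x) (%x. a * u1 x + b * w1 x) (%x. a * u2 x + b * w2 x)"
 using assms unfolding W2_def by (auto intro!: L2_add L2_cmult weak_deriv_lin)

lemma W2_diff: "W2 u u1 u2 ==> W2 w w1 w2 ==> W2 (%x. u x - w x) (%x. u1 x - w1 x) (%x. u2 x - w2 x)"
 using W2_lin[of u u1 u2 w w1 w2 1 "-1"] by simp

lemma W2_add: "W2 u u1 u2 ==> W2 w w1 w2 ==> W2 (%x. u x + w x) (%x. u1 x + w1 x) (%x. u2 x + w2 x)"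
 using W2_lin[of u u1 u2 w w1 w2 1 1] by simp

lemma W2_cmult: "W2 u u1 u2 ==> W2 (%x. a * u x) (%x. a * u1 x) (%x. a * u2 x)"
 using W2_lin[of u u1 u2 u u1 u2 a 0] by simp

lemma weak_deriv_shift: assumes "weak_deriv u g" "L2 u" "L2 g" shows "weak_deriv (%x. u (x + r)) (%x. g (x + r))"
 unfolding weak_deriv_def
proof (intro conjI allI impI)
 fix t assume t: "test_fun t"
 define s where "s = (%x. t (x - r))"
 have s: "test_fun s" using test_affine[OF t, of 1 "- r"] by (simp add: s_def)
 have ds: "deriv s = (%x. deriv t (x - r))" using deriv_affine[OF test_smooth[OF t], of 1 "- r"] by (simp add: s_def)
 have "(LI x. u (x + r) * deriv t x) = (LI x. u x * deriv s x)"
  using LINT_shift[of "%x. u x * deriv s x" r] by (simp add: ds)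
 also have "\<dots> = - (LI x. g x * s x)" using assms(1) s by (simp add: weak_deriv_def)
 also have "(LI x. g x * s x) = (LI x. g (x + r) * t x)"
  using LINT_shift[of "%x. g x * s x" r] by (simp add: s_def)
 finally show "(LI x. u (x + r) * deriv t x) = - (LI x. g (x + r) * t x)" .
qed (use assms L2_shift L2_loc_int in auto)

lemma W2_shift: "W2 u u1 u2 ==> W2 (%x. u (x + r)) (%x. u1 (x + r)) (%x. u2 (x + r))"
 unfolding W2_def by (auto intro!: L2_shift weak_deriv_shift)

lemma W2_test: assumes "test_fun t" shows "W2 t (deriv t) (deriv (deriv t))"
proof -
 have "weak_deriv t (deriv t)" if "test_fun t" for t
  by (rule classical_weak) (use that smooth_DERIV test_smooth test_deriv smooth_cont in blast)+
 then show ?thesis using assms test_deriv test_L2 unfolding W2_def by blast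
qed

lemma X_norm_W2:
 assumes "W2 u u1 u2"
 shows "X_norm (u, v) = sqrt ((nrm u)\<^sup>2 + (nrm u1)\<^sup>2 + (nrm u2)\<^sup>2 + (nrm v)\<^sup>2)"
proof -
 have W: "W2 u (d1 u) (d2 u)" by (rule H2_W2[OF W2_H2[OF assms]])
 note ae = W2_unique[OF W assms AE_I2[OF refl]]
 have "nrm (d1 u) = nrm u1" "nrm (d2 u) = nrm u2"
  by (rule nrm_cong_AE; use ae W2D[OF W] W2D[OF assms] L2_meas in blast)+
 then show ?thesis by (simp add: X_norm_def nrm_sq[symmetric])
qed

lemma X_dist_W2:
 assumes "W2 u u1 u2" "W2 w w1 w2"
 shows "X_dist (u, v) (w, z) = sqrt ((ndist u w)\<^sup>2 + (ndist u1 w1)\<^sup>2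
   + (ndist u2 w2)\<^sup>2 + (ndist v z)\<^sup>2)"
 unfolding X_dist_def using X_norm_W2[OF W2_diff[OF assms]] by simp

lemma X_dist_ge:
 assumes "W2 u u1 u2" "W2 w w1 w2"
 shows "ndist u w \<le> X_dist (u, v) (w, z)" "ndist u1 w1 \<le> X_dist (u, v) (w, z)"
  "ndist u2 w2 \<le> X_dist (u, v) (w, z)" "ndist v z \<le> X_dist (u, v) (w, z)"
 unfolding X_dist_W2[OF assms] by (auto intro!: real_le_rsqrt)

lemma X_dist_le:
 assumes "W2 u u1 u2" "W2 w w1 w2"
 shows "X_dist (u, v) (w, z) \<le> ndist u w + ndist u1 w1 + ndist u2 w2 + ndist v z"
proof -
 have "sqrt (a\<^sup>2 + b\<^sup>2 + c\<^sup>2 + d\<^sup>2) \<le> a + b + c + d" if "a \<ge> 0" "b \<ge> 0" "c \<ge> 0" "d \<ge> 0" for a b c d :: real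
 proof (rule real_le_lsqrt)
  have "0 \<le> a * b + a * c + a * d + b * c + b * d + c * d" using that by (intro add_nonneg_nonneg mult_nonneg_nonneg)
  then show "a\<^sup>2 + b\<^sup>2 + c\<^sup>2 + d\<^sup>2 \<le> (a + b + c + d)\<^sup>2" by (simp add: power2_eq_square algebra_simps)
 qed (use that in auto)
 then show ?thesis unfolding X_dist_W2[OF assms] by simp
qed

section \<open>The nonlinearity\<close>

locale nonlin =
 fixes p :: real and f :: "real => real"
 assumes p2: "p \<ge> 2"
  and fd: "\<And>x. (f has_real_derivative deriv f x) (at x)"
  and f'c: "continuous_on UNIV (deriv f)"
  and hom: "\<And>l s. l > 0 ==> f (l * s) = l powr p * f s"
begin

text \<open>Homogeneity gives the primitive in closed form: Euler's identity yields F' = f, and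
  \<open>Fprim_eq\<close> matches it with the interval integral. The form also gives f(s) s = (p +
  1) F(s), which links K with the pairing of f(u) and u.\<close>

definition F :: "real => real" where "F s = s * f s / (p + 1)"

lemma fc: "continuous_on UNIV f"
 by (meson DERIV_isCont continuous_at_imp_continuous_on fd)

lemma fm[measurable]: "f \<in> borel_measurable borel" by (rule borel_measurable_continuous_onI[OF fc])

lemma f0: "f 0 = 0"
proof -
 have "f 0 = 2 powr p * f 0" using hom[of 2 0] by simp
 moreover have "(2::real) powr p \<noteq> 1" using p2 powr_less_mono[of 0 p 2] by simp
 ultimately show ?thesis by (metis mult_cancel_right1)
qed

text \<open>Differentiate f(l s) = l^p f(s) with respect to l at l = 1.\<close>

lemma euler: "deriv f s * s = p * f s"
proof -
 have "((%l. f (s * l + 0)) has_real_derivative s * deriv f s) (at 1)"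
  using DERIV_affine[of f "deriv f s" s 1 0] fd[of s] by simp
 moreover have "((%l. f (s * l + 0)) has_real_derivative p * f s) (at 1)"
 proof (rule has_field_derivative_transform_within_open[where S="{0<..}"])
  show "((%l. l powr p * f s) has_real_derivative p * f s) (at 1)"
   by (auto intro!: derivative_eq_intros)
  show "l powr p * f s = f (s * l + 0)" if "l \<in> {0<..}" for l
   using hom[of l s] that by (simp add: mult.commute)
 qed auto
 ultimately show ?thesis using DERIV_unique by (metis mult.commute)
qed

lemma Fd: "(F has_real_derivative f x) (at x)"
proof -
 have "(F has_real_derivative (1 * f x + deriv f x * x) / (p + 1)) (at x)"
  unfolding F_def[abs_def] by (intro DERIV_cdivide DERIV_mult DERIV_ident fd)
 moreover have "(1 * f x + deriv f x * x) / (p + 1) = f x" unfolding euler using p2 by (simp add: field_simps)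
 ultimately show ?thesis by simp
qed

lemma F0: "F 0 = 0" by (simp add: F_def)

lemma Fc: "continuous_on UNIV F"
 by (meson DERIV_isCont continuous_at_imp_continuous_on Fd)

lemma Fm[measurable]: "F \<in> borel_measurable borel" by (rule borel_measurable_continuous_onI[OF Fc])

lemma Fprim_eq: "Fprim f = F"
proof
 fix s
 have "(LBINT y=ereal 0..ereal s. f y) = F s - F 0"
 proof (rule interval_integral_FTC_finite)
  show "continuous_on {min 0 s..max 0 s} f" using fc continuous_on_subset by blast
  show "(F has_vector_derivative f x) (at x within {min 0 s..max 0 s})" for x
   using has_field_derivative_at_within[OF Fd] by (simp add: has_real_derivative_iff_has_vector_derivative)
 qed
 then show "Fprim f s = F s" by (simp add: Fprim_def F0)
qed

lemma F_hom: "l > 0 ==> F (l * s) = l powr (p + 1) * F s"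
 unfolding F_def using hom[of l s] by (simp add: powr_add)

text \<open>H2 functions on the line are bounded, so Lipschitz estimates on an interval turn into L2
  estimates; one constant serves f', f and F at once.\<close>

lemma local_bounds:
 obtains C where "C > 0" "\<And>s. \<bar>s\<bar> \<le> M ==> \<bar>deriv f s\<bar> \<le> C"
  "\<And>a b. \<bar>a\<bar> \<le> M ==> \<bar>b\<bar> \<le> M ==> \<bar>f a - f b\<bar> \<le> C * \<bar>a - b\<bar>"
  "\<And>a. \<bar>a\<bar> \<le> M ==> \<bar>f a\<bar> \<le> C * \<bar>a\<bar>"
  "\<And>a b. \<bar>a\<bar> \<le> M ==> \<bar>b\<bar> \<le> M ==> \<bar>F a - F b\<bar> \<le> C * (\<bar>a\<bar> + \<bar>b\<bar>) * \<bar>a - b\<bar>"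
  "\<And>a. \<bar>a\<bar> \<le> M ==> \<bar>F a\<bar> \<le> C * a\<^sup>2"
proof -
 have "compact (deriv f ` {-M..M})" by (intro compact_continuous_image continuous_on_subset[OF f'c]) auto
 then have "bounded (deriv f ` {-M..M})" by (rule compact_imp_bounded)
 then obtain C0 where C0: "\<And>s. s \<in> {-M..M} ==> \<bar>deriv f s\<bar> \<le> C0" unfolding bounded_iff by fastforce
 define C where "C = max C0 1"
 have C: "C > 0" "\<And>s. \<bar>s\<bar> \<le> M ==> \<bar>deriv f s\<bar> \<le> C"
  using C0 by (auto simp: C_def abs_le_iff max_def) (smt (verit))+
 have 1: "\<bar>f a - f b\<bar> \<le> C * \<bar>a - b\<bar>" if "\<bar>a\<bar> \<le> M" "\<bar>b\<bar> \<le> M" for a b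
  using field_differentiable_bound[of "{-M..M}" f "deriv f" C a b] that C(2) fd
  by (auto simp: has_field_derivative_at_within abs_le_iff)
 have 2: "\<bar>f a\<bar> \<le> C * \<bar>a\<bar>" if "\<bar>a\<bar> \<le> M" for a
  using 1[of a 0] that f0 by auto
 have 3: "\<bar>F a - F b\<bar> \<le> C * (\<bar>a\<bar> + \<bar>b\<bar>) * \<bar>a - b\<bar>" if ab: "\<bar>a\<bar> \<le> M" "\<bar>b\<bar> \<le> M" for a b
 proof -
  define R where "R = max \<bar>a\<bar> \<bar>b\<bar>"
  have "norm (F a - F b) \<le> (C * R) * norm (a - b)"
  proof (rule field_differentiable_bound[of "{-R..R}" F f])
   fix z assume z: "z \<in> {-R..R}"
   then have zR: "\<bar>z\<bar> \<le> R" by auto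
   then have zR: "\<bar>z\<bar> \<le> R" "\<bar>z\<bar> \<le> M" using ab by (auto simp: R_def)
   show "(F has_real_derivative f z) (at z within {-R..R})" by (rule has_field_derivative_at_within[OF Fd])
   show "norm (f z) \<le> C * R" using order_trans[OF 2[OF zR(2)] mult_left_mono[OF zR(1) less_imp_le[OF C(1)]]] by simp
  qed (auto simp: R_def abs_le_iff)
  also have "\<dots> \<le> (C * (\<bar>a\<bar> + \<bar>b\<bar>)) * norm (a - b)"
   using C(1) by (intro mult_right_mono mult_left_mono) (auto simp: R_def)
  finally show ?thesis by simp
 qed
 have 4: "\<bar>F a\<bar> \<le> C * a\<^sup>2" if "\<bar>a\<bar> \<le> M" for a
 proof -
  have "0 \<le> M" using that by linarith
  then show ?thesis using 3[OF that, of 0] F0 by (simp add: power2_eq_square abs_mult_self_eq mult.assoc)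
 qed
 show ?thesis by (rule that[OF C 1 2 3 4])
qed

text \<open>By homogeneity F is determined by its values at 1 and -1; the extra 1 in the constant
  only makes it positive.\<close>

lemma F_growth: obtains C where "C > 0" "\<And>s. \<bar>F s\<bar> \<le> C * \<bar>s\<bar> powr (p + 1)"
proof -
 define C where "C = \<bar>F 1\<bar> + \<bar>F (-1)\<bar> + 1"
 have "\<bar>F s\<bar> \<le> C * \<bar>s\<bar> powr (p + 1)" for s
 proof -
  consider "s = 0" | "s > 0" | "s < 0" by linarith
  then show ?thesis
  proof cases
   case 2
   then have "\<bar>F s\<bar> = \<bar>s\<bar> powr (p + 1) * \<bar>F 1\<bar>" using F_hom[of s 1] by (simp add: abs_mult)
   also have "\<dots> \<le> \<bar>s\<bar> powr (p + 1) * C" by (intro mult_left_mono) (auto simp: C_def)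
   finally show ?thesis by (simp add: mult.commute)
  next
   case 3
   then have "\<bar>F s\<bar> = \<bar>s\<bar> powr (p + 1) * \<bar>F (-1)\<bar>" using F_hom[of "-s" "-1"] by (simp add: abs_mult)
   also have "\<dots> \<le> \<bar>s\<bar> powr (p + 1) * C" by (intro mult_left_mono) (auto simp: C_def)
   finally show ?thesis by (simp add: mult.commute)
  qed (simp add: F0)
 qed
 then show ?thesis using that[of C] by (simp add: C_def add_nonneg_pos)
qed

lemma fL2: assumes u: "L2 u" and b: "AE x in lborel. \<bar>u x\<bar> \<le> M" shows "L2 (%x. f (u x))"
proof -
 have [measurable]: "u \<in> borel_measurable borel" by (rule L2_meas[OF u])
 obtain C where C: "C > 0" "\<And>a. \<bar>a\<bar> \<le> M ==> \<bar>f a\<bar> \<le> C * \<bar>a\<bar>" by (rule local_bounds[of M], rule that)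
 show ?thesis
 proof (rule nrm_mono(1)[OF L2_cmult[OF u, of C]])
  show "AE x in lborel. \<bar>f (u x)\<bar> \<le> \<bar>C * u x\<bar>" using b C by (auto simp: abs_mult elim!: eventually_mono)
 qed measurable
qed

lemma f_lip:
 obtains C where "C > 0" "\<And>u w. L2 u ==> L2 w ==> AE x in lborel. \<bar>u x\<bar> \<le> M ==> AE x in lborel. \<bar>w x\<bar> \<le> M ==>
  nrm (%x. f (u x) - f (w x)) \<le> C * ndist u w"
  "\<And>u. L2 u ==> AE x in lborel. \<bar>u x\<bar> \<le> M ==> nrm (%x. f (u x)) \<le> C * nrm u"
proof -
 obtain C where C: "C > 0" "\<And>a b. \<bar>a\<bar> \<le> M ==> \<bar>b\<bar> \<le> M ==> \<bar>f a - f b\<bar> \<le> C * \<bar>a - b\<bar>"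
  "\<And>a. \<bar>a\<bar> \<le> M ==> \<bar>f a\<bar> \<le> C * \<bar>a\<bar>" by (rule local_bounds[of M], rule that)
 have 1: "nrm (%x. f (u x) - f (w x)) \<le> C * ndist u w"
  if a: "L2 u" "L2 w" "AE x in lborel. \<bar>u x\<bar> \<le> M" "AE x in lborel. \<bar>w x\<bar> \<le> M" for u w
 proof -
  have [measurable]: "u \<in> borel_measurable borel" "w \<in> borel_measurable borel" using a L2_meas by auto
  have "nrm (%x. f (u x) - f (w x)) \<le> nrm (%x. C * (u x - w x))"
  proof (rule nrm_mono(2)[OF L2_cmult[OF L2_diff[OF a(1,2)], of C]])
   show "AE x in lborel. \<bar>f (u x) - f (w x)\<bar> \<le> \<bar>C * (u x - w x)\<bar>"
    using a(3,4) by eventually_elim (use C in \<open>auto simp: abs_mult\<close>)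
  qed measurable
  then show ?thesis using C(1) by (simp add: nrm_cmult)
 qed
 have 2: "nrm (%x. f (u x)) \<le> C * nrm u" if a: "L2 u" "AE x in lborel. \<bar>u x\<bar> \<le> M" for u
 proof -
  have [measurable]: "u \<in> borel_measurable borel" using a L2_meas by auto
  have "nrm (%x. f (u x)) \<le> nrm (%x. C * u x)"
  proof (rule nrm_mono(2)[OF L2_cmult[OF a(1), of C]])
   show "AE x in lborel. \<bar>f (u x)\<bar> \<le> \<bar>C * u x\<bar>"
    using a(2) by eventually_elim (use C in \<open>auto simp: abs_mult\<close>)
  qed measurable
  then show ?thesis using C(1) by (simp add: nrm_cmult)
 qed
 show ?thesis by (rule that[OF C(1) 1 2])
qed

lemma F_lip:
 obtains C where "C > 0" "\<And>u. L2 u ==> AE x in lborel. \<bar>u x\<bar> \<le> M ==> integrable lborel (%x. F (u x))"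
  "\<And>u w. L2 u ==> L2 w ==> AE x in lborel. \<bar>u x\<bar> \<le> M ==> AE x in lborel. \<bar>w x\<bar> \<le> M ==>
  \<bar>(LI x. F (u x)) - (LI x. F (w x))\<bar> \<le> C * (nrm u + nrm w) * ndist u w"
proof -
 obtain C where C: "C > 0" "\<And>a b. \<bar>a\<bar> \<le> M ==> \<bar>b\<bar> \<le> M ==> \<bar>F a - F b\<bar> \<le> C * (\<bar>a\<bar> + \<bar>b\<bar>) * \<bar>a - b\<bar>"
  "\<And>a. \<bar>a\<bar> \<le> M ==> \<bar>F a\<bar> \<le> C * a\<^sup>2" by (rule local_bounds[of M], rule that)
 have 1: "integrable lborel (%x. F (u x))" if a: "L2 u" "AE x in lborel. \<bar>u x\<bar> \<le> M" for u
 proof -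
  have [measurable]: "u \<in> borel_measurable borel" using a L2_meas by auto
  show ?thesis
  proof (rule Bochner_Integration.integrable_bound)
   show "integrable lborel (%x. C * (u x)\<^sup>2)" using L2_sq[OF a(1)] by simp
   show "AE x in lborel. norm (F (u x)) \<le> norm (C * (u x)\<^sup>2)"
    using a(2) by eventually_elim (use C in \<open>auto simp: abs_mult\<close>)
  qed measurable
 qed
 have 2: "\<bar>(LI x. F (u x)) - (LI x. F (w x))\<bar> \<le> C * (nrm u + nrm w) * ndist u w"
  if a: "L2 u" "L2 w" "AE x in lborel. \<bar>u x\<bar> \<le> M" "AE x in lborel. \<bar>w x\<bar> \<le> M" for u w
 proof -
  note i = 1[OF a(1,3)] 1[OF a(2,4)]
  define g where "g = (%x. \<bar>u x\<bar> + \<bar>w x\<bar>)"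
  define h where "h = (%x. \<bar>u x - w x\<bar>)"
  have g: "L2 g" unfolding g_def by (intro L2_add L2_abs a)
  have h: "L2 h" unfolding h_def by (intro L2_diff L2_abs a)
  have "\<bar>LI x. F (u x) - F (w x)\<bar> \<le> (LI x. \<bar>F (u x) - F (w x)\<bar>)" by (rule integral_abs_bound)
  also have "\<dots> \<le> (LI x. C * (g x * h x))"
  proof (rule integral_mono_AE)
   show "AE x in lborel. \<bar>F (u x) - F (w x)\<bar> \<le> C * (g x * h x)"
    using a(3,4) by eventually_elim (use C in \<open>auto simp: g_def h_def mult.assoc\<close>)
  qed (use i L2_mult[OF g h] in auto)
  also have "\<dots> = C * (LI x. g x * h x)" by simp
  also have "\<dots> \<le> C * (nrm g * nrm h)" using CS_ineq[OF g h] C(1) by (intro mult_left_mono) auto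
  also have "\<dots> \<le> C * ((nrm u + nrm w) * ndist u w)"
  proof (intro mult_left_mono mult_mono)
   show "nrm g \<le> nrm u + nrm w" unfolding g_def using nrm_triangle[OF L2_abs[OF a(1)] L2_abs[OF a(2)]] by simp
   show "nrm h \<le> ndist u w" by (simp add: h_def)
  qed (use C in auto)
  finally show ?thesis using i by (simp add: mult.assoc)
 qed
 show ?thesis by (rule that[OF C(1) 1 2])
qed

end

lemma W2_bound: assumes "W2 u u1 u2" shows "AE x in lborel. \<bar>u x\<bar> \<le> 2 * (nrm u + nrm u1)"
proof -
 obtain U U1 where U: "AE x in lborel. u x = U x" "\<And>x. \<bar>U x\<bar> \<le> 2 * (nrm u + nrm u1)"
  using W2_rep[OF assms] by metis
 show ?thesis using U(1) by eventually_elim (use U(2) in simp)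
qed

section \<open>Weak solutions in time\<close>

lemma inv_arch: assumes "e > 0" obtains N where "1 / (real N + 1) < e"
 using nat_approx_posE[OF assms] by (metis add.commute of_nat_Suc)

lemma deriv_multc': "smooth f ==> deriv (%x. f x * c) = (%x. deriv f x * c)"
 using smooth_DERIV by (auto intro!: DERIV_imp_deriv DERIV_cmult_right)

text \<open>Product test functions a(t) b(x) separate time from space: every mixed partial of such a
  product factors, so the weak system reduces to scalar equations in time for spatial
  pairings.\<close>

lemma pder_prod:
 assumes "smooth a" "smooth b"
 shows "\<exists>i j. pder w (%t x. a t * b x) = (%t x. (deriv ^^ i) a t * (deriv ^^ j) b x)"
proof (induction w)
 case Nil
 show ?case by (rule exI[of _ 0], rule exI[of _ 0]) (simp add: pder_def)
next
 case (Cons c w)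
 then obtain i j where ij: "pder w (%t x. a t * b x) = (%t x. (deriv ^^ i) a t * (deriv ^^ j) b x)" by blast
 have s: "smooth ((deriv ^^ i) a)" "smooth ((deriv ^^ j) b)" for i j
  by (induction i, use assms smooth_deriv in auto) (induction j, use assms smooth_deriv in auto)
 show ?case
 proof (cases c)
  case True
  have "pder (c # w) (%t x. a t * b x) = (%t x. deriv (%s. (deriv ^^ i) a s * (deriv ^^ j) b x) t)"
   using True ij by (simp add: pder_def pt_def)
  also have "\<dots> = (%t x. (deriv ^^ Suc i) a t * (deriv ^^ j) b x)"
   using deriv_multc'[OF s(1)] by (simp add: fun_eq_iff)
  finally show ?thesis by blast
 next
  case False
  have "pder (c # w) (%t x. a t * b x) = (%t x. deriv (%y. (deriv ^^ i) a t * (deriv ^^ j) b y) x)"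
   using False ij by (simp add: pder_def px_def)
  also have "\<dots> = (%t x. (deriv ^^ i) a t * (deriv ^^ Suc j) b x)"
   using deriv_cmult'[OF s(2)] by (simp add: fun_eq_iff)
  finally show ?thesis by blast
 qed
qed

lemma pt_prod: "smooth a ==> pt (%t x. a t * b x) = (%t x. deriv a t * b x)"
 by (simp add: pt_def deriv_multc')

lemma px_prod: "smooth b ==> px (%t x. a t * b x) = (%t x. a t * deriv b x)"
 using deriv_cmult'[of b] by (simp add: px_def fun_eq_iff)

lemma smooth_derivs: "smooth a ==> smooth ((deriv ^^ i) a)"
 by (induction i) (auto simp: smooth_deriv)

lemma st_test_prod:
 assumes a: "test_fun a" and b: "test_fun b" and s: "0 < s0" "\<And>t. t < s0 ==> a t = 0"
 shows "st_test \<infinity> (%t x. a t * b x)"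
 unfolding st_test_def
proof (intro conjI allI)
 fix w
 obtain i j where ij: "pder w (%t x. a t * b x) = (%t x. (deriv ^^ i) a t * (deriv ^^ j) b x)"
  using pder_prod[OF test_smooth[OF a] test_smooth[OF b]] by blast
 have sm: "smooth ((deriv ^^ i) a)" "smooth ((deriv ^^ j) b)" using a b test_smooth smooth_derivs by auto
 show "continuous_on UNIV (%z. pder w (%t x. a t * b x) (fst z) (snd z))"
  unfolding ij by (intro continuous_intros continuous_on_compose2[OF smooth_cont[OF sm(1), of UNIV]] continuous_on_compose2[OF smooth_cont[OF sm(2), of UNIV]]) auto
 fix t x
 show "(%s. pder w (%t x. a t * b x) s x) differentiable at t" "(%y. pder w (%t x. a t * b x) t y) differentiable at x"
  unfolding ij using smooth_DERIV[OF smooth_mult[OF sm(1) smooth_const]] smooth_DERIV[OF smooth_mult[OF smooth_const sm(2)]]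
  by (simp add: real_differentiable_def, blast)+
next
 obtain R where R: "R > 0" "\<And>x. R \<le> \<bar>x\<bar> ==> a x = 0" using test_supp[OF a] by metis
 obtain R' where R': "R' > 0" "\<And>x. R' \<le> \<bar>x\<bar> ==> b x = 0" using test_supp[OF b] by metis
 show "\<exists>aa ba R. 0 < aa \<and> ereal ba < \<infinity> \<and> (\<forall>t x. t < aa \<or> ba < t \<or> R < \<bar>x\<bar> --> a t * b x = 0)"
  by (rule exI[of _ s0], rule exI[of _ R], rule exI[of _ R']) (use s R R' in auto)
qed

text \<open>Mollifying in time gives classical functions whose derivatives are the mollified
  \<open>n\<close>. Continuity makes both converge, the derivatives uniformly near
  \<open>t0\<close>, so the limit is differentiable.\<close>

lemma time_weak:
 assumes m: "continuous_on UNIV m" and n: "continuous_on UNIV n"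
  and w: "\<And>a s0. test_fun a ==> 0 < s0 ==> (\<And>t. t < s0 ==> a t = 0) ==>
   (LI t. deriv a t * m t) = - (LI t. a t * n t)"
  and t0: "t0 > 0"
 shows "(m has_real_derivative n t0) (at t0)"
proof -
 \<comment> \<open>Times in the window exceed t0/2, so with a radius below t0/4 the reflected
   mollifiers vanish before t0/4 and are admissible in \<open>w\<close>.\<close>
 obtain N0 where N0: "1 / (real N0 + 1) < t0 / 4"
  by (rule inv_arch[of "t0 / 4"]) (use t0 in auto)
 define S where "S = {t0 / 2 <..< t0 + 1}"
 have d1: "1 / (real (k + N0) + 1) < t0 / 4" for k
  by (rule le_less_trans[OF _ N0]) (auto intro!: divide_left_mono)
 have mm: "loc_int m" "loc_int n" using m n cont_loc_int by auto
 have eq: "conv (deriv (moll (k + N0))) m t = conv (moll (k + N0)) n t" if "t \<in> S" for k t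
 proof -
  define a where "a = (%s. moll (k + N0) (t - s))"
  have a: "test_fun a" unfolding a_def by (rule test_refl[OF moll_test])
  have da: "deriv a = (%s. - deriv (moll (k + N0)) (t - s))" unfolding a_def by (rule deriv_refl[OF moll_test])
  have a0: "a s = 0" if s: "s < t0 / 4" for s
  proof -
   have "1 / (real (k + N0) + 1) \<le> \<bar>t - s\<bar>" using d1[of k] s \<open>t \<in> S\<close> by (auto simp: S_def)
   then show ?thesis unfolding a_def by (rule moll_supp)
  qed
  from w[OF a, of "t0 / 4"] a0 t0 have "(LI s. deriv a s * m s) = - (LI s. a s * n s)" by simp
  then show ?thesis unfolding da by (simp add: a_def conv_def)
 qed
 show ?thesis
 proof (rule deriv_uniform_limit[where S=S and f="%k. conv (moll (k + N0)) m" and f'="%k. conv (moll (k + N0)) n"])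
  show "convex S" "open S" "t0 \<in> S" using t0 by (auto simp: S_def)
  show "(conv (moll (k + N0)) m has_real_derivative conv (moll (k + N0)) n x) (at x)" if "x \<in> S" for k x
   using conv_DERIV[OF moll_test mm(1), of "k + N0" x] eq[OF that] by simp
  have cmp: "uniformly_continuous_on {0..t0 + 2} g" if "continuous_on UNIV g" for g :: "real => real"
   using that by (intro compact_uniformly_continuous) (auto intro: continuous_on_subset)
  have uc: "\<exists>K. \<forall>k\<ge>K. \<forall>x\<in>S. \<bar>conv (moll (k + N0)) g x - g x\<bar> < e" if g: "continuous_on UNIV g" and e: "e > 0" for g e
  proof -
   obtain d where d: "d > 0" "\<And>x y. x \<in> {0..t0+2} ==> y \<in> {0..t0+2} ==> dist y x < d ==> dist (g y) (g x) < e/2"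
    using cmp[OF g, unfolded uniformly_continuous_on_def, rule_format, of "e/2"] e by auto
   obtain K where K: "1 / (real K + 1) < min d 1" by (rule inv_arch[of "min d 1"]) (use d(1) in auto)
   show ?thesis
   proof (intro exI[of _ K] allI impI ballI)
    fix k x assume k: "K \<le> k" and x: "x \<in> S"
    have kk: "1 / (real (k + N0) + 1) < min d 1" by (rule le_less_trans[OF _ K]) (use k in \<open>auto intro!: divide_left_mono\<close>)
    have "\<bar>conv (moll (k + N0)) g x - g x\<bar> \<le> e / 2"
    proof (rule moll_pointwise[OF cont_loc_int[OF g]])
     fix y assume "\<bar>y\<bar> \<le> 1 / (real (k + N0) + 1)"
     then have y: "\<bar>y\<bar> < min d 1" "\<bar>y\<bar> < t0 / 4" using kk d1[of k] by linarith+
     have "dist (g (x - y)) (g x) < e/2"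
      by (rule d(2)) (use y x in \<open>auto simp: S_def dist_real_def\<close>)
     then show "\<bar>g (x - y) - g x\<bar> \<le> e / 2" by (simp add: dist_real_def)
    qed
    then show "\<bar>conv (moll (k + N0)) g x - g x\<bar> < e" using e by linarith
   qed
  qed
  show "uniform_limit S (%k. conv (moll (k + N0)) n) n sequentially"
   unfolding uniform_limit_iff eventually_sequentially using uc[OF n] by (auto simp: dist_real_def)
  show "(%k. conv (moll (k + N0)) m x) \<longlonglongrightarrow> m x" if "x \<in> S" for x
  proof (rule LIMSEQ_I)
   fix r :: real assume "r > 0"
   then show "\<exists>no. \<forall>k\<ge>no. norm (conv (moll (k + N0)) m x - m x) < r" using uc[OF m, of r] that by auto
  qed
 qed
qed

text \<open>The derivative is known for positive times, and continuity at the left end is all the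
  fundamental theorem asks there, so s = 0 is included.\<close>

lemma time_weak_integral:
 assumes m: "continuous_on UNIV m" and n: "continuous_on UNIV n"
  and w: "\<And>a s0. test_fun a ==> 0 < s0 ==> (\<And>t. t < s0 ==> a t = 0) ==>
   (LI t. deriv a t * m t) = - (LI t. a t * n t)"
  and st: "0 \<le> s" "s \<le> t"
 shows "(n has_integral (m t - m s)) {s..t}"
proof (rule fundamental_theorem_of_calculus_interior[OF st(2)])
 show "continuous_on {s..t} m" using m continuous_on_subset by blast
 show "(m has_vector_derivative n x) (at x)" if x: "x \<in> {s<..<t}" for x
 proof -
  have "x > 0" using x st by auto
  have "(m has_real_derivative n x) (at x)" by (rule time_weak[OF m n w \<open>x > 0\<close>])
  then show ?thesis by (simp add: has_real_derivative_iff_has_vector_derivative)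
 qed
qed

section \<open>Solutions as continuous curves in H2 x L2\<close>

locale sol = nonlin +
 fixes \<beta> :: real and U :: "real => state"
 assumes sol: "is_solution \<beta> f \<infinity> U"
begin

definition "u t = fst (U t)"
definition "u1 t = d1 (u t)"
definition "u2 t = d2 (u t)"
definition "v t = snd (U t)"
definition "D s t = X_dist (U s) (U t)"

lemma W2u: "t \<ge> 0 ==> W2 (u t) (u1 t) (u2 t)"
 using sol H2_W2 unfolding is_solution_def in_X_def u_def u1_def u2_def by auto

lemma L2v: "t \<ge> 0 ==> L2 (v t)"
 using sol unfolding is_solution_def in_X_def v_def by auto

lemma U_eq: "U t = (u t, v t)" by (simp add: u_def v_def)

lemmas L2u = W2D(1)[OF W2u] and L2u1 = W2D(2)[OF W2u] and L2u2 = W2D(3)[OF W2u]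

lemma D_tendsto: assumes "t \<ge> 0" shows "((%s. D s t) \<longlongrightarrow> 0) (at t within {0..})"
proof -
 have "{s. 0 \<le> s \<and> ereal s < \<infinity>} = {0..}" by auto
 moreover have "((%s. X_dist (U s) (U t)) \<longlongrightarrow> 0) (at t within {s. 0 \<le> s \<and> ereal s < \<infinity>})"
  using sol assms unfolding is_solution_def by auto
 ultimately show ?thesis by (simp add: D_def)
qed

lemma D_ge:
 assumes "s \<ge> 0" "t \<ge> 0"
 shows "ndist (u s) (u t) \<le> D s t" "ndist (u1 s) (u1 t) \<le> D s t"
  "ndist (u2 s) (u2 t) \<le> D s t" "ndist (v s) (v t) \<le> D s t" "0 \<le> D s t"
proof -
 have D: "D s t = X_dist (u s, v s) (u t, v t)" by (simp add: D_def u_def v_def)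
 note X = X_dist_ge[OF W2u[OF assms(1)] W2u[OF assms(2)], of "v s" "v t"]
 show "ndist (u s) (u t) \<le> D s t" unfolding D by (rule X(1))
 then show "0 \<le> D s t" by (rule order_trans[OF nrm_nonneg])
 show "ndist (u1 s) (u1 t) \<le> D s t" unfolding D by (rule X(2))
 show "ndist (u2 s) (u2 t) \<le> D s t" unfolding D by (rule X(3))
 show "ndist (v s) (v t) \<le> D s t" unfolding D by (rule X(4))
qed

lemma cont_of_D:
 assumes "\<And>s t. s \<ge> 0 ==> t \<ge> 0 ==> \<bar>s - t\<bar> \<le> 1 ==> D s t \<le> 1 ==> \<bar>g s - g t\<bar> \<le> C t * D s t"
 shows "continuous_on {0..} g"
 unfolding continuous_on_def
proof
 fix t :: real assume t: "t \<in> {0..}"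
 have "((%s. g s - g t) \<longlongrightarrow> 0) (at t within {0..})"
 proof (rule Lim_null_comparison)
  have "\<forall>\<^sub>F s in at t within {0..}. D s t < 1" using order_tendstoD(2)[OF D_tendsto, of t 1] t by simp
  moreover have "\<forall>\<^sub>F s in at t within {0..}. s \<in> {0..} \<and> \<bar>s - t\<bar> \<le> 1"
   unfolding eventually_at by (rule exI[of _ 1]) (auto simp: dist_real_def)
  ultimately show "\<forall>\<^sub>F s in at t within {0..}. norm (g s - g t) \<le> C t * D s t"
   by eventually_elim (use assms[of _ t] t in auto)
  show "((%s. C t * D s t) \<longlongrightarrow> 0) (at t within {0..})"
   using tendsto_mult[OF tendsto_const D_tendsto, of t "C t"] t by simp
 qed
 then show "(g \<longlongrightarrow> g t) (at t within {0..})" by (rule Lim_null[THEN iffD2])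
qed

lemma nrm_cont: "continuous_on {0..} (%t. nrm (u t))" "continuous_on {0..} (%t. nrm (u1 t))"
  "continuous_on {0..} (%t. nrm (u2 t))" "continuous_on {0..} (%t. nrm (v t))"
proof -
 have gen: "continuous_on {0..} (%t. nrm (w t))"
  if "\<And>t. t \<ge> 0 ==> L2 (w t)" "\<And>s t. s \<ge> 0 ==> t \<ge> 0 ==> ndist (w s) (w t) \<le> D s t" for w
 proof (rule cont_of_D[where C="%_. 1"])
  fix s t :: real assume "s \<ge> 0" "t \<ge> 0"
  then show "\<bar>nrm (w s) - nrm (w t)\<bar> \<le> 1 * D s t"
   using order_trans[OF nrm_diff_ge[OF that(1) that(1)] that(2), of s t] by simp
 qed
 show "continuous_on {0..} (%t. nrm (u t))" by (rule gen[OF L2u D_ge(1)])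
 show "continuous_on {0..} (%t. nrm (u1 t))" by (rule gen[OF L2u1 D_ge(2)])
 show "continuous_on {0..} (%t. nrm (u2 t))" by (rule gen[OF L2u2 D_ge(3)])
 show "continuous_on {0..} (%t. nrm (v t))" by (rule gen[OF L2v D_ge(4)])
qed

text \<open>Such a bound exists by compactness of [0, T] and continuity of the four norms; fixing it
  by choice lets later constants refer to it.\<close>

definition "MM T = (SOME M. M > 0 \<and> (\<forall>t\<in>{0..T}. nrm (u t) \<le> M \<and> nrm (u1 t) \<le> M \<and> nrm (u2 t) \<le> M \<and> nrm (v t) \<le> M))"

lemma MM: "MM T > 0" "\<And>t. 0 \<le> t ==> t \<le> T ==> nrm (u t) \<le> MM T" "\<And>t. 0 \<le> t ==> t \<le> T ==> nrm (u1 t) \<le> MM T"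
 "\<And>t. 0 \<le> t ==> t \<le> T ==> nrm (u2 t) \<le> MM T" "\<And>t. 0 \<le> t ==> t \<le> T ==> nrm (v t) \<le> MM T"
proof -
 define g where "g t = nrm (u t) + nrm (u1 t) + nrm (u2 t) + nrm (v t)" for t
 have "continuous_on {0..T} g" unfolding g_def
  by (intro continuous_intros continuous_on_subset[OF nrm_cont(1)] continuous_on_subset[OF nrm_cont(2)]
   continuous_on_subset[OF nrm_cont(3)] continuous_on_subset[OF nrm_cont(4)]) auto
 then have "bounded (g ` {0..T})" by (intro compact_imp_bounded compact_continuous_image) auto
 then obtain M where M: "\<And>t. t \<in> {0..T} ==> \<bar>g t\<bar> \<le> M" unfolding bounded_iff by fastforce
 have "\<exists>M. M > 0 \<and> (\<forall>t\<in>{0..T}. nrm (u t) \<le> M \<and> nrm (u1 t) \<le> M \<and> nrm (u2 t) \<le> M \<and> nrm (v t) \<le> M)"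
 proof (rule exI[of _ "max M 1"], intro conjI ballI)
  fix t assume t: "t \<in> {0..T}"
  have "g t \<le> max M 1" using M[OF t] by linarith
  moreover have "0 \<le> nrm (u t)" "0 \<le> nrm (u1 t)" "0 \<le> nrm (u2 t)" "0 \<le> nrm (v t)" by simp_all
  ultimately show "nrm (u t) \<le> max M 1" "nrm (u1 t) \<le> max M 1" "nrm (u2 t) \<le> max M 1" "nrm (v t) \<le> max M 1"
   unfolding g_def by linarith+
 qed auto
 from someI_ex[OF this] show "MM T > 0" "\<And>t. 0 \<le> t ==> t \<le> T ==> nrm (u t) \<le> MM T" "\<And>t. 0 \<le> t ==> t \<le> T ==> nrm (u1 t) \<le> MM T"
  "\<And>t. 0 \<le> t ==> t \<le> T ==> nrm (u2 t) \<le> MM T" "\<And>t. 0 \<le> t ==> t \<le> T ==> nrm (v t) \<le> MM T"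
  unfolding MM_def by auto
qed

lemma u_sup: assumes "0 \<le> t" "t \<le> T" shows "AE x in lborel. \<bar>u t x\<bar> \<le> 4 * MM T"
 using W2_bound[OF W2u[OF assms(1)]] MM(2,3)[OF assms] by (auto elim!: eventually_mono)

lemma fu_L2: "0 \<le> t ==> L2 (%x. f (u t x))"
 using fL2[OF L2u u_sup[of t t]] by auto

definition "Lf T = (SOME C. C > 0 \<and> (\<forall>s t. 0 \<le> s --> s \<le> T --> 0 \<le> t --> t \<le> T -->
  nrm (%x. f (u s x) - f (u t x)) \<le> C * D s t) \<and> (\<forall>t. 0 \<le> t --> t \<le> T --> nrm (%x. f (u t x)) \<le> C))"

lemma Lf: "Lf T > 0" "\<And>s t. 0 \<le> s ==> s \<le> T ==> 0 \<le> t ==> t \<le> T ==> nrm (%x. f (u s x) - f (u t x)) \<le> Lf T * D s t"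
 "\<And>t. 0 \<le> t ==> t \<le> T ==> nrm (%x. f (u t x)) \<le> Lf T"
proof -
 obtain C where C: "C > 0" "\<And>u w. L2 u ==> L2 w ==> AE x in lborel. \<bar>u x\<bar> \<le> 4 * MM T ==> AE x in lborel. \<bar>w x\<bar> \<le> 4 * MM T ==>
  nrm (%x. f (u x) - f (w x)) \<le> C * ndist u w"
  "\<And>u. L2 u ==> AE x in lborel. \<bar>u x\<bar> \<le> 4 * MM T ==> nrm (%x. f (u x)) \<le> C * nrm u"
  by (rule f_lip[of "4 * MM T"], rule that)
 have "\<exists>C. C > 0 \<and> (\<forall>s t. 0 \<le> s --> s \<le> T --> 0 \<le> t --> t \<le> T -->
  nrm (%x. f (u s x) - f (u t x)) \<le> C * D s t) \<and> (\<forall>t. 0 \<le> t --> t \<le> T --> nrm (%x. f (u t x)) \<le> C)"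
 proof (rule exI[of _ "C * (MM T + 1)"], intro conjI allI impI)
  show "0 < C * (MM T + 1)" using C(1) MM(1)[of T] by (intro mult_pos_pos) auto
  fix t :: real assume t: "0 \<le> t" "t \<le> T"
  have "nrm (%x. f (u t x)) \<le> C * nrm (u t)" by (rule C(3)[OF L2u u_sup]) (use t in auto)
  also have "\<dots> \<le> C * (MM T + 1)" using MM(2)[OF t] C(1) by (intro mult_left_mono) auto
  finally show "nrm (%x. f (u t x)) \<le> C * (MM T + 1)" .
  fix s :: real assume s: "0 \<le> s" "s \<le> T"
  have "nrm (%x. f (u s x) - f (u t x)) \<le> C * ndist (u s) (u t)"
   by (rule C(2)[OF L2u L2u u_sup u_sup]) (use s t in auto)
  also have "\<dots> \<le> C * D s t" using D_ge[OF s(1) t(1)] C(1) by (intro mult_left_mono) auto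
  also have "\<dots> \<le> C * (MM T + 1) * D s t" using C(1) MM(1)[of T] D_ge[OF s(1) t(1)] by (intro mult_right_mono) auto
  finally show "nrm (%x. f (u s x) - f (u t x)) \<le> C * (MM T + 1) * D s t" .
 qed
 from someI_ex[OF this] show "Lf T > 0" "\<And>s t. 0 \<le> s ==> s \<le> T ==> 0 \<le> t ==> t \<le> T ==> nrm (%x. f (u s x) - f (u t x)) \<le> Lf T * D s t"
  "\<And>t. 0 \<le> t ==> t \<le> T ==> nrm (%x. f (u t x)) \<le> Lf T"
  unfolding Lf_def by auto
qed

lemma LINT_diff_bound: "L2 a ==> L2 b ==> L2 g ==> \<bar>(LI x. a x * g x) - (LI x. b x * g x)\<bar> \<le> ndist a b * nrm g"
 using CS_ineq[OF L2_diff, of a b g] L2_mult[of a g] L2_mult[of b g] by (simp add: left_diff_distrib)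

lemma pair_cont:
 assumes "L2 g"
 shows "continuous_on {0..} (%t. LI x. u t x * g x)" "continuous_on {0..} (%t. LI x. v t x * g x)"
  "continuous_on {0..} (%t. LI x. f (u t x) * g x)"
proof -
 show "continuous_on {0..} (%t. LI x. u t x * g x)"
 proof (rule cont_of_D[where C="%_. nrm g"])
  fix s t :: real assume st: "s \<ge> 0" "t \<ge> 0"
  show "\<bar>(LI x. u s x * g x) - (LI x. u t x * g x)\<bar> \<le> nrm g * D s t"
   using order_trans[OF LINT_diff_bound[OF L2u[OF st(1)] L2u[OF st(2)] assms] mult_right_mono[OF D_ge(1)[OF st] nrm_nonneg]]
   by (simp add: mult.commute)
 qed
 show "continuous_on {0..} (%t. LI x. v t x * g x)"
 proof (rule cont_of_D[where C="%_. nrm g"])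
  fix s t :: real assume st: "s \<ge> 0" "t \<ge> 0"
  show "\<bar>(LI x. v s x * g x) - (LI x. v t x * g x)\<bar> \<le> nrm g * D s t"
   using order_trans[OF LINT_diff_bound[OF L2v[OF st(1)] L2v[OF st(2)] assms] mult_right_mono[OF D_ge(4)[OF st] nrm_nonneg]]
   by (simp add: mult.commute)
 qed
 show "continuous_on {0..} (%t. LI x. f (u t x) * g x)"
 proof (rule cont_of_D[where C="%t. Lf (t + 1) * nrm g"])
  fix s t :: real assume st: "s \<ge> 0" "t \<ge> 0" "\<bar>s - t\<bar> \<le> 1"
  have "\<bar>(LI x. f (u s x) * g x) - (LI x. f (u t x) * g x)\<bar> \<le> nrm (%x. f (u s x) - f (u t x)) * nrm g"
   by (rule LINT_diff_bound[OF fu_L2 fu_L2 assms]) (use st in auto)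
  also have "\<dots> \<le> (Lf (t + 1) * D s t) * nrm g"
   by (intro mult_right_mono Lf) (use st in auto)
  finally show "\<bar>(LI x. f (u s x) * g x) - (LI x. f (u t x) * g x)\<bar> \<le> Lf (t + 1) * nrm g * D s t"
   by (simp add: mult_ac)
 qed
qed

text \<open>Freezing time at 0 for negative t makes pairings continuous on the whole line; test
  functions supported in positive times do not see the extension.\<close>

lemma clamp_cont: "continuous_on {0..} g ==> continuous_on UNIV (%t. g (max t (0::real)))"
 by (rule continuous_on_compose2[of "{0..}" g]) (auto intro!: continuous_intros)

lemma weak_in_time:
 assumes m: "continuous_on {0..} m" and n: "continuous_on {0..} n"
  and w: "\<And>a s0. test_fun a ==> 0 < s0 ==> (\<And>t. t < s0 ==> a t = 0) ==>
   (LI t. deriv a t * m t) = - (LI t. a t * n t)"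
  and st: "0 \<le> s" "s \<le> t"
 shows "(n has_integral (m t - m s)) {s..t}"
proof -
 have "((%t. n (max t 0)) has_integral (m (max t 0) - m (max s 0))) {s..t}"
 proof (rule time_weak_integral[OF clamp_cont[OF m] clamp_cont[OF n] _ st])
  fix a s0 assume a: "test_fun a" "0 < s0" "\<And>t. t < s0 ==> a t = (0::real)"
  have d0: "deriv a t = 0" if "t < s0" for t
  proof (rule DERIV_imp_deriv)
   have "((%x. 0) has_real_derivative 0) (at t)" by simp
   then show "(a has_real_derivative 0) (at t)"
    by (rule has_field_derivative_transform_within_open[where S="{..<s0}"]) (use that a(3) in auto)
  qed
  have "(%t. deriv a t * m (max t 0)) = (%t. deriv a t * m t)" "(%t. a t * n (max t 0)) = (%t. a t * n t)"
   using d0 a(2,3) by (auto simp: fun_eq_iff max_def)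
  then show "(LI t. deriv a t * m (max t 0)) = - (LI t. a t * n (max t 0))"
   using w[OF a] by simp
 qed
 then have "((%t. n (max t 0)) has_integral (m t - m s)) {s..t}" using st by simp
 then show ?thesis by (rule has_integral_eq[rotated]) (use st in auto)
qed

lemma deriv_supp:
 assumes "test_fun a" "\<And>t. t < s0 ==> a t = (0::real)" "t < s0" shows "deriv a t = 0"
proof (rule DERIV_imp_deriv)
 have "((%x. 0) has_real_derivative 0) (at t)" by simp
 then show "(a has_real_derivative 0) (at t)"
  by (rule has_field_derivative_transform_within_open[where S="{..<s0}"]) (use assms in auto)
qed

lemma test_times_cont: assumes a: "test_fun a" "0 < s0" "\<And>t. t < s0 ==> a t = (0::real)" and m: "continuous_on {0..} m"
 shows "integrable lborel (%t. a t * m t)"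
proof -
 have "integrable lborel (%t. m (max t 0) * a t)" by (rule loc_int_test[OF cont_loc_int[OF clamp_cont[OF m]] a(1)])
 moreover have "(%t. m (max t 0) * a t) = (%t. a t * m t)" using a(2,3) by (auto simp: fun_eq_iff max_def)
 ultimately show ?thesis by simp
qed

lemma sol_u:
 assumes g: "test_fun g" and st: "0 \<le> s" "s \<le> t"
 shows "((%r. - (LI x. v r x * deriv g x)) has_integral
   ((LI x. u t x * g x) - (LI x. u s x * g x))) {s..t}"
proof (rule weak_in_time[where m="%t. LI x. u t x * g x", OF _ _ _ st])
 note L = test_L2[OF g] test_L2[OF test_deriv[OF g]]
 show c: "continuous_on {0..} (%t. LI x. u t x * g x)" by (rule pair_cont(1)[OF L(1)])
 show c': "continuous_on {0..} (%t. - (LI x. v t x * deriv g x))" by (intro continuous_intros pair_cont(2)[OF L(2)])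
 fix a s0 assume a: "test_fun a" "0 < s0" "\<And>t. t < s0 ==> a t = (0::real)"
 have sm: "smooth a" "smooth g" using a g test_smooth by auto
 have "(LI t. LI x. u t x * pt (%t x. a t * g x) t x - v t x * px (%t x. a t * g x) t x) = 0"
  using sol st_test_prod[OF a(1) g a(2,3)] unfolding is_solution_def u_def v_def by blast
 also have "(%t. LI x. u t x * pt (%t x. a t * g x) t x - v t x * px (%t x. a t * g x) t x)
   = (%t. deriv a t * (LI x. u t x * g x) + a t * (- (LI x. v t x * deriv g x)))"
 proof
  fix t
  show "(LI x. u t x * pt (%t x. a t * g x) t x - v t x * px (%t x. a t * g x) t x)
   = deriv a t * (LI x. u t x * g x) + a t * (- (LI x. v t x * deriv g x))"
  proof (cases "t < s0")
   case True then show ?thesis using a(3) deriv_supp[OF a(1,3)] by (simp add: pt_prod[OF sm(1)] px_prod[OF sm(2)])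
  next
   case False
   then have t: "t \<ge> 0" using a by linarith
   show ?thesis using L2_mult[OF L2u[OF t] L(1)] L2_mult[OF L2v[OF t] L(2)]
    by (simp add: pt_prod[OF sm(1)] px_prod[OF sm(2)] mult.left_commute)
  qed
 qed
 finally show "(LI t. deriv a t * (LI x. u t x * g x)) = - (LI t. a t * (- (LI x. v t x * deriv g x)))"
  using test_times_cont[OF test_deriv[OF a(1)] a(2) deriv_supp[OF a(1,3)] c] test_times_cont[OF a c'] by simp
qed

text \<open>The linear part of the energy gradient in u. It contains derivatives of even order only,
  so moving it from u to the test function costs no sign.\<close>

definition Lop :: "(real => real) => real => real" where
 "Lop g x = g x + \<beta> * (deriv ^^ 2) g x + (deriv ^^ 4) g x"

lemma Lop_test: "test_fun g ==> test_fun (Lop g)"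
 unfolding Lop_def[abs_def] by (intro test_add test_cmult test_derivs)

lemma sol_v:
 assumes g: "test_fun g" and st: "0 \<le> s" "s \<le> t"
 shows "((%r. (LI x. f (u r x) * deriv g x) - (LI x. u r x * Lop (deriv g) x)) has_integral
   ((LI x. v t x * g x) - (LI x. v s x * g x))) {s..t}"
proof (rule weak_in_time[where m="%t. LI x. v t x * g x"
   and n="%r. (LI x. f (u r x) * deriv g x) - (LI x. u r x * Lop (deriv g) x)", OF _ _ _ st])
 note L = test_L2[OF g] test_L2[OF test_deriv[OF g]] test_L2[OF Lop_test[OF test_deriv[OF g]]]
 show c: "continuous_on {0..} (%t. LI x. v t x * g x)" by (rule pair_cont(2)[OF L(1)])
 show c': "continuous_on {0..} (%r. (LI x. f (u r x) * deriv g x) - (LI x. u r x * Lop (deriv g) x))"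
  by (intro continuous_intros pair_cont L)
 fix a s0 assume a: "test_fun a" "0 < s0" "\<And>t. t < s0 ==> a t = (0::real)"
 have sm: "smooth a" "smooth g" using a g test_smooth by auto
 have p3: "pder [False, False, False] (%t x. a t * g x) = (%t x. a t * (deriv ^^ 2) (deriv g) x)"
  "pder [False, False, False, False, False] (%t x. a t * g x) = (%t x. a t * (deriv ^^ 4) (deriv g) x)"
  using sm by (simp_all add: pder_def px_prod smooth_deriv numeral_eq_Suc)
 have "(LI t. LI x. v t x * pt (%t x. a t * g x) t x)
  = (LI t. LI x. u t x * px (%t x. a t * g x) t x
     + \<beta> * u t x * pder [False, False, False] (%t x. a t * g x) t x
     + u t x * pder [False, False, False, False, False] (%t x. a t * g x) t x
     - f (u t x) * px (%t x. a t * g x) t x)"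
  using sol st_test_prod[OF a(1) g a(2,3)] unfolding is_solution_def u_def v_def by blast
 also have "\<dots> = (LI t. - (a t * ((LI x. f (u t x) * deriv g x) - (LI x. u t x * Lop (deriv g) x))))"
 proof (intro Bochner_Integration.integral_cong refl)
  fix t
  show "(LI x. u t x * px (%t x. a t * g x) t x
     + \<beta> * u t x * pder [False, False, False] (%t x. a t * g x) t x
     + u t x * pder [False, False, False, False, False] (%t x. a t * g x) t x
     - f (u t x) * px (%t x. a t * g x) t x)
   = - (a t * ((LI x. f (u t x) * deriv g x) - (LI x. u t x * Lop (deriv g) x)))"
  proof (cases "t < s0")
   case True then show ?thesis using a(3) by (simp add: p3 px_prod[OF sm(2)])
  next
   case False
   then have t: "t \<ge> 0" using a by linarith
   have "(LI x. u t x * px (%t x. a t * g x) t x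
     + \<beta> * u t x * pder [False, False, False] (%t x. a t * g x) t x
     + u t x * pder [False, False, False, False, False] (%t x. a t * g x) t x
     - f (u t x) * px (%t x. a t * g x) t x)
    = (LI x. a t * (u t x * Lop (deriv g) x) - a t * (f (u t x) * deriv g x))"
    by (intro Bochner_Integration.integral_cong refl)
      (simp add: p3 px_prod[OF sm(2)] Lop_def algebra_simps)
   then show ?thesis using L2_mult[OF L2u[OF t] L(3)] L2_mult[OF fu_L2[OF t] L(2)]
    by (simp add: right_diff_distrib)
  qed
 qed
 also have "(%t. LI x. v t x * pt (%t x. a t * g x) t x) = (%t. deriv a t * (LI x. v t x * g x))"
  by (simp add: pt_prod[OF sm(1)] mult.left_commute)
 finally show "(LI t. deriv a t * (LI x. v t x * g x))
  = - (LI t. a t * ((LI x. f (u t x) * deriv g x) - (LI x. u t x * Lop (deriv g) x)))"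
  by simp
qed

end

section \<open>Conservation laws\<close>

text \<open>Passes a time integral known for each x through the x-integral. Joint continuity
  supplies measurability, and the uniform L1 bound supplies integrability on the product.\<close>

lemma fubini_time:
 fixes N :: "real => real => real"
 assumes st: "s \<le> t" and c: "continuous_on ({s..t} \<times> UNIV) (%z. N (fst z) (snd z))"
  and L: "\<And>r. r \<in> {s..t} ==> integrable lborel (N r)" and b: "\<And>r. r \<in> {s..t} ==> (LI x. \<bar>N r x\<bar>) \<le> C"
  and d: "\<And>x. ((%r. N r x) has_integral d x) {s..t}"
 shows "((%r. LI x. N r x) has_integral (LI x. d x)) {s..t}"
proof -
 define H where "H z = indicator ({s..t} \<times> UNIV) z *\<^sub>R N (fst z) (snd z)" for z
 have Hm: "H \<in> borel_measurable borel" unfolding H_def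
  by (rule borel_measurable_continuous_on_indicator[OF _ c]) (auto intro!: borel_closed closed_Times)
 then have Hm': "H \<in> borel_measurable (lborel \<Otimes>\<^sub>M lborel)" by (simp add: lborel_prod)
 then have [measurable]: "(%(x, y). H (x, y)) \<in> borel_measurable (lborel \<Otimes>\<^sub>M lborel)" by simp
 have H: "H (r, x) = indicator {s..t} r * N r x" for r x by (simp add: H_def indicator_def)
 have "0 \<le> (LI x. \<bar>N s x\<bar>)" by simp
 then have C0: "0 \<le> C" by (rule order_trans) (use b[of s] st in simp)
 have I: "integrable (lborel \<Otimes>\<^sub>M lborel) (%(r, x). H (r, x))"
 proof (rule lborel_pair.Fubini_integrable)
  show "integrable lborel (%r. LI x. norm (case (r, x) of (r, x) => H (r, x)))"
  proof (rule Bochner_Integration.integrable_bound)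
   show "integrable lborel (%r. C * indicat_real {s..t} r)" by (simp add: emeasure_lborel_Icc_eq)
   show "AE r in lborel. norm (LI x. norm (case (r, x) of (r, x) => H (r, x))) \<le> norm (C * indicat_real {s..t} r)"
   proof (rule AE_I2)
    fix r show "norm (LI x. norm (case (r, x) of (r, x) => H (r, x))) \<le> norm (C * indicat_real {s..t} r)"
     using b[of r] C0 by (cases "r \<in> {s..t}") (auto simp: H abs_mult)
   qed
  qed measurable
  show "AE r in lborel. integrable lborel (%x. case (r, x) of (r, x) => H (r, x))"
  proof (rule AE_I2)
   fix r show "integrable lborel (%x. case (r, x) of (r, x) => H (r, x))"
    using L[of r] by (cases "r \<in> {s..t}") (auto simp: H)
  qed
 qed measurable
 have 1: "(LI r. H (r, x)) = d x" for x
 proof -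
  have "continuous_on {s..t} (%r. N r x)"
  proof -
   have "continuous_on {s..t} (%r. (%z. N (fst z) (snd z)) (r, x))"
    by (rule continuous_on_compose2[OF c]) (auto intro!: continuous_intros)
   then show ?thesis by simp
  qed
  then have si: "set_integrable lborel {s..t} (%r. N r x)" by (rule borel_integrable_atLeastAtMost')
  have "(LI r. H (r, x)) = (LINT r:{s..t}|lborel. N r x)" by (simp add: H set_lebesgue_integral_def)
  also have "\<dots> = integral {s..t} (%r. N r x)" by (rule set_borel_integral_eq_integral(2)[OF si])
  finally show ?thesis using d[of x] by (simp add: integral_unique)
 qed
 have i2: "set_integrable lborel {s..t} (%r. LI x. N r x)"
  using lborel_pair.integrable_fst[OF I] by (simp add: H set_integrable_def)
 have "(LI x. d x) = (LI x. LI r. H (r, x))" by (simp add: 1)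
 also have "\<dots> = (LI r. LI x. H (r, x))" by (rule lborel_pair.Fubini_integral[OF I])
 also have "\<dots> = (LINT r:{s..t}|lborel. LI x. N r x)" by (simp add: H set_lebesgue_integral_def)
 also have "\<dots> = integral {s..t} (%r. LI x. N r x)" by (rule set_borel_integral_eq_integral(2)[OF i2])
 finally show ?thesis using set_borel_integral_eq_integral(1)[OF i2] by (simp add: integrable_integral)
qed

text \<open>Moving in time changes the convolution by at most \<open>nrm k\<close> times the L2
  distance, uniformly in x; at a fixed time it is continuous in x. Together this is the joint
  continuity that \<open>fubini_time\<close> asks for.\<close>

lemma conv_joint:
 fixes S :: "real set"
 assumes k: "test_fun k" and L: "\<And>t. t \<in> S ==> L2 (a t)"
  and c: "\<And>t. t \<in> S ==> ((%s. ndist (a s) (a t)) \<longlongrightarrow> 0) (at t within S)"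
 shows "continuous_on (S \<times> UNIV) (%z. conv k (a (fst z)) (snd z))"
 unfolding continuous_on_iff
proof (intro ballI allI impI)
 fix z :: "real \<times> real" and e :: real assume z: "z \<in> S \<times> UNIV" and e: "e > 0"
 define t where "t = fst z"
 define x where "x = snd z"
 have t: "t \<in> S" using z by (auto simp: t_def)
 have ic: "isCont (conv k (a t)) x" using conv_DERIV[OF k L2_loc_int[OF L[OF t]]] DERIV_isCont by blast
 then obtain d1 where d1: "d1 > 0" "\<And>y. dist y x < d1 ==> dist (conv k (a t) y) (conv k (a t) x) < e / 2"
  using ic[unfolded continuous_at_eps_delta, rule_format, of "e/2"] e by auto
 have "((%s. nrm k * ndist (a s) (a t)) \<longlongrightarrow> nrm k * 0) (at t within S)" by (intro tendsto_intros c t)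
 then have "\<forall>\<^sub>F s in at t within S. nrm k * ndist (a s) (a t) < e / 2"
  using e order_tendstoD(2)[of _ "nrm k * 0" _ "e/2"] by simp
 then obtain d2 where d2: "d2 > 0" "\<And>s. s \<in> S ==> s \<noteq> t ==> dist s t < d2 ==> nrm k * ndist (a s) (a t) < e / 2"
  unfolding eventually_at by blast
 show "\<exists>d>0. \<forall>z'\<in>S \<times> UNIV. dist z' z < d --> dist (conv k (a (fst z')) (snd z')) (conv k (a (fst z)) (snd z)) < e"
 proof (intro exI[of _ "min d1 d2"] conjI ballI impI)
  fix z' assume z': "z' \<in> S \<times> UNIV" "dist z' z < min d1 d2"
  define s where "s = fst z'"
  define y where "y = snd z'"
  have s: "s \<in> S" using z' by (auto simp: s_def)
  have ds: "dist s t < d2" "dist y x < d1"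
   using z'(2) dist_fst_le[of z' z] dist_snd_le[of z' z] by (auto simp: s_def t_def x_def y_def)
  have "\<bar>conv k (a s) y - conv k (a t) y\<bar> \<le> nrm k * ndist (a s) (a t)"
   using conv_sup[OF test_kern[OF k] L2_diff[OF L[OF s] L[OF t]], of y] conv_diff[OF test_kern[OF k] L[OF s] L[OF t]] by simp
  also have "\<dots> < e / 2"
  proof (cases "s = t")
   case True then show ?thesis using e by (simp add: nrm_def)
  next
   case False then show ?thesis using d2(2)[OF s] ds by simp
  qed
  finally have "\<bar>conv k (a s) y - conv k (a t) y\<bar> < e / 2" .
  moreover have "\<bar>conv k (a t) y - conv k (a t) x\<bar> < e / 2" using d1(2)[OF ds(2)] by (simp add: dist_real_def)
  ultimately have "\<bar>conv k (a s) y - conv k (a t) x\<bar> < e" by linarith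
  then show "dist (conv k (a (fst z')) (snd z')) (conv k (a (fst z)) (snd z)) < e"
   by (simp add: dist_real_def s_def t_def x_def y_def)
 qed (use d1 d2 in auto)
qed

lemma has_integral_imp_DERIV:
 fixes m n :: "real => real"
 assumes "\<And>a b. s \<le> a ==> a \<le> b ==> b \<le> t ==> (n has_integral (m b - m a)) {a..b}" "continuous_on {s..t} n" "r \<in> {s..t}"
 shows "(m has_real_derivative n r) (at r within {s..t})"
proof -
 have "((%x. m s + integral {s..x} n) has_real_derivative 0 + n r) (at r within {s..t})"
  by (intro DERIV_add DERIV_const integral_has_real_derivative assms)
 then have "((%x. m s + integral {s..x} n) has_real_derivative n r) (at r within {s..t})" by simp
 moreover have "m s + integral {s..x} n = m x" if "x \<in> {s..t}" for x
  using integral_unique[OF assms(1)[of s x]] that by auto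
 ultimately show ?thesis
  by (rule has_field_derivative_transform_within[OF _ zero_less_one assms(3)])
qed

lemma derivs_refl: "test_fun k ==> (deriv ^^ j) (%y. k (x - y)) = (%y. (-1) ^ j * (deriv ^^ j) k (x - y))"
proof (induction j)
 case (Suc j)
 have t: "test_fun ((deriv ^^ j) k)" using Suc test_derivs by blast
 have "(deriv ^^ Suc j) (%y. k (x - y)) = deriv (%y. (-1) ^ j * (deriv ^^ j) k (x - y))"
  using Suc by simp
 also have "\<dots> = (%y. (-1) ^ j * deriv (%y. (deriv ^^ j) k (x - y)) y)"
  by (rule deriv_cmult'[OF test_smooth[OF test_refl[OF t]]])
 also have "\<dots> = (%y. (-1) ^ Suc j * (deriv ^^ Suc j) k (x - y))"
  by (simp add: deriv_refl[OF t])
 finally show ?case .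
qed simp

lemma conv_ibp:
 assumes "test_fun k" "test_fun l" "L2 a" "L2 b"
 shows "(LI x. conv k a x * conv (deriv l) b x) = - (LI x. conv (deriv k) a x * conv l b x)"
proof (rule classical_ibp)
 note Li = L2_loc_int[OF assms(3)] L2_loc_int[OF assms(4)]
 show "(conv k a has_real_derivative conv (deriv k) a x) (at x)" "(conv l b has_real_derivative conv (deriv l) b x) (at x)" for x
  using conv_DERIV assms Li by auto
 show "continuous_on UNIV (conv (deriv k) a)" "continuous_on UNIV (conv (deriv l) b)"
  using smooth_cont conv_smooth test_deriv assms Li by auto
qed (use conv_young(1) test_kern test_deriv assms in auto)

text \<open>Bounds uniform over a set of times. Products of two \<open>bdd2\<close> families are
  \<open>bdd1\<close>, and \<open>bdd1\<close> is the domination hypothesis of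
  \<open>fubini_time\<close>.\<close>

definition bdd2 :: "real set => (real => real => real) => bool" where
 "bdd2 S a \<longleftrightarrow> (\<forall>r\<in>S. L2 (a r)) \<and> (\<exists>B. \<forall>r\<in>S. nrm (a r) \<le> B)"

definition bdd1 :: "real set => (real => real => real) => bool" where
 "bdd1 S a \<longleftrightarrow> (\<forall>r\<in>S. integrable lborel (a r)) \<and> (\<exists>B. \<forall>r\<in>S. (LI x. \<bar>a r x\<bar>) \<le> B)"

lemma bdd1_mult: assumes "bdd2 S a" "bdd2 S b" shows "bdd1 S (%r x. a r x * b r x)"
proof -
 obtain A where A: "\<And>r. r \<in> S ==> nrm (a r) \<le> A" using assms unfolding bdd2_def by blast
 obtain B where B: "\<And>r. r \<in> S ==> nrm (b r) \<le> B" using assms unfolding bdd2_def by blast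
 note AB = A B
 have L: "\<And>r. r \<in> S ==> L2 (a r)" "\<And>r. r \<in> S ==> L2 (b r)" using assms by (auto simp: bdd2_def)
 have "(LI x. \<bar>a r x * b r x\<bar>) \<le> A * B" if r: "r \<in> S" for r
 proof -
  have "(LI x. \<bar>a r x\<bar> * \<bar>b r x\<bar>) \<le> nrm (a r) * nrm (b r)"
   using CS_ineq[OF L2_abs[OF L(1)[OF r]] L2_abs[OF L(2)[OF r]]] by simp
  also have "\<dots> \<le> A * B" by (intro mult_mono AB r) (use AB(1)[OF r] order_trans[OF nrm_nonneg] in auto)
  finally show ?thesis by (simp add: abs_mult)
 qed
 then show ?thesis unfolding bdd1_def using L2_mult L by blast
qed

lemma bdd1_cmult: assumes "bdd1 S a" shows "bdd1 S (%r x. c * a r x)"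
proof -
 obtain A where A: "\<And>r. r \<in> S ==> (LI x. \<bar>a r x\<bar>) \<le> A" using assms unfolding bdd1_def by blast
 have "(LI x. \<bar>c * a r x\<bar>) \<le> \<bar>c\<bar> * A" if "r \<in> S" for r
  using mult_left_mono[OF A[OF that] abs_ge_zero[of c]] by (simp add: abs_mult)
 then show ?thesis using assms unfolding bdd1_def by auto
qed

lemma bdd1_add: assumes "bdd1 S a" "bdd1 S b" shows "bdd1 S (%r x. a r x + b r x)"
proof -
 obtain A where A: "\<And>r. r \<in> S ==> (LI x. \<bar>a r x\<bar>) \<le> A" using assms unfolding bdd1_def by blast
 obtain B where B: "\<And>r. r \<in> S ==> (LI x. \<bar>b r x\<bar>) \<le> B" using assms unfolding bdd1_def by blast
 note AB = A B
 have I: "\<And>r. r \<in> S ==> integrable lborel (a r)" "\<And>r. r \<in> S ==> integrable lborel (b r)" using assms by (auto simp: bdd1_def)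
 have "(LI x. \<bar>a r x + b r x\<bar>) \<le> A + B" if r: "r \<in> S" for r
 proof -
  have "(LI x. \<bar>a r x + b r x\<bar>) \<le> (LI x. \<bar>a r x\<bar> + \<bar>b r x\<bar>)"
   by (rule integral_mono) (use I[OF r] in auto)
  also have "\<dots> \<le> A + B" using I[OF r] AB[OF r] by simp
  finally show ?thesis .
 qed
 then show ?thesis unfolding bdd1_def using I by auto
qed

lemma bdd1_diff: "bdd1 S a ==> bdd1 S b ==> bdd1 S (%r x. a r x - b r x)"
 using bdd1_add[OF _ bdd1_cmult[of S b "-1"], of a] by simp

lemma bdd2_conv: assumes "test_fun k" "bdd2 S a" shows "bdd2 S (%r. conv k (a r))"
proof -
 obtain A where A: "\<And>r. r \<in> S ==> nrm (a r) \<le> A" "\<And>r. r \<in> S ==> L2 (a r)" using assms by (auto simp: bdd2_def)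
 have "nrm (conv k (a r)) \<le> (LI x. \<bar>k x\<bar>) * A" if "r \<in> S" for r
  by (rule order_trans[OF conv_young(2)[OF test_kern[OF assms(1)] A(2)[OF that]] mult_left_mono[OF A(1)[OF that]]]) simp
 then show ?thesis unfolding bdd2_def using A conv_young(1)[OF test_kern[OF assms(1)]] by blast
qed

section \<open>Chain rule for f(u) and the action under mollification\<close>

context nonlin begin

lemma chain_L2: assumes "L2 g" "h \<in> borel_measurable borel" "AE x in lborel. \<bar>h x\<bar> \<le> M"
 shows "L2 (%x. deriv f (h x) * g x)"
proof -
 have [measurable]: "deriv f \<in> borel_measurable borel" by (rule borel_measurable_continuous_onI[OF f'c])
 have [measurable]: "g \<in> borel_measurable borel" by (rule L2_meas[OF assms(1)])
 note [measurable] = assms(2)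
 obtain C where C: "C > 0" "\<And>s. \<bar>s\<bar> \<le> M ==> \<bar>deriv f s\<bar> \<le> C" by (rule local_bounds[of M], rule that)
 show ?thesis
 proof (rule nrm_mono(1)[OF L2_cmult[OF assms(1), of C]])
  show "AE x in lborel. \<bar>deriv f (h x) * g x\<bar> \<le> \<bar>C * g x\<bar>"
   using assms(3) by eventually_elim (use C in \<open>auto simp: abs_mult intro!: mult_right_mono\<close>)
 qed measurable
qed

lemma W2_chain:
 assumes "W2 w w1 w2"
 shows "weak_deriv (%x. f (w x)) (%x. deriv f (w x) * w1 x)" "L2 (%x. f (w x))" "L2 (%x. deriv f (w x) * w1 x)"
proof -
 obtain W W1 where W: "\<And>x. (W has_real_derivative W1 x) (at x)" "continuous_on UNIV W1"
  "AE x in lborel. w x = W x" "AE x in lborel. w1 x = W1 x" by (rule W2_rep[OF assms], rule that)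
 note b = W2_bound[OF assms] and L = W2D[OF assms]
 show 2: "L2 (%x. f (w x))" by (rule fL2[OF L(1) b])
 show 3: "L2 (%x. deriv f (w x) * w1 x)" by (rule chain_L2[OF L(2) L2_meas[OF L(1)] b])
 have Wc: "continuous_on UNIV W" using W(1) by (meson DERIV_isCont continuous_at_imp_continuous_on)
 have "weak_deriv (%x. f (W x)) (%x. deriv f (W x) * W1 x)"
 proof (rule classical_weak)
  show "((%x. f (W x)) has_real_derivative deriv f (W x) * W1 x) (at x)" for x by (rule DERIV_chain2[OF fd W(1)])
  show "continuous_on UNIV (%x. deriv f (W x) * W1 x)"
   by (intro continuous_intros W(2) continuous_on_compose2[OF f'c Wc]) auto
 qed
 then show "weak_deriv (%x. f (w x)) (%x. deriv f (w x) * w1 x)"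
 proof (rule weak_deriv_cong)
  show "AE x in lborel. f (W x) = f (w x)" using W(3) by eventually_elim simp
  show "AE x in lborel. deriv f (W x) * W1 x = deriv f (w x) * w1 x" using W(3,4) by eventually_elim simp
 qed (use 2 3 L2_loc_int in auto)
qed

text \<open>f' of the mollified function stays bounded and converges pointwise, so dominated
  convergence handles the factor multiplying \<open>w1\<close>; replacing \<open>w1\<close> by its
  mollification costs a bounded factor times an L2 error.\<close>

lemma chain_moll:
 assumes "W2 w w1 w2"
 shows "(%n. nrm (%x. deriv f (conv (moll n) w x) * conv (moll n) w1 x - deriv f (w x) * w1 x)) \<longlonglongrightarrow> 0"
proof -
 obtain W W1 where W: "\<And>x. (W has_real_derivative W1 x) (at x)" "continuous_on UNIV W1"
  "AE x in lborel. w x = W x" "AE x in lborel. w1 x = W1 x" "\<And>x. \<bar>W x\<bar> \<le> 2 * (nrm w + nrm w1)"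
  "uniform_limit UNIV (%n. conv (moll n) w) W sequentially"
  by (rule W2_rep[OF assms], rule that)
 note L = W2D[OF assms]
 define M where "M = 2 * (nrm w + nrm w1)"
 have Wc: "continuous_on UNIV W" using W(1) by (meson DERIV_isCont continuous_at_imp_continuous_on)
 have [measurable]: "deriv f \<in> borel_measurable borel" by (rule borel_measurable_continuous_onI[OF f'c])
 have [measurable]: "W \<in> borel_measurable borel" by (rule borel_measurable_continuous_onI[OF Wc])
 have [measurable]: "w \<in> borel_measurable borel" "w1 \<in> borel_measurable borel" using L2_meas L by auto
 define Y where "Y n = conv (moll n) w" for n
 define Y1 where "Y1 n = conv (moll n) w1" for n
 have YL: "L2 (Y n)" "L2 (Y1 n)" for n unfolding Y_def Y1_def using conv_young(1)[OF moll_kern] L by auto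
 have [measurable]: "Y n \<in> borel_measurable borel" "Y1 n \<in> borel_measurable borel" for n using YL L2_meas by auto
 have Yb: "\<bar>Y n x\<bar> \<le> M" for n x
 proof (rule order_trans[OF sup_bound[of "Y n" "Y1 n"]])
  show "2 * (nrm (Y n) + nrm (Y1 n)) \<le> M" unfolding M_def Y_def Y1_def
   using moll_young[OF L(1), of n] moll_young[OF L(2), of n] by (intro mult_left_mono add_mono) auto
 qed (use weak_moll[OF L(4,1,2)] YL in \<open>auto simp: Y_def Y1_def\<close>)
 obtain C where C: "C > 0" "\<And>s. \<bar>s\<bar> \<le> M ==> \<bar>deriv f s\<bar> \<le> C" by (rule local_bounds[of M], rule that)
 have Wb: "\<bar>W x\<bar> \<le> M" for x using W(5) by (simp add: M_def)
 have l1: "L2 (%x. deriv f (Y n x) * (Y1 n x - w1 x))" for n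
  by (rule chain_L2[where M=M]) (use Yb YL L L2_diff in auto)
 have l2: "L2 (%x. deriv f (Y n x) * w1 x)" for n by (rule chain_L2[where M=M]) (use Yb L in auto)
 have l3: "L2 (%x. deriv f (W x) * w1 x)" by (rule chain_L2[where M=M]) (use Wb L in auto)
 have 1: "(%n. nrm (%x. deriv f (Y n x) * w1 x - deriv f (W x) * w1 x)) \<longlonglongrightarrow> 0"
 proof (rule L2_dominated_tendsto[OF _ L2_cmult[OF L(2), of "2 * C"]])
  fix n x
  have "\<bar>deriv f (Y n x) - deriv f (W x)\<bar> \<le> 2 * C" using C(2)[OF Yb[of n x]] C(2)[OF Wb[of x]] by linarith
  from mult_right_mono[OF this abs_ge_zero[of "w1 x"]]
  show "\<bar>deriv f (Y n x) * w1 x - deriv f (W x) * w1 x\<bar> \<le> \<bar>2 * C * w1 x\<bar>"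
   using C(1) by (simp add: abs_mult flip: left_diff_distrib)
 next
  fix x
  have "(%n. Y n x) \<longlonglongrightarrow> W x" unfolding Y_def by (rule tendsto_uniform_limitI[OF W(6) UNIV_I])
  then have "(%n. deriv f (Y n x)) \<longlonglongrightarrow> deriv f (W x)"
   by (rule continuous_on_tendsto_compose[OF f'c]) auto
  then show "(%n. deriv f (Y n x) * w1 x) \<longlonglongrightarrow> deriv f (W x) * w1 x" by (intro tendsto_intros)
 qed measurable
 have 2: "(%n. C * ndist (Y1 n) w1 + nrm (%x. deriv f (Y n x) * w1 x - deriv f (W x) * w1 x)) \<longlonglongrightarrow> C * 0 + 0"
  unfolding Y1_def by (intro tendsto_intros moll_tendsto L 1)
 show ?thesis unfolding Y_def[symmetric] Y1_def[symmetric]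
 proof (rule Lim_null_comparison)
  show "(%n. C * ndist (Y1 n) w1 + nrm (%x. deriv f (Y n x) * w1 x - deriv f (W x) * w1 x)) \<longlonglongrightarrow> 0" using 2 by simp
  show "\<forall>\<^sub>F n in sequentially. norm (nrm (%x. deriv f (Y n x) * Y1 n x - deriv f (w x) * w1 x)) \<le>
    C * ndist (Y1 n) w1 + nrm (%x. deriv f (Y n x) * w1 x - deriv f (W x) * w1 x)"
  proof (intro always_eventually allI)
   fix n
   have "nrm (%x. deriv f (Y n x) * Y1 n x - deriv f (w x) * w1 x)
    = nrm (%x. deriv f (Y n x) * (Y1 n x - w1 x) + (deriv f (Y n x) * w1 x - deriv f (W x) * w1 x))"
    by (rule nrm_cong_AE) (use W(3) in \<open>auto simp: algebra_simps elim!: eventually_mono\<close>)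
   also have "\<dots> \<le> nrm (%x. deriv f (Y n x) * (Y1 n x - w1 x)) + nrm (%x. deriv f (Y n x) * w1 x - deriv f (W x) * w1 x)"
    by (intro nrm_triangle L2_diff l1 l2 l3)
   also have "nrm (%x. deriv f (Y n x) * (Y1 n x - w1 x)) \<le> nrm (%x. C * (Y1 n x - w1 x))"
   proof (rule nrm_mono(2)[OF L2_cmult[OF L2_diff[OF YL(2) L(2)]] L2_meas[OF l1]], rule AE_I2)
    fix x show "\<bar>deriv f (Y n x) * (Y1 n x - w1 x)\<bar> \<le> \<bar>C * (Y1 n x - w1 x)\<bar>"
     using mult_right_mono[OF C(2)[OF Yb[of n x]] abs_ge_zero[of "Y1 n x - w1 x"]] C(1) by (simp add: abs_mult)
   qed
   also have "\<dots> = C * ndist (Y1 n) w1" using C(1) by (simp add: nrm_cmult)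
   finally show "norm (nrm (%x. deriv f (Y n x) * Y1 n x - deriv f (w x) * w1 x)) \<le>
    C * ndist (Y1 n) w1 + nrm (%x. deriv f (Y n x) * w1 x - deriv f (W x) * w1 x)" by simp
  qed
 qed
qed

text \<open>By Euler's identity the integrand is p f(w) w1, and integration by parts gives that the
  integral of f(w) w1 equals -p times itself. This is the nonlinear part of momentum
  conservation.\<close>

lemma int_u_chain: assumes "W2 w w1 w2" shows "(LI x. w x * (deriv f (w x) * w1 x)) = 0"
proof -
 note L = W2D[OF assms] and Ch = W2_chain[OF assms]
 have e: "(%x. w x * (deriv f (w x) * w1 x)) = (%x. p * (f (w x) * w1 x))"
  using euler by (simp add: fun_eq_iff mult_ac)
 have "(LI x. f (w x) * w1 x) = - (LI x. (deriv f (w x) * w1 x) * w x)"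
  by (rule weak_ibp[OF Ch L(4,1,2)])
 also have "\<dots> = - (p * (LI x. f (w x) * w1 x))" using e by (simp add: mult.commute)
 finally have "(1 + p) * (LI x. f (w x) * w1 x) = 0" by (simp add: algebra_simps)
 then show ?thesis using p2 by (simp add: e)
qed

text \<open>The action E + cQ, where Q is the integral of the product of the two components, written
  on explicit derivatives.\<close>

definition Sf :: "real => real => (real => real) => (real => real) => (real => real) => (real => real) => real" where
 "Sf \<beta> c w w1 w2 z = ((nrm w2)\<^sup>2 - \<beta> * (nrm w1)\<^sup>2 + (nrm w)\<^sup>2 + (nrm z)\<^sup>2) / 2
   - (LI x. F (w x)) + c * (LI x. w x * z x)"

lemma Sf_tendsto:
 assumes "W2 w w1 w2" "L2 z"
 shows "(%n. Sf \<beta> c (conv (moll n) w) (conv (moll n) w1) (conv (moll n) w2) (conv (moll n) z)) \<longlonglongrightarrow> Sf \<beta> c w w1 w2 z"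
proof -
 note L = W2D[OF assms(1)] and Y = conv_young(1)[OF moll_kern]
 have n: "(%n. nrm (conv (moll n) h)) \<longlonglongrightarrow> nrm h" if h: "L2 h" for h
 proof (rule Lim_null[THEN iffD2], rule Lim_null_comparison[OF _ moll_tendsto[OF h]])
  show "\<forall>\<^sub>F n in sequentially. norm (nrm (conv (moll n) h) - nrm h) \<le> nrm (%x. conv (moll n) h x - h x)"
   using nrm_diff_ge[OF Y[OF h] h] by simp
 qed
 define M where "M = 2 * (nrm w + nrm w1)"
 have Yb: "\<bar>conv (moll n) w x\<bar> \<le> M" for n x
 proof (rule order_trans[OF sup_bound[of "conv (moll n) w" "conv (moll n) w1"]])
  show "2 * (nrm (conv (moll n) w) + nrm (conv (moll n) w1)) \<le> M" unfolding M_def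
   using moll_young[OF L(1), of n] moll_young[OF L(2), of n] by (intro mult_left_mono add_mono) auto
 qed (use weak_moll[OF L(4,1,2)] Y L in auto)
 obtain C where C: "C > 0" "\<And>u w. L2 u ==> L2 w ==> AE x in lborel. \<bar>u x\<bar> \<le> M ==> AE x in lborel. \<bar>w x\<bar> \<le> M ==>
  \<bar>(LI x. F (u x)) - (LI x. F (w x))\<bar> \<le> C * (nrm u + nrm w) * ndist u w"
  by (rule F_lip[of M], rule that)
 have Fl: "(%n. LI x. F (conv (moll n) w x)) \<longlonglongrightarrow> (LI x. F (w x))"
 proof (rule Lim_null[THEN iffD2], rule Lim_null_comparison)
  show "\<forall>\<^sub>F n in sequentially. norm ((LI x. F (conv (moll n) w x)) - (LI x. F (w x)))
   \<le> C * (nrm (conv (moll n) w) + nrm w) * nrm (%x. conv (moll n) w x - w x)"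
  proof (intro always_eventually allI)
   fix n
   show "norm ((LI x. F (conv (moll n) w x)) - (LI x. F (w x)))
    \<le> C * (nrm (conv (moll n) w) + nrm w) * nrm (%x. conv (moll n) w x - w x)"
    using C(2)[OF Y[OF L(1)] L(1)] Yb W2_bound[OF assms(1)] by (simp add: M_def)
  qed
  have "(%n. C * (nrm (conv (moll n) w) + nrm w) * nrm (%x. conv (moll n) w x - w x)) \<longlonglongrightarrow> C * (nrm w + nrm w) * 0"
   by (intro tendsto_intros n L moll_tendsto)
  then show "(%n. C * (nrm (conv (moll n) w) + nrm w) * nrm (%x. conv (moll n) w x - w x)) \<longlonglongrightarrow> 0" by simp
 qed
 show ?thesis unfolding Sf_def
  by (intro tendsto_intros n Fl LINT_tendsto_L2 moll_tendsto Y L assms) simp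
qed

end

lemma DERIV_sq:
 fixes g :: "real => real"
 assumes "(g has_real_derivative g') (at x within S)"
 shows "((%x. (g x)\<^sup>2) has_real_derivative 2 * g x * g') (at x within S)"
 using DERIV_power[OF assms, of 2] by (simp add: mult_ac)

section \<open>Energy balance of the spatially mollified solution\<close>

context sol begin

text \<open>The j-th derivative is put on the kernel, so even five space derivatives of an H2
  function are available; for mollifiers and j at most 2, \<open>Y_moll\<close> puts them back on
  u.\<close>

definition "Y k j r = conv ((deriv ^^ j) k) (u r)"
definition "Vv k j r = conv ((deriv ^^ j) k) (v r)"
definition "Fk k r = conv (deriv k) (%x. f (u r x))"

lemma Y_time:
 assumes k: "test_fun k" and st: "0 \<le> s" "s \<le> t"
 shows "((%r. Vv k (Suc j) r x) has_integral (Y k j t x - Y k j s x)) {s..t}"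
proof -
 define l where "l = (deriv ^^ j) k"
 have l: "test_fun l" unfolding l_def by (rule test_derivs[OF k])
 have "((%r. - (LI y. v r y * deriv (%y. l (x - y)) y)) has_integral
   ((LI y. u t y * l (x - y)) - (LI y. u s y * l (x - y)))) {s..t}"
  by (rule sol_u[OF test_refl[OF l] st])
 then show ?thesis
  by (simp add: deriv_refl[OF l] Y_def Vv_def conv_def l_def[symmetric] mult.commute)
qed

lemma V_time:
 assumes k: "test_fun k" and st: "0 \<le> s" "s \<le> t"
 shows "((%r. Y k 1 r x + \<beta> * Y k 3 r x + Y k 5 r x - Fk k r x) has_integral (Vv k 0 t x - Vv k 0 s x)) {s..t}"
proof -
 define g where "g = (%y. k (x - y))"
 have g: "test_fun g" unfolding g_def by (rule test_refl[OF k])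
 have dk: "test_fun (deriv k)" "test_fun (deriv (deriv (deriv k)))" "test_fun (deriv (deriv (deriv (deriv (deriv k)))))"
  using k test_deriv by auto
 have "((%r. (LI y. f (u r y) * deriv g y) - (LI y. u r y * Lop (deriv g) y)) has_integral
   ((LI y. v t y * g y) - (LI y. v s y * g y))) {s..t}"
  by (rule sol_v[OF g st])
 then have "((%r. (LI y. f (u r y) * deriv g y) - (LI y. u r y * Lop (deriv g) y)) has_integral
   (Vv k 0 t x - Vv k 0 s x)) {s..t}"
  by (simp add: Vv_def conv_def g_def mult.commute)
 then show ?thesis
 proof (rule has_integral_eq[rotated])
  fix r assume "r \<in> {s..t}"
  then have r: "r \<ge> 0" using st by simp
  have dg: "deriv g = (%y. - deriv k (x - y))" unfolding g_def by (rule deriv_refl[OF k])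
  have gj: "(deriv ^^ j) (deriv g) y = (-1) ^ Suc j * (deriv ^^ Suc j) k (x - y)" for j y
   using derivs_refl[OF k, of "Suc j" x] by (simp add: g_def funpow_swap1)
  have L: "Lop (deriv g) y = - (deriv k (x - y) + \<beta> * (deriv ^^ 3) k (x - y) + (deriv ^^ 5) k (x - y))" for y
   using gj[of 2 y] gj[of 4 y] by (simp add: Lop_def dg numeral_eq_Suc)
  note ku = conv_int[OF test_kern[OF test_derivs[OF k]] L2u[OF r]]
  have "(LI y. u r y * Lop (deriv g) y)
   = (LI y. - ((deriv ^^ 1) k (x - y) * u r y + \<beta> * ((deriv ^^ 3) k (x - y) * u r y) + (deriv ^^ 5) k (x - y) * u r y))"
   by (intro Bochner_Integration.integral_cong refl) (simp add: L algebra_simps)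
  also have "\<dots> = - (Y k 1 r x + \<beta> * Y k 3 r x + Y k 5 r x)"
   unfolding Y_def conv_def using ku[of 1 x] ku[of 3 x] ku[of 5 x] by (simp del: One_nat_def funpow.simps)
  finally show "(LI y. f (u r y) * deriv g y) - (LI y. u r y * Lop (deriv g) y)
   = Y k 1 r x + \<beta> * Y k 3 r x + Y k 5 r x - Fk k r x"
   by (simp add: dg Fk_def conv_def mult.commute)
 qed
qed

lemma L2c_u: "t \<in> {0..} ==> ((%s. ndist (u s) (u t)) \<longlongrightarrow> 0) (at t within {0..})"
proof (rule Lim_null_comparison[OF _ D_tendsto])
 assume t: "t \<in> {0..}"
 then show "\<forall>\<^sub>F s in at t within {0..}. norm (ndist (u s) (u t)) \<le> D s t"
  unfolding eventually_at by (intro exI[of _ 1]) (use D_ge(1) in auto)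
qed simp

lemma L2c_v: "t \<in> {0..} ==> ((%s. ndist (v s) (v t)) \<longlongrightarrow> 0) (at t within {0..})"
proof (rule Lim_null_comparison[OF _ D_tendsto])
 assume t: "t \<in> {0..}"
 then show "\<forall>\<^sub>F s in at t within {0..}. norm (ndist (v s) (v t)) \<le> D s t"
  unfolding eventually_at by (intro exI[of _ 1]) (use D_ge(4) in auto)
qed simp

lemma L2c_f: assumes t: "t \<in> {0..}" shows "((%s. nrm (%x. f (u s x) - f (u t x))) \<longlongrightarrow> 0) (at t within {0..})"
proof (rule Lim_null_comparison)
 show "\<forall>\<^sub>F s in at t within {0..}. norm (nrm (%x. f (u s x) - f (u t x))) \<le> Lf (t + 1) * D s t"
  unfolding eventually_at
 proof (intro exI[of _ 1] conjI ballI impI)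
  fix s assume "s \<in> {0..}" "s \<noteq> t \<and> dist s t < 1"
  then show "norm (nrm (%x. f (u s x) - f (u t x))) \<le> Lf (t + 1) * D s t"
   using Lf(2)[of s "t + 1" t] t by (auto simp: dist_real_def)
 qed simp
 show "((%s. Lf (t + 1) * D s t) \<longlongrightarrow> 0) (at t within {0..})"
  using tendsto_mult[OF tendsto_const D_tendsto, of t "Lf (t + 1)"] t by simp
qed

lemma joint:
 assumes "test_fun k"
 shows "continuous_on ({0..} \<times> UNIV) (%z. Y k j (fst z) (snd z))" "continuous_on ({0..} \<times> UNIV) (%z. Vv k j (fst z) (snd z))"
  "continuous_on ({0..} \<times> UNIV) (%z. Fk k (fst z) (snd z))"
 unfolding Y_def Vv_def Fk_def
 by (rule conv_joint; use test_derivs test_deriv assms L2u L2v fu_L2 L2c_u L2c_v L2c_f in simp)+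

lemma slice_cont:
 fixes g :: "real => real => real"
 assumes "continuous_on ({0..} \<times> UNIV) (%z. g (fst z) (snd z))" "0 \<le> s"
 shows "continuous_on {s..t} (%r. g r x)"
proof -
 have "continuous_on {s..t} (%r. (%z. g (fst z) (snd z)) (r, x))"
  by (rule continuous_on_compose2[OF assms(1)]) (use assms(2) in \<open>auto intro!: continuous_intros\<close>)
 then show ?thesis by simp
qed

lemma Y_DERIV:
 assumes "test_fun k" "0 \<le> s" "r \<in> {s..t}"
 shows "((%r. Y k j r x) has_real_derivative Vv k (Suc j) r x) (at r within {s..t})"
proof (rule has_integral_imp_DERIV[OF _ _ assms(3)])
 show "((%r. Vv k (Suc j) r x) has_integral (Y k j b x - Y k j a x)) {a..b}" if "s \<le> a" "a \<le> b" "b \<le> t" for a b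
  by (rule Y_time) (use assms that in auto)
 show "continuous_on {s..t} (%r. Vv k (Suc j) r x)" by (rule slice_cont[OF joint(2)[OF assms(1)] assms(2)])
qed

lemma V_DERIV:
 assumes "test_fun k" "0 \<le> s" "r \<in> {s..t}"
 shows "((%r. Vv k 0 r x) has_real_derivative (Y k 1 r x + \<beta> * Y k 3 r x + Y k 5 r x - Fk k r x)) (at r within {s..t})"
proof (rule has_integral_imp_DERIV[OF _ _ assms(3)])
 show "((%r. Y k 1 r x + \<beta> * Y k 3 r x + Y k 5 r x - Fk k r x) has_integral (Vv k 0 b x - Vv k 0 a x)) {a..b}" if "s \<le> a" "a \<le> b" "b \<le> t" for a b
  by (rule V_time) (use assms that in auto)
 show "continuous_on {s..t} (%r. Y k 1 r x + \<beta> * Y k 3 r x + Y k 5 r x - Fk k r x)"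
  by (intro continuous_intros slice_cont[OF joint(1)] slice_cont[OF joint(3)] assms)
qed

definition "dens c k r x = ((Y k 2 r x)\<^sup>2 - \<beta> * (Y k 1 r x)\<^sup>2 + (Y k 0 r x)\<^sup>2 + (Vv k 0 r x)\<^sup>2) / 2
  - F (Y k 0 r x) + c * (Y k 0 r x * Vv k 0 r x)"

text \<open>The time derivative of \<open>dens\<close> after inserting the mollified equations,
  expanded into products of two square integrable factors so that \<open>bdd1_mult\<close> applies
  term by term.\<close>

definition "ddens c k r x = Vv k 0 r x * Y k 1 r x + \<beta> * (Vv k 0 r x * Y k 3 r x) + Vv k 0 r x * Y k 5 r x - Vv k 0 r x * Fk k r x
  + Y k 2 r x * Vv k 3 r x - \<beta> * (Y k 1 r x * Vv k 2 r x) + Y k 0 r x * Vv k 1 r x - f (Y k 0 r x) * Vv k 1 r x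
  + c * (Vv k 1 r x * Vv k 0 r x) + c * (Y k 0 r x * Y k 1 r x) + (c * \<beta>) * (Y k 0 r x * Y k 3 r x)
  + c * (Y k 0 r x * Y k 5 r x) - c * (Y k 0 r x * Fk k r x)"

lemma dens_time:
 assumes k: "test_fun k" and st: "0 \<le> s" "s \<le> t"
 shows "((%r. ddens c k r x) has_integral (dens c k t x - dens c k s x)) {s..t}"
proof (rule fundamental_theorem_of_calculus[OF st(2)])
 fix r assume r: "r \<in> {s..t}"
 note d = Y_DERIV[OF k st(1) r] V_DERIV[OF k st(1) r]
 have d2: "((%r. (Y k 2 r x)\<^sup>2) has_real_derivative 2 * Y k 2 r x * Vv k 3 r x) (at r within {s..t})"
  using DERIV_sq[OF d(1)[of 2 x]] by (simp add: numeral_eq_Suc)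
 have d1: "((%r. (Y k 1 r x)\<^sup>2) has_real_derivative 2 * Y k 1 r x * Vv k 2 r x) (at r within {s..t})"
  using DERIV_sq[OF d(1)[of 1 x]] by (simp add: numeral_eq_Suc)
 have d0': "((%r. Y k 0 r x) has_real_derivative Vv k 1 r x) (at r within {s..t})"
  using d(1)[of 0 x] by simp
 have d0: "((%r. (Y k 0 r x)\<^sup>2) has_real_derivative 2 * Y k 0 r x * Vv k 1 r x) (at r within {s..t})"
  by (rule DERIV_sq[OF d0'])
 have dv: "((%r. (Vv k 0 r x)\<^sup>2) has_real_derivative 2 * Vv k 0 r x * (Y k 1 r x + \<beta> * Y k 3 r x + Y k 5 r x - Fk k r x)) (at r within {s..t})"
  by (rule DERIV_sq[OF d(2)])
 have dF: "((%r. F (Y k 0 r x)) has_real_derivative f (Y k 0 r x) * Vv k 1 r x) (at r within {s..t})"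
  by (rule DERIV_chain2[OF Fd d0'])
 have dq: "((%r. Y k 0 r x * Vv k 0 r x) has_real_derivative Vv k 1 r x * Vv k 0 r x + (Y k 1 r x + \<beta> * Y k 3 r x + Y k 5 r x - Fk k r x) * Y k 0 r x) (at r within {s..t})"
  by (rule DERIV_mult[OF d0' d(2)])
 have "((%r. dens c k r x) has_real_derivative
   ((2 * Y k 2 r x * Vv k 3 r x - \<beta> * (2 * Y k 1 r x * Vv k 2 r x) + 2 * Y k 0 r x * Vv k 1 r x
    + 2 * Vv k 0 r x * (Y k 1 r x + \<beta> * Y k 3 r x + Y k 5 r x - Fk k r x)) / 2 - f (Y k 0 r x) * Vv k 1 r x
    + c * (Vv k 1 r x * Vv k 0 r x + (Y k 1 r x + \<beta> * Y k 3 r x + Y k 5 r x - Fk k r x) * Y k 0 r x))) (at r within {s..t})"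
  unfolding dens_def by (intro DERIV_add DERIV_diff DERIV_cdivide DERIV_cmult d2 d1 d0 dv dF dq)
 moreover have "((2 * Y k 2 r x * Vv k 3 r x - \<beta> * (2 * Y k 1 r x * Vv k 2 r x) + 2 * Y k 0 r x * Vv k 1 r x
    + 2 * Vv k 0 r x * (Y k 1 r x + \<beta> * Y k 3 r x + Y k 5 r x - Fk k r x)) / 2 - f (Y k 0 r x) * Vv k 1 r x
    + c * (Vv k 1 r x * Vv k 0 r x + (Y k 1 r x + \<beta> * Y k 3 r x + Y k 5 r x - Fk k r x) * Y k 0 r x)) = ddens c k r x"
  by (simp add: ddens_def field_simps)
 ultimately show "((%r. dens c k r x) has_vector_derivative ddens c k r x) (at r within {s..t})"
  by (simp add: has_real_derivative_iff_has_vector_derivative)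
qed

lemma Y_L2: assumes "test_fun k" "0 \<le> r" shows "L2 (Y k j r)" "L2 (Vv k j r)" "L2 (Fk k r)"
 unfolding Y_def Vv_def Fk_def
 using conv_young(1) test_kern test_derivs test_deriv assms L2u L2v fu_L2 by auto

lemma Y_sup: assumes "test_fun k" "0 \<le> r" "r \<le> T" shows "\<bar>Y k 0 r x\<bar> \<le> nrm k * MM T"
proof -
 have "\<bar>Y k 0 r x\<bar> \<le> nrm k * nrm (u r)" unfolding Y_def using conv_sup[OF test_kern[OF assms(1)] L2u[OF assms(2)]] by simp
 also have "\<dots> \<le> nrm k * MM T" by (intro mult_left_mono MM assms) auto
 finally show ?thesis .
qed

lemma bdds:
 assumes k: "test_fun k" and s: "0 \<le> s"
 shows "bdd2 {s..t} (Y k j)" "bdd2 {s..t} (Vv k j)" "bdd2 {s..t} (Fk k)" "bdd2 {s..t} (%r x. f (Y k 0 r x))"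
proof -
 have I: "bdd2 {s..t} a" if "\<And>r. 0 \<le> r ==> L2 (a r)" "\<And>r. 0 \<le> r ==> r \<le> t ==> nrm (a r) \<le> B" for a B
  unfolding bdd2_def using s that by (auto intro!: exI[of _ B])
 have b: "bdd2 {s..t} u" "bdd2 {s..t} v" "bdd2 {s..t} (%r x. f (u r x))"
  by (rule I[OF L2u MM(2)], assumption+, rule I[OF L2v MM(5)], assumption+, rule I[OF fu_L2 Lf(3)], assumption+)
 show Y: "bdd2 {s..t} (Y k j)" for j
  using bdd2_conv[OF test_derivs[OF k] b(1), of j] unfolding Y_def[abs_def] .
 show "bdd2 {s..t} (Vv k j)"
  using bdd2_conv[OF test_derivs[OF k] b(2), of j] unfolding Vv_def[abs_def] .
 show "bdd2 {s..t} (Fk k)"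
  using bdd2_conv[OF test_deriv[OF k] b(3)] unfolding Fk_def[abs_def] .
 define M where "M = nrm k * MM t"
 obtain C where C: "C > 0" "\<And>u. L2 u ==> AE x in lborel. \<bar>u x\<bar> \<le> M ==> nrm (%x. f (u x)) \<le> C * nrm u"
  by (rule f_lip[of M], rule that)
 obtain B where B: "\<And>r. r \<in> {s..t} ==> nrm (Y k 0 r) \<le> B" using Y[of 0] unfolding bdd2_def by blast
 have Ys: "AE x in lborel. \<bar>Y k 0 r x\<bar> \<le> M" if "r \<in> {s..t}" for r
  unfolding M_def using Y_sup[OF k, of r t] that s by auto
 have "nrm (%x. f (Y k 0 r x)) \<le> C * B" if r: "r \<in> {s..t}" for r
  by (rule order_trans[OF C(2)[OF Y_L2(1)[OF k] Ys[OF r]] mult_left_mono[OF B[OF r]]]) (use r s C in auto)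
 moreover have "L2 (%x. f (Y k 0 r x))" if r: "r \<in> {s..t}" for r
  by (rule fL2[OF Y_L2(1)[OF k] Ys[OF r]]) (use r s in auto)
 ultimately show "bdd2 {s..t} (%r x. f (Y k 0 r x))" unfolding bdd2_def by blast
qed

lemma ddens_bdd1:
 assumes k: "test_fun k" and s: "0 \<le> s"
 shows "bdd1 {s..t} (ddens c k)"
 unfolding ddens_def[abs_def] by (intro bdd1_add bdd1_diff bdd1_cmult bdd1_mult bdds k s)

lemma ddens_joint: assumes k: "test_fun k" shows "continuous_on ({0..} \<times> UNIV) (%z. ddens c k (fst z) (snd z))"
 unfolding ddens_def
 by (intro continuous_intros joint[OF k] continuous_on_compose2[OF fc joint(1)[OF k]]) auto

text \<open>What survives once all linear terms have cancelled: the defect between f of the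
  mollified u and the mollified f(u), and the nonlinear momentum term.\<close>

definition "RR c k r = (LI x. Vv k 0 r x * (deriv f (Y k 0 r x) * Y k 1 r x)) - (LI x. Vv k 0 r x * Fk k r x)
 - c * (LI x. Y k 0 r x * Fk k r x)"

lemma ddens_integral:
 assumes k: "test_fun k" and r: "0 \<le> r"
 shows "(LI x. ddens c k r x) = RR c k r"
proof -
 note L = Y_L2[OF k r]
 have s: "bdd2 {r..r} (%r x. f (Y k 0 r x))" by (rule bdds(4)[OF k r])
 have Lf': "L2 (%x. f (Y k 0 r x))" using s by (simp add: bdd2_def)
 note i = L2_mult[OF L(1) L(1)] L2_mult[OF L(1) L(2)] L2_mult[OF L(2) L(1)] L2_mult[OF L(2) L(2)] L2_mult[OF L(2) L(3)]
  L2_mult[OF L(1) L(3)] L2_mult[OF Lf' L(2)]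
 have YY: "(LI x. Y k a r x * Y k (Suc b) r x) = - (LI x. Y k (Suc a) r x * Y k b r x)" for a b
  using conv_ibp[OF test_derivs[OF k] test_derivs[OF k] L2u[OF r] L2u[OF r]] by (simp add: Y_def)
 have VV: "(LI x. Vv k a r x * Vv k (Suc b) r x) = - (LI x. Vv k (Suc a) r x * Vv k b r x)" for a b
  using conv_ibp[OF test_derivs[OF k] test_derivs[OF k] L2v[OF r] L2v[OF r]] by (simp add: Vv_def)
 have VY: "(LI x. Vv k a r x * Y k (Suc b) r x) = - (LI x. Vv k (Suc a) r x * Y k b r x)" for a b
  using conv_ibp[OF test_derivs[OF k] test_derivs[OF k] L2v[OF r] L2u[OF r]] by (simp add: Vv_def Y_def)
 have sw: "(LI x. Y k a r x * Vv k b r x) = (LI x. Vv k b r x * Y k a r x)"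
  "(LI x. Y k a r x * Y k b r x) = (LI x. Y k b r x * Y k a r x)"
  "(LI x. Vv k a r x * Vv k b r x) = (LI x. Vv k b r x * Vv k a r x)" for a b
  by (simp_all add: mult.commute)
 \<comment> \<open>\<open>e1\<close> to \<open>e3\<close> cancel the linear energy terms in pairs,
   \<open>e4\<close> to \<open>e7\<close> are integrals of exact derivatives, and \<open>e8\<close>
   moves the derivative from the velocity to f(u).\<close>
 have e1: "(LI x. Y k 0 r x * Vv k 1 r x) = - (LI x. Vv k 0 r x * Y k 1 r x)"
  using VY[of 0 0] sw(1)[of 0 1] by simp
 have e2: "(LI x. Vv k 0 r x * Y k 3 r x) = (LI x. Y k 1 r x * Vv k 2 r x)"
  using VY[of 0 2] VY[of 1 1] sw(1)[of 1 2] by (simp add: numeral_eq_Suc)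
 have e3: "(LI x. Vv k 0 r x * Y k 5 r x) = - (LI x. Y k 2 r x * Vv k 3 r x)"
  using VY[of 0 4] VY[of 1 3] VY[of 2 2] sw(1)[of 2 3] by (simp add: numeral_eq_Suc)
 have e4: "(LI x. Vv k 1 r x * Vv k 0 r x) = 0"
  using VV[of 0 0] sw(3)[of 0 1] by simp
 have e5: "(LI x. Y k 0 r x * Y k 1 r x) = 0"
  using YY[of 0 0] sw(2)[of 0 1] by simp
 have e6: "(LI x. Y k 0 r x * Y k 3 r x) = 0"
  using YY[of 0 2] YY[of 1 1] sw(2)[of 1 2] by (simp add: numeral_eq_Suc)
 have e7: "(LI x. Y k 0 r x * Y k 5 r x) = 0"
  using YY[of 0 4] YY[of 1 3] YY[of 2 2] sw(2)[of 2 3] by (simp add: numeral_eq_Suc)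
 have dY: "(Y k 0 r has_real_derivative Y k 1 r x) (at x)" "(Vv k 0 r has_real_derivative Vv k 1 r x) (at x)" for x
  unfolding Y_def Vv_def using conv_DERIV[OF k L2_loc_int[OF L2u[OF r]]] conv_DERIV[OF k L2_loc_int[OF L2v[OF r]]] by auto
 have cY: "continuous_on UNIV (Y k 1 r)" "continuous_on UNIV (Vv k 1 r)"
  unfolding Y_def Vv_def using smooth_cont conv_smooth[OF test_deriv[OF k] L2_loc_int[OF L2u[OF r]]] conv_smooth[OF test_deriv[OF k] L2_loc_int[OF L2v[OF r]]] by auto
 have cY0: "continuous_on UNIV (Y k 0 r)" using dY(1) by (meson DERIV_isCont continuous_at_imp_continuous_on)
 have e8: "(LI x. f (Y k 0 r x) * Vv k 1 r x) = - (LI x. (deriv f (Y k 0 r x) * Y k 1 r x) * Vv k 0 r x)"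
 proof (rule classical_ibp)
  show "((%x. f (Y k 0 r x)) has_real_derivative deriv f (Y k 0 r x) * Y k 1 r x) (at x)" for x
   by (rule DERIV_chain2[OF fd dY(1)])
  show "continuous_on UNIV (%x. deriv f (Y k 0 r x) * Y k 1 r x)"
   by (intro continuous_intros cY continuous_on_compose2[OF f'c cY0]) auto
  show "L2 (%x. deriv f (Y k 0 r x) * Y k 1 r x)"
   by (rule chain_L2[OF L(1) L2_meas[OF L(1)] AE_I2[OF Y_sup[OF k r order_refl]]])
 qed (use dY cY L Lf' in auto)
 show ?thesis unfolding ddens_def RR_def
  using i e1 e2 e3 e4 e5 e6 e7 e8 by (simp add: mult.commute[of "Vv k 0 r _" "_ * _"] mult.commute[of "Vv k 0 r _" "deriv f _ * _"])
qed

lemma dens_integral: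
 assumes k: "test_fun k" and r: "0 \<le> r"
 shows "integrable lborel (dens c k r)" "(LI x. dens c k r x) = Sf \<beta> c (Y k 0 r) (Y k 1 r) (Y k 2 r) (Vv k 0 r)"
proof -
 note L = Y_L2[OF k r]
 obtain C where C: "\<And>u. L2 u ==> AE x in lborel. \<bar>u x\<bar> \<le> nrm k * MM r ==> integrable lborel (%x. F (u x))"
  by (rule F_lip[of "nrm k * MM r"], rule that)
 have iF: "integrable lborel (%x. F (Y k 0 r x))" by (rule C[OF L(1) AE_I2[OF Y_sup[OF k r order_refl]]])
 note i = L2_sq[OF L(1)] L2_sq[OF L(2)] L2_mult[OF L(1) L(2)] iF
 show "integrable lborel (dens c k r)" unfolding dens_def[abs_def] using i by simp
 show "(LI x. dens c k r x) = Sf \<beta> c (Y k 0 r) (Y k 1 r) (Y k 2 r) (Vv k 0 r)"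
  unfolding dens_def Sf_def nrm_sq using i by simp
qed

lemma energy_moll:
 assumes k: "test_fun k" and st: "0 \<le> s" "s \<le> t"
 shows "((%r. RR c k r) has_integral (Sf \<beta> c (Y k 0 t) (Y k 1 t) (Y k 2 t) (Vv k 0 t) - Sf \<beta> c (Y k 0 s) (Y k 1 s) (Y k 2 s) (Vv k 0 s))) {s..t}"
proof -
 have t: "0 \<le> t" using st by simp
 obtain B where B: "\<And>r. r \<in> {s..t} ==> integrable lborel (ddens c k r)" "\<And>r. r \<in> {s..t} ==> (LI x. \<bar>ddens c k r x\<bar>) \<le> B"
  using ddens_bdd1[OF k st(1), of t c] unfolding bdd1_def by blast
 have "((%r. LI x. ddens c k r x) has_integral (LI x. dens c k t x - dens c k s x)) {s..t}"
 proof (rule fubini_time[OF st(2) _ B dens_time[OF k st]])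
  show "continuous_on ({s..t} \<times> UNIV) (%z. ddens c k (fst z) (snd z))"
   by (rule continuous_on_subset[OF ddens_joint[OF k]]) (use st in auto)
 qed
 also have "(LI x. dens c k t x - dens c k s x) = Sf \<beta> c (Y k 0 t) (Y k 1 t) (Y k 2 t) (Vv k 0 t) - Sf \<beta> c (Y k 0 s) (Y k 1 s) (Y k 2 s) (Vv k 0 s)"
  using dens_integral[OF k st(1)] dens_integral[OF k t] by simp
 finally show ?thesis
  by (rule has_integral_eq[rotated]) (use ddens_integral[OF k] st in auto)
qed

definition "gg r x = deriv f (u r x) * u1 r x"

lemma Y_moll: assumes "0 \<le> r" shows "Y (moll n) 0 r = conv (moll n) (u r)" "Y (moll n) 1 r = conv (moll n) (u1 r)"
  "Y (moll n) 2 r = conv (moll n) (u2 r)" "Vv (moll n) 0 r = conv (moll n) (v r)" "Fk (moll n) r = conv (moll n) (gg r)"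
proof -
 note W = W2D[OF W2u[OF assms]]
 show "Y (moll n) 0 r = conv (moll n) (u r)" "Vv (moll n) 0 r = conv (moll n) (v r)" by (simp_all add: Y_def Vv_def)
 show "Y (moll n) 1 r = conv (moll n) (u1 r)" using conv_weak[OF W(4) moll_test] by (simp add: Y_def fun_eq_iff)
 show "Y (moll n) 2 r = conv (moll n) (u2 r)"
  using conv_weak[OF W(4) test_deriv[OF moll_test]] conv_weak[OF W(5) moll_test] by (simp add: Y_def fun_eq_iff numeral_eq_Suc)
 show "Fk (moll n) r = conv (moll n) (gg r)"
  using conv_weak[OF W2_chain(1)[OF W2u[OF assms]] moll_test] by (simp add: Fk_def fun_eq_iff gg_def[abs_def])
qed

text \<open>In the limit the first two terms both become the pairing of v with f'(u) u_x and cancel;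
  the third is \<open>int_u_chain\<close>.\<close>

lemma RR_tendsto: assumes r: "0 \<le> r" shows "(%n. RR c (moll n) r) \<longlonglongrightarrow> 0"
proof -
 note W = W2D[OF W2u[OF r]] and C = W2_chain[OF W2u[OF r]] and Yg = conv_young(1)[OF moll_kern]
 have g: "L2 (gg r)" using C(3) by (simp add: gg_def[abs_def])
 have b: "\<bar>conv (moll n) (u r) x\<bar> \<le> nrm (moll n) * nrm (u r)" for n x by (rule conv_sup[OF moll_kern W(1)])
 have Lc: "L2 (%x. deriv f (conv (moll n) (u r) x) * conv (moll n) (u1 r) x)" for n
  by (rule chain_L2[OF Yg[OF W(2)] L2_meas[OF Yg[OF W(1)]] AE_I2[OF b]])
 have "(%n. RR c (moll n) r) \<longlonglongrightarrow> (LI x. v r x * gg r x) - (LI x. v r x * gg r x) - c * (LI x. u r x * gg r x)"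
  unfolding RR_def Y_moll[OF r]
  by (intro tendsto_diff tendsto_mult tendsto_const LINT_tendsto_L2 moll_tendsto Yg g W L2v[OF r] Lc chain_moll[OF W2u[OF r], folded gg_def])
 then show ?thesis using int_u_chain[OF W2u[OF r]] by (simp add: gg_def)
qed

lemma RR_bound: assumes T: "0 \<le> T" shows "\<exists>B. \<forall>n. \<forall>r\<in>{0..T}. \<bar>RR c (moll n) r\<bar> \<le> B"
proof -
 define M where "M = 4 * MM T"
 obtain C where C: "C > 0" "\<And>s. \<bar>s\<bar> \<le> M ==> \<bar>deriv f s\<bar> \<le> C" by (rule local_bounds[of M], rule that)
 have M0: "MM T > 0" by (rule MM)
 have "\<bar>RR c (moll n) r\<bar> \<le> MM T * (C * MM T) + MM T * (C * MM T) + \<bar>c\<bar> * (MM T * (C * MM T))" if "r \<in> {0..T}" for n r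
 proof -
  have r: "0 \<le> r" "r \<le> T" using that by auto
  note W = W2D[OF W2u[OF r(1)]] and Ch = W2_chain[OF W2u[OF r(1)]] and Yg = conv_young(1)[OF moll_kern]
  have g: "L2 (gg r)" using Ch(3) by (simp add: gg_def[abs_def])
  have bu: "AE x in lborel. \<bar>u r x\<bar> \<le> M" unfolding M_def by (rule u_sup[OF r])
  have by': "\<bar>conv (moll n) (u r) x\<bar> \<le> M" for x
  proof (rule order_trans[OF sup_bound[of "conv (moll n) (u r)" "conv (moll n) (u1 r)"]])
   show "2 * (nrm (conv (moll n) (u r)) + nrm (conv (moll n) (u1 r))) \<le> M"
   proof -
    have "nrm (conv (moll n) (u r)) + nrm (conv (moll n) (u1 r)) \<le> MM T + MM T"
     by (intro add_mono order_trans[OF moll_young] W MM r)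
    then show ?thesis by (simp add: M_def)
   qed
  qed (use weak_moll[OF W(4,1,2)] Yg W in auto)
  have n: "nrm (%x. deriv f (h x) * w x) \<le> C * nrm w" if w: "L2 w" "h \<in> borel_measurable borel" "AE x in lborel. \<bar>h x\<bar> \<le> M" for h w
  proof -
   have "nrm (%x. deriv f (h x) * w x) \<le> nrm (%x. C * w x)"
   proof (rule nrm_mono(2)[OF L2_cmult[OF w(1)] L2_meas[OF chain_L2[OF w]]])
    show "AE x in lborel. \<bar>deriv f (h x) * w x\<bar> \<le> \<bar>C * w x\<bar>"
     using w(3) by eventually_elim (use C in \<open>auto simp: abs_mult intro!: mult_right_mono\<close>)
   qed
   then show ?thesis using C(1) by (simp add: nrm_cmult)
  qed
  have nu1: "C * nrm (u1 r) \<le> C * MM T" using MM(3)[OF r] C(1) by simp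
  have n1: "nrm (conv (moll n) (gg r)) \<le> C * MM T"
   using moll_young[OF g, of n] n[OF W(2) L2_meas[OF W(1)] bu] nu1 by (simp add: gg_def[abs_def])
  have n2: "nrm (%x. deriv f (conv (moll n) (u r) x) * conv (moll n) (u1 r) x) \<le> C * MM T"
  proof -
   have "nrm (%x. deriv f (conv (moll n) (u r) x) * conv (moll n) (u1 r) x) \<le> C * nrm (conv (moll n) (u1 r))"
    by (rule n[OF Yg[OF W(2)] L2_meas[OF Yg[OF W(1)]] AE_I2[OF by']])
   also have "\<dots> \<le> C * nrm (u1 r)" using moll_young[OF W(2), of n] C(1) by simp
   finally show ?thesis using nu1 by simp
  qed
  have nv: "nrm (conv (moll n) (v r)) \<le> MM T" using moll_young[OF L2v[OF r(1)], of n] MM(5)[OF r] by simp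
  have nu: "nrm (conv (moll n) (u r)) \<le> MM T" using moll_young[OF W(1), of n] MM(2)[OF r] by simp
  have Lc: "L2 (%x. deriv f (conv (moll n) (u r) x) * conv (moll n) (u1 r) x)"
   by (rule chain_L2[OF Yg[OF W(2)] L2_meas[OF Yg[OF W(1)]] AE_I2[OF by']])
  have m: "nrm a * nrm b \<le> MM T * (C * MM T)" if "nrm a \<le> MM T" "nrm b \<le> C * MM T" for a b
   using that M0 by (intro mult_mono) auto
  have "\<bar>RR c (moll n) r\<bar> \<le> \<bar>LI x. conv (moll n) (v r) x * (deriv f (conv (moll n) (u r) x) * conv (moll n) (u1 r) x)\<bar>
    + \<bar>LI x. conv (moll n) (v r) x * conv (moll n) (gg r) x\<bar> + \<bar>c\<bar> * \<bar>LI x. conv (moll n) (u r) x * conv (moll n) (gg r) x\<bar>"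
   unfolding RR_def Y_moll[OF r(1)] abs_mult[symmetric] by linarith
  also have "\<dots> \<le> MM T * (C * MM T) + MM T * (C * MM T) + \<bar>c\<bar> * (MM T * (C * MM T))"
   by (intro add_mono mult_left_mono order_trans[OF CS_ineq m] Yg W g L2v r Lc nv nu n1 n2) auto
  finally show ?thesis .
 qed
 then show ?thesis by blast
qed

text \<open>The residual of the mollified balance tends to 0 at each time and is bounded uniformly
  by \<open>RR_bound\<close>, so dominated convergence in time removes it. As c is arbitrary here,
  energy and momentum are both conserved.\<close>

lemma S_conserved:
 assumes t: "0 \<le> t"
 shows "Sf \<beta> c (u t) (u1 t) (u2 t) (v t) = Sf \<beta> c (u 0) (u1 0) (u2 0) (v 0)"
proof -
 obtain B where B: "\<And>n r. r \<in> {0..t} ==> \<bar>RR c (moll n) r\<bar> \<le> B" using RR_bound[OF t] by blast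
 define E where "E n r = Sf \<beta> c (conv (moll n) (u r)) (conv (moll n) (u1 r)) (conv (moll n) (u2 r)) (conv (moll n) (v r))" for n r
 have I: "(RR c (moll n) has_integral (E n t - E n 0)) {0..t}" for n
  using energy_moll[OF moll_test order_refl t, of c n] unfolding E_def Y_moll[OF t] Y_moll[OF order_refl] by simp
 have "(%n. integral {0..t} (RR c (moll n))) \<longlonglongrightarrow> integral {0..t} (%r. 0)"
  by (rule dominated_convergence(2)[where h="%r. B"]) (use I B RR_tendsto in \<open>auto simp: integrable_on_def\<close>)
 then have 1: "(%n. E n t - E n 0) \<longlonglongrightarrow> 0" unfolding integral_unique[OF I] by simp
 have "(%n. E n t - E n 0) \<longlonglongrightarrow> Sf \<beta> c (u t) (u1 t) (u2 t) (v t) - Sf \<beta> c (u 0) (u1 0) (u2 0) (v 0)"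
  unfolding E_def by (intro tendsto_diff Sf_tendsto W2u L2v t) auto
 from LIMSEQ_unique[OF 1 this] show ?thesis by simp
qed

end

section \<open>Ground states\<close>

lemma W2_interp: assumes "W2 w w1 w2" shows "(nrm w1)\<^sup>2 \<le> nrm w * nrm w2"
proof -
 note L = W2D[OF assms]
 have "(nrm w1)\<^sup>2 = - (LI x. w x * w2 x)"
  using weak_ibp[OF L(4,1,2,5,2,3)] by (simp only: nrm_sq) (simp add: power2_eq_square)
 then show ?thesis using CS_ineq[OF L(1,3)] by linarith
qed

lemma nrm_const_zero: assumes "L2 (%x::real. k)" shows "k = 0"
proof (rule ccontr)
 assume "k \<noteq> 0"
 then have "integrable lborel (%x::real. (1 / k\<^sup>2) * k\<^sup>2)"
  using L2_sq[OF assms] by (intro integrable_mult_right) auto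
 then have "integrable lborel (%x::real. 1::real)" using \<open>k \<noteq> 0\<close> by simp
 then show False by (simp add: integrable_iff_bounded)
qed

text \<open>The mollifications of \<open>w\<close> have zero derivative, hence are constants lying
  in L2, hence vanish.\<close>

lemma nrm_deriv_zero:
 assumes "weak_deriv w w1" "L2 w" "L2 w1" "nrm w1 = 0" shows "nrm w = 0"
proof -
 have z: "conv (moll n) w1 x = 0" for n x using conv_sup[OF moll_kern assms(3), of n x] assms(4) by simp
 have "conv (moll n) w = (%x. 0)" for n
 proof -
  have "\<forall>x. (conv (moll n) w has_real_derivative 0) (at x)"
   using weak_moll(1)[OF assms(1-3), of n] z by simp
  then have c: "conv (moll n) w = (%x. conv (moll n) w 0)" using DERIV_isconst_all by blast
  then have "L2 (%x. conv (moll n) w 0)" using conv_young(1)[OF moll_kern assms(2), of n] by metis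
  then show ?thesis using c nrm_const_zero by metis
 qed
 then have "(%n. nrm (%x. 0 - w x)) \<longlonglongrightarrow> 0" using moll_tendsto[OF assms(2)] by simp
 then show ?thesis using nrm_cmult[of "-1" w] by (simp add: LIMSEQ_const_iff)
qed

section \<open>Completed-square form of the action and first variation of K\<close>

context nonlin begin

definition II :: "real => real => (real => real) => (real => real) => (real => real) => real" where
 "II \<beta> c w w1 w2 = (nrm w2)\<^sup>2 - \<beta> * (nrm w1)\<^sup>2 + (1 - c\<^sup>2) * (nrm w)\<^sup>2"

definition KK :: "(real => real) => real" where "KK w = (p + 1) * (LI x. F (w x))"

lemma K_fun_eq: "K_fun p f w = KK w" by (simp add: K_fun_def KK_def Fprim_eq)

lemma I_fun_eq: assumes "W2 w w1 w2" shows "I_fun \<beta> c w = II \<beta> c w w1 w2"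
proof -
 have W: "W2 w (d1 w) (d2 w)" by (rule H2_W2[OF W2_H2[OF assms]])
 note L = W2D[OF W] and ae = W2_unique[OF W assms AE_I2[OF refl]]
 have n: "nrm (d1 w) = nrm w1" "nrm (d2 w) = nrm w2"
  by (rule nrm_cong_AE; use ae L W2D[OF assms] L2_meas in blast)+
 have "I_fun \<beta> c w = II \<beta> c w (d1 w) (d2 w)"
  unfolding I_fun_def II_def nrm_sq using L2_sq[OF L(1)] L2_sq[OF L(2)] L2_sq[OF L(3)] by simp
 then show ?thesis by (simp add: II_def n)
qed

text \<open>Completing the square in the velocity turns the coefficient 1 of u^2 into 1 - c^2 and
  isolates z + c w. For fixed w the action is least at z = -c w, which is why the wave has that
  second component.\<close>

lemma Sf_II: assumes "W2 w w1 w2" "L2 z"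
 shows "Sf \<beta> c w w1 w2 z = II \<beta> c w w1 w2 / 2 - KK w / (p + 1) + (nrm (%x. z x + c * w x))\<^sup>2 / 2"
proof -
 note L = W2D[OF assms(1)]
 have "(nrm (%x. z x + c * w x))\<^sup>2 = (LI x. (z x)\<^sup>2 + 2 * c * (w x * z x) + c\<^sup>2 * (w x)\<^sup>2)"
  unfolding nrm_sq by (intro Bochner_Integration.integral_cong refl) (simp add: power2_eq_square algebra_simps)
 also have "\<dots> = (nrm z)\<^sup>2 + 2 * c * (LI x. w x * z x) + c\<^sup>2 * (nrm w)\<^sup>2"
  using L2_sq[OF L(1)] L2_sq[OF assms(2)] L2_mult[OF L(1) assms(2)] by (simp add: nrm_sq)
 finally show ?thesis using p2 by (simp add: Sf_def II_def KK_def field_simps)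
qed

lemma F_taylor:
 obtains C where "C > 0" "\<And>a b. \<bar>a\<bar> \<le> M ==> \<bar>b\<bar> \<le> M ==> \<bar>F (a + b) - F a - f a * b\<bar> \<le> C * b\<^sup>2"
proof -
 obtain C where C: "C > 0" "\<And>a b. \<bar>a\<bar> \<le> 2 * M ==> \<bar>b\<bar> \<le> 2 * M ==> \<bar>f a - f b\<bar> \<le> C * \<bar>a - b\<bar>"
  by (rule local_bounds[of "2 * M"], rule that)
 have "\<bar>F (a + b) - F a - f a * b\<bar> \<le> C * b\<^sup>2" if ab: "\<bar>a\<bar> \<le> M" "\<bar>b\<bar> \<le> M" for a b
 proof -
  have "norm ((F (a + b) - f a * b) - (F (a + 0) - f a * 0)) \<le> (C * \<bar>b\<bar>) * norm (b - 0)"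
  proof (rule field_differentiable_bound[of "{- \<bar>b\<bar>..\<bar>b\<bar>}" "%x. F (a + x) - f a * x" "%x. f (a + x) - f a"])
   fix z assume z: "z \<in> {- \<bar>b\<bar>..\<bar>b\<bar>}"
   have "((%x. F (1 * x + a)) has_real_derivative 1 * f (1 * z + a)) (at z within {- \<bar>b\<bar>..\<bar>b\<bar>})"
    by (rule has_field_derivative_at_within[OF DERIV_affine[OF Fd]])
   then show "((%x. F (a + x) - f a * x) has_real_derivative f (a + z) - f a) (at z within {- \<bar>b\<bar>..\<bar>b\<bar>})"
    by (auto intro!: derivative_eq_intros simp: add.commute)
   have zb: "\<bar>z\<bar> \<le> \<bar>b\<bar>" using z by auto
   have "\<bar>f (a + z) - f a\<bar> \<le> C * \<bar>a + z - a\<bar>" by (rule C(2)) (use ab zb in auto)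
   also have "\<dots> \<le> C * \<bar>b\<bar>" using zb C(1) by simp
   finally show "norm (f (a + z) - f a) \<le> C * \<bar>b\<bar>" by simp
  qed auto
  then show ?thesis by (simp add: power2_eq_square)
 qed
 then show ?thesis using that C(1) by blast
qed

text \<open>The second-order bound on F has a constant independent of x, so the error of the
  difference quotient is controlled by the integral of t^2.\<close>

lemma KK_deriv:
 assumes w: "L2 w" "AE x in lborel. \<bar>w x\<bar> \<le> M" and t: "test_fun t"
 shows "((%e. KK (%x. w x + e * t x)) has_real_derivative (p + 1) * (LI x. f (w x) * t x)) (at 0)"
proof -
 obtain B where B: "B > 0" "\<And>x. \<bar>t x\<bar> \<le> B" using test_bounded[OF t] by metis
 define M' where "M' = \<bar>M\<bar> + B"
 obtain C where C: "C > 0" "\<And>a b. \<bar>a\<bar> \<le> M' ==> \<bar>b\<bar> \<le> M' ==> \<bar>F (a + b) - F a - f a * b\<bar> \<le> C * b\<^sup>2"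
  using F_taylor[of M'] by metis
 obtain C' where C': "\<And>u. L2 u ==> AE x in lborel. \<bar>u x\<bar> \<le> M' ==> integrable lborel (%x. F (u x))"
  by (rule F_lip[of M'], rule that)
 have tL: "L2 t" by (rule test_L2[OF t])
 define G where "G e = (LI x. F (w x + e * t x))" for e
 have bw: "AE x in lborel. \<bar>w x\<bar> \<le> M'" using w(2) by eventually_elim (use B in \<open>auto simp: M'_def\<close>)
 have est: "\<bar>G e - G 0 - e * (LI x. f (w x) * t x)\<bar> \<le> C * e\<^sup>2 * (nrm t)\<^sup>2" if e: "\<bar>e\<bar> \<le> 1" for e
 proof -
  have et: "\<bar>e * t x\<bar> \<le> B" for x using mult_mono[OF e B(2)[of x]] by (simp add: abs_mult)
  have b2: "AE x in lborel. \<bar>w x + e * t x\<bar> \<le> M'"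
   using w(2)
  proof eventually_elim
   case (elim x) then show ?case using et[of x] unfolding M'_def by linarith
  qed
  have i: "integrable lborel (%x. F (w x + e * t x))" "integrable lborel (%x. F (w x))" "integrable lborel (%x. f (w x) * t x)"
   by (rule C'[OF L2_add[OF w(1) L2_cmult[OF tL]] b2], rule C'[OF w(1) bw], rule L2_mult[OF fL2[OF w(1) bw] tL])
  have eq: "G e - G 0 - e * (LI x. f (w x) * t x) = (LI x. F (w x + e * t x) - F (w x) - e * (f (w x) * t x))"
   using i by (simp add: G_def)
  have "\<bar>LI x. F (w x + e * t x) - F (w x) - e * (f (w x) * t x)\<bar> \<le> (LI x. \<bar>F (w x + e * t x) - F (w x) - e * (f (w x) * t x)\<bar>)"
   by (rule integral_abs_bound)
  also have "\<dots> \<le> (LI x. (C * e\<^sup>2) * (t x)\<^sup>2)"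
  proof (rule integral_mono_AE)
   show "AE x in lborel. \<bar>F (w x + e * t x) - F (w x) - e * (f (w x) * t x)\<bar> \<le> C * e\<^sup>2 * (t x)\<^sup>2"
    using bw
   proof eventually_elim
    case (elim x)
    have "\<bar>e * t x\<bar> \<le> M'" using et[of x] by (simp add: M'_def)
    from C(2)[OF elim this] show ?case by (simp add: power_mult_distrib mult_ac)
   qed
  qed (use i L2_sq[OF tL] in auto)
  also have "\<dots> = C * e\<^sup>2 * (nrm t)\<^sup>2" unfolding nrm_sq by (rule integral_mult_right_zero)
  finally show ?thesis unfolding eq .
 qed
 have "(G has_real_derivative (LI x. f (w x) * t x)) (at 0)"
  unfolding DERIV_def
 proof (rule Lim_null[THEN iffD2], rule Lim_null_comparison)
  show "((%h. C * (nrm t)\<^sup>2 * \<bar>h\<bar>) \<longlongrightarrow> 0) (at 0)" by (rule tendsto_eq_intros | simp)+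
  show "\<forall>\<^sub>F h in at 0. norm ((G (0 + h) - G 0) / h - (LI x. f (w x) * t x)) \<le> C * (nrm t)\<^sup>2 * \<bar>h\<bar>"
   unfolding eventually_at
  proof (intro exI[of _ 1] conjI ballI impI)
   fix h :: real assume h: "h \<noteq> 0 \<and> dist h 0 < 1"
   have "norm ((G (0 + h) - G 0) / h - (LI x. f (w x) * t x)) = \<bar>G h - G 0 - h * (LI x. f (w x) * t x)\<bar> / \<bar>h\<bar>"
    using h by (simp add: abs_divide[symmetric] diff_divide_distrib)
   also have "\<dots> \<le> C * h\<^sup>2 * (nrm t)\<^sup>2 / \<bar>h\<bar>" by (intro divide_right_mono est) (use h in auto)
   also have "\<dots> = C * (nrm t)\<^sup>2 * \<bar>h\<bar>" using h by (simp add: power2_eq_square abs_if)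
   finally show "norm ((G (0 + h) - G 0) / h - (LI x. f (w x) * t x)) \<le> C * (nrm t)\<^sup>2 * \<bar>h\<bar>" .
  qed simp
 qed
 then show ?thesis unfolding KK_def G_def[abs_def] by (rule DERIV_cmult)
qed

end

lemma nrm_lin_sq: assumes "L2 a" "L2 b"
 shows "(nrm (%x. a x + e * b x))\<^sup>2 = (nrm a)\<^sup>2 + 2 * e * (LI x. a x * b x) + e\<^sup>2 * (nrm b)\<^sup>2"
proof -
 have "(nrm (%x. a x + e * b x))\<^sup>2 = (LI x. (a x)\<^sup>2 + 2 * e * (a x * b x) + e\<^sup>2 * (b x)\<^sup>2)"
  unfolding nrm_sq by (intro Bochner_Integration.integral_cong refl) (simp add: power2_eq_square algebra_simps)
 also have "\<dots> = (nrm a)\<^sup>2 + 2 * e * (LI x. a x * b x) + e\<^sup>2 * (nrm b)\<^sup>2"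
  using L2_sq[OF assms(1)] L2_sq[OF assms(2)] L2_mult[OF assms] by (simp add: nrm_sq)
 finally show ?thesis .
qed

section \<open>Variational characterisation of the ground state\<close>

locale gstate = nonlin +
 fixes \<beta> c :: real and phi :: "real => real"
 assumes F_pos: "\<exists>s. Fprim f s > 0" and c1: "c\<^sup>2 < 1" and \<beta>1: "\<beta> < 2 * sqrt (1 - c\<^sup>2)"
  and gs: "phi \<in> ground_states p f \<beta> c"
begin

definition "s = 1 - c\<^sup>2"
definition "phi1 = d1 phi"
definition "phi2 = d2 phi"
definition "m = m_val p f \<beta> c"

lemma s_pos: "s > 0" using c1 by (simp add: s_def)

lemma W2phi: "W2 phi phi1 phi2" unfolding phi1_def phi2_def using gs by (intro H2_W2) (simp add: ground_states_def)

lemmas L2phi = W2D(1)[OF W2phi] and L2phi1 = W2D(2)[OF W2phi] and L2phi2 = W2D(3)[OF W2phi]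

text \<open>Interpolation bounds \<beta>_+ |w'|^2 by \<beta>_+ |w| |w''|, and 2 sqrt(s) |w| |w''| is
  at most s|w|^2 + |w''|^2. The ratio \<open>q\<close> of \<beta>_+ to the threshold 2 sqrt(s) is
  below 1, so a fraction 1 - q of the form remains.\<close>

lemma II_coercive:
 obtains \<theta> where "\<theta> > 0" "\<And>w w1 w2. W2 w w1 w2 ==> II \<beta> c w w1 w2 \<ge> \<theta> * ((nrm w)\<^sup>2 + (nrm w1)\<^sup>2 + (nrm w2)\<^sup>2)"
proof -
 define b where "b = max \<beta> 0"
 define q where "q = b / (2 * sqrt s)"
 have sq: "sqrt s > 0" "(sqrt s)\<^sup>2 = s" using s_pos by auto
 have q: "0 \<le> q" "q < 1" using \<beta>1 sq by (auto simp: q_def b_def s_def)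
 \<comment> \<open>The factor 1/2 leaves room for |w1|^2, which is at most |w|^2 + |w2|^2.\<close>
 define \<theta> where "\<theta> = (1 - q) * min 1 s / 2"
 have \<theta>: "\<theta> > 0" using q s_pos by (simp add: \<theta>_def)
 have "II \<beta> c w w1 w2 \<ge> \<theta> * ((nrm w)\<^sup>2 + (nrm w1)\<^sup>2 + (nrm w2)\<^sup>2)" if W: "W2 w w1 w2" for w w1 w2
 proof -
  define A where "A = nrm w2"
  define C where "C = nrm w"
  have AC: "A \<ge> 0" "C \<ge> 0" by (simp_all add: A_def C_def)
  have B: "(nrm w1)\<^sup>2 \<le> C * A" using W2_interp[OF W] by (simp add: A_def C_def)
  have am: "2 * (sqrt s * C) * A \<le> s * C\<^sup>2 + A\<^sup>2"
   using sum_squares_bound[of "sqrt s * C" A] sq(2) by (simp add: power_mult_distrib)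
  have "\<beta> * (nrm w1)\<^sup>2 \<le> b * (nrm w1)\<^sup>2" by (intro mult_right_mono) (auto simp: b_def)
  also have "\<dots> \<le> b * (C * A)" using B by (intro mult_left_mono) (auto simp: b_def)
  also have "\<dots> = q * (2 * (sqrt s * C) * A)" using sq(1) by (simp add: q_def)
  also have "\<dots> \<le> q * (s * C\<^sup>2 + A\<^sup>2)" by (rule mult_left_mono[OF am q(1)])
  finally have "II \<beta> c w w1 w2 \<ge> (1 - q) * (s * C\<^sup>2 + A\<^sup>2)"
   by (simp add: II_def A_def C_def s_def algebra_simps)
  moreover have "\<theta> * (C\<^sup>2 + (nrm w1)\<^sup>2 + A\<^sup>2) \<le> (1 - q) * (s * C\<^sup>2 + A\<^sup>2)"
  proof -
   have "C\<^sup>2 + (nrm w1)\<^sup>2 + A\<^sup>2 \<le> 2 * (C\<^sup>2 + A\<^sup>2)"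
   proof -
    have "C * A \<le> C\<^sup>2 + A\<^sup>2"
     using sum_squares_bound[of C A] mult_nonneg_nonneg[OF AC(2) AC(1)] by (simp add: mult.assoc)
    then show ?thesis using B by simp
   qed
   then have "\<theta> * (C\<^sup>2 + (nrm w1)\<^sup>2 + A\<^sup>2) \<le> \<theta> * (2 * (C\<^sup>2 + A\<^sup>2))" using \<theta> by (intro mult_left_mono) auto
   also have "\<dots> = (1 - q) * (min 1 s * C\<^sup>2 + min 1 s * A\<^sup>2)" by (simp add: \<theta>_def field_simps)
   also have "\<dots> \<le> (1 - q) * (s * C\<^sup>2 + 1 * A\<^sup>2)" using q by (intro mult_left_mono add_mono mult_right_mono) auto
   finally show ?thesis by simp
  qed
  ultimately show ?thesis by (simp add: A_def C_def)
 qed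
 then show ?thesis using that \<theta> by blast
qed

text \<open>Of the p + 1 powers of |w| in the growth bound for F, p - 1 are estimated by the sup
  norm, itself controlled by the H2 norm, and two are integrated.\<close>

lemma KK_sobolev:
 obtains C where "C > 0" "\<And>w w1 w2. W2 w w1 w2 ==> KK w \<le> C * ((nrm w)\<^sup>2 + (nrm w1)\<^sup>2 + (nrm w2)\<^sup>2) powr ((p + 1) / 2)"
proof -
 obtain CF where CF: "CF > 0" "\<And>s. \<bar>F s\<bar> \<le> CF * \<bar>s\<bar> powr (p + 1)" by (rule F_growth, rule that)
 define C where "C = (p + 1) * CF * 4 powr (p - 1)"
 have C: "C > 0" using p2 CF by (simp add: C_def)
 have "KK w \<le> C * ((nrm w)\<^sup>2 + (nrm w1)\<^sup>2 + (nrm w2)\<^sup>2) powr ((p + 1) / 2)" if W: "W2 w w1 w2" for w w1 w2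
 proof -
  define H where "H = (nrm w)\<^sup>2 + (nrm w1)\<^sup>2 + (nrm w2)\<^sup>2"
  define M where "M = 4 * sqrt H"
  have H0: "H \<ge> 0" by (simp add: H_def)
  have n: "nrm w \<le> sqrt H" "nrm w1 \<le> sqrt H" by (auto simp: H_def intro!: real_le_rsqrt)
  note L = W2D[OF W]
  have b: "AE x in lborel. \<bar>w x\<bar> \<le> M"
   using W2_bound[OF W] by eventually_elim (use n in \<open>auto simp: M_def\<close>)
  obtain C' where C': "\<And>u. L2 u ==> AE x in lborel. \<bar>u x\<bar> \<le> M ==> integrable lborel (%x. F (u x))"
   by (rule F_lip[of M], rule that)
  have "(LI x. F (w x)) \<le> (LI x. (CF * M powr (p - 1)) * (w x)\<^sup>2)"
  proof (rule integral_mono_AE)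
   show "AE x in lborel. F (w x) \<le> (CF * M powr (p - 1)) * (w x)\<^sup>2"
    using b
   proof eventually_elim
    case (elim x)
    have "F (w x) \<le> CF * \<bar>w x\<bar> powr (p + 1)" using CF(2)[of "w x"] by linarith
    also have "\<bar>w x\<bar> powr (p + 1) = \<bar>w x\<bar> powr (p - 1) * (w x)\<^sup>2"
    proof -
     have e: "p - 1 + 2 = p + 1" by simp
     have "\<bar>w x\<bar> powr (p + 1) = \<bar>w x\<bar> powr (p - 1) * \<bar>w x\<bar> powr 2" unfolding powr_add[symmetric] e ..
     also have "\<bar>w x\<bar> powr 2 = (w x)\<^sup>2"
      using powr_realpow[of "\<bar>w x\<bar>" 2] by (cases "w x = 0") auto
     finally show ?thesis .
    qed
    also have "CF * (\<bar>w x\<bar> powr (p - 1) * (w x)\<^sup>2) \<le> CF * (M powr (p - 1) * (w x)\<^sup>2)"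
     using CF(1) p2 elim by (intro mult_left_mono mult_right_mono powr_mono2) auto
    finally show ?case by (simp add: mult.assoc)
   qed
  qed (use C'[OF L(1) b] L2_sq[OF L(1)] in auto)
  also have "\<dots> = CF * M powr (p - 1) * (nrm w)\<^sup>2" unfolding nrm_sq by (rule integral_mult_right_zero)
  also have "\<dots> \<le> CF * M powr (p - 1) * H" using CF by (intro mult_left_mono) (auto simp: H_def)
  also have "\<dots> = CF * 4 powr (p - 1) * H powr ((p + 1) / 2)"
  proof (cases "H = 0")
   case False
   then have Hp: "H > 0" using H0 by simp
   have "M powr (p - 1) = 4 powr (p - 1) * H powr ((p - 1) / 2)"
    using Hp by (simp add: M_def powr_mult powr_half_sqrt[symmetric] powr_powr field_simps)
   moreover have "H powr ((p - 1) / 2) * H = H powr ((p + 1) / 2)"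
   proof -
    have "H powr ((p - 1) / 2) * H powr 1 = H powr ((p - 1) / 2 + 1)" by (rule powr_add[symmetric])
    also have "(p - 1) / 2 + 1 = (p + 1) / 2" by (simp add: field_simps)
    finally show ?thesis using Hp by simp
   qed
   ultimately show ?thesis by simp
  qed simp
  finally show ?thesis unfolding KK_def C_def H_def[symmetric] using p2 by (simp add: mult.assoc)
 qed
 then show ?thesis using that C by blast
qed

text \<open>A value where F is positive is spread over the bump; homogeneity keeps F of the result
  nonnegative everywhere.\<close>

lemma KK_pos_ex: "\<exists>w w1 w2. W2 w w1 w2 \<and> KK w > 0"
proof -
 obtain s0 where s0: "F s0 > 0" using F_pos Fprim_eq by auto
 define w where "w = (%x. s0 * bump x)"
 have W: "W2 w (deriv w) (deriv (deriv w))" unfolding w_def by (intro W2_test test_cmult test_bump)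
 have Fw: "F (w x) = bump x powr (p + 1) * F s0" for x
  using F_hom[of "bump x" s0] bump_nonneg[of x] F0 by (cases "bump x = 0") (auto simp: w_def mult.commute)
 have i: "integrable lborel (%x. F (w x))"
  by (rule F_lip[of "2 * (nrm w + nrm (deriv w))"]) (use W2_bound[OF W] W2D[OF W] in blast)
 have "(LI x. F (w x)) \<noteq> 0"
 proof
  assume "(LI x. F (w x)) = 0"
  then have "AE x in lborel. F (w x) = 0"
   using integral_nonneg_eq_0_iff_AE[OF i] s0 by (simp add: Fw)
  then have "AE x in lborel. bump x = 0" by eventually_elim (use s0 in \<open>simp add: Fw\<close>)
  then have "(LI x. bump x) = 0" by (rule integral_eq_zero_AE)
  then show False using bump_integral_pos by simp
 qed
 moreover have "(LI x. F (w x)) \<ge> 0" using s0 by (intro integral_nonneg_AE) (simp add: Fw)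
 ultimately have "KK w > 0" using p2 by (simp add: KK_def)
 then show ?thesis using W by blast
qed

lemma m_facts: "m > 0" "\<And>w w1 w2. W2 w w1 w2 ==> KK w > 0 ==> m * KK w powr (2 / (p + 1)) \<le> II \<beta> c w w1 w2"
proof -
 define X where "X = {I_fun \<beta> c u / (K_fun p f u) powr (2 / (p + 1)) | u. H2 u \<and> K_fun p f u > 0}"
 obtain \<theta> where \<theta>: "\<theta> > 0" "\<And>w w1 w2. W2 w w1 w2 ==> II \<beta> c w w1 w2 \<ge> \<theta> * ((nrm w)\<^sup>2 + (nrm w1)\<^sup>2 + (nrm w2)\<^sup>2)"
  by (rule II_coercive, rule that)
 obtain C where C: "C > 0" "\<And>w w1 w2. W2 w w1 w2 ==> KK w \<le> C * ((nrm w)\<^sup>2 + (nrm w1)\<^sup>2 + (nrm w2)\<^sup>2) powr ((p + 1) / 2)"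
  by (rule KK_sobolev, rule that)
 \<comment> \<open>Coercivity of I from below and the Sobolev bound on K from above combine to this
   lower bound for the quotient, which makes \<open>m\<close> positive.\<close>
 define l where "l = \<theta> / C powr (2 / (p + 1))"
 have l0: "l > 0" using \<theta> C by (simp add: l_def)
 have lb: "l \<le> y" if yX: "y \<in> X" for y
 proof -
  obtain u where u: "H2 u" "KK u > 0" "y = I_fun \<beta> c u / KK u powr (2 / (p + 1))" using yX by (auto simp: X_def K_fun_eq)
  have W: "W2 u (d1 u) (d2 u)" by (rule H2_W2[OF u(1)])
  define H where "H = (nrm u)\<^sup>2 + (nrm (d1 u))\<^sup>2 + (nrm (d2 u))\<^sup>2"
  have K: "KK u \<le> C * H powr ((p + 1) / 2)" using C(2)[OF W] by (simp add: H_def)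
  have H0: "H > 0"
  proof (rule ccontr)
   assume "\<not> H > 0" then have "H = 0" by (auto simp: H_def intro: antisym)
   then show False using K u(2) by simp
  qed
  have "KK u powr (2 / (p + 1)) \<le> (C * H powr ((p + 1) / 2)) powr (2 / (p + 1))" using K u(2) p2 by (intro powr_mono2) auto
  also have "\<dots> = C powr (2 / (p + 1)) * H"
  proof -
   have e: "(p + 1) / 2 * (2 / (p + 1)) = 1" using p2 by simp
   have "(H powr ((p + 1) / 2)) powr (2 / (p + 1)) = H" unfolding powr_powr e using H0 by simp
   then show ?thesis using C(1) by (simp add: powr_mult)
  qed
  finally have "l * KK u powr (2 / (p + 1)) \<le> l * (C powr (2 / (p + 1)) * H)" using l0 by simp
  also have "\<dots> = \<theta> * H" using C(1) by (simp add: l_def)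
  also have "\<dots> \<le> I_fun \<beta> c u" using \<theta>(2)[OF W] I_fun_eq[OF W] by (simp add: H_def)
  finally show ?thesis using u(2,3) by (simp add: pos_le_divide_eq)
 qed
 have ne: "X \<noteq> {}" using KK_pos_ex W2_H2 unfolding X_def K_fun_eq by blast
 have mX: "m = Inf X" by (simp add: m_def m_val_def X_def)
 show "m > 0" unfolding mX using l0 cInf_greatest[OF ne lb] by linarith
 fix w w1 w2 assume W: "W2 w w1 w2" and K: "KK w > 0"
 have "I_fun \<beta> c w / KK w powr (2 / (p + 1)) \<in> X" using W2_H2[OF W] K by (auto simp: X_def K_fun_eq)
 then have "m \<le> I_fun \<beta> c w / KK w powr (2 / (p + 1))" unfolding mX by (rule cInf_lower) (use lb in \<open>auto simp: bdd_below_def\<close>)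
 then show "m * KK w powr (2 / (p + 1)) \<le> II \<beta> c w w1 w2" using K I_fun_eq[OF W] by (simp add: pos_le_divide_eq)
qed

abbreviation "Iphi \<equiv> II \<beta> c phi phi1 phi2"

lemma gs_facts: "Iphi = m powr ((p + 1) / (p - 1))" "KK phi = Iphi" "Iphi > 0"
proof -
 show 1: "Iphi = m powr ((p + 1) / (p - 1))" using gs I_fun_eq[OF W2phi] by (simp add: ground_states_def m_def)
 show "KK phi = Iphi" unfolding 1 using gs K_fun_eq[of phi] by (simp add: ground_states_def m_def)
 show "Iphi > 0" unfolding 1 using m_facts(1) by simp
qed

text \<open>Where I = K = x the quotient inequality reads m x^(2/(p+1)) <= x; solving for x gives
  the ground state level m^((p+1)/(p-1)).\<close>

lemma nehari:
 assumes W: "W2 w w1 w2" and K: "KK w > 0" and N: "II \<beta> c w w1 w2 = KK w"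
 shows "Iphi \<le> II \<beta> c w w1 w2"
proof -
 define x where "x = II \<beta> c w w1 w2"
 have x: "x > 0" using K N by (simp add: x_def)
 have "m * x powr (2 / (p + 1)) \<le> x" using m_facts(2)[OF W K] N by (simp add: x_def)
 then have "m \<le> x / x powr (2 / (p + 1))" using x by (simp add: pos_le_divide_eq)
 also have "\<dots> = x powr (1 - 2 / (p + 1))" using x by (simp add: powr_diff)
 also have "1 - 2 / (p + 1) = (p - 1) / (p + 1)" using p2 by (simp add: field_simps)
 finally have "m powr ((p + 1) / (p - 1)) \<le> (x powr ((p - 1) / (p + 1))) powr ((p + 1) / (p - 1))"
  using m_facts(1) p2 by (intro powr_mono2) auto
 also have "\<dots> = x" using x p2 by (simp add: powr_powr)
 finally show ?thesis using gs_facts(1) by (simp add: x_def)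
qed

lemma phi_bound: "AE x in lborel. \<bar>phi x\<bar> \<le> 2 * (nrm phi + nrm phi1)" by (rule W2_bound[OF W2phi])

lemma fphi_L2: "L2 (%x. f (phi x))" by (rule fL2[OF L2phi phi_bound])

lemma II_lin:
 assumes "W2 w w1 w2" "W2 a a1 a2"
 shows "II \<beta> c (%x. w x + e * a x) (%x. w1 x + e * a1 x) (%x. w2 x + e * a2 x) =
  II \<beta> c w w1 w2 + 2 * e * ((LI x. w2 x * a2 x) - \<beta> * (LI x. w1 x * a1 x) + s * (LI x. w x * a x))
   + e\<^sup>2 * II \<beta> c a a1 a2"
 using W2D[OF assms(1)] W2D[OF assms(2)] by (simp add: II_def nrm_lin_sq s_def algebra_simps)

text \<open>The function I - m K^(2/(p+1)) is nonnegative where K > 0 and vanishes at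
  \<open>phi\<close>, so its derivative along \<open>t\<close> is zero there.\<close>

lemma euler_lagrange:
 assumes t: "test_fun t"
 shows "(LI x. phi2 x * deriv (deriv t) x) - \<beta> * (LI x. phi1 x * deriv t x) + s * (LI x. phi x * t x)
  = (LI x. f (phi x) * t x)" (is "?B = ?f")
proof -
 note Wt = W2_test[OF t]
 define k where "k e = KK (%x. phi x + e * t x)" for e
 define q where "q e = Iphi + 2 * e * ?B + e\<^sup>2 * II \<beta> c t (deriv t) (deriv (deriv t))" for e
 have k': "(k has_real_derivative (p + 1) * ?f) (at 0)" unfolding k_def by (rule KK_deriv[OF L2phi phi_bound t])
 have k0: "k 0 = KK phi" by (simp add: k_def)
 have q': "(q has_real_derivative 2 * ?B) (at 0)" unfolding q_def[abs_def]
  by (auto intro!: derivative_eq_intros)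
 define h where "h e = q e - m * k e powr (2 / (p + 1))" for e
 define D where "D = 2 * ?B - m * ((2 / (p + 1)) * KK phi powr (2 / (p + 1) - 1) * ((p + 1) * ?f))"
 have Kp: "KK phi > 0" using gs_facts by simp
 have h': "(h has_real_derivative D) (at 0)"
 proof -
  have "((%e. k e powr (2 / (p + 1))) has_real_derivative (2 / (p + 1)) * KK phi powr (2 / (p + 1) - 1) * ((p + 1) * ?f)) (at 0)"
   using DERIV_fun_powr[OF k', of "2 / (p + 1)"] Kp by (simp add: k0)
  then show ?thesis unfolding h_def[abs_def] D_def by (intro DERIV_diff q' DERIV_cmult)
 qed
 \<comment> \<open>The normalisation I = K = m^((p+1)/(p-1)) makes the Lagrange multiplier equal to
   1.\<close>
 have mK: "m * KK phi powr (2 / (p + 1) - 1) = 1"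
 proof -
  have "KK phi powr (2 / (p + 1) - 1) = m powr ((p + 1) / (p - 1) * (2 / (p + 1) - 1))"
   unfolding gs_facts(2) gs_facts(1) by (simp only: powr_powr)
  also have "(p + 1) / (p - 1) * (2 / (p + 1) - 1) = - 1" using p2 by (simp add: divide_simps)
  finally show ?thesis using m_facts(1) by (simp add: powr_minus)
 qed
 have "D = 2 * ?B - 2 * (m * KK phi powr (2 / (p + 1) - 1)) * ?f" using p2 by (simp add: D_def)
 then have D: "D = 2 * ?B - 2 * ?f" unfolding mK by simp
 have h0: "h 0 = 0"
 proof -
  have "m * KK phi powr (2 / (p + 1)) = (m * KK phi powr (2 / (p + 1) - 1)) * KK phi"
   using Kp by (simp add: powr_diff)
  then show ?thesis unfolding mK using gs_facts(2) by (simp add: h_def q_def k0)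
 qed
 have "isCont k 0" using k' DERIV_isCont by blast
 then have "\<forall>\<^sub>F e in at 0. k e > 0"
  using Kp k0 by (intro order_tendstoD(1)[of k "k 0"]) (auto simp: isCont_def)
 then obtain d where d: "d > 0" "\<And>e. e \<noteq> 0 ==> dist e 0 < d ==> k e > 0" unfolding eventually_at by blast
 have "D = 0"
 proof (rule DERIV_local_min[OF h' d(1)], intro allI impI)
  fix e assume e: "\<bar>0 - e\<bar> < d"
  have kp: "k e > 0" using d(2)[of e] e Kp k0 by (cases "e = 0") auto
  have "m * k e powr (2 / (p + 1)) \<le> q e"
   using m_facts(2)[OF W2_add[OF W2phi W2_cmult[OF Wt, of e]]] kp II_lin[OF W2phi Wt, of e] by (simp add: k_def q_def)
  then show "h 0 \<le> h e" unfolding h0 by (simp add: h_def)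
 qed
 then show ?thesis using D by simp
qed

lemma phi1_pos: "nrm phi > 0" "nrm phi1 > 0" "nrm phi2 > 0"
proof -
 note L = W2D[OF W2phi]
 show n0: "nrm phi > 0"
 proof (rule ccontr)
  assume "\<not> nrm phi > 0"
  then have z: "nrm phi = 0" using nrm_nonneg[of phi] by linarith
  have "AE x in lborel. phi x = 0" by (rule nrm_zero_AE[OF L(1) z])
  then have "AE x in lborel. F (phi x) = 0" by eventually_elim (simp add: F0)
  then have "KK phi = 0" unfolding KK_def by (simp add: integral_eq_zero_AE)
  then show False using gs_facts by simp
 qed
 show n1: "nrm phi1 > 0"
  using nrm_deriv_zero[OF L(4,1,2)] n0 nrm_nonneg[of phi1] by linarith
 show "nrm phi2 > 0"
  using nrm_deriv_zero[OF L(5,2,3)] n1 nrm_nonneg[of phi2] by linarith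
qed

end

section \<open>Density of derivatives of test functions\<close>

lemma cont_compact_L2:
 assumes "continuous_on UNIV h" "\<And>x. R < \<bar>x\<bar> ==> h x = 0" shows "L2 h"
proof (rule L2I)
 show "h \<in> borel_measurable borel" by (rule borel_measurable_continuous_onI[OF assms(1)])
 show "integrable lborel (%x. (h x)\<^sup>2)"
  by (rule integrable_compact_supp[where R=R]) (use assms in \<open>auto intro!: continuous_intros\<close>)
qed

lemma loc_int_test_mult: assumes "test_fun t" "loc_int u" shows "loc_int (%x. t x * u x)"
proof -
 obtain C where C: "C > 0" "\<And>x. \<bar>t x\<bar> \<le> C" using test_bounded[OF assms(1)] by metis
 have [measurable]: "t \<in> borel_measurable borel" "u \<in> borel_measurable borel" using assms test_meas loc_int_meas by auto
 show ?thesis unfolding loc_int_def set_integrable_def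
 proof (intro allI)
  fix a b
  show "integrable lborel (%x. indicat_real {a..b} x *\<^sub>R (t x * u x))"
  proof (rule Bochner_Integration.integrable_bound)
   show "integrable lborel (%x. C * (indicat_real {a..b} x * \<bar>u x\<bar>))" using loc_int_ind[OF assms(2)] by simp
   show "AE x in lborel. norm (indicat_real {a..b} x *\<^sub>R (t x * u x)) \<le> norm (C * (indicat_real {a..b} x * \<bar>u x\<bar>))"
   proof (rule AE_I2)
    fix x show "norm (indicat_real {a..b} x *\<^sub>R (t x * u x)) \<le> norm (C * (indicat_real {a..b} x * \<bar>u x\<bar>))"
     using mult_right_mono[OF C(2)[of x] abs_ge_zero[of "u x"]] C(1) by (auto simp: indicator_def abs_mult)
   qed
  qed measurable
 qed
qed

lemma loc_int_add: "loc_int u ==> loc_int w ==> loc_int (%x. u x + w x)"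
 unfolding loc_int_def by auto

lemma weak_deriv_prod:
 assumes s: "test_fun s" and w: "weak_deriv u u1"
 shows "weak_deriv (%x. s x * u x) (%x. deriv s x * u x + s x * u1 x)"
proof -
 have l: "loc_int u" "loc_int u1" using w by (auto simp: weak_deriv_def)
 show ?thesis unfolding weak_deriv_def
 proof (intro conjI allI impI loc_int_add loc_int_test_mult s test_deriv l)
  fix t assume t: "test_fun t"
  have st: "test_fun (%x. s x * t x)" "test_fun (%x. deriv s x * t x)"
   using test_mult_smooth[OF test_smooth t] s test_deriv[OF s] by auto
  have sdt: "test_fun (%x. s x * deriv t x)" using test_mult_smooth[OF test_smooth[OF s] test_deriv[OF t]] .
  have dst: "deriv (%x. s x * t x) = (%x. deriv s x * t x + s x * deriv t x)"
   by (rule deriv_mult'[OF test_smooth[OF s] test_smooth[OF t]])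
  have "(LI x. u x * deriv (%x. s x * t x) x) = - (LI x. u1 x * (s x * t x))"
   using w st(1) unfolding weak_deriv_def by blast
  then have "(LI x. u x * (deriv s x * t x)) + (LI x. u x * (s x * deriv t x)) = - (LI x. u1 x * (s x * t x))"
   unfolding dst using loc_int_test[OF l(1) st(2)] loc_int_test[OF l(1) sdt] by (simp add: distrib_left)
  moreover have "(LI x. (deriv s x * u x + s x * u1 x) * t x) = (LI x. u x * (deriv s x * t x)) + (LI x. u1 x * (s x * t x))"
   using loc_int_test[OF l(1) st(2)] loc_int_test[OF l(2) st(1)]
   by (subst Bochner_Integration.integral_add[symmetric]) (auto intro!: Bochner_Integration.integral_cong simp: algebra_simps)
  moreover have "(LI x. s x * u x * deriv t x) = (LI x. u x * (s x * deriv t x))"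
   by (intro Bochner_Integration.integral_cong) auto
  ultimately show "(LI x. s x * u x * deriv t x) = - (LI x. (deriv s x * u x + s x * u1 x) * t x)" by simp
 qed
qed

lemma weak_deriv_add: "weak_deriv u g ==> weak_deriv w h ==> weak_deriv (%x. u x + w x) (%x. g x + h x)"
 using weak_deriv_lin[of u g w h 1 1] by simp

lemma chi_deriv_bdd: obtains C where "C > 0" "\<And>n x. \<bar>(deriv ^^ j) (chi n) x\<bar> \<le> C"
proof -
 obtain C where C: "C > 0" "\<And>n x. \<bar>(deriv ^^ j) (chi n) x\<bar> \<le> C * (1 / (real n + 1)) ^ j" using chi_deriv_bound[of j] by metis
 have "C * (1 / (real n + 1)) ^ j \<le> C * 1" for n using C(1) by (intro mult_left_mono power_le_one) auto
 then show ?thesis using that C order_trans by (metis mult.right_neutral)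
qed

definition appr :: "(real => real) => (real => real) => (real => real) => (real => real) => (real => real) => (real => real) => real => bool" where
 "appr b b1 b2 a a1 a2 e \<longleftrightarrow> ndist b a < e \<and> ndist b1 a1 < e \<and> ndist b2 a2 < e"

lemma appr_trans:
 assumes "appr b b1 b2 a a1 a2 e" "appr h h1 h2 b b1 b2 e'" "W2 a a1 a2" "W2 b b1 b2" "W2 h h1 h2"
 shows "appr h h1 h2 a a1 a2 (e + e')"
proof -
 have "nrm (%x. z x - x' x) < e + e'" if "nrm (%x. y x - x' x) < e" "ndist z y < e'" "L2 x'" "L2 y" "L2 z" for x' y z
  using nrm_triangle3[OF that(5,4,3)] that(1,2) by simp
 then show ?thesis using assms W2D[OF assms(3)] W2D[OF assms(4)] W2D[OF assms(5)] unfolding appr_def by blast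
qed

text \<open>Cut off the C^1 representative with \<open>chi n\<close>; the terms with a derivative on
  the cutoff tend to 0 pointwise and are dominated.\<close>

lemma trunc_density:
 assumes W: "W2 a a1 a2" and e: "e > 0"
 obtains b b1 b2 R where "W2 b b1 b2" "\<And>x. (b has_real_derivative b1 x) (at x)" "continuous_on UNIV b1"
  "\<And>x. R \<le> \<bar>x\<bar> ==> b x = 0" "appr b b1 b2 a a1 a2 e"
proof -
 obtain A A1 where A: "\<And>x. (A has_real_derivative A1 x) (at x)" "continuous_on UNIV A1"
  "AE x in lborel. a x = A x" "AE x in lborel. a1 x = A1 x" by (rule W2_rep[OF W], rule that)
 note L = W2D[OF W]
 have Ac: "continuous_on UNIV A" using A(1) by (meson DERIV_isCont continuous_at_imp_continuous_on)
 have Am[measurable]: "A \<in> borel_measurable borel" "A1 \<in> borel_measurable borel" using Ac A(2) by (auto intro: borel_measurable_continuous_onI)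
 have LA: "L2 A" "L2 A1" using L2_cong_AE[OF L(1) A(3) Am(1)] L2_cong_AE[OF L(2) A(4) Am(2)] by auto
 have wA: "weak_deriv A A1" by (rule classical_weak[OF A(1,2)])
 have wA1: "weak_deriv A1 a2"
  by (rule weak_deriv_cong[OF L(5) A(4)]) (use L2_loc_int LA L in auto)
 have sm: "smooth (chi n)" for n by (rule test_smooth[OF chi_test])
 define b where "b n x = chi n x * A x" for n x
 define b1 where "b1 n x = deriv (chi n) x * A x + chi n x * A1 x" for n x
 define b2 where "b2 n x = (deriv (deriv (chi n)) x * A x + deriv (chi n) x * A1 x) + (deriv (chi n) x * A1 x + chi n x * a2 x)" for n x
 have [measurable]: "chi n \<in> borel_measurable borel" "deriv (chi n) \<in> borel_measurable borel" "deriv (deriv (chi n)) \<in> borel_measurable borel" "a2 \<in> borel_measurable borel" for n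
  using test_meas chi_test test_deriv L2_meas[OF L(3)] by auto
 obtain C1 where C1: "C1 > 0" "\<And>n x. \<bar>(deriv ^^ 1) (chi n) x\<bar> \<le> C1" using chi_deriv_bdd[of 1] by metis
 obtain C2 where C2: "C2 > 0" "\<And>n x. \<bar>(deriv ^^ 2) (chi n) x\<bar> \<le> C2" using chi_deriv_bdd[of 2] by metis
 have C: "\<bar>deriv (chi n) x\<bar> \<le> C1" "\<bar>deriv (deriv (chi n)) x\<bar> \<le> C2" for n x
  using C1(2)[of n x] C2(2)[of n x] by (simp_all add: numeral_eq_Suc)
 have Lm: "L2 (%x. h x * w x)" if "L2 w" "h \<in> borel_measurable borel" "\<And>x. \<bar>h x\<bar> \<le> K" for h w K
 proof (rule nrm_mono(1)[OF L2_cmult[OF that(1), of K]])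
  show "AE x in lborel. \<bar>h x * w x\<bar> \<le> \<bar>K * w x\<bar>"
   using order_trans[OF that(3) abs_ge_self] by (auto simp: abs_mult intro!: mult_right_mono)
 qed (use that L2_meas in measurable)
 have Wb: "W2 (b n) (b1 n) (b2 n)" for n
 proof -
  have "L2 (b n)" "L2 (b1 n)" "L2 (b2 n)" unfolding b_def[abs_def] b1_def[abs_def] b2_def[abs_def]
   by (intro L2_add Lm[where K=1] Lm[where K=C1] Lm[where K=C2] LA L; use C chi_bounds in \<open>auto simp: abs_le_iff intro: order_trans[OF _ chi_bounds(1)]\<close>)+
  moreover have "weak_deriv (b n) (b1 n)" unfolding b_def[abs_def] b1_def[abs_def] by (rule weak_deriv_prod[OF chi_test wA])
  moreover have "weak_deriv (b1 n) (b2 n)" unfolding b1_def[abs_def] b2_def[abs_def]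
   by (intro weak_deriv_add weak_deriv_prod chi_test test_deriv wA wA1)
  ultimately show ?thesis by (simp add: W2_def)
 qed
 have d: "(b n has_real_derivative b1 n x) (at x)" for n x
  unfolding b_def b1_def using DERIV_mult[OF smooth_DERIV[OF sm] A(1), of n x] by (simp add: mult.commute)
 have cc: "continuous_on UNIV (b1 n)" for n unfolding b1_def
  by (intro continuous_intros smooth_cont[OF sm] smooth_cont[OF smooth_deriv[OF sm]] Ac A(2))
 have ct: "(%n. deriv (chi n) x) \<longlonglongrightarrow> 0" "(%n. deriv (deriv (chi n)) x) \<longlonglongrightarrow> 0" for x
  using chi_derivs_tendsto[of 0 x] chi_derivs_tendsto[of 1 x] by simp_all
 have c1: "\<bar>chi n x - 1\<bar> \<le> 1" for n x using chi_bounds[of n x] by auto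
 have t0: "(%n. ndist (b n) A) \<longlonglongrightarrow> 0"
 proof (rule L2_dominated_tendsto[OF _ LA(1)])
  show "\<bar>b n x - A x\<bar> \<le> \<bar>A x\<bar>" for n x
   using mult_right_mono[OF c1[of n x] abs_ge_zero[of "A x"]] by (simp add: b_def abs_mult[symmetric] left_diff_distrib)
  show "(%n. b n x) \<longlonglongrightarrow> A x" for x
   unfolding b_def using tendsto_mult[OF chi_tendsto tendsto_const, of x "A x"] by simp
 qed (auto simp: b_def[abs_def])
 have t1: "(%n. ndist (b1 n) A1) \<longlonglongrightarrow> 0"
 proof (rule L2_dominated_tendsto[OF _ L2_add[OF L2_cmult[OF L2_abs[OF LA(1)], of C1] L2_abs[OF LA(2)]]])
  show "\<bar>b1 n x - A1 x\<bar> \<le> \<bar>C1 * \<bar>A x\<bar> + \<bar>A1 x\<bar>\<bar>" for n x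
  proof -
   have "b1 n x - A1 x = deriv (chi n) x * A x + (chi n x - 1) * A1 x" by (simp add: b1_def algebra_simps)
   also have "\<bar>\<dots>\<bar> \<le> \<bar>deriv (chi n) x\<bar> * \<bar>A x\<bar> + \<bar>chi n x - 1\<bar> * \<bar>A1 x\<bar>" by (simp add: abs_mult[symmetric])
   also have "\<dots> \<le> C1 * \<bar>A x\<bar> + 1 * \<bar>A1 x\<bar>" by (intro add_mono mult_right_mono C c1) auto
   finally show ?thesis by simp
  qed
  show "(%n. b1 n x) \<longlonglongrightarrow> A1 x" for x
  proof -
   have "(%n. deriv (chi n) x * A x + chi n x * A1 x) \<longlonglongrightarrow> 0 * A x + 1 * A1 x"
    by (intro tendsto_intros ct chi_tendsto)
   then show ?thesis unfolding b1_def by simp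
  qed
 qed (auto simp: b1_def[abs_def])
 have t2: "(%n. ndist (b2 n) a2) \<longlonglongrightarrow> 0"
 proof (rule L2_dominated_tendsto[OF _ L2_add[OF L2_add[OF L2_cmult[OF L2_abs[OF LA(1)], of C2] L2_cmult[OF L2_abs[OF LA(2)], of "2 * C1"]] L2_abs[OF L(3)]]])
  show "\<bar>b2 n x - a2 x\<bar> \<le> \<bar>C2 * \<bar>A x\<bar> + 2 * C1 * \<bar>A1 x\<bar> + \<bar>a2 x\<bar>\<bar>" for n x
  proof -
   have "b2 n x - a2 x = deriv (deriv (chi n)) x * A x + 2 * (deriv (chi n) x * A1 x) + (chi n x - 1) * a2 x" by (simp add: b2_def algebra_simps)
   also have "\<bar>\<dots>\<bar> \<le> \<bar>deriv (deriv (chi n)) x\<bar> * \<bar>A x\<bar> + 2 * (\<bar>deriv (chi n) x\<bar> * \<bar>A1 x\<bar>) + \<bar>chi n x - 1\<bar> * \<bar>a2 x\<bar>"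
    unfolding abs_mult[symmetric] by linarith
   also have "\<dots> \<le> C2 * \<bar>A x\<bar> + 2 * (C1 * \<bar>A1 x\<bar>) + 1 * \<bar>a2 x\<bar>" by (intro add_mono mult_left_mono mult_right_mono C c1) auto
   finally show ?thesis by simp
  qed
  show "(%n. b2 n x) \<longlonglongrightarrow> a2 x" for x
  proof -
   have "(%n. (deriv (deriv (chi n)) x * A x + deriv (chi n) x * A1 x) + (deriv (chi n) x * A1 x + chi n x * a2 x))
     \<longlonglongrightarrow> (0 * A x + 0 * A1 x) + (0 * A1 x + 1 * a2 x)"
    by (intro tendsto_intros ct chi_tendsto)
   then show ?thesis unfolding b2_def by simp
  qed
 qed (use L(3) in \<open>auto simp: b2_def[abs_def]\<close>)
 have "\<forall>\<^sub>F n in sequentially. ndist (b n) A < e \<and> ndist (b1 n) A1 < e \<and> ndist (b2 n) a2 < e"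
  using order_tendstoD(2)[OF t0 e] order_tendstoD(2)[OF t1 e] order_tendstoD(2)[OF t2 e] by eventually_elim simp
 then obtain n where n: "ndist (b n) A < e" "ndist (b1 n) A1 < e" "ndist (b2 n) a2 < e"
  by (auto simp: eventually_sequentially)
 have q: "ndist (b n) a = ndist (b n) A" "ndist (b1 n) a1 = ndist (b1 n) A1"
  by (rule nrm_cong_AE; use A(3,4) W2D[OF Wb[of n]] L LA in \<open>auto intro!: borel_measurable_diff L2_meas elim!: eventually_mono\<close>)+
 show ?thesis
  by (rule that[OF Wb d cc, of "3 * (real n + 1)" n]) (use n q chi_far in \<open>auto simp: appr_def b_def\<close>)
qed

lemma antideriv_bounded:
 assumes c: "continuous_on UNIV b" and z: "\<And>x. R \<le> \<bar>x\<bar> ==> b x = (0::real)"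
 obtains G K where "\<And>x. (G has_real_derivative b x) (at x)" "\<And>x. \<bar>G x\<bar> \<le> K"
proof -
 define l where "l = - \<bar>R\<bar> - 1"
 define G where "G x = integral {l..x} b" for x
 have cs: "continuous_on S b" for S using c continuous_on_subset by blast
 have d: "(G has_real_derivative b x) (at x)" for x
 proof (cases "x > l")
  case True
  have "((%x. integral {l..x} b) has_real_derivative b x) (at x within {l..x + 1})"
   by (rule integral_has_real_derivative[OF cs]) (use True in auto)
  then show ?thesis unfolding G_def[abs_def] using True by (simp add: at_within_Icc_at)
 next
  case False
  have "((%x. 0) has_real_derivative b x) (at x)" using z[of x] False by (auto simp: l_def)
  then show ?thesis
  proof (rule has_field_derivative_transform_within_open[where S="{..< - \<bar>R\<bar>}"])
   fix y assume y: "y \<in> {..< - \<bar>R\<bar>}"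
   have "integral {l..y} b = integral {l..y} (%x. 0)" by (rule integral_cong) (use y z in auto)
   then show "0 = G y" by (simp add: G_def)
  qed (use False in \<open>auto simp: l_def\<close>)
 qed
 have ib: "integrable lborel b" by (rule integrable_compact_supp[OF c, of R]) (use z in auto)
 have bd: "\<bar>G x\<bar> \<le> (LI x. \<bar>b x\<bar>)" for x
 proof -
  have si: "set_integrable lborel {l..x} b" by (rule borel_integrable_atLeastAtMost'[OF cs])
  have "G x = (LI y. indicat_real {l..x} y * b y)"
   using set_borel_integral_eq_integral(2)[OF si] by (simp add: G_def set_lebesgue_integral_def)
  also have "\<bar>\<dots>\<bar> \<le> (LI x. \<bar>b x\<bar>)"
   by (rule LINT_abs_le) (use si ib in \<open>auto simp: set_integrable_def indicator_def\<close>)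
  finally show ?thesis .
 qed
 show ?thesis by (rule that[OF d bd])
qed

text \<open>The antiderivative G of a compactly supported b is bounded but need not vanish at
  infinity. Truncating it to \<open>chi n\<close> times G adds chi' G to the derivative, of size 1/n
  on a set of length about n, hence of L2 norm of order n^(-1/2): a nonzero mean is no obstruction
  in L2.\<close>

lemma prim_density:
 assumes W: "W2 b b1 b2" and d: "\<And>x. (b has_real_derivative b1 x) (at x)" and c: "continuous_on UNIV b1"
  and z: "\<And>x. R \<le> \<bar>x\<bar> ==> b x = 0" and e: "e > 0"
 obtains h a a1 a2 Q where "W2 a a1 a2" "continuous_on UNIV h" "weak_deriv h a" "\<And>x. Q \<le> \<bar>x\<bar> ==> h x = 0" "appr a a1 a2 b b1 b2 e"
proof -
 have bc: "continuous_on UNIV b" using d by (meson DERIV_isCont continuous_at_imp_continuous_on)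
 obtain G K where G: "\<And>x. (G has_real_derivative b x) (at x)" "\<And>x. \<bar>G x\<bar> \<le> K"
  by (rule antideriv_bounded[OF bc z]; (assumption | rule that))
 have Gc: "continuous_on UNIV G" using G(1) by (meson DERIV_isCont continuous_at_imp_continuous_on)
 have K0: "K \<ge> 0" using G(2)[of 0] by linarith
 define q where "q j n x = (deriv ^^ j) (chi n) x * G x" for j n x
 have sm: "smooth ((deriv ^^ j) (chi n))" for j n using smooth_derivs test_smooth[OF chi_test] by blast
 have qc: "continuous_on UNIV (q j n)" for j n unfolding q_def by (intro continuous_intros smooth_cont[OF sm] Gc)
 have qL: "L2 (q j n)" for j n
  by (rule cont_compact_L2[OF qc, of "3 * (real n + 1)"]) (simp add: q_def chi_deriv_far)
 \<comment> \<open>For n at least R the derivatives of the cutoff vanish wherever b is nonzero, so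
   differentiating \<open>q\<close> again produces no term with b.\<close>
 have qd: "(q (Suc j) n has_real_derivative q (Suc (Suc j)) n x) (at x)" if n: "real n \<ge> R" for j n x
 proof -
  have z: "b x * (deriv ^^ Suc j) (chi n) x = 0"
   using chi_deriv_near[of x n j] z[of x] n by (cases "\<bar>x\<bar> < real n + 1") auto
  have "((%x. (deriv ^^ Suc j) (chi n) x * G x) has_real_derivative deriv ((deriv ^^ Suc j) (chi n)) x * G x + b x * (deriv ^^ Suc j) (chi n) x) (at x)"
   by (rule DERIV_mult[OF smooth_DERIV[OF sm[of "Suc j" n]] G(1)[of x]])
  then show ?thesis unfolding q_def z by simp
 qed
 have q0d: "(q 0 n has_real_derivative b x + q 1 n x) (at x)" if n: "real n \<ge> R" for n x
 proof -
  have z: "b x * chi n x = b x" using chi_one[of x n] z[of x] n by (cases "\<bar>x\<bar> \<le> real n + 1") auto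
  have "((%x. (deriv ^^ 0) (chi n) x * G x) has_real_derivative deriv ((deriv ^^ 0) (chi n)) x * G x + b x * (deriv ^^ 0) (chi n) x) (at x)"
   by (rule DERIV_mult[OF smooth_DERIV[OF sm[of 0 n]] G(1)[of x]])
  then show ?thesis unfolding q_def funpow_0 z by (simp add: add.commute)
 qed
 have qn: "(%n. nrm (q (Suc j) n)) \<longlonglongrightarrow> 0" for j
 proof -
  obtain C where C: "C > 0" "\<And>n x. \<bar>(deriv ^^ Suc j) (chi n) x\<bar> \<le> C * (1 / (real n + 1)) ^ Suc j" using chi_deriv_bound[of "Suc j"] by metis
  have bd: "\<forall>\<^sub>F n in sequentially. norm (nrm (q (Suc j) n)) \<le> C * K * sqrt (6 / (real n + 1))"
  proof (intro always_eventually allI)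
   fix n
   let ?r = "1 / (real n + 1)"
   let ?I = "indicat_real {-(3 * (real n + 1))..3 * (real n + 1)}"
   have "nrm (q (Suc j) n) \<le> nrm (%x. C * ?r * K * ?I x)"
   proof (rule nrm_mono(2)[OF L2_cmult[OF L2_indicator_Icc] L2_meas[OF qL]], rule AE_I2)
    fix x
    show "\<bar>q (Suc j) n x\<bar> \<le> \<bar>C * ?r * K * ?I x\<bar>"
    proof (cases "\<bar>x\<bar> \<le> 3 * (real n + 1)")
     case True
     have rr: "?r ^ Suc j \<le> ?r ^ 1" by (intro power_decreasing) auto
     have "\<bar>q (Suc j) n x\<bar> \<le> (C * ?r ^ Suc j) * K" unfolding q_def abs_mult
      by (intro mult_mono C G) (use C in auto)
     also have "\<dots> \<le> (C * ?r) * K" using rr C(1) K0 by (intro mult_right_mono mult_left_mono) auto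
     also have "\<dots> = \<bar>C * ?r * K * ?I x\<bar>" using True C(1) K0 by (auto simp: indicator_def abs_le_iff)
     finally show ?thesis .
    next
     case False
     then show ?thesis using chi_deriv_far[of n x "Suc j"] by (simp add: q_def)
    qed
   qed
   also have "\<dots> = C * ?r * K * nrm ?I" unfolding nrm_cmult using C(1) K0 by simp
   also have "nrm ?I = sqrt (6 * (real n + 1))"
   proof -
    have "(%x. (?I x)\<^sup>2) = ?I" by (auto simp: indicator_def)
    then show ?thesis by (simp add: nrm_def)
   qed
   also have "C * ?r * K * sqrt (6 * (real n + 1)) = C * K * (?r * sqrt (6 * (real n + 1)))" by simp
   also have "?r * sqrt (6 * (real n + 1)) = sqrt (6 / (real n + 1))"
   proof -
    have "?r * sqrt (6 * (real n + 1)) = sqrt (?r\<^sup>2) * sqrt (6 * (real n + 1))" by simp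
    also have "\<dots> = sqrt (?r\<^sup>2 * (6 * (real n + 1)))" by (simp only: real_sqrt_mult)
    also have "?r\<^sup>2 * (6 * (real n + 1)) = 6 / (real n + 1)"
    proof -
     have "(1 / m)\<^sup>2 * (6 * m) = 6 / m" if "m > 0" for m :: real using that by (simp add: power2_eq_square)
     then show ?thesis by (metis add.commute of_nat_0_less_iff of_nat_Suc zero_less_Suc)
    qed
    finally show ?thesis .
   qed
   finally show "norm (nrm (q (Suc j) n)) \<le> C * K * sqrt (6 / (real n + 1))" by simp
  qed
  have "(%n. 6 * inverse (real (Suc n))) \<longlonglongrightarrow> 6 * 0" by (intro tendsto_mult tendsto_const LIMSEQ_inverse_real_of_nat)
  then have "(%n. C * K * sqrt (6 * inverse (real (Suc n)))) \<longlonglongrightarrow> C * K * sqrt (6 * 0)"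
   by (rule tendsto_mult[OF tendsto_const tendsto_real_sqrt])
  then have "(%n. C * K * sqrt (6 / (real n + 1))) \<longlonglongrightarrow> 0" by (simp add: divide_inverse add.commute)
  then show ?thesis by (rule Lim_null_comparison[OF bd])
 qed
 have "\<forall>\<^sub>F n in sequentially. nrm (q 1 n) < e \<and> nrm (q 2 n) < e \<and> nrm (q 3 n) < e \<and> real n \<ge> R"
  using order_tendstoD(2)[OF qn[of 0] e] order_tendstoD(2)[OF qn[of 1] e] order_tendstoD(2)[OF qn[of 2] e]
   eventually_ge_at_top[of "nat \<lceil>R\<rceil>"]
  by eventually_elim (auto simp: numeral_eq_Suc nat_le_iff ceiling_le_iff)
 then obtain n where n: "nrm (q 1 n) < e" "nrm (q 2 n) < e" "nrm (q 3 n) < e" "real n \<ge> R" by (auto simp: eventually_sequentially)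
 have wq: "weak_deriv (q (Suc j) n) (q (Suc (Suc j)) n)" for j by (rule classical_weak[OF qd[OF n(4)] qc])
 have Wq: "W2 (q 1 n) (q 2 n) (q 3 n)" using wq[of 0] wq[of 1] qL by (simp add: W2_def numeral_eq_Suc)
 have "weak_deriv (q 0 n) (%x. b x + q 1 n x)"
  by (rule classical_weak[OF q0d[OF n(4)]]) (intro continuous_intros bc qc)
 then show ?thesis
  by (rule that[OF W2_add[OF W Wq] qc, of 0 n "3 * (real n + 1)"]) (use n chi_far in \<open>auto simp: q_def[of 0] appr_def\<close>)
qed

text \<open>Mollifying the compactly supported primitive gives a genuine test function, and its
  first three derivatives are the mollifications of a, a1, a2.\<close>

lemma moll_density:
 assumes W: "W2 a a1 a2" and h: "continuous_on UNIV h" "weak_deriv h a" "\<And>x. Q \<le> \<bar>x\<bar> ==> h x = 0" and e: "e > 0"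
 obtains g where "test_fun g" "appr (deriv g) (deriv (deriv g)) (deriv (deriv (deriv g))) a a1 a2 e"
proof -
 note L = W2D[OF W] and hl = cont_loc_int[OF h(1)]
 define g where "g n = conv (moll n) h" for n
 have gt: "test_fun (g n)" for n
  unfolding test_fun_iff
 proof (intro conjI exI allI impI)
  show "smooth (g n)" unfolding g_def by (rule conv_smooth[OF moll_test hl])
  fix x assume x: "Q + 1 / (real n + 1) < \<bar>x\<bar>"
  show "g n x = 0" unfolding g_def
   by (rule conv_compact_supp[where R=Q and R'="1 / (real n + 1)"]) (use h(3) moll_supp x in auto)
 qed
 have g1: "deriv (g n) = conv (moll n) a" for n
  unfolding g_def deriv_conv[OF moll_test hl] using conv_weak[OF h(2) moll_test] by (simp add: fun_eq_iff)
 have g2: "deriv (conv (moll n) a) = conv (moll n) a1" for n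
  unfolding deriv_conv[OF moll_test L2_loc_int[OF L(1)]] using conv_weak[OF L(4) moll_test] by (simp add: fun_eq_iff)
 have g3: "deriv (conv (moll n) a1) = conv (moll n) a2" for n
  unfolding deriv_conv[OF moll_test L2_loc_int[OF L(2)]] using conv_weak[OF L(5) moll_test] by (simp add: fun_eq_iff)
 have "\<forall>\<^sub>F n in sequentially. appr (conv (moll n) a) (conv (moll n) a1) (conv (moll n) a2) a a1 a2 e"
  using order_tendstoD(2)[OF moll_tendsto[OF L(1)] e] order_tendstoD(2)[OF moll_tendsto[OF L(2)] e] order_tendstoD(2)[OF moll_tendsto[OF L(3)] e]
  by eventually_elim (simp add: appr_def)
 then obtain n where "appr (conv (moll n) a) (conv (moll n) a1) (conv (moll n) a2) a a1 a2 e" by (auto simp: eventually_sequentially)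
 then have "appr (deriv (g n)) (deriv (deriv (g n))) (deriv (deriv (deriv (g n)))) a a1 a2 e" unfolding g1 g2 g3 .
 then show ?thesis by (rule that[OF gt])
qed

text \<open>Three approximations with a third of the error each: truncate, replace by the derivative
  of a compactly supported function, smooth.\<close>

lemma density:
 assumes W: "W2 a a1 a2" and e: "e > 0"
 shows "\<exists>g. test_fun g \<and> appr (deriv g) (deriv (deriv g)) (deriv (deriv (deriv g))) a a1 a2 e"
proof -
 have e3: "e / 3 > 0" using e by simp
 obtain b b1 b2 R where b: "W2 b b1 b2" "\<And>x. (b has_real_derivative b1 x) (at x)" "continuous_on UNIV b1"
  "\<And>x. R \<le> \<bar>x\<bar> ==> b x = 0" "appr b b1 b2 a a1 a2 (e/3)" by (rule trunc_density[OF W e3], rule that)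
 obtain h d d1 d2 Q where d: "W2 d d1 d2" "continuous_on UNIV h" "weak_deriv h d" "\<And>x. Q \<le> \<bar>x\<bar> ==> h x = 0" "appr d d1 d2 b b1 b2 (e/3)"
  by (rule prim_density[OF b(1-4) e3], assumption, rule that)
 obtain g where g: "test_fun g" "appr (deriv g) (deriv (deriv g)) (deriv (deriv (deriv g))) d d1 d2 (e/3)"
  by (rule moll_density[OF d(1-4) e3], assumption, rule that)
 have "appr d d1 d2 a a1 a2 (e/3 + e/3)" by (rule appr_trans[OF b(5) d(5) W b(1) d(1)])
 from appr_trans[OF this g(2) W d(1) W2_test[OF test_deriv[OF g(1)]]] g(1) show ?thesis by (intro exI[of _ g]) simp
qed

lemma density_seq:
 assumes W: "W2 a a1 a2"
 obtains g where "\<And>n::nat. test_fun (g n)" "(%n. nrm (%x. deriv (g n) x - a x)) \<longlonglongrightarrow> 0"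
  "(%n. nrm (%x. deriv (deriv (g n)) x - a1 x)) \<longlonglongrightarrow> 0" "(%n. nrm (%x. deriv (deriv (deriv (g n))) x - a2 x)) \<longlonglongrightarrow> 0"
proof -
 have "\<forall>n. \<exists>g. test_fun g \<and> appr (deriv g) (deriv (deriv g)) (deriv (deriv (deriv g))) a a1 a2 (inverse (real (Suc n)))"
  by (intro allI density[OF W]) simp
 then obtain g where g: "\<And>n. test_fun (g n)" "\<And>n. appr (deriv (g n)) (deriv (deriv (g n))) (deriv (deriv (deriv (g n)))) a a1 a2 (inverse (real (Suc n)))"
  by metis
 have "(%n. X n) \<longlonglongrightarrow> 0" if "\<And>n. 0 \<le> X n" "\<And>n. X n < inverse (real (Suc n))" for X :: "nat => real"
  by (rule Lim_null_comparison[OF always_eventually LIMSEQ_inverse_real_of_nat]) (use that less_imp_le in auto)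
 then show ?thesis by (intro that[of g]) (use g in \<open>auto simp: appr_def\<close>)
qed

section \<open>The unstable direction\<close>

context gstate begin

text \<open>The momentum pairing at the wave: Q' at (phi, -c phi) applied to (a, b) is
  \<open>pr b - c * pr a\<close>.\<close>

definition "pr w = (LI x. phi x * w x)"

lemma pr_int: "L2 w ==> integrable lborel (%x. phi x * w x)" by (rule L2_mult[OF L2phi])

lemma pr_lin: "L2 a ==> L2 b ==> pr (%x. k * a x + l * b x) = k * pr a + l * pr b"
 unfolding pr_def using pr_int[of a] pr_int[of b] by (simp add: distrib_left mult.left_commute)

lemma L2_const_tendsto: "L2 a ==> (%n. ndist a a) \<longlonglongrightarrow> 0"
 by (simp add: nrm_def)

lemma pr_tendsto: "L2 a ==> (\<And>n. L2 (A n)) ==> (%n. ndist (A n) a) \<longlonglongrightarrow> 0 ==> (%n. pr (A n)) \<longlonglongrightarrow> pr a"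
 unfolding pr_def by (rule LINT_tendsto_L2[OF L2phi _ L2phi _ L2_const_tendsto[OF L2phi]])

lemma pr_phi1: "pr phi1 = 0"
proof -
 note L = W2D[OF W2phi]
 show ?thesis using weak_ibp[OF L(4,1,2) L(4,1,2)] by (simp add: pr_def mult.commute)
qed

lemma pr_phi2: "pr phi2 = - (nrm phi1)\<^sup>2"
proof -
 note L = W2D[OF W2phi]
 have "(nrm phi1)\<^sup>2 = (LI x. phi1 x * phi1 x)" unfolding nrm_sq by (simp add: power2_eq_square)
 then show ?thesis using weak_ibp[OF L(4,1,2) L(5,2,3)] by (simp add: pr_def)
qed

lemma kappa0: "\<exists>k. test_fun k \<and> pr (deriv k) \<noteq> 0"
proof -
 obtain g where g: "\<And>n::nat. test_fun (g n)" "(%n. nrm (%x. deriv (g n) x - phi x)) \<longlonglongrightarrow> 0"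
  by (rule density_seq[OF W2phi], rule that)
 have "(%n. pr (deriv (g n))) \<longlonglongrightarrow> pr phi" by (rule pr_tendsto[OF L2phi _ g(2)]) (use g test_L2 test_deriv in blast)
 moreover have "pr phi > 0" using phi1_pos nrm_sq[of phi] by (simp add: pr_def power2_eq_square[of "phi _", symmetric] flip: nrm_sq)
 ultimately have "\<forall>\<^sub>F n in sequentially. pr (deriv (g n)) > 0" by (rule order_tendstoD(1))
 then obtain n where "pr (deriv (g n)) > 0" by (auto simp: eventually_sequentially)
 then show ?thesis using g(1) by (intro exI[of _ "g n"]) auto
qed

lemma deriv_lin2:
 assumes "test_fun a" "test_fun b" shows "deriv (%x. k * a x + l * b x) = (%x. k * deriv a x + l * deriv b x)"
proof -
 have s: "smooth a" "smooth b" using assms test_smooth by auto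
 show ?thesis
  using deriv_add'[OF smooth_mult[OF smooth_const s(1)] smooth_mult[OF smooth_const s(2)], of k l] deriv_cmult'[OF s(1), of k] deriv_cmult'[OF s(2), of l] by simp
qed

text \<open>Otherwise k -> pr(k'') vanishes on the kernel of k -> pr(k') and is therefore a multiple
  \<mu> of it. Taking k = g' with g' close to \<open>phi\<close> in H2 turns this into -|phi'|^2 =
  \<mu> 0 in the limit, a contradiction.\<close>

lemma kappa1: "\<exists>k. test_fun k \<and> pr (deriv k) = 0 \<and> pr (deriv (deriv k)) \<noteq> 0"
proof (rule ccontr)
 assume "\<not> ?thesis"
 then have N: "pr (deriv (deriv k)) = 0" if "test_fun k" "pr (deriv k) = 0" for k using that by blast
 obtain k0 where k0: "test_fun k0" "pr (deriv k0) \<noteq> 0" using kappa0 by blast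
 define \<mu> where "\<mu> = pr (deriv (deriv k0)) / pr (deriv k0)"
 have eq: "pr (deriv (deriv k)) = \<mu> * pr (deriv k)" if k: "test_fun k" for k
 proof -
  define r where "r = - pr (deriv k) / pr (deriv k0)"
  define l where "l = (%x. 1 * k x + r * k0 x)"
  have l: "test_fun l" unfolding l_def by (intro test_add test_cmult k k0)
  have d1: "deriv l = (%x. 1 * deriv k x + r * deriv k0 x)" unfolding l_def by (rule deriv_lin2[OF k k0(1)])
  have d2: "deriv (deriv l) = (%x. 1 * deriv (deriv k) x + r * deriv (deriv k0) x)"
   unfolding d1 by (rule deriv_lin2[OF test_deriv[OF k] test_deriv[OF k0(1)]])
  note T = test_L2[OF test_deriv[OF k]] test_L2[OF test_deriv[OF k0(1)]] test_L2[OF test_deriv[OF test_deriv[OF k]]] test_L2[OF test_deriv[OF test_deriv[OF k0(1)]]]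
  have "pr (deriv l) = 0" unfolding d1 pr_lin[OF T(1,2)] using k0(2) by (simp add: r_def)
  from N[OF l this] have "pr (deriv (deriv k)) + r * pr (deriv (deriv k0)) = 0" unfolding d2 pr_lin[OF T(3,4)] by simp
  then show ?thesis using k0(2) by (simp add: r_def \<mu>_def field_simps)
 qed
 obtain g where g: "\<And>n::nat. test_fun (g n)" "(%n. nrm (%x. deriv (g n) x - phi x)) \<longlonglongrightarrow> 0"
  "(%n. nrm (%x. deriv (deriv (g n)) x - phi1 x)) \<longlonglongrightarrow> 0" "(%n. nrm (%x. deriv (deriv (deriv (g n))) x - phi2 x)) \<longlonglongrightarrow> 0"
  by (rule density_seq[OF W2phi], rule that)
 have gL: "L2 (deriv (g n))" "L2 (deriv (deriv (g n)))" "L2 (deriv (deriv (deriv (g n))))" for n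
  using g(1) test_L2 test_deriv by blast+
 have 0: "(%n. pr (deriv (g n))) \<longlonglongrightarrow> pr phi" by (rule pr_tendsto[OF L2phi gL(1) g(2)])
 have 1: "(%n. pr (deriv (deriv (g n)))) \<longlonglongrightarrow> 0" using pr_tendsto[OF L2phi1 gL(2) g(3)] pr_phi1 by simp
 have 2: "(%n. pr (deriv (deriv (deriv (g n))))) \<longlonglongrightarrow> - (nrm phi1)\<^sup>2" using pr_tendsto[OF L2phi2 gL(3) g(4)] pr_phi2 by simp
 have "(%n. pr (deriv (deriv (deriv (g n))))) \<longlonglongrightarrow> \<mu> * 0"
  unfolding eq[OF test_deriv[OF g(1)]] by (intro tendsto_intros 1)
 from LIMSEQ_unique[OF 2 this] show False using phi1_pos by simp
qed

text \<open>Second variation of the profile part I/2 minus the integral of F. Along (a, b) the full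
  second variation of S at the wave is \<open>Qf\<close> plus |b + c a|^2.\<close>

definition "Qf a a1 a2 = (nrm a2)\<^sup>2 - \<beta> * (nrm a1)\<^sup>2 + s * (nrm a)\<^sup>2 - (LI x. (deriv f (phi x) * a x) * a x)"

lemma f'phi_L2: "L2 w ==> L2 (%x. deriv f (phi x) * w x)"
 by (rule chain_L2[OF _ L2_meas[OF L2phi] phi_bound])

lemma f'phi_nrm: obtains C where "C > 0" "\<And>w. L2 w ==> nrm (%x. deriv f (phi x) * w x) \<le> C * nrm w"
proof -
 obtain C where C: "C > 0" "\<And>s. \<bar>s\<bar> \<le> 2 * (nrm phi + nrm phi1) ==> \<bar>deriv f s\<bar> \<le> C" by (rule local_bounds[of "2 * (nrm phi + nrm phi1)"], rule that)
 have "nrm (%x. deriv f (phi x) * w x) \<le> C * nrm w" if w: "L2 w" for w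
 proof -
  have "nrm (%x. deriv f (phi x) * w x) \<le> nrm (%x. C * w x)"
  proof (rule nrm_mono(2)[OF L2_cmult[OF w] L2_meas[OF f'phi_L2[OF w]]])
   show "AE x in lborel. \<bar>deriv f (phi x) * w x\<bar> \<le> \<bar>C * w x\<bar>"
    using phi_bound by eventually_elim (use C in \<open>auto simp: abs_mult intro!: mult_right_mono\<close>)
  qed
  then show ?thesis using C(1) by (simp add: nrm_cmult)
 qed
 then show ?thesis using that C(1) by blast
qed

lemma nrm_tendsto:
 assumes "L2 a" "\<And>n. L2 (A n)" "(%n. ndist (A n) a) \<longlonglongrightarrow> 0" shows "(%n. nrm (A n)) \<longlonglongrightarrow> nrm a"
 by (rule Lim_null[THEN iffD2], rule Lim_null_comparison[OF always_eventually assms(3)]) (use nrm_diff_ge[OF assms(2,1)] in simp)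

lemma Qf_tendsto:
 assumes "L2 a" "L2 a1" "L2 a2" "\<And>n. L2 (A n)" "\<And>n. L2 (A1 n)" "\<And>n. L2 (A2 n)"
  "(%n. ndist (A n) a) \<longlonglongrightarrow> 0" "(%n. ndist (A1 n) a1) \<longlonglongrightarrow> 0" "(%n. ndist (A2 n) a2) \<longlonglongrightarrow> 0"
 shows "(%n. Qf (A n) (A1 n) (A2 n)) \<longlonglongrightarrow> Qf a a1 a2"
proof -
 obtain C where C: "C > 0" "\<And>w. L2 w ==> nrm (%x. deriv f (phi x) * w x) \<le> C * nrm w" by (rule f'phi_nrm, rule that)
 have "(%n. nrm (%x. deriv f (phi x) * A n x - deriv f (phi x) * a x)) \<longlonglongrightarrow> 0"
 proof (rule Lim_null_comparison[OF always_eventually])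
  show "\<forall>n. norm (nrm (%x. deriv f (phi x) * A n x - deriv f (phi x) * a x)) \<le> C * ndist (A n) a"
   using C(2)[OF L2_diff[OF assms(4,1)]] by (simp add: right_diff_distrib)
  show "(%n. C * ndist (A n) a) \<longlonglongrightarrow> 0" using tendsto_mult[OF tendsto_const assms(7), of C] by simp
 qed
 then show ?thesis unfolding Qf_def
  by (intro tendsto_intros nrm_tendsto LINT_tendsto_L2 f'phi_L2 assms)
qed

text \<open>With h = w - c g, the completed square in S sees exactly w' = h' + c g'. After the
  regularity of g and w the clauses are: tangency to the level set of Q, strict concavity in the
  translation of the pairing with (h, g), negative second variation, and transversality to N =
  0.\<close>

definition direction :: "(real => real) => (real => real) => bool" where
 "direction g w \<longleftrightarrow> test_fun g \<and> test_fun w \<and> pr (deriv w) = 2 * c * pr (deriv g)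
   \<and> pr (deriv (deriv w)) - 2 * c * pr (deriv (deriv g)) < 0
   \<and> Qf (deriv g) (deriv (deriv g)) (deriv (deriv (deriv g))) + (nrm (deriv w))\<^sup>2 < 0
   \<and> (LI x. f (phi x) * deriv g x) \<noteq> 0"

text \<open>The profile a is approximated by g', and w' is taken close to k a. The alternative for
  \<open>k\<close> makes the tangency defect vanish in the limit: w' = 2c a is tangent for every a,
  and any k will do when pr(a) = 0.\<close>

lemma direction_exists:
 assumes W: "W2 a a1 a2" and k: "k = 2 * c \<or> pr a = 0"
  and Q: "Qf a a1 a2 + k\<^sup>2 * (nrm a)\<^sup>2 < 0" and D: "(LI x. f (phi x) * a x) \<noteq> 0"
 shows "\<exists>g w. direction g w"
proof -
 note L = W2D[OF W]
 obtain g where g: "\<And>n::nat. test_fun (g n)" "(%n. nrm (%x. deriv (g n) x - a x)) \<longlonglongrightarrow> 0"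
  "(%n. nrm (%x. deriv (deriv (g n)) x - a1 x)) \<longlonglongrightarrow> 0" "(%n. nrm (%x. deriv (deriv (deriv (g n))) x - a2 x)) \<longlonglongrightarrow> 0"
  by (rule density_seq[OF W], rule that)
 obtain k0 where k0: "test_fun k0" "pr (deriv k0) \<noteq> 0" using kappa0 by blast
 obtain k1 where k1: "test_fun k1" "pr (deriv k1) = 0" "pr (deriv (deriv k1)) \<noteq> 0" using kappa1 by blast
 have gL: "L2 (deriv (g n))" "L2 (deriv (deriv (g n)))" "L2 (deriv (deriv (deriv (g n))))" for n
  using g(1) test_L2 test_deriv by blast+
 have kL: "L2 (deriv k0)" "L2 (deriv k1)" "L2 (deriv (deriv k0))" "L2 (deriv (deriv k1))"
  using k0(1) k1(1) test_L2 test_deriv by blast+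
 \<comment> \<open>This multiple of \<open>k0\<close> restores exact tangency for each n; it tends
   to 0 because (2c - k) pr(a) = 0.\<close>
 define r where "r n = (2 * c - k) * pr (deriv (g n)) / pr (deriv k0)" for n
 define w0 where "w0 n = (%x. k * g n x + r n * k0 x)" for n
 define B where "B n = pr (deriv (deriv (w0 n))) - 2 * c * pr (deriv (deriv (g n)))" for n
 \<comment> \<open>Since pr(k1') = 0 and pr(k1'') is nonzero, adding \<open>k1\<close> leaves
   tangency intact and shifts the concavity quantity away from 0; this is done only when that
   quantity happens to vanish.\<close>
 define \<epsilon> where "\<epsilon> n = (if B n \<noteq> 0 then 0 else inverse (real (Suc n)))" for n
 define w where "w n = (%x. 1 * w0 n x + \<epsilon> n * k1 x)" for n
 have w0t: "test_fun (w0 n)" for n unfolding w0_def by (intro test_add test_cmult g k0)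
 have wt: "test_fun (w n)" for n unfolding w_def by (intro test_add test_cmult w0t k1)
 have dw0: "deriv (w0 n) = (%x. k * deriv (g n) x + r n * deriv k0 x)" for n
  unfolding w0_def by (rule deriv_lin2[OF g(1) k0(1)])
 have dw: "deriv (w n) = (%x. 1 * deriv (w0 n) x + \<epsilon> n * deriv k1 x)" for n
  unfolding w_def by (rule deriv_lin2[OF w0t k1(1)])
 have ddw: "deriv (deriv (w n)) = (%x. 1 * deriv (deriv (w0 n)) x + \<epsilon> n * deriv (deriv k1) x)" for n
  unfolding dw by (rule deriv_lin2[OF test_deriv[OF w0t] test_deriv[OF k1(1)]])
 have w0L: "L2 (deriv (w0 n))" "L2 (deriv (deriv (w0 n)))" "L2 (deriv (w n))" for n
  using w0t wt test_L2 test_deriv by blast+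
 have A: "pr (deriv (w n)) = 2 * c * pr (deriv (g n))" for n
 proof -
  have "pr (deriv (w n)) = pr (deriv (w0 n))" unfolding dw pr_lin[OF w0L(1) kL(2)] using k1(2) by simp
  also have "\<dots> = k * pr (deriv (g n)) + r n * pr (deriv k0)" unfolding dw0 by (rule pr_lin[OF gL(1) kL(1)])
  also have "\<dots> = 2 * c * pr (deriv (g n))" using k0(2) by (simp add: r_def) (simp add: left_diff_distrib)
  finally show ?thesis .
 qed
 have B: "pr (deriv (deriv (w n))) - 2 * c * pr (deriv (deriv (g n))) \<noteq> 0" for n
 proof -
  have "pr (deriv (deriv (w n))) - 2 * c * pr (deriv (deriv (g n))) = B n + \<epsilon> n * pr (deriv (deriv k1))"
   unfolding ddw pr_lin[OF w0L(2) kL(4)] by (simp add: B_def)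
  then show ?thesis using k1(3) by (auto simp: \<epsilon>_def)
 qed
 have pg: "(%n. pr (deriv (g n))) \<longlonglongrightarrow> pr a" by (rule pr_tendsto[OF L(1) gL(1) g(2)])
 have "r \<longlonglongrightarrow> (2 * c - k) * pr a / pr (deriv k0)" unfolding r_def[abs_def] using k0(2) by (intro tendsto_intros pg) auto
 then have r0: "r \<longlonglongrightarrow> 0" using k by auto
 have e0: "\<epsilon> \<longlonglongrightarrow> 0" by (rule Lim_null_comparison[OF always_eventually LIMSEQ_inverse_real_of_nat]) (simp add: \<epsilon>_def)
 have wl: "(%n. nrm (%x. deriv (w n) x - k * a x)) \<longlonglongrightarrow> 0"
 proof (rule Lim_null_comparison[OF always_eventually])
  show "\<forall>n. norm (nrm (%x. deriv (w n) x - k * a x)) \<le> \<bar>k\<bar> * nrm (%x. deriv (g n) x - a x) + \<bar>r n\<bar> * nrm (deriv k0) + \<bar>\<epsilon> n\<bar> * nrm (deriv k1)"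
  proof
   fix n
   have e: "(%x. deriv (w n) x - k * a x) = (%x. (k * (deriv (g n) x - a x) + r n * deriv k0 x) + \<epsilon> n * deriv k1 x)"
    by (simp add: dw dw0 fun_eq_iff algebra_simps)
   have 1: "nrm (%x. (k * (deriv (g n) x - a x) + r n * deriv k0 x) + \<epsilon> n * deriv k1 x)
     \<le> nrm (%x. k * (deriv (g n) x - a x) + r n * deriv k0 x) + nrm (%x. \<epsilon> n * deriv k1 x)"
    by (rule nrm_triangle; intro L2_add L2_cmult L2_diff gL L kL)
   have 2: "nrm (%x. k * (deriv (g n) x - a x) + r n * deriv k0 x) \<le> nrm (%x. k * (deriv (g n) x - a x)) + nrm (%x. r n * deriv k0 x)"
    by (rule nrm_triangle; intro L2_cmult L2_diff gL L kL)
   show "norm (nrm (%x. deriv (w n) x - k * a x)) \<le> \<bar>k\<bar> * nrm (%x. deriv (g n) x - a x) + \<bar>r n\<bar> * nrm (deriv k0) + \<bar>\<epsilon> n\<bar> * nrm (deriv k1)"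
    using order_trans[OF 1 add_right_mono[OF 2]] unfolding e[symmetric] nrm_cmult by simp
  qed
  have "(%n. \<bar>k\<bar> * nrm (%x. deriv (g n) x - a x) + \<bar>r n\<bar> * nrm (deriv k0) + \<bar>\<epsilon> n\<bar> * nrm (deriv k1)) \<longlonglongrightarrow> \<bar>k\<bar> * 0 + \<bar>0\<bar> * nrm (deriv k0) + \<bar>0\<bar> * nrm (deriv k1)"
   by (intro tendsto_intros g r0 e0)
  then show "(%n. \<bar>k\<bar> * nrm (%x. deriv (g n) x - a x) + \<bar>r n\<bar> * nrm (deriv k0) + \<bar>\<epsilon> n\<bar> * nrm (deriv k1)) \<longlonglongrightarrow> 0" by simp
 qed
 have "(%n. Qf (deriv (g n)) (deriv (deriv (g n))) (deriv (deriv (deriv (g n)))) + (nrm (deriv (w n)))\<^sup>2) \<longlonglongrightarrow> Qf a a1 a2 + (nrm (%x. k * a x))\<^sup>2"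
  by (intro tendsto_intros Qf_tendsto nrm_tendsto L L2_cmult gL w0L g wl)
 then have C: "\<forall>\<^sub>F n in sequentially. Qf (deriv (g n)) (deriv (deriv (g n))) (deriv (deriv (deriv (g n)))) + (nrm (deriv (w n)))\<^sup>2 < 0"
  by (rule order_tendstoD(2)) (use Q in \<open>simp add: nrm_cmult power_mult_distrib\<close>)
 have "(%n. LI x. f (phi x) * deriv (g n) x) \<longlonglongrightarrow> (LI x. f (phi x) * a x)"
  by (rule LINT_tendsto_L2[OF fphi_L2 L(1) fphi_L2 gL(1) L2_const_tendsto[OF fphi_L2] g(2)])
 then have DD: "\<forall>\<^sub>F n in sequentially. (LI x. f (phi x) * deriv (g n) x) \<noteq> 0" using D tendsto_imp_eventually_ne by blast
 obtain n where n: "Qf (deriv (g n)) (deriv (deriv (g n))) (deriv (deriv (deriv (g n)))) + (nrm (deriv (w n)))\<^sup>2 < 0"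
   "(LI x. f (phi x) * deriv (g n) x) \<noteq> 0"
  using eventually_conj[OF C DD] by (auto simp: eventually_sequentially)
 show ?thesis
 proof (cases "pr (deriv (deriv (w n))) - 2 * c * pr (deriv (deriv (g n))) < 0")
  case True
  then show ?thesis using n A g(1) wt unfolding direction_def by blast
 next
  case False
  \<comment> \<open>Changing the sign of both g and w flips the concavity quantity and preserves the
    other clauses.\<close>
  define g' where "g' = (%x. (-1) * g n x)"
  define w' where "w' = (%x. (-1) * w n x)"
  have dm: "deriv (%x. (-1) * h x) = (%x. (-1) * deriv h x)" if "test_fun h" for h
   by (rule deriv_cmult'[OF test_smooth[OF that]])
  note td = test_deriv[OF g(1)] test_deriv[OF wt] test_deriv[OF test_deriv[OF g(1)]]
  note dg = dm[OF g(1)[of n]] dm[OF wt[of n]] dm[OF td(1)[of n]] dm[OF td(2)[of n]] dm[OF td(3)[of n]]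
  have pm: "pr (%x. (-1) * h x) = - pr h" for h by (simp add: pr_def)
  have "direction g' w'" unfolding direction_def g'_def w'_def dg pm
  proof (intro conjI)
   show "test_fun (%x. - 1 * g n x)" "test_fun (%x. - 1 * w n x)" by (intro test_cmult g wt)+
   show "- pr (deriv (w n)) = 2 * c * - pr (deriv (g n))" using A[of n] by simp
   show "- pr (deriv (deriv (w n))) - 2 * c * - pr (deriv (deriv (g n))) < 0" using False B[of n] by simp
   show "Qf (%x. - 1 * deriv (g n) x) (%x. - 1 * deriv (deriv (g n)) x) (%x. - 1 * deriv (deriv (deriv (g n))) x) + (nrm (%x. - 1 * deriv (w n) x))\<^sup>2 < 0"
    using n(1) unfolding Qf_def nrm_cmult by simp
   show "(LI x. f (phi x) * (- 1 * deriv (g n) x)) \<noteq> 0" using n(2) by simp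
  qed
  then show ?thesis by blast
 qed
qed

text \<open>For a = phi and k = 2c, Euler's identity gives Qf = (1 - p) I, and I is at least (s -
  \<beta>_+^2/4)|phi|^2 by interpolation. The hypothesis makes (2c)^2 |phi|^2 smaller than (p - 1)
  I.\<close>

lemma direction_case_i:
 assumes "4 * c\<^sup>2 < (p - 1) * (s - (max \<beta> 0)\<^sup>2 / 4)"
 shows "\<exists>g w. direction g w"
proof (rule direction_exists[OF W2phi])
 define b where "b = max \<beta> 0"
 have I: "Iphi \<ge> (s - b\<^sup>2 / 4) * (nrm phi)\<^sup>2"
 proof -
  have "\<beta> * (nrm phi1)\<^sup>2 \<le> b * (nrm phi1)\<^sup>2" by (intro mult_right_mono) (auto simp: b_def)
  also have "\<dots> \<le> b * (nrm phi * nrm phi2)" using W2_interp[OF W2phi] by (intro mult_left_mono) (auto simp: b_def)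
  also have "\<dots> \<le> (nrm phi2)\<^sup>2 + b\<^sup>2 / 4 * (nrm phi)\<^sup>2"
   using sum_squares_bound[of "nrm phi2" "b / 2 * nrm phi"] by (simp add: power_mult_distrib power_divide mult_ac)
  finally show ?thesis by (simp add: II_def s_def algebra_simps)
 qed
 have e: "(LI x. (deriv f (phi x) * phi x) * phi x) = p * Iphi" "(LI x. f (phi x) * phi x) = Iphi"
 proof -
  have 1: "(LI x. f (phi x) * phi x) = KK phi"
   using p2 unfolding KK_def F_def by (simp add: mult.commute)
  then show "(LI x. f (phi x) * phi x) = Iphi" using gs_facts by simp
  have "(LI x. (deriv f (phi x) * phi x) * phi x) = p * (LI x. f (phi x) * phi x)"
   unfolding euler by (simp add: mult.assoc)
  then show "(LI x. (deriv f (phi x) * phi x) * phi x) = p * Iphi" using 1 gs_facts by simp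
 qed
 show "2 * c = 2 * c \<or> pr phi = 0" by simp
 show "(LI x. f (phi x) * phi x) \<noteq> 0" using e gs_facts by simp
 have q: "Qf phi phi1 phi2 = (1 - p) * Iphi" unfolding Qf_def e by (simp add: II_def s_def algebra_simps)
 have "4 * c\<^sup>2 * (nrm phi)\<^sup>2 < (p - 1) * (s - b\<^sup>2 / 4) * (nrm phi)\<^sup>2"
  using assms phi1_pos by (intro mult_strict_right_mono) (auto simp: b_def)
 also have "\<dots> \<le> (p - 1) * Iphi" using mult_left_mono[OF I, of "p - 1"] p2 by (simp add: mult.assoc)
 finally show "Qf phi phi1 phi2 + (2 * c)\<^sup>2 * (nrm phi)\<^sup>2 < 0"
  unfolding q by (simp add: power_mult_distrib algebra_simps)
qed

end

section \<open>Decay of ground states\<close>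

lemma nrm_bmult:
 assumes "L2 u" "t \<in> borel_measurable borel" "\<And>x. \<bar>t x\<bar> \<le> C"
 shows "L2 (%x. t x * u x)" "nrm (%x. t x * u x) \<le> C * nrm u"
proof -
 have C: "C \<ge> 0" using assms(3)[of 0] by linarith
 have m: "(%x. t x * u x) \<in> borel_measurable borel" using assms(2) L2_meas[OF assms(1)] by measurable
 have b: "AE x in lborel. \<bar>t x * u x\<bar> \<le> \<bar>C * u x\<bar>"
  using assms(3) C by (auto simp: abs_mult intro!: mult_right_mono)
 show "L2 (%x. t x * u x)" by (rule nrm_mono(1)[OF L2_cmult[OF assms(1)] m b])
 show "nrm (%x. t x * u x) \<le> C * nrm u"
  using nrm_mono(2)[OF L2_cmult[OF assms(1)] m b] C by (simp add: nrm_cmult)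
qed

lemma W2_prod:
 assumes t: "test_fun t" and W: "W2 u u1 u2"
 shows "W2 (%x. t x * u x) (%x. deriv t x * u x + t x * u1 x)
  (%x. (deriv (deriv t) x * u x + deriv t x * u1 x) + (deriv t x * u1 x + t x * u2 x))"
proof -
 note L = W2D[OF W] and t1 = test_deriv[OF t]
 have m: "L2 (%x. k x * v x)" if k: "test_fun k" and v: "L2 v" for k v
 proof -
  obtain C where C: "\<And>x. \<bar>k x\<bar> \<le> C" using test_bounded[OF k] by metis
  show ?thesis by (rule nrm_bmult(1)[OF v test_meas[OF k] C])
 qed
 show ?thesis unfolding W2_def
  by (intro conjI L2_add m t t1 test_deriv[OF t1] L weak_deriv_add weak_deriv_prod)
qed

lemma L2_fatou:
 assumes h: "h \<in> borel_measurable borel" and E: "E \<ge> 0" and L: "\<And>n. L2 (%x. chi n x * h x)" and b: "\<And>n. nrm (%x. chi n x * h x) \<le> E"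
 shows "L2 h"
proof (rule L2I[OF h])
 have [measurable]: "chi n \<in> borel_measurable borel" for n by (rule test_meas[OF chi_test])
 note [measurable] = h
 have lim: "(%n. ennreal ((chi n x * h x)\<^sup>2)) \<longlonglongrightarrow> ennreal ((h x)\<^sup>2)" for x
 proof -
  have "(%n. (chi n x * h x)\<^sup>2) \<longlonglongrightarrow> (1 * h x)\<^sup>2" by (intro tendsto_power tendsto_mult chi_tendsto tendsto_const)
  then show ?thesis by simp
 qed
 have bn: "(\<integral>\<^sup>+x. ennreal ((chi n x * h x)\<^sup>2) \<partial>lborel) \<le> ennreal (E\<^sup>2)" for n
 proof -
  have "(\<integral>\<^sup>+x. ennreal ((chi n x * h x)\<^sup>2) \<partial>lborel) = ennreal ((nrm (%x. chi n x * h x))\<^sup>2)"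
   unfolding nrm_sq by (rule nn_integral_eq_integral[OF L2_sq[OF L]]) simp
  also have "\<dots> \<le> ennreal (E\<^sup>2)" by (intro ennreal_leI power_mono b) simp
  finally show ?thesis .
 qed
 have "(\<integral>\<^sup>+x. ennreal ((h x)\<^sup>2) \<partial>lborel) = (\<integral>\<^sup>+x. liminf (%n. ennreal ((chi n x * h x)\<^sup>2)) \<partial>lborel)"
  by (intro nn_integral_cong) (metis lim lim_imp_Liminf sequentially_bot)
 also have "\<dots> \<le> liminf (%n. \<integral>\<^sup>+x. ennreal ((chi n x * h x)\<^sup>2) \<partial>lborel)"
  by (rule nn_integral_liminf) measurable
 also have "\<dots> \<le> liminf (%n::nat. ennreal (E\<^sup>2))" by (intro Liminf_mono always_eventually allI bn)
 also have "\<dots> = ennreal (E\<^sup>2)" by (simp add: Liminf_const)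
 finally have "(\<integral>\<^sup>+x. ennreal ((h x)\<^sup>2) \<partial>lborel) < \<infinity>" by (simp add: order_le_less_trans)
 then show "integrable lborel (%x. (h x)\<^sup>2)" by (simp add: integrable_iff_bounded)
qed

text \<open>The weight x made compactly supported, with first and second derivatives still bounded
  independently of n.\<close>

definition xchi :: "nat => real => real" where "xchi n x = x * chi n x"

lemma smooth_id: "smooth (%x. x)"
proof -
 have "deriv (%x::real. x) = (%x. 1)" by simp
 then show ?thesis using smooth_rec[of "%x. x"] smooth_const[of 1] by simp
qed

lemma xchi_test: "test_fun (xchi n)" unfolding xchi_def[abs_def] by (rule test_mult_smooth[OF smooth_id chi_test])

lemma xchi_deriv: "deriv (xchi n) = (%x. chi n x + x * deriv (chi n) x)"
 "deriv (deriv (xchi n)) = (%x. 2 * deriv (chi n) x + x * deriv (deriv (chi n)) x)"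
proof -
 have sm: "smooth (chi n)" by (rule test_smooth[OF chi_test])
 have id: "deriv (%x::real. x) = (%x. 1)" by simp
 show 1: "deriv (xchi n) = (%x. chi n x + x * deriv (chi n) x)"
  unfolding xchi_def[abs_def] deriv_mult'[OF smooth_id sm] id by simp
 show "deriv (deriv (xchi n)) = (%x. 2 * deriv (chi n) x + x * deriv (deriv (chi n)) x)"
  unfolding 1 deriv_add'[OF sm smooth_mult[OF smooth_id smooth_deriv[OF sm]]] deriv_mult'[OF smooth_id smooth_deriv[OF sm]] id
  by (simp add: fun_eq_iff)
qed

lemma xchi_le: "\<bar>xchi n x\<bar> \<le> \<bar>x\<bar>"
 using chi_bounds[of n x] by (simp add: xchi_def abs_mult mult_left_le)

text \<open>The extra factor x is at most 3(n + 1) where the cutoff lives, and is compensated by the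
  factor 1/(n + 1) in the derivatives of the cutoff.\<close>

lemma xchi_bounds: obtains C where "C > 0" "\<And>n x. \<bar>deriv (xchi n) x\<bar> \<le> C" "\<And>n x. \<bar>deriv (deriv (xchi n)) x\<bar> \<le> C"
proof -
 obtain C1 where C1: "C1 > 0" "\<And>n x. \<bar>(deriv ^^ 1) (chi n) x\<bar> \<le> C1 * (1 / (real n + 1)) ^ 1" by (rule chi_deriv_bound[of 1], rule that)
 obtain C2 where C2: "C2 > 0" "\<And>n x. \<bar>(deriv ^^ 2) (chi n) x\<bar> \<le> C2 * (1 / (real n + 1)) ^ 2" by (rule chi_deriv_bound[of 2], rule that)
 have d2: "(deriv ^^ 2) (chi n) = deriv (deriv (chi n))" for n by (simp add: numeral_2_eq_2)
 have r: "1 / (real n + 1) \<le> 1" "0 \<le> 1 / (real n + 1)" for n by auto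
 have b1: "\<bar>deriv (chi n) x\<bar> \<le> C1 * (1 / (real n + 1))" for n x using C1(2)[of n x] by simp
 have b2: "\<bar>deriv (deriv (chi n)) x\<bar> \<le> C2 * (1 / (real n + 1))" for n x
 proof -
  have "(1 / (real n + 1)) ^ 2 \<le> 1 / (real n + 1)" using power_decreasing[of 1 2 "1 / (real n + 1)"] r[of n] by simp
  from mult_left_mono[OF this, of C2] show ?thesis using C2(1) C2(2)[of n x, unfolded d2] by linarith
 qed
 have x: "\<bar>x * k\<bar> \<le> 3 * C" if k: "\<bar>k\<bar> \<le> C * (1 / (real n + 1))" "3 * (real n + 1) < \<bar>x\<bar> ==> k = 0" and C: "C > 0" for x k C :: real and n
 proof (cases "3 * (real n + 1) < \<bar>x\<bar>")
  case True then show ?thesis using k C by simp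
 next
  case False
  have "\<bar>x * k\<bar> \<le> (3 * (real n + 1)) * (C * (1 / (real n + 1)))" unfolding abs_mult
   by (rule mult_mono) (use False k in auto)
  also have "\<dots> = 3 * C" by (simp add: field_simps)
  finally show ?thesis .
 qed
 have x1: "\<bar>x * deriv (chi n) x\<bar> \<le> 3 * C1" for n x
  by (rule x[OF b1 _ C1(1)]) (use chi_deriv_far[of n x 1] in simp)
 have x2: "\<bar>x * deriv (deriv (chi n)) x\<bar> \<le> 3 * C2" for n x
  by (rule x[OF b2 _ C2(1)]) (use chi_deriv_far[of n x 2] in \<open>simp add: d2\<close>)
 have b1': "\<bar>deriv (chi n) x\<bar> \<le> C1" for n x
  using b1[of n x] mult_left_mono[OF r(1)[of n], of C1] C1(1) by linarith
 show ?thesis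
 proof (rule that[of "1 + 3 * C1 + 3 * C2"])
  show "\<bar>deriv (xchi n) x\<bar> \<le> 1 + 3 * C1 + 3 * C2" for n x
   unfolding xchi_deriv(1) using x1[of x n] chi_bounds[of n x] C2(1) by linarith
  show "\<bar>deriv (deriv (xchi n)) x\<bar> \<le> 1 + 3 * C1 + 3 * C2" for n x
   unfolding xchi_deriv(2) using x2[of x n] b1'[of n x] C1(1) by linarith
 qed (use C1 C2 in auto)
qed

section \<open>Weighted energy estimate for the ground state\<close>

context gstate begin

lemma euler_lagrange_W2:
 assumes W: "W2 a a1 a2"
 shows "(LI x. phi2 x * a2 x) - \<beta> * (LI x. phi1 x * a1 x) + s * (LI x. phi x * a x) = (LI x. f (phi x) * a x)"
proof -
 note L = W2D[OF W]
 obtain g where g: "\<And>n::nat. test_fun (g n)" "(%n. nrm (%x. deriv (g n) x - a x)) \<longlonglongrightarrow> 0"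
  "(%n. nrm (%x. deriv (deriv (g n)) x - a1 x)) \<longlonglongrightarrow> 0" "(%n. nrm (%x. deriv (deriv (deriv (g n))) x - a2 x)) \<longlonglongrightarrow> 0"
  by (rule density_seq[OF W], rule that)
 have gL: "L2 (deriv (g n))" "L2 (deriv (deriv (g n)))" "L2 (deriv (deriv (deriv (g n))))" for n
  using g(1) test_L2 test_deriv by blast+
 have l: "(%n. LI x. u x * B n x) \<longlonglongrightarrow> (LI x. u x * b x)" if "L2 u" "L2 b" "\<And>n. L2 (B n)" "(%n. ndist (B n) b) \<longlonglongrightarrow> 0" for u b B
  by (rule LINT_tendsto_L2[OF that(1,2,1,3) L2_const_tendsto[OF that(1)] that(4)])
 have 1: "(%n. (LI x. phi2 x * deriv (deriv (deriv (g n))) x) - \<beta> * (LI x. phi1 x * deriv (deriv (g n)) x) + s * (LI x. phi x * deriv (g n) x))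
   \<longlonglongrightarrow> (LI x. phi2 x * a2 x) - \<beta> * (LI x. phi1 x * a1 x) + s * (LI x. phi x * a x)"
  by (intro tendsto_add tendsto_diff tendsto_mult tendsto_const l L2phi L2phi1 L2phi2 L gL g)
 have 2: "(%n. LI x. f (phi x) * deriv (g n) x) \<longlonglongrightarrow> (LI x. f (phi x) * a x)"
  by (rule l[OF fphi_L2 L(1) gL(1) g(2)])
 show ?thesis by (rule LIMSEQ_unique[OF 1]) (use 2 in \<open>simp add: euler_lagrange[OF test_deriv[OF g(1)]]\<close>)
qed

text \<open>Test the Euler-Lagrange equation with t^2 phi and compare with the form at t phi. Apart
  from the nonlinear term, the difference contains derivatives of t only, so for t =
  \<open>xchi n\<close> it stays bounded in n although the weight does not.\<close>

lemma weighted_identity: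
 assumes t: "test_fun t"
 defines "w \<equiv> %x. t x * phi x" and "w1 \<equiv> %x. deriv t x * phi x + t x * phi1 x"
  and "w2 \<equiv> %x. (deriv (deriv t) x * phi x + deriv t x * phi1 x) + (deriv t x * phi1 x + t x * phi2 x)"
 shows "II \<beta> c w w1 w2 = (LI x. f (phi x) * (t x * w x))
  + (nrm (%x. 2 * (deriv t x * phi1 x) + deriv (deriv t) x * phi x))\<^sup>2
  - 2 * (LI x. (deriv t x * phi x) * (deriv t x * phi2 x)) - \<beta> * (nrm (%x. deriv t x * phi x))\<^sup>2"
proof -
 have W: "W2 w w1 w2" unfolding w_def w1_def w2_def by (rule W2_prod[OF t W2phi])
 define a where "a x = t x * w x" for x
 define a1 where "a1 x = deriv t x * w x + t x * w1 x" for x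
 define a2 where "a2 x = (deriv (deriv t) x * w x + deriv t x * w1 x) + (deriv t x * w1 x + t x * w2 x)" for x
 have Wa: "W2 a a1 a2" unfolding a_def[abs_def] a1_def[abs_def] a2_def[abs_def] by (rule W2_prod[OF t W])
 note La = W2D[OF Wa] and L = W2D[OF W]
 have m: "L2 (%x. k x * v x)" if k: "test_fun k" and v: "L2 v" for k v
 proof -
  obtain C where C: "\<And>x. \<bar>k x\<bar> \<le> C" using test_bounded[OF k] by metis
  show ?thesis by (rule nrm_bmult(1)[OF v test_meas[OF k] C])
 qed
 note t1 = test_deriv[OF t] and t2 = test_deriv[OF test_deriv[OF t]]
 have q: "L2 (%x. 2 * (deriv t x * phi1 x) + deriv (deriv t) x * phi x)" by (intro L2_add L2_cmult m t1 t2 L2phi L2phi1)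
 note i = L2_sq[OF q] L2_mult[OF m[OF t1 L2phi] m[OF t1 L2phi2]] L2_mult[OF L2phi2 La(3)]
 have 2: "(nrm w2)\<^sup>2 = (LI x. phi2 x * a2 x) + (nrm (%x. 2 * (deriv t x * phi1 x) + deriv (deriv t) x * phi x))\<^sup>2
   - 2 * (LI x. (deriv t x * phi x) * (deriv t x * phi2 x))"
 proof -
  have "(nrm w2)\<^sup>2 = (LI x. phi2 x * a2 x + (2 * (deriv t x * phi1 x) + deriv (deriv t) x * phi x)\<^sup>2 - 2 * ((deriv t x * phi x) * (deriv t x * phi2 x)))"
   unfolding nrm_sq a2_def w2_def w1_def w_def by (intro Bochner_Integration.integral_cong refl) (simp add: power2_eq_square algebra_simps)
  also have "\<dots> = (LI x. phi2 x * a2 x) + (nrm (%x. 2 * (deriv t x * phi1 x) + deriv (deriv t) x * phi x))\<^sup>2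
   - 2 * (LI x. (deriv t x * phi x) * (deriv t x * phi2 x))" unfolding nrm_sq using i by simp
  finally show ?thesis .
 qed
 have 1: "(nrm w1)\<^sup>2 = (LI x. phi1 x * a1 x) + (nrm (%x. deriv t x * phi x))\<^sup>2"
 proof -
  have "(nrm w1)\<^sup>2 = (LI x. phi1 x * a1 x + (deriv t x * phi x)\<^sup>2)"
   unfolding nrm_sq a1_def w1_def w_def by (intro Bochner_Integration.integral_cong refl) (simp add: power2_eq_square algebra_simps)
  then show ?thesis unfolding nrm_sq using L2_mult[OF L2phi1 La(2)] L2_sq[OF m[OF t1 L2phi]] by simp
 qed
 have 0: "(nrm w)\<^sup>2 = (LI x. phi x * a x)"
  unfolding nrm_sq a_def w_def by (intro Bochner_Integration.integral_cong refl) (simp add: power2_eq_square algebra_simps)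
 have "II \<beta> c w w1 w2 = ((LI x. phi2 x * a2 x) - \<beta> * (LI x. phi1 x * a1 x) + s * (LI x. phi x * a x))
  + (nrm (%x. 2 * (deriv t x * phi1 x) + deriv (deriv t) x * phi x))\<^sup>2
  - 2 * (LI x. (deriv t x * phi x) * (deriv t x * phi2 x)) - \<beta> * (nrm (%x. deriv t x * phi x))\<^sup>2"
  unfolding II_def 0 1 2 s_def by (simp add: algebra_simps)
 then show ?thesis unfolding euler_lagrange_W2[OF Wa] by (simp add: a_def)
qed

text \<open>A compactly supported H2 approximation leaves an error that is small in sup
  norm.\<close>

lemma phi_small:
 assumes d: "\<delta> > 0" obtains R where "R > 0" "AE x in lborel. R \<le> \<bar>x\<bar> --> \<bar>phi x\<bar> \<le> \<delta>"
proof -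
 have d4: "\<delta> / 4 > 0" using d by simp
 obtain b b1 b2 R where b: "W2 b b1 b2" "\<And>x. (b has_real_derivative b1 x) (at x)" "continuous_on UNIV b1"
  "\<And>x. R \<le> \<bar>x\<bar> ==> b x = 0" "appr b b1 b2 phi phi1 phi2 (\<delta> / 4)"
  by (rule trunc_density[OF W2phi d4], rule that)
 have gen: "2 * (A + B) \<le> \<delta>" if "A < \<delta> / 4" "B < \<delta> / 4" for A B using that by simp
 have le: "2 * (ndist b phi + ndist b1 phi1) \<le> \<delta>" using b(5) unfolding appr_def by (elim conjE) (rule gen)
 have "AE x in lborel. \<bar>R\<bar> + 1 \<le> \<bar>x\<bar> --> \<bar>phi x\<bar> \<le> \<delta>"
  using W2_bound[OF W2_diff[OF b(1) W2phi]]
 proof eventually_elim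
  case (elim x)
  then show ?case using le b(4)[of x] by auto
 qed
 then show ?thesis by (rule that[of "\<bar>R\<bar> + 1", rotated]) simp
qed

text \<open>Outside a ball phi is so small that the nonlinear term is absorbed by half the
  coercivity constant; inside, the weight is at most R. Coercivity then bounds (t phi)' uniformly in
  n for t = \<open>xchi n\<close>, and Fatou lets n tend to infinity. This puts the dilation
  generator phi/2 + x phi' in L2.\<close>

lemma xphi1_L2: "L2 (%x. x * phi1 x)"
proof -
 obtain \<theta> where \<theta>: "\<theta> > 0" "\<And>w w1 w2. W2 w w1 w2 ==> II \<beta> c w w1 w2 \<ge> \<theta> * ((nrm w)\<^sup>2 + (nrm w1)\<^sup>2 + (nrm w2)\<^sup>2)"
  by (rule II_coercive, rule that)
 obtain CF where CF: "CF > 0" "\<And>s. \<bar>F s\<bar> \<le> CF * \<bar>s\<bar> powr (p + 1)" by (rule F_growth, rule that)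
 obtain C where C: "C > 0" "\<And>n x. \<bar>deriv (xchi n) x\<bar> \<le> C" "\<And>n x. \<bar>deriv (deriv (xchi n)) x\<bar> \<le> C" by (rule xchi_bounds, rule that)
 define k where "k = (p + 1) * CF"
 have k: "k > 0" using p2 CF(1) by (simp add: k_def)
 \<comment> \<open>Being at most 1 allows |a|^(p+1) <= |a|^3, as p is at least 2, which leaves one
   factor \<open>\<delta>\<close> beyond a^2; the second bound makes it fit under
   \<theta>/2.\<close>
 define \<delta> where "\<delta> = min 1 (\<theta> / (2 * k))"
 have \<delta>: "\<delta> > 0" "\<delta> \<le> 1" "(p + 1) * CF * \<delta> \<le> \<theta> / 2"
 proof -
  show "\<delta> > 0" "\<delta> \<le> 1" using \<theta>(1) k by (auto simp: \<delta>_def)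
  have "k * \<delta> \<le> k * (\<theta> / (2 * k))" using k by (intro mult_left_mono) (auto simp: \<delta>_def)
  then show "(p + 1) * CF * \<delta> \<le> \<theta> / 2" using k by (simp add: k_def[symmetric])
 qed
 have sm: "f a * a \<le> \<theta> / 2 * a\<^sup>2" if a: "\<bar>a\<bar> \<le> \<delta>" for a
 proof -
  have "f a * a = (p + 1) * F a" using p2 by (simp add: F_def)
  also have "\<dots> \<le> (p + 1) * (CF * \<bar>a\<bar> powr (p + 1))" using CF(2)[of a] p2 by (intro mult_left_mono) auto
  also have "\<bar>a\<bar> powr (p + 1) \<le> \<bar>a\<bar> powr 3" by (rule powr_mono') (use a \<delta> p2 in auto)
  also have "\<bar>a\<bar> powr 3 = \<bar>a\<bar> * a\<^sup>2" by (simp add: powr_numeral power3_eq_cube power2_eq_square)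
  also have "\<bar>a\<bar> * a\<^sup>2 \<le> \<delta> * a\<^sup>2" using a by (intro mult_right_mono) auto
  finally have "f a * a \<le> ((p + 1) * CF * \<delta>) * a\<^sup>2" using p2 CF(1) by (simp add: mult.assoc)
  also have "\<dots> \<le> \<theta> / 2 * a\<^sup>2" using \<delta>(3) by (intro mult_right_mono) auto
  finally show ?thesis .
 qed
 obtain R where R: "R > 0" "AE x in lborel. R \<le> \<bar>x\<bar> --> \<bar>phi x\<bar> \<le> \<delta>" by (rule phi_small[OF \<delta>(1)], rule that)
 note ifphi = L2_mult[OF fphi_L2 L2phi]
 define P where "P = R\<^sup>2 * (LI x. \<bar>f (phi x) * phi x\<bar>)"
 define E where "E = P + (2 * (C * nrm phi1) + C * nrm phi)\<^sup>2 + 2 * ((C * nrm phi) * (C * nrm phi2)) + \<bar>\<beta>\<bar> * (C * nrm phi)\<^sup>2"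
 have bound: "\<theta> * (nrm (%x. deriv (xchi n) x * phi x + xchi n x * phi1 x))\<^sup>2 \<le> E" for n
 proof -
  define t where "t = xchi n"
  have t: "test_fun t" unfolding t_def by (rule xchi_test)
  note t1 = test_deriv[OF t] and t2 = test_deriv[OF test_deriv[OF t]]
  have tb: "\<bar>t x\<bar> \<le> \<bar>x\<bar>" "\<bar>deriv t x\<bar> \<le> C" "\<bar>deriv (deriv t) x\<bar> \<le> C" for x unfolding t_def using xchi_le C by auto
  note N1 = nrm_bmult[OF L2phi test_meas[OF t1] tb(2)] and N2 = nrm_bmult[OF L2phi1 test_meas[OF t1] tb(2)]
   and N3 = nrm_bmult[OF L2phi test_meas[OF t2] tb(3)] and N4 = nrm_bmult[OF L2phi2 test_meas[OF t1] tb(2)]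
  define w where "w = (%x. t x * phi x)"
  define w1 where "w1 = (%x. deriv t x * phi x + t x * phi1 x)"
  define w2 where "w2 = (%x. (deriv (deriv t) x * phi x + deriv t x * phi1 x) + (deriv t x * phi1 x + t x * phi2 x))"
  have W: "W2 w w1 w2" unfolding w_def w1_def w2_def by (rule W2_prod[OF t W2phi])
  note L = W2D[OF W]
  have Ww: "L2 (%x. t x * w x)" using W2D(1)[OF W2_prod[OF t W]] .
  have e1: "(LI x. f (phi x) * (t x * w x)) \<le> (LI x. \<theta> / 2 * (w x)\<^sup>2 + R\<^sup>2 * \<bar>f (phi x) * phi x\<bar>)"
  proof (rule integral_mono_AE)
   show "integrable lborel (%x. f (phi x) * (t x * w x))" by (rule L2_mult[OF fphi_L2 Ww])
   show "integrable lborel (%x. \<theta> / 2 * (w x)\<^sup>2 + R\<^sup>2 * \<bar>f (phi x) * phi x\<bar>)" using L2_sq[OF L(1)] ifphi by simp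
   show "AE x in lborel. f (phi x) * (t x * w x) \<le> \<theta> / 2 * (w x)\<^sup>2 + R\<^sup>2 * \<bar>f (phi x) * phi x\<bar>"
    using R(2)
   proof eventually_elim
    case (elim x)
    have e: "f (phi x) * (t x * w x) = (t x)\<^sup>2 * (f (phi x) * phi x)" by (simp add: w_def power2_eq_square)
    show ?case
    proof (cases "R \<le> \<bar>x\<bar>")
     case True
     then have "(t x)\<^sup>2 * (f (phi x) * phi x) \<le> (t x)\<^sup>2 * (\<theta> / 2 * (phi x)\<^sup>2)" using sm elim by (intro mult_left_mono) auto
     also have "\<dots> = \<theta> / 2 * (w x)\<^sup>2" by (simp add: w_def power_mult_distrib)
     finally show ?thesis unfolding e by (rule order_trans) simp
    next
     case False
     then have "(t x)\<^sup>2 \<le> R\<^sup>2" using tb(1)[of x] R(1) by (intro abs_le_square_iff[THEN iffD1]) linarith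
     then have "(t x)\<^sup>2 * (f (phi x) * phi x) \<le> R\<^sup>2 * \<bar>f (phi x) * phi x\<bar>"
      by (rule order_trans[OF mult_left_mono[OF abs_ge_self] mult_right_mono, rotated]) auto
     moreover have "0 \<le> \<theta> / 2 * (w x)\<^sup>2" using \<theta>(1) by simp
     ultimately show ?thesis unfolding e by linarith
    qed
   qed
  qed
  also have "\<dots> = \<theta> / 2 * (nrm w)\<^sup>2 + P" unfolding nrm_sq P_def using L2_sq[OF L(1)] ifphi by simp
  finally have e1: "(LI x. f (phi x) * (t x * w x)) \<le> \<theta> / 2 * (nrm w)\<^sup>2 + P" .
  have e2: "(nrm (%x. 2 * (deriv t x * phi1 x) + deriv (deriv t) x * phi x))\<^sup>2 \<le> (2 * (C * nrm phi1) + C * nrm phi)\<^sup>2"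
  proof (rule power_mono)
   have "nrm (%x. 2 * (deriv t x * phi1 x) + deriv (deriv t) x * phi x) \<le> nrm (%x. 2 * (deriv t x * phi1 x)) + nrm (%x. deriv (deriv t) x * phi x)"
    by (rule nrm_triangle[OF L2_cmult[OF N2(1)] N3(1)])
   then show "nrm (%x. 2 * (deriv t x * phi1 x) + deriv (deriv t) x * phi x) \<le> 2 * (C * nrm phi1) + C * nrm phi"
    using N2(2) N3(2) unfolding nrm_cmult by (simp only: abs_numeral)
  qed simp
  have e3: "\<bar>LI x. (deriv t x * phi x) * (deriv t x * phi2 x)\<bar> \<le> (C * nrm phi) * (C * nrm phi2)"
   by (rule order_trans[OF CS_ineq[OF N1(1) N4(1)] mult_mono[OF N1(2) N4(2)]]) (use C(1) in auto)
  have e4: "- \<beta> * (nrm (%x. deriv t x * phi x))\<^sup>2 \<le> \<bar>\<beta>\<bar> * (C * nrm phi)\<^sup>2"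
   by (rule order_trans[OF mult_right_mono[of "- \<beta>" "\<bar>\<beta>\<bar>"] mult_left_mono[OF power_mono[OF N1(2)]]]) auto
  have id: "II \<beta> c w w1 w2 = (LI x. f (phi x) * (t x * w x))
   + (nrm (%x. 2 * (deriv t x * phi1 x) + deriv (deriv t) x * phi x))\<^sup>2
   - 2 * (LI x. (deriv t x * phi x) * (deriv t x * phi2 x)) - \<beta> * (nrm (%x. deriv t x * phi x))\<^sup>2"
   unfolding w_def w1_def w2_def by (rule weighted_identity[OF t])
  have "\<theta> * ((nrm w)\<^sup>2 + (nrm w1)\<^sup>2 + (nrm w2)\<^sup>2) \<le> \<theta> / 2 * (nrm w)\<^sup>2 + E"
   using \<theta>(2)[OF W] e1 e2 e3 e4 unfolding id E_def by linarith
  moreover have "\<theta> * ((nrm w)\<^sup>2 + (nrm w1)\<^sup>2 + (nrm w2)\<^sup>2) - \<theta> / 2 * (nrm w)\<^sup>2 = \<theta> * (nrm w1)\<^sup>2 + (\<theta> / 2 * (nrm w)\<^sup>2 + \<theta> * (nrm w2)\<^sup>2)"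
   by (simp add: algebra_simps)
  moreover have "0 \<le> \<theta> / 2 * (nrm w)\<^sup>2 + \<theta> * (nrm w2)\<^sup>2" using \<theta>(1) by simp
  ultimately show ?thesis unfolding w1_def t_def by linarith
 qed
 define D where "D = sqrt (E / \<theta>) + C * nrm phi"
 have nb: "L2 (%x. xchi n x * phi1 x)" "nrm (%x. xchi n x * phi1 x) \<le> D" for n
 proof -
  have W: "L2 (%x. deriv (xchi n) x * phi x + xchi n x * phi1 x)" by (rule W2D(2)[OF W2_prod[OF xchi_test W2phi]])
  note N1 = nrm_bmult[OF L2phi test_meas[OF test_deriv[OF xchi_test]] C(2)]
  have e: "(%x. xchi n x * phi1 x) = (%x. (deriv (xchi n) x * phi x + xchi n x * phi1 x) - deriv (xchi n) x * phi x)" by simp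
  show "L2 (%x. xchi n x * phi1 x)" by (subst e) (rule L2_diff[OF W N1(1)])
  have "(nrm (%x. deriv (xchi n) x * phi x + xchi n x * phi1 x))\<^sup>2 \<le> E / \<theta>"
   using bound[of n] \<theta>(1) by (simp add: pos_le_divide_eq mult.commute)
  then have s: "nrm (%x. deriv (xchi n) x * phi x + xchi n x * phi1 x) \<le> sqrt (E / \<theta>)" by (rule real_le_rsqrt)
  show "nrm (%x. xchi n x * phi1 x) \<le> D"
   by (subst e, rule order_trans[OF nrm_triangle_diff[OF W N1(1)]]) (unfold D_def, rule add_mono[OF s N1(2)])
 qed
 have e: "(%x. xchi n x * phi1 x) = (%x. chi n x * (x * phi1 x))" for n by (simp add: xchi_def fun_eq_iff)
 show ?thesis
 proof (rule L2_fatou)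
  show "(%x. x * phi1 x) \<in> borel_measurable borel" using L2_meas[OF L2phi1] by measurable
  show "D \<ge> 0" using order_trans[OF nrm_nonneg nb(2)] .
  show "L2 (%x. chi n x * (x * phi1 x))" "nrm (%x. chi n x * (x * phi1 x)) \<le> D" for n using nb[of n] unfolding e by auto
 qed
qed

end

section \<open>Dilations\<close>

text \<open>The factor sqrt l makes the dilation unitary on L2, so the term (1 - c^2)|u|^2 of I is
  invariant.\<close>

definition dil :: "real => (real => real) => real => real" where "dil l w x = sqrt l * w (l * x)"

lemma LINT_scale: fixes u :: "real => real" assumes "l > 0" shows "(LI x. u (l * x)) = (LI x. u x) / l"
 using lborel_integral_real_affine[of l u 0] assms by simp

lemma dil_L2: assumes "l > 0" "L2 w" shows "L2 (dil l w)" "nrm (dil l w) = nrm w"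
proof -
 note [measurable] = L2_meas[OF assms(2)]
 have e: "(%x. (dil l w x)\<^sup>2) = (%x. l * (w (l * x))\<^sup>2)" using assms(1) by (simp add: dil_def power_mult_distrib fun_eq_iff)
 have i: "integrable lborel (%x. (w (l * x))\<^sup>2)"
  using lborel_integrable_real_affine[OF L2_sq[OF assms(2)], of l 0] assms(1) by simp
 show "L2 (dil l w)"
 proof (rule L2I)
  show "dil l w \<in> borel_measurable borel" unfolding dil_def[abs_def] by measurable
  show "integrable lborel (%x. (dil l w x)\<^sup>2)" unfolding e using i by simp
 qed
 have "(nrm (dil l w))\<^sup>2 = (nrm w)\<^sup>2" unfolding nrm_sq e using LINT_scale[OF assms(1), of "%x. (w x)\<^sup>2"] assms(1) by simp
 then show "nrm (dil l w) = nrm w" by (simp add: power2_eq_iff_nonneg)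
qed

lemma dil_weak: assumes l: "l > 0" and W: "weak_deriv u g" and L: "L2 u" "L2 g" shows "weak_deriv (dil l u) (%x. l * dil l g x)"
 unfolding weak_deriv_def
proof (intro conjI allI impI)
 show "loc_int (dil l u)" "loc_int (%x. l * dil l g x)" by (intro L2_loc_int L2_cmult dil_L2(1)[OF l] L)+
 fix t assume t: "test_fun t"
 define k where "k = (%x. t (1 / l * x + 0))"
 have k: "test_fun k" unfolding k_def by (rule test_affine[OF t]) (use l in simp)
 have dk: "deriv k = (%x. 1 / l * deriv t (1 / l * x + 0))" unfolding k_def by (rule deriv_affine[OF test_smooth[OF t]])
 have "(LI x. dil l u x * deriv t x) = (LI x. (sqrt l * l) * (u (l * x) * deriv k (l * x)))"
  by (intro Bochner_Integration.integral_cong refl) (use l in \<open>simp add: dil_def dk\<close>)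
 also have "\<dots> = sqrt l * (LI x. u x * deriv k x)"
  using LINT_scale[OF l, of "%x. u x * deriv k x"] l by simp
 also have "(LI x. u x * deriv k x) = - (LI x. g x * k x)" using W k by (simp add: weak_deriv_def)
 also have "sqrt l * - (LI x. g x * k x) = - (LI x. (sqrt l * l) * (g (l * x) * k (l * x)))"
  using LINT_scale[OF l, of "%x. g x * k x"] l by simp
 also have "(LI x. (sqrt l * l) * (g (l * x) * k (l * x))) = (LI x. l * dil l g x * t x)"
  by (intro Bochner_Integration.integral_cong refl) (use l in \<open>simp add: dil_def k_def\<close>)
 finally show "(LI x. dil l u x * deriv t x) = - (LI x. l * dil l g x * t x)" .
qed

lemma weak_deriv_cmult: "weak_deriv u g ==> weak_deriv (%x. a * u x) (%x. a * g x)"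
 using weak_deriv_lin[of u g u g a 0] by simp

lemma dil_W2: assumes l: "l > 0" and W: "W2 u u1 u2" shows "W2 (dil l u) (%x. l * dil l u1 x) (%x. l * (l * dil l u2 x))"
proof -
 note L = W2D[OF W]
 show ?thesis unfolding W2_def
  by (intro conjI L2_cmult dil_L2(1)[OF l] L dil_weak[OF l] weak_deriv_cmult)
qed

text \<open>The dilation group has generator V = u/2 + x u'. Pairing the integrated identity with
  the difference g itself turns it into the scalar estimate |g|^2 <= \<tau> |V| |g|, since dilations
  preserve the norm of V.\<close>

lemma dil_lipschitz:
 assumes W: "W2 u u1 u2" and D: "L2 (%x. x * u1 x)" and t: "\<tau> > 0"
 shows "nrm (%x. dil (exp \<tau>) u x - u x) \<le> \<tau> * nrm (%x. u x / 2 + x * u1 x)"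
proof -
 note L = W2D[OF W]
 obtain U U1 where U: "\<And>x. (U has_real_derivative U1 x) (at x)" "continuous_on UNIV U1" "AE x in lborel. u x = U x" "AE x in lborel. u1 x = U1 x"
  by (rule W2_rep[OF W], rule that)
 have Uc: "continuous_on UNIV U" using U(1) by (meson DERIV_isCont continuous_at_imp_continuous_on)
 have [measurable]: "U \<in> borel_measurable borel" "U1 \<in> borel_measurable borel" using Uc U(2) by (auto intro: borel_measurable_continuous_onI)
 note [measurable] = L2_meas[OF L(1)] L2_meas[OF L(2)]
 define V where "V x = U x / 2 + x * U1 x" for x
 have Vc: "continuous_on UNIV V" unfolding V_def by (intro continuous_intros Uc U(2)) auto
 have UL: "L2 U" by (rule L2_cong_AE[OF L(1) U(3)]) measurable
 have vL: "L2 (%x. u x / 2 + x * u1 x)" using L2_add[OF L2_cmult[OF L(1), of "1/2"] D] by simp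
 have ae: "AE x in lborel. u x / 2 + x * u1 x = V x" using U(3,4) by eventually_elim (simp add: V_def)
 have VL: "L2 V" by (rule L2_cong_AE[OF vL ae]) (use Vc in \<open>simp add: borel_measurable_continuous_onI\<close>)
 have nV: "nrm (%x. u x / 2 + x * u1 x) = nrm V" by (rule nrm_cong_AE[OF ae L2_meas[OF vL] L2_meas[OF VL]])
 define g where "g x = dil (exp \<tau>) U x - U x" for x
 have gL: "L2 g" unfolding g_def by (intro L2_diff dil_L2(1) UL) simp
 have gc: "continuous_on UNIV g" unfolding g_def dil_def by (intro continuous_intros continuous_on_compose2[OF Uc] Uc) auto
 have e2: "sqrt (exp r) = exp (r / 2)" for r :: real using exp_double[of "r / 2"] by (simp add: real_sqrt_unique)
 have ng: "nrm (%x. dil (exp \<tau>) u x - u x) = nrm g"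
 proof -
  have a: "L2 (%x. dil (exp \<tau>) u x - dil (exp \<tau>) U x)" "L2 (%x. u x - U x)"
   by (intro L2_diff dil_L2(1) UL L(1) exp_gt_zero)+
  have "ndist u U = 0"
  proof -
   have "ndist u U = nrm (%x. 0)" by (rule nrm_cong_AE) (use U(3) in auto)
   then show ?thesis by (simp add: nrm_def)
  qed
  moreover have "(%x. dil (exp \<tau>) u x - dil (exp \<tau>) U x) = dil (exp \<tau>) (%x. u x - U x)" by (simp add: dil_def fun_eq_iff right_diff_distrib)
  ultimately have z: "nrm (%x. dil (exp \<tau>) u x - dil (exp \<tau>) U x) = 0" "ndist u U = 0"
   using dil_L2(2)[OF exp_gt_zero a(2), of \<tau>] by simp_all
  have "AE x in lborel. dil (exp \<tau>) u x - u x = g x"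
   using nrm_zero_AE[OF a(1) z(1)] nrm_zero_AE[OF a(2) z(2)] by eventually_elim (simp add: g_def)
  then show ?thesis by (rule nrm_cong_AE) (auto intro!: L2_meas L2_diff dil_L2(1) L(1) gL)
 qed
 define N where "N r x = dil (exp r) V x * g x" for r x
 have key: "((%r. LI x. N r x) has_integral (LI x. g x * g x)) {0..\<tau>}"
 proof (rule fubini_time[where C="nrm V * nrm g"])
  show "0 \<le> \<tau>" using t by simp
  show "continuous_on ({0..\<tau>} \<times> UNIV) (%z. N (fst z) (snd z))"
   unfolding N_def dil_def by (intro continuous_intros continuous_on_compose2[OF Vc] continuous_on_compose2[OF gc]) auto
  have VL': "L2 (dil (exp r) V)" "nrm (dil (exp r) V) = nrm V" for r by (rule dil_L2[OF exp_gt_zero VL])+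
  show "integrable lborel (N r)" for r unfolding N_def by (rule L2_mult[OF VL'(1) gL])
  show "(LI x. \<bar>N r x\<bar>) \<le> nrm V * nrm g" for r
  proof -
   have "\<bar>LI x. \<bar>dil (exp r) V x\<bar> * \<bar>g x\<bar>\<bar> \<le> nrm (%x. \<bar>dil (exp r) V x\<bar>) * nrm (%x. \<bar>g x\<bar>)"
    by (rule CS_ineq[OF L2_abs[OF VL'(1)] L2_abs[OF gL]])
   then show ?thesis unfolding N_def by (simp add: abs_mult VL'(2))
  qed
  show "((%r. N r x) has_integral g x * g x) {0..\<tau>}" for x
  proof -
   have "((%r. dil (exp r) V x) has_integral (dil (exp \<tau>) U x - dil (exp 0) U x)) {0..\<tau>}"
   proof (rule fundamental_theorem_of_calculus)
    fix r assume "r \<in> {0..\<tau>}"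
    have "((%r. exp (r / 2) * U (exp r * x)) has_real_derivative (exp (r / 2) / 2) * U (exp r * x) + (U1 (exp r * x) * (exp r * x)) * exp (r / 2)) (at r)"
    proof (rule DERIV_mult)
     show "((%r. exp (r / 2)) has_real_derivative exp (r / 2) / 2) (at r)" by (auto intro!: derivative_eq_intros)
     have "((%r. exp r * x) has_real_derivative exp r * x) (at r)" by (auto intro!: derivative_eq_intros)
     from DERIV_chain2[OF U(1) this] show "((%r. U (exp r * x)) has_real_derivative U1 (exp r * x) * (exp r * x)) (at r)" .
    qed
    then have "((%r. dil (exp r) U x) has_real_derivative dil (exp r) V x) (at r)"
     by (simp add: dil_def e2 V_def algebra_simps)
    then show "((%r. dil (exp r) U x) has_vector_derivative dil (exp r) V x) (at r within {0..\<tau>})"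
     unfolding has_real_derivative_iff_has_vector_derivative by (rule has_vector_derivative_at_within)
   qed (use t in simp)
   from has_integral_mult_left[OF this, of "g x"] show ?thesis by (simp add: N_def g_def dil_def)
  qed
 qed
 have "norm (LI x. g x * g x) \<le> (nrm V * nrm g) * measure lborel (cbox 0 \<tau>)"
 proof (rule has_integral_bound)
  show "((%r. LI x. N r x) has_integral (LI x. g x * g x)) (cbox 0 \<tau>)" using key by simp
  fix r
  show "norm (LI x. N r x) \<le> nrm V * nrm g"
   unfolding N_def using CS_ineq[OF dil_L2(1)[OF exp_gt_zero VL] gL, of r] dil_L2(2)[OF exp_gt_zero VL, of r] by simp
 qed simp
 then have "nrm g * nrm g \<le> (\<tau> * nrm V) * nrm g"
  using t nrm_sq[of g] by (simp add: power2_eq_square mult_ac)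
 then have "nrm g \<le> \<tau> * nrm V"
 proof (cases "nrm g = 0")
  case True then show ?thesis using t by simp
 next
  case False
  then have "nrm g > 0" using nrm_nonneg[of g] by linarith
  with \<open>nrm g * nrm g \<le> (\<tau> * nrm V) * nrm g\<close> show ?thesis by (rule mult_right_le_imp_le)
 qed
 then show ?thesis unfolding ng nV .
qed

section \<open>Second-order Taylor expansion of F and scaling laws\<close>

context nonlin begin

text \<open>Uniform continuity of f' on a compact interval bounds its increments by \<epsilon>; two
  applications of the mean value inequality lift this to the remainder of F.\<close>

lemma F_taylor2:
 assumes e: "e > 0"
 obtains d where "d > 0" "\<And>a b. \<bar>a\<bar> \<le> M ==> \<bar>b\<bar> \<le> d ==> \<bar>F (a + b) - F a - f a * b - deriv f a * b\<^sup>2 / 2\<bar> \<le> e * b\<^sup>2"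
  "\<And>a b. \<bar>a\<bar> \<le> M ==> \<bar>b\<bar> \<le> d ==> \<bar>deriv f (a + b) - deriv f a\<bar> \<le> e"
proof -
 define K where "K = {- (\<bar>M\<bar> + 1)..\<bar>M\<bar> + 1}"
 have "uniformly_continuous_on K (deriv f)"
  by (rule compact_uniformly_continuous) (use f'c continuous_on_subset in \<open>auto simp: K_def\<close>)
 then obtain d0 where d0: "d0 > 0" "\<And>x y. x \<in> K ==> y \<in> K ==> dist y x < d0 ==> dist (deriv f y) (deriv f x) < e"
  unfolding uniformly_continuous_on_def using e by metis
 define d where "d = min (d0 / 2) 1"
 have d: "d > 0" "d \<le> 1" "d < d0" using d0(1) by (auto simp: d_def)
 have 0: "\<bar>deriv f (a + b) - deriv f a\<bar> \<le> e" if ab: "\<bar>a\<bar> \<le> M" "\<bar>b\<bar> \<le> d" for a b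
 proof -
  have "a \<in> K" "a + b \<in> K" unfolding K_def atLeastAtMost_iff using ab d(2) by linarith+
  from d0(2)[OF this] show ?thesis using ab(2) d(3) by (simp add: dist_real_def)
 qed
 have sh: "((%x. h (a + x)) has_real_derivative h' (a + z)) (at z within S)" if "\<And>x. (h has_real_derivative h' x) (at x)" for h h' :: "real => real" and a z S
  using has_field_derivative_at_within[OF DERIV_affine[of h "h' (1 * z + a)" 1 z a, OF that]] by (simp add: add.commute)
 have 1: "\<bar>f (a + b) - f a - deriv f a * b\<bar> \<le> e * \<bar>b\<bar>" if ab: "\<bar>a\<bar> \<le> M" "\<bar>b\<bar> \<le> d" for a b
 proof -
  have "norm ((f (a + b) - deriv f a * b) - (f (a + 0) - deriv f a * 0)) \<le> e * norm (b - 0)"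
  proof (rule field_differentiable_bound[of "{- \<bar>b\<bar>..\<bar>b\<bar>}" "%x. f (a + x) - deriv f a * x" "%x. deriv f (a + x) - deriv f a"])
   fix z assume z: "z \<in> {- \<bar>b\<bar>..\<bar>b\<bar>}"
   show "((%x. f (a + x) - deriv f a * x) has_real_derivative deriv f (a + z) - deriv f a) (at z within {- \<bar>b\<bar>..\<bar>b\<bar>})"
    by (intro DERIV_diff sh fd) (auto intro!: derivative_eq_intros)
   show "norm (deriv f (a + z) - deriv f a) \<le> e" using 0[OF ab(1), of z] z ab(2) by auto
  qed auto
  then show ?thesis by simp
 qed
 have 2: "\<bar>F (a + b) - F a - f a * b - deriv f a * b\<^sup>2 / 2\<bar> \<le> e * b\<^sup>2" if ab: "\<bar>a\<bar> \<le> M" "\<bar>b\<bar> \<le> d" for a b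
 proof -
  have "norm ((F (a + b) - f a * b - deriv f a / 2 * b\<^sup>2) - (F (a + 0) - f a * 0 - deriv f a / 2 * 0\<^sup>2)) \<le> (e * \<bar>b\<bar>) * norm (b - 0)"
  proof (rule field_differentiable_bound[of "{- \<bar>b\<bar>..\<bar>b\<bar>}" "%x. F (a + x) - f a * x - deriv f a / 2 * x\<^sup>2" "%x. f (a + x) - f a - deriv f a * x"])
   fix z assume z: "z \<in> {- \<bar>b\<bar>..\<bar>b\<bar>}"
   show "((%x. F (a + x) - f a * x - deriv f a / 2 * x\<^sup>2) has_real_derivative f (a + z) - f a - deriv f a * z) (at z within {- \<bar>b\<bar>..\<bar>b\<bar>})"
    by (intro DERIV_diff sh Fd) (auto intro!: derivative_eq_intros)
   have zb: "\<bar>z\<bar> \<le> \<bar>b\<bar>" using z by auto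
   have "\<bar>f (a + z) - f a - deriv f a * z\<bar> \<le> e * \<bar>z\<bar>" using 1[OF ab(1), of z] zb ab(2) by linarith
   then show "norm (f (a + z) - f a - deriv f a * z) \<le> e * \<bar>b\<bar>" using mult_left_mono[OF zb, of e] e unfolding real_norm_def by linarith
  qed auto
  then show ?thesis by (simp add: power2_eq_square)
 qed
 show ?thesis by (rule that[OF d(1) 2 0])
qed

lemma KK_dil: assumes l: "l > 0" shows "KK (dil l w) = l powr ((p - 1) / 2) * KK w"
proof -
 have "F (dil l w x) = l powr ((p + 1) / 2) * F (w (l * x))" for x
  unfolding dil_def using F_hom[of "sqrt l" "w (l * x)"] l by (simp add: powr_half_sqrt[symmetric] powr_powr)
 then have "KK (dil l w) = (p + 1) * (l powr ((p + 1) / 2) * ((LI x. F (w x)) / l))"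
  unfolding KK_def using LINT_scale[OF l, of "%x. F (w x)"] by simp
 also have "l powr ((p + 1) / 2) = l powr ((p - 1) / 2) * l" using powr_add[of l "(p - 1) / 2" 1] l by (simp add: field_simps)
 finally show ?thesis using l by (simp add: KK_def)
qed

lemma II_dil: assumes l: "l > 0" and W: "W2 w w1 w2"
 shows "II \<beta> c (dil l w) (%x. l * dil l w1 x) (%x. l * (l * dil l w2 x)) = l ^ 4 * (nrm w2)\<^sup>2 - \<beta> * (l\<^sup>2 * (nrm w1)\<^sup>2) + (1 - c\<^sup>2) * (nrm w)\<^sup>2"
 using dil_L2(2)[OF l W2D(1)[OF W]] dil_L2(2)[OF l W2D(2)[OF W]] dil_L2(2)[OF l W2D(3)[OF W]] l
 unfolding II_def nrm_cmult by (simp add: power_mult_distrib power2_eq_square power4_eq_xxxx mult_ac)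

end

section \<open>Pohozaev identity and second variation along dilations\<close>

context gstate begin

text \<open>Along the dilations of \<open>phi\<close> the quotient inequality says that G is
  nonnegative, and G(0) = 0; the identity is G'(0) = 0. Every norm scales explicitly, so the
  differentiation is of elementary functions of t.\<close>

lemma pohozaev: "4 * (nrm phi2)\<^sup>2 - 2 * \<beta> * (nrm phi1)\<^sup>2 = (p - 1) / (p + 1) * Iphi"
proof -
 \<comment> \<open>K scales by exp((p - 1)t/2) and enters with the power 2/(p + 1), which gives this
   rate.\<close>
 define q where "q = (p - 1) / (p + 1)"
 define G where "G t = exp (4 * t) * (nrm phi2)\<^sup>2 - \<beta> * (exp (2 * t) * (nrm phi1)\<^sup>2) + (1 - c\<^sup>2) * (nrm phi)\<^sup>2 - exp (q * t) * Iphi" for t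
 have mI: "m * Iphi powr (2 / (p + 1)) = Iphi"
 proof -
  have "m * Iphi powr (2 / (p + 1)) = m powr 1 * m powr ((p + 1) / (p - 1) * (2 / (p + 1)))" using gs_facts(1) m_facts(1) by (simp add: powr_powr)
  also have "\<dots> = m powr (1 + (p + 1) / (p - 1) * (2 / (p + 1)))" by (simp only: powr_add)
  also have "(p + 1) / (p - 1) * (2 / (p + 1)) = 2 / (p - 1)"
  proof -
   have "a / b * (2 / a) = 2 / b" if "a \<noteq> 0" for a b :: real using that by simp
   then show ?thesis using p2 by (metis add_nonneg_pos not_one_less_zero less_irrefl order_trans zero_le_numeral zero_less_one)
  qed
  also have "1 + 2 / (p - 1) = (p + 1) / (p - 1)" using p2 by (simp add: field_simps)
  finally show ?thesis using gs_facts(1) by simp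
 qed
 have G0: "0 \<le> G t" for t
 proof -
  have W: "W2 (dil (exp t) phi) (%x. exp t * dil (exp t) phi1 x) (%x. exp t * (exp t * dil (exp t) phi2 x))" by (rule dil_W2[OF exp_gt_zero W2phi])
  have K: "KK (dil (exp t) phi) = exp ((p - 1) / 2 * t) * Iphi" using KK_dil[of "exp t" phi] gs_facts(2) by (simp add: powr_def)
  have e: "exp t ^ 4 = exp (4 * t)" "(exp t)\<^sup>2 = exp (2 * t)" by (simp_all add: exp_of_nat_mult[symmetric])
  have "KK (dil (exp t) phi) powr (2 / (p + 1)) = exp (q * t) * Iphi powr (2 / (p + 1))"
  proof -
   have ep: "exp x powr b = exp (b * x)" for x b :: real by (simp add: powr_def)
   have "2 / a * (b / 2 * t) = b / a * t" for a b :: real by simp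
   then show ?thesis unfolding K q_def using gs_facts(3) by (simp only: powr_mult ep)
  qed
  then have "m * KK (dil (exp t) phi) powr (2 / (p + 1)) = exp (q * t) * Iphi" using mI by simp
  then show ?thesis using m_facts(2)[OF W] K gs_facts(3) unfolding II_dil[OF exp_gt_zero W2phi] e G_def by simp
 qed
 have "G 0 = 0" by (simp add: G_def II_def)
 have d: "(G has_real_derivative 4 * (nrm phi2)\<^sup>2 - \<beta> * (2 * (nrm phi1)\<^sup>2) - q * Iphi) (at 0)"
  unfolding G_def by (auto intro!: derivative_eq_intros)
 have "4 * (nrm phi2)\<^sup>2 - \<beta> * (2 * (nrm phi1)\<^sup>2) - q * Iphi = 0"
  by (rule DERIV_local_min[OF d, of 1]) (use G0 \<open>G 0 = 0\<close> in auto)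
 then show ?thesis by (simp add: q_def)
qed

text \<open>Assume the contrary and put A = |phi''|^2, B = |phi'|^2, C = |phi|^2, y = \<beta> B/A.
  The Pohozaev identity expresses s C through A and \<beta> B, interpolation gives B^2 <= A C, and
  \<beta> is bounded by hypothesis; together these contradict the assumed lower bound 2(p - 9) <= (p
  - 5) y.\<close>

lemma second_variation_negative:
 assumes p9: "p \<ge> 9" and b: "\<beta> < (p - 1) * (p - 9) / ((p - 1)\<^sup>2 + 16) * (2 * sqrt s)"
 shows "(p - 5) * (\<beta> * (nrm phi1)\<^sup>2) < 2 * (p - 9) * (nrm phi2)\<^sup>2"
proof (rule ccontr)
 assume neg: "\<not> ?thesis"
 define A where "A = (nrm phi2)\<^sup>2"
 define B where "B = (nrm phi1)\<^sup>2"
 define C where "C = (nrm phi)\<^sup>2"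
 have pos: "A > 0" "B > 0" "C > 0" using phi1_pos by (auto simp: A_def B_def C_def)
 have n: "2 * (p - 9) * A \<le> (p - 5) * (\<beta> * B)" using neg by (simp add: A_def B_def)
 have "0 \<le> 2 * (p - 9) * A" using p9 pos by simp
 then have "0 \<le> (p - 5) * (\<beta> * B)" using n by linarith
 then have "0 \<le> \<beta> * B" using p9 by (simp add: zero_le_mult_iff)
 then have b0: "\<beta> \<ge> 0" using pos by (simp add: zero_le_mult_iff)
 define T where "T = (p - 1) * (p - 9) / ((p - 1)\<^sup>2 + 16)"
 have s: "sqrt s > 0" "(sqrt s)\<^sup>2 = s" using s_pos by auto
 have "p \<noteq> 9"
 proof
  assume "p = 9"
  then show False using b b0 by simp
 qed
 then have p9': "p > 9" using p9 by simp
 then have "0 < 2 * (p - 9) * A" using pos by simp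
 then have "0 < (p - 5) * (\<beta> * B)" using n by linarith
 then have yp: "\<beta> * B > 0" using p9 by (simp add: zero_less_mult_iff)
 then have bp: "\<beta> > 0" using pos by (simp add: zero_less_mult_iff)
 have T0: "T > 0" using p9' by (simp add: T_def add_nonneg_pos)
 have "\<beta>\<^sup>2 < (T * (2 * sqrt s))\<^sup>2" using b bp unfolding T_def[symmetric] by (intro power_strict_mono) auto
 also have "\<dots> = 4 * T\<^sup>2 * s" using s by (simp add: power_mult_distrib)
 finally have b2: "\<beta>\<^sup>2 < 4 * T\<^sup>2 * s" .
 have BC: "B\<^sup>2 \<le> A * C"
 proof -
  have "(B)\<^sup>2 \<le> (nrm phi * nrm phi2)\<^sup>2" unfolding B_def by (intro power_mono W2_interp[OF W2phi]) simp
  then show ?thesis by (simp add: A_def C_def power_mult_distrib mult.commute)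
 qed
 have I: "Iphi = A - \<beta> * B + s * C" by (simp add: II_def A_def B_def C_def s_def)
 have P: "(p + 1) * (4 * A - 2 * (\<beta> * B)) = (p - 1) * (A - \<beta> * B + s * C)"
  using pohozaev p2 unfolding I A_def[symmetric] B_def[symmetric] by (simp add: field_simps)
 then have sC: "(p - 1) * (s * C) = A * (3 * p + 5) - (\<beta> * B) * (p + 3)" by (simp add: algebra_simps)
 define y where "y = \<beta> * B / A"
 have y: "\<beta> * B = y * A" "y > 0" using pos yp by (auto simp: y_def)
 have y0: "2 * (p - 9) \<le> (p - 5) * y" using n pos unfolding y(1) by (simp add: mult.assoc[symmetric])
 have "y\<^sup>2 * A\<^sup>2 * s * (p - 1) = \<beta>\<^sup>2 * (B\<^sup>2 * (s * (p - 1)))" using y(1) by (simp add: power_mult_distrib[symmetric] mult_ac)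
 also have "\<dots> \<le> \<beta>\<^sup>2 * ((A * C) * (s * (p - 1)))" using BC s_pos p9 by (intro mult_left_mono mult_right_mono) auto
 also have "\<dots> = \<beta>\<^sup>2 * (A * ((p - 1) * (s * C)))" by (simp add: mult_ac)
 also have "\<dots> = \<beta>\<^sup>2 * (A\<^sup>2 * (3 * p + 5 - y * (p + 3)))" unfolding sC y(1) by (simp add: power2_eq_square algebra_simps)
 \<comment> \<open>Interpolation with s C eliminated and A^2 divided out: a relation between y, s,
   \<beta> and p alone.\<close>
 finally have 1: "y\<^sup>2 * s * (p - 1) \<le> \<beta>\<^sup>2 * (3 * p + 5 - y * (p + 3))"
  using pos by (simp add: mult.assoc mult.left_commute[of _ "A\<^sup>2"])
 define Z where "Z = 3 * p + 5 - y * (p + 3)"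
 have "0 < y\<^sup>2 * s * (p - 1)" using y(2) s_pos p9 by simp
 then have "0 < \<beta>\<^sup>2 * Z" using 1 unfolding Z_def by linarith
 then have Z: "Z > 0" using bp by (simp add: zero_less_mult_iff)
 have "\<beta>\<^sup>2 * Z < 4 * T\<^sup>2 * s * Z" using b2 Z by (rule mult_strict_right_mono)
 then have "(y\<^sup>2 * (p - 1)) * s < (4 * T\<^sup>2 * Z) * s" using 1 unfolding Z_def[symmetric] by (simp add: mult_ac)
 then have 2: "y\<^sup>2 * (p - 1) < 4 * T\<^sup>2 * Z" using s_pos by simp
 have 3: "(2 * (p - 9))\<^sup>2 \<le> ((p - 5) * y)\<^sup>2" using y0 p9 by (intro power_mono) auto
 have 4: "(p - 5) * Z \<le> p\<^sup>2 + 2 * p + 29"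
 proof -
  have "(p - 5) * Z = (p - 5) * (3 * p + 5) - ((p - 5) * y) * (p + 3)" by (simp add: Z_def algebra_simps)
  also have "\<dots> \<le> (p - 5) * (3 * p + 5) - (2 * (p - 9)) * (p + 3)" using mult_right_mono[OF y0, of "p + 3"] p9 by simp
  also have "\<dots> = p\<^sup>2 + 2 * p + 29" by (simp add: power2_eq_square algebra_simps)
  finally show ?thesis .
 qed
 have "4 * (p - 9)\<^sup>2 * (p - 1) \<le> ((p - 5) * y)\<^sup>2 * (p - 1)" using mult_right_mono[OF 3, of "p - 1"] p9 unfolding power_mult_distrib[of 2 "p - 9"] by simp
 also have "\<dots> = (p - 5)\<^sup>2 * (y\<^sup>2 * (p - 1))" by (simp add: power_mult_distrib)
 also have "\<dots> < (p - 5)\<^sup>2 * (4 * T\<^sup>2 * Z)" using 2 p9 by (intro mult_strict_left_mono) auto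
 also have "\<dots> = 4 * T\<^sup>2 * (p - 5) * ((p - 5) * Z)" by (simp add: power2_eq_square)
 also have "\<dots> \<le> 4 * T\<^sup>2 * (p - 5) * (p\<^sup>2 + 2 * p + 29)" using 4 p9 by (intro mult_left_mono) auto
 finally have 5: "(p - 9)\<^sup>2 * (p - 1) < T\<^sup>2 * ((p - 5) * (p\<^sup>2 + 2 * p + 29))" by simp
 \<comment> \<open>The denominator of T. The cleared inequality forces E^2 below a quartic in p, but
   E^2 exceeds that quartic by 16 (p + 3)^2.\<close>
 define E where "E = (p - 1)\<^sup>2 + 16"
 have E: "E > 0" by (simp add: E_def add_nonneg_pos)
 have "T\<^sup>2 * E\<^sup>2 = (p - 1)\<^sup>2 * (p - 9)\<^sup>2" using E by (simp add: T_def E_def[symmetric] power_divide power_mult_distrib)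
 then have "((p - 9)\<^sup>2 * (p - 1)) * E\<^sup>2 < ((p - 1)\<^sup>2 * (p - 9)\<^sup>2) * ((p - 5) * (p\<^sup>2 + 2 * p + 29))"
 proof -
  have "((p - 9)\<^sup>2 * (p - 1)) * E\<^sup>2 < (T\<^sup>2 * ((p - 5) * (p\<^sup>2 + 2 * p + 29))) * E\<^sup>2" using 5 by (rule mult_strict_right_mono) (use E in simp)
  also have "\<dots> = (T\<^sup>2 * E\<^sup>2) * ((p - 5) * (p\<^sup>2 + 2 * p + 29))" by (simp only: mult_ac)
  finally show ?thesis using \<open>T\<^sup>2 * E\<^sup>2 = (p - 1)\<^sup>2 * (p - 9)\<^sup>2\<close> by simp
 qed
 then have "((p - 9)\<^sup>2 * (p - 1)) * E\<^sup>2 < ((p - 9)\<^sup>2 * (p - 1)) * ((p - 1) * ((p - 5) * (p\<^sup>2 + 2 * p + 29)))"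
  by (simp add: power2_eq_square[of "p - 1"] mult_ac)
 then have 6: "E\<^sup>2 < (p - 1) * ((p - 5) * (p\<^sup>2 + 2 * p + 29))" using p9' by (simp add: mult_less_cancel_left_pos)
 have "E\<^sup>2 - (p - 1) * ((p - 5) * (p\<^sup>2 + 2 * p + 29)) = 16 * (p - 1)\<^sup>2 + 128 * (p - 1) + 256"
  unfolding E_def by (simp add: power2_eq_square algebra_simps)
 then show False using 6 p9' zero_le_power2[of "p - 1"] by simp
qed

text \<open>For a = dilated phi minus phi, the quadratic form is the increment of the scaling
  function \<open>G 0\<close> up to a small Taylor error, and \<open>G 0\<close> has a strict
  maximum at 0 to second order. A fixed small t is used; adding a multiple of phi makes the profile
  orthogonal to phi, so that k = 0 is admissible in \<open>direction_exists\<close>.\<close>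

lemma direction_case_ii:
 assumes "p \<ge> 9" and "\<beta> < (p - 1) * (p - 9) / ((p - 1)\<^sup>2 + 16) * (2 * sqrt s)"
 shows "\<exists>g w. direction g w"
proof -
 define r where "r = (p - 1) / 2"
 define k where "k = 2 / (p + 1)"
 \<comment> \<open>\<open>G 0\<close> is I - 2K/(p + 1) along dilations, twice the profile part of
   S; \<open>G j\<close> is its j-th derivative in closed form, ready for Maclaurin's
   formula.\<close>
 define G where "G j t = 4 ^ j * (exp (4 * t) * (nrm phi2)\<^sup>2) - 2 ^ j * (\<beta> * (exp (2 * t) * (nrm phi1)\<^sup>2)) + (if j = 0 then s * (nrm phi)\<^sup>2 else 0)
   - k * (r ^ j * (exp (r * t) * Iphi))" for j :: nat and t :: real
 have Gd: "(G j has_real_derivative G (Suc j) t) (at t)" for j t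
  unfolding G_def by (auto intro!: derivative_eq_intros simp: algebra_simps)
 have kr: "k * r = (p - 1) / (p + 1)"
 proof -
  have "2 / a * (b / 2) = b / a" for a b :: real by simp
  then show ?thesis unfolding k_def r_def .
 qed
 have "G 1 0 = 4 * (nrm phi2)\<^sup>2 - 2 * \<beta> * (nrm phi1)\<^sup>2 - (k * r) * Iphi" by (simp add: G_def)
 then have G1: "G 1 0 = 0" unfolding kr using pohozaev by simp
 have pz: "(p - 1) / (p + 1) * Iphi = 4 * (nrm phi2)\<^sup>2 - 2 * \<beta> * (nrm phi1)\<^sup>2" using pohozaev by simp
 have G2: "G 2 0 < 0"
 proof -
  \<comment> \<open>One factor k r is traded for the Pohozaev expression, which leaves only |phi'|^2
    and |phi''|^2.\<close>
  have "k * (r\<^sup>2 * Iphi) = r * ((p - 1) / (p + 1) * Iphi)" unfolding kr[symmetric] by (simp add: power2_eq_square)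
  then have "G 2 0 = 16 * (nrm phi2)\<^sup>2 - 4 * (\<beta> * (nrm phi1)\<^sup>2) - r * (4 * (nrm phi2)\<^sup>2 - 2 * \<beta> * (nrm phi1)\<^sup>2)"
   unfolding pz by (simp add: G_def)
  also have "\<dots> = (p - 5) * (\<beta> * (nrm phi1)\<^sup>2) - 2 * (p - 9) * (nrm phi2)\<^sup>2"    proof -
   have "16 * x - 4 * (b * z) - (p - 1) / 2 * (4 * x - 2 * b * z) = (p - 5) * (b * z) - 2 * (p - 9) * x" for x z b :: real
    by (simp add: field_simps)
   then show ?thesis unfolding r_def .
  qed
  also have "\<dots> < 0" using second_variation_negative[OF assms] by simp
  finally show ?thesis .
 qed
 define \<kappa> where "\<kappa> = - G 2 0"
 have \<kappa>: "\<kappa> > 0" using G2 by (simp add: \<kappa>_def)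
 have "isCont (G 2) 0" by (rule DERIV_isCont[OF Gd])
 then obtain \<eta> where \<eta>: "\<eta> > 0" "\<And>t. \<bar>t\<bar> < \<eta> ==> \<bar>G 2 t - G 2 0\<bar> < \<kappa> / 2"
  unfolding continuous_at_eps_delta using \<kappa> by (metis dist_real_def diff_zero half_gt_zero)
 have Gdec: "G 0 t - G 0 0 \<le> - \<kappa> / 4 * t\<^sup>2" if t: "0 < t" "t < \<eta>" for t
 proof -
  obtain z where z: "0 < z" "z < t" "G 0 t = (\<Sum>m<2. G m 0 / fact m * t ^ m) + G 2 z / fact 2 * t ^ 2"
   using Maclaurin[of t 2 G "G 0"] t Gd by auto
  have "G 2 z \<le> - \<kappa> / 2" using \<eta>(2)[of z] z t by (auto simp: \<kappa>_def)
  then have "G 2 z / 2 * t\<^sup>2 \<le> - \<kappa> / 4 * t\<^sup>2" by (intro mult_right_mono) auto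
  then show ?thesis using z(3) G1 by (simp add: numeral_2_eq_2)
 qed
 define V where "V = nrm (%x. phi x / 2 + x * phi1 x)"
 define M where "M = 2 * (nrm phi + nrm phi1)"
 \<comment> \<open>Chosen so that the Taylor error costs at most \<kappa>/8 t^2 against the gain
   \<kappa>/4 t^2.\<close>
 define \<epsilon> where "\<epsilon> = \<kappa> / (16 * (V\<^sup>2 + 1))"
 have V0: "V \<ge> 0" "V\<^sup>2 + 1 > 0" by (auto simp: V_def add_nonneg_pos)
 have \<epsilon>: "\<epsilon> > 0" using \<kappa> V0 by (simp add: \<epsilon>_def)
 have \<epsilon>V: "2 * \<epsilon> * V\<^sup>2 \<le> \<kappa> / 8"
 proof -
  have "2 * \<epsilon> * V\<^sup>2 \<le> 2 * \<epsilon> * (V\<^sup>2 + 1)" using \<epsilon> by (intro mult_left_mono) auto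
  also have "\<dots> = \<kappa> / 8" using V0(2) unfolding \<epsilon>_def by (simp add: field_simps)
  finally show ?thesis .
 qed
 obtain \<delta> where \<delta>: "\<delta> > 0" "\<And>a b. \<bar>a\<bar> \<le> M ==> \<bar>b\<bar> \<le> \<delta> ==> \<bar>F (a + b) - F a - f a * b - deriv f a * b\<^sup>2 / 2\<bar> \<le> \<epsilon> * b\<^sup>2"
  by (rule F_taylor2[OF \<epsilon>, of M], rule that)
 obtain C where C: "C > 0" "\<And>s. \<bar>s\<bar> \<le> M ==> \<bar>deriv f s\<bar> \<le> C" by (rule local_bounds[of M], rule that)
 define m2 where "m2 t = ((exp t)\<^sup>2 + 1) * nrm phi2" for t :: real
 \<comment> \<open>Requirements on t: \<open>G 0\<close> has dropped by at least \<kappa> t^2/4, the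
   sup norm of a is below \<delta>, and the linear growth of K beats the quadratic errors, so that J
   > 0.\<close>
 have ev: "\<forall>\<^sub>F t in at_right 0. 0 < t \<and> t < \<eta> \<and> 2 * (t * V + sqrt (t * V * m2 t)) < \<delta> \<and> (C / 2 + \<epsilon>) * V\<^sup>2 * t < r * Iphi / (p + 1)"
 proof (intro eventually_conj)
  show "\<forall>\<^sub>F t in at_right 0. (0::real) < t" by (simp add: eventually_at_right_less)
  show "\<forall>\<^sub>F t in at_right 0. t < \<eta>" using \<eta>(1) by (rule eventually_at_right_real[THEN eventually_mono]) simp
  have "((%t. 2 * (t * V + sqrt (t * V * m2 t))) \<longlongrightarrow> 2 * (0 * V + sqrt (0 * V * m2 0))) (at_right 0)"
   unfolding m2_def by (intro tendsto_intros)
  then show "\<forall>\<^sub>F t in at_right 0. 2 * (t * V + sqrt (t * V * m2 t)) < \<delta>" by (rule order_tendstoD(2)) (use \<delta>(1) in simp)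
  have "((%t. (C / 2 + \<epsilon>) * V\<^sup>2 * t) \<longlongrightarrow> (C / 2 + \<epsilon>) * V\<^sup>2 * 0) (at_right 0)" by (intro tendsto_intros)
  then show "\<forall>\<^sub>F t in at_right 0. (C / 2 + \<epsilon>) * V\<^sup>2 * t < r * Iphi / (p + 1)"
   by (rule order_tendstoD(2)) (use gs_facts(3) p2 in \<open>simp add: r_def\<close>)
 qed
 then obtain t where t: "0 < t" "t < \<eta>" "2 * (t * V + sqrt (t * V * m2 t)) < \<delta>" "(C / 2 + \<epsilon>) * V\<^sup>2 * t < r * Iphi / (p + 1)"
  using eventually_happens'[OF trivial_limit_at_right_real] by blast
 define l where "l = exp t"
 have l: "l > 0" by (simp add: l_def)
 define a where "a x = dil l phi x + (-1) * phi x" for x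
 define a1 where "a1 x = l * dil l phi1 x + (-1) * phi1 x" for x
 define a2 where "a2 x = l * (l * dil l phi2 x) + (-1) * phi2 x" for x
 note Wd = dil_W2[OF l W2phi]
 have Wa: "W2 a a1 a2" unfolding a_def a1_def a2_def by (intro W2_add Wd W2_cmult W2phi)
 note La = W2D[OF Wa] and Ld = W2D[OF Wd]
 have na: "nrm a \<le> t * V"
 proof -
  have "(%x. dil (exp t) phi x - phi x) = a" by (simp add: a_def l_def fun_eq_iff)
  then show ?thesis using dil_lipschitz[OF W2phi xphi1_L2 t(1)] by (simp add: V_def)
 qed
 have na2: "nrm a2 \<le> m2 t"
 proof -
  have "nrm a2 \<le> nrm (%x. l * (l * dil l phi2 x)) + nrm (%x. (-1) * phi2 x)" unfolding a2_def by (rule nrm_triangle[OF Ld(3) L2_cmult[OF L2phi2]])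
  also have "\<dots> = m2 t" using l dil_L2(2)[OF l L2phi2] unfolding nrm_cmult m2_def l_def by (simp add: power2_eq_square algebra_simps)
  finally show ?thesis .
 qed
 have na1: "nrm a1 \<le> sqrt (t * V * m2 t)"
 proof (rule real_le_rsqrt)
  show "(nrm a1)\<^sup>2 \<le> t * V * m2 t" by (rule order_trans[OF W2_interp[OF Wa] mult_mono[OF na na2]]) (use t(1) V0 in auto)
 qed
 have ab: "AE x in lborel. \<bar>a x\<bar> \<le> \<delta>"
  using W2_bound[OF Wa]
 proof eventually_elim
  case (elim x)
  have "2 * (nrm a + nrm a1) \<le> 2 * (t * V + sqrt (t * V * m2 t))" using add_mono[OF na na1] by simp
  then show ?case using elim t(3) by linarith
 qed
 have phib: "AE x in lborel. \<bar>phi x\<bar> \<le> M" unfolding M_def by (rule phi_bound)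
 define J where "J = (LI x. f (phi x) * a x)"
 define Q where "Q = (LI x. (deriv f (phi x) * a x) * a x)"
 define rem where "rem = (KK (dil l phi) - KK phi) / (p + 1) - J - Q / 2"
 note iJ = L2_mult[OF fphi_L2 La(1)] and iQ = L2_mult[OF f'phi_L2[OF La(1)] La(1)]
 have rem: "\<bar>rem\<bar> \<le> \<epsilon> * (nrm a)\<^sup>2"
 proof -
  have i: "integrable lborel (%x. F (phi x))" by (rule F_lip[of M]) (use phib L2phi in blast)
  have i2: "integrable lborel (%x. F (dil l phi x))"
   by (rule F_lip[of "2 * (nrm (dil l phi) + nrm (%x. l * dil l phi1 x))"]) (use W2_bound[OF Wd] Ld(1) in blast)
  have k: "KK w / (p + 1) = (LI x. F (w x))" for w using p2 by (simp add: KK_def)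
  have re: "rem = (LI x. F (dil l phi x) - F (phi x) - f (phi x) * a x - (deriv f (phi x) * a x) * a x / 2)"
   unfolding rem_def diff_divide_distrib k J_def Q_def using i i2 iJ iQ by simp
  have "\<bar>rem\<bar> \<le> (LI x. \<epsilon> * (a x)\<^sup>2)" unfolding re
  proof (rule order_trans[OF integral_abs_bound integral_mono_AE])
   show "AE x in lborel. \<bar>F (dil l phi x) - F (phi x) - f (phi x) * a x - (deriv f (phi x) * a x) * a x / 2\<bar> \<le> \<epsilon> * (a x)\<^sup>2"
    using phib ab
   proof eventually_elim
    case (elim x)
    have "phi x + a x = dil l phi x" by (simp add: a_def)
    with \<delta>(2)[OF elim] show ?case by (simp add: power2_eq_square mult.assoc)
   qed
  qed (use i i2 iJ iQ L2_sq[OF La(1)] in auto)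
  then show ?thesis by (simp add: nrm_sq)
 qed
 have na_sq: "(nrm a)\<^sup>2 \<le> V\<^sup>2 * t\<^sup>2" using power_mono[OF na, of 2] by (simp add: power_mult_distrib mult.commute)
 have lr: "l powr ((p - 1) / 2) = exp (r * t)" by (simp add: l_def powr_def r_def)
 have KKd: "KK (dil l phi) = exp (r * t) * Iphi" unfolding KK_dil[OF l] lr using gs_facts(2) by simp
 have IId: "II \<beta> c (dil l phi) (%x. l * dil l phi1 x) (%x. l * (l * dil l phi2 x)) = exp (4 * t) * (nrm phi2)\<^sup>2 - \<beta> * (exp (2 * t) * (nrm phi1)\<^sup>2) + s * (nrm phi)\<^sup>2"
 proof -
  have e: "l ^ 4 = exp (4 * t)" "l\<^sup>2 = exp (2 * t)" by (simp_all add: l_def exp_of_nat_mult[symmetric])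
  show ?thesis unfolding II_dil[OF l W2phi] e s_def ..
 qed
 have IIe: "II \<beta> c (dil l phi) (%x. l * dil l phi1 x) (%x. l * (l * dil l phi2 x)) = Iphi + 2 * J + II \<beta> c a a1 a2"
  using II_lin[OF W2phi Wa, of 1] euler_lagrange_W2[OF Wa] by (simp add: a_def a1_def a2_def J_def)
 \<comment> \<open>First-order terms cancel: the form at the dilated profile contributes 2J by the
   Euler-Lagrange equation, and the expansion of K removes it.\<close>
 have Qa: "Qf a a1 a2 = (G 0 t - G 0 0) + 2 * rem"
 proof -
  have 1: "Qf a a1 a2 = II \<beta> c a a1 a2 - Q" by (simp add: Qf_def II_def s_def Q_def)
  have 2: "2 * rem = k * (exp (r * t) * Iphi) - k * Iphi - 2 * J - Q"
   unfolding rem_def KKd gs_facts(2) k_def by (simp add: diff_divide_distrib)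
  have 3: "G 0 t - G 0 0 = (exp (4 * t) * (nrm phi2)\<^sup>2 - \<beta> * (exp (2 * t) * (nrm phi1)\<^sup>2) + s * (nrm phi)\<^sup>2) - Iphi - (k * (exp (r * t) * Iphi) - k * Iphi)"
   by (simp add: G_def II_def s_def)
  show ?thesis unfolding 1 2 3 IId[symmetric] IIe by simp
 qed
 have Qneg: "Qf a a1 a2 < 0"
 proof -
  have "2 * rem \<le> 2 * (\<epsilon> * (nrm a)\<^sup>2)" using rem by simp
  also have "\<dots> \<le> 2 * (\<epsilon> * (V\<^sup>2 * t\<^sup>2))" using na_sq \<epsilon> by simp
  also have "\<dots> = (2 * \<epsilon> * V\<^sup>2) * t\<^sup>2" by simp
  also have "\<dots> \<le> \<kappa> / 8 * t\<^sup>2" using \<epsilon>V by (rule mult_right_mono) simp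
  finally have "Qf a a1 a2 \<le> - \<kappa> / 4 * t\<^sup>2 + \<kappa> / 8 * t\<^sup>2" using Gdec[OF t(1,2)] unfolding Qa by linarith
  also have "\<dots> < 0" using \<kappa> t(1) by simp
  finally show ?thesis .
 qed
 have Qb: "\<bar>Q\<bar> \<le> C * (nrm a)\<^sup>2"
 proof -
  have "\<bar>Q\<bar> \<le> (LI x. C * (a x)\<^sup>2)" unfolding Q_def
  proof (rule order_trans[OF integral_abs_bound integral_mono_AE])
   show "AE x in lborel. \<bar>(deriv f (phi x) * a x) * a x\<bar> \<le> C * (a x)\<^sup>2"
    using phib by eventually_elim (use C in \<open>auto simp: abs_mult power2_eq_square mult.assoc intro!: mult_right_mono\<close>)
  qed (use iQ L2_sq[OF La(1)] in auto)
  then show ?thesis by (simp add: nrm_sq)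
 qed
 \<comment> \<open>K grows linearly in t along dilations while the corrections are O(t^2).
   Positivity gives the cross term between a and e phi the right sign and provides
   transversality.\<close>
 have Jpos: "J > 0"
 proof -
  have "r * t \<le> exp (r * t) - 1" using exp_ge_add_one_self[of "r * t"] by linarith
  then have "(r * t) * Iphi / (p + 1) \<le> (exp (r * t) - 1) * Iphi / (p + 1)" using gs_facts(3) p2 by (intro divide_right_mono mult_right_mono) auto
  moreover have "J = (exp (r * t) - 1) * Iphi / (p + 1) - Q / 2 - rem" unfolding rem_def KKd gs_facts(2) by (simp add: left_diff_distrib)
  moreover have "Q / 2 + rem \<le> C / 2 * (nrm a)\<^sup>2 + \<epsilon> * (nrm a)\<^sup>2" using Qb rem by simp
  moreover have "C / 2 * (nrm a)\<^sup>2 + \<epsilon> * (nrm a)\<^sup>2 \<le> ((C / 2 + \<epsilon>) * V\<^sup>2 * t) * t"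
   using mult_left_mono[OF na_sq, of "C / 2 + \<epsilon>"] C(1) \<epsilon> by (simp add: algebra_simps power2_eq_square)
  moreover have "((C / 2 + \<epsilon>) * V\<^sup>2 * t) * t < (r * Iphi / (p + 1)) * t" using t(4,1) by (rule mult_strict_right_mono)
  moreover have "(r * t) * Iphi / (p + 1) = (r * Iphi / (p + 1)) * t" by simp
  ultimately show ?thesis by linarith
 qed
 \<comment> \<open>Unitarity of dilations makes pr(a) = -|a|^2/2, of second order; this multiple of
   phi cancels it.\<close>
 define e where "e = (nrm a)\<^sup>2 / (2 * (nrm phi)\<^sup>2)"
 have e0: "e \<ge> 0" by (simp add: e_def)
 have pra: "pr a = - (nrm a)\<^sup>2 / 2"
 proof -
  have "(nrm (%x. dil l phi x + (-1) * phi x))\<^sup>2 = (nrm (dil l phi))\<^sup>2 + 2 * (-1) * (LI x. dil l phi x * phi x) + (-1)\<^sup>2 * (nrm phi)\<^sup>2"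
   by (rule nrm_lin_sq[OF Ld(1) L2phi])
  then have 1: "(nrm a)\<^sup>2 = 2 * (nrm phi)\<^sup>2 - 2 * (LI x. phi x * dil l phi x)"
   using dil_L2(2)[OF l L2phi] by (simp add: a_def[abs_def] mult.commute)
  have "pr a = (LI x. phi x * dil l phi x) - (nrm phi)\<^sup>2"
  proof -
   have "pr a = (LI x. phi x * dil l phi x - (phi x)\<^sup>2)" unfolding pr_def a_def
    by (intro Bochner_Integration.integral_cong refl) (simp add: power2_eq_square algebra_simps)
   then show ?thesis using L2_mult[OF L2phi Ld(1)] L2_sq[OF L2phi] by (simp add: nrm_sq)
  qed
  then show ?thesis using 1 by simp
 qed
 note Wb = W2_add[OF Wa W2_cmult[OF W2phi, of e]]
 show ?thesis
 proof (rule direction_exists[OF Wb, of 0])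
  have "pr (%x. 1 * a x + e * phi x) = 1 * pr a + e * pr phi" by (rule pr_lin[OF La(1) L2phi])
  moreover have "pr phi = (nrm phi)\<^sup>2" unfolding pr_def nrm_sq by (simp add: power2_eq_square)
  ultimately have "pr (%x. a x + e * phi x) = 0" using pra phi1_pos(1) by (simp add: e_def)
  then show "0 = 2 * c \<or> pr (%x. a x + e * phi x) = 0" by simp
  have J': "(LI x. a2 x * phi2 x) - \<beta> * (LI x. a1 x * phi1 x) + s * (LI x. a x * phi x) = J"
   using euler_lagrange_W2[OF Wa] by (simp add: J_def mult.commute)
  have Kphi: "(LI x. f (phi x) * phi x) = Iphi"
  proof -
   have "KK phi = (LI x. f (phi x) * phi x)" using p2 by (simp add: KK_def F_def mult.commute)
   then show ?thesis using gs_facts(2) by simp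
  qed
  have Q': "(LI x. (deriv f (phi x) * (a x + e * phi x)) * (a x + e * phi x)) = Q + 2 * e * (p * J) + e\<^sup>2 * (p * Iphi)"
  proof -
   have "(LI x. (deriv f (phi x) * (a x + e * phi x)) * (a x + e * phi x))
    = (LI x. (deriv f (phi x) * a x) * a x + (2 * e) * ((deriv f (phi x) * phi x) * a x) + e\<^sup>2 * ((deriv f (phi x) * phi x) * phi x))"
    by (intro Bochner_Integration.integral_cong refl) (simp add: power2_eq_square algebra_simps)
   also have "\<dots> = Q + 2 * e * (p * J) + e\<^sup>2 * (p * (LI x. f (phi x) * phi x))"
    unfolding euler mult.assoc[of p] using iQ iJ L2_mult[OF fphi_L2 L2phi] by (simp add: Q_def J_def)
   finally show ?thesis unfolding Kphi .
  qed
  have "Qf (%x. a x + e * phi x) (%x. a1 x + e * phi1 x) (%x. a2 x + e * phi2 x)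
    = II \<beta> c (%x. a x + e * phi x) (%x. a1 x + e * phi1 x) (%x. a2 x + e * phi2 x) - (Q + 2 * e * (p * J) + e\<^sup>2 * (p * Iphi))"
   unfolding Qf_def Q' by (simp add: II_def s_def)
  also have "\<dots> = Qf a a1 a2 - (2 * e * ((p - 1) * J) + e\<^sup>2 * ((p - 1) * Iphi))"
  proof -
   have 1: "Qf a a1 a2 = II \<beta> c a a1 a2 - Q" by (simp add: Qf_def II_def s_def Q_def)
   show ?thesis unfolding II_lin[OF Wa W2phi] J' 1 by (simp add: left_diff_distrib right_diff_distrib)
  qed
  also have "\<dots> \<le> Qf a a1 a2"
  proof -
   have "0 \<le> 2 * e * ((p - 1) * J)" "0 \<le> e\<^sup>2 * ((p - 1) * Iphi)" using e0 Jpos gs_facts(3) p2 by (intro mult_nonneg_nonneg; simp)+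
   then show ?thesis by linarith
  qed
  also have "\<dots> < 0" by (rule Qneg)
  finally show "Qf (%x. a x + e * phi x) (%x. a1 x + e * phi1 x) (%x. a2 x + e * phi2 x) + 0\<^sup>2 * (nrm (%x. a x + e * phi x))\<^sup>2 < 0" by simp
  have "(LI x. f (phi x) * (a x + e * phi x)) = (LI x. f (phi x) * a x + e * (f (phi x) * phi x))"
   by (intro Bochner_Integration.integral_cong refl) (simp add: algebra_simps)
  also have "\<dots> = J + e * Iphi" unfolding Kphi[symmetric] using iJ L2_mult[OF fphi_L2 L2phi] by (simp add: J_def)
  finally show "(LI x. f (phi x) * (a x + e * phi x)) \<noteq> 0" using Jpos mult_nonneg_nonneg[OF e0, of Iphi] gs_facts(3) by simp
 qed
qed

end

section \<open>Estimates near the ground state\<close>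

lemma square_diff_le: fixes x y :: real
 assumes "\<bar>x - y\<bar> \<le> d" "0 \<le> x" "0 \<le> y" "y \<le> A" "d \<le> 1" shows "\<bar>x\<^sup>2 - y\<^sup>2\<bar> \<le> d * (2 * A + 1)"
proof -
 have "\<bar>x\<^sup>2 - y\<^sup>2\<bar> = \<bar>x - y\<bar> * \<bar>x + y\<bar>" by (simp add: power2_eq_square square_diff_square_factored abs_mult mult.commute)
 also have "\<dots> \<le> d * (2 * A + 1)" by (rule mult_mono) (use assms in auto)
 finally show ?thesis .
qed

definition cr :: "(real => real) => (real => real) => real => real" where
 "cr k w \<alpha> = (LI x. w x * k (x - \<alpha>))"

lemma cr_shift: "cr k w \<alpha> = (LI x. w (x + \<alpha>) * k x)"
 using LINT_shift[of "%x. w x * k (x - \<alpha>)" \<alpha>] by (simp add: cr_def)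

lemma cr_add: "cr k (%x. w (x + z)) \<alpha> = cr k w (\<alpha> + z)"
 unfolding cr_shift by (simp add: add.commute add.left_commute)

lemma cr_DERIV: assumes k: "test_fun k" and w: "L2 w"
 shows "(cr k w has_real_derivative - cr (deriv k) w \<alpha>) (at \<alpha>)"
proof -
 have e: "cr k w = conv (%y. k (0 - y)) w" "conv (%y. - deriv k (0 - y)) w \<alpha> = - cr (deriv k) w \<alpha>"
  by (simp_all add: fun_eq_iff cr_def conv_def mult.commute)
 show ?thesis using conv_DERIV[OF test_refl[OF k, of 0] L2_loc_int[OF w], of \<alpha>] unfolding deriv_refl[OF k] e(2) e(1)[symmetric] .
qed

lemma nrm_reach: assumes "L2 u" "L2 w" shows "nrm u \<le> nrm w + ndist u w"
 using nrm_diff_ge[OF assms] by linarith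

lemma nrm_shift_close: assumes "L2 u" "L2 w" shows "nrm (%x. u (x + a) - w x) \<le> ndist u w + nrm (%x. w (x + a) - w x)"
 using nrm_triangle3[OF L2_shift[OF assms(1)] L2_shift[OF assms(2)] assms(2), of a a] nrm_shift[of "%x. u x - w x" a] by simp

text \<open>Far translates are nearly orthogonal, so their distance is close to sqrt 2 times the
  norm; the truncations \<open>b n\<close> make the orthogonality exact.\<close>

lemma nrm_translation_far:
 assumes w: "L2 w" and pos: "nrm w > 0"
 obtains R where "R > 0" "\<And>r. R \<le> \<bar>r\<bar> ==> nrm w \<le> nrm (%x. w (x + r) - w x)"
proof -
 define b where "b n x = indicat_real {-(real n)..real n} x * w x" for n x
 have [measurable]: "w \<in> borel_measurable borel" by (rule L2_meas[OF w])
 have bm: "b n \<in> borel_measurable borel" for n unfolding b_def by measurable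
 have bL: "L2 (b n)" for n by (rule nrm_mono(1)[OF w bm]) (auto simp: b_def indicator_def)
 have "(%n. ndist (b n) w) \<longlonglongrightarrow> 0"
 proof (rule L2_dominated_tendsto[OF bm w])
  show "w \<in> borel_measurable borel" by simp
  show "\<bar>b i x - w x\<bar> \<le> \<bar>w x\<bar>" for i x by (auto simp: b_def indicator_def)
  show "(%i. b i x) \<longlonglongrightarrow> w x" for x
  proof (rule tendsto_eventually)
   show "\<forall>\<^sub>F i in sequentially. b i x = w x" using eventually_ge_at_top[of "nat \<lceil>\<bar>x\<bar>\<rceil>"]
    by eventually_elim (auto simp: b_def indicator_def nat_le_iff ceiling_le_iff abs_le_iff)
  qed
 qed
 \<comment> \<open>The error of 1/16 of the norm suffices: 2 (15/16)^2 >= (5/4)^2, and 5/4 - 2/16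
   still exceeds 1.\<close>
 then have "\<forall>\<^sub>F n in sequentially. ndist (b n) w < nrm w / 16" by (rule order_tendstoD(2)) (use pos in simp)
 then obtain n where n: "ndist (b n) w < nrm w / 16" by (auto simp: eventually_sequentially)
 have "nrm w \<le> nrm (%x. w (x + r) - w x)" if r: "2 * real n + 1 \<le> \<bar>r\<bar>" for r
 proof -
  define e where "e = ndist (b n) w"
  have bs: "L2 (%x. b n (x + r))" "L2 (%x. w (x + r))" by (intro L2_shift bL w)+
  have z: "b n (x + r) * b n x = 0" for x using r by (auto simp: b_def indicator_def)
  have eq: "(nrm (%x. b n (x + r) + (-1) * b n x))\<^sup>2 = (nrm (b n))\<^sup>2 + (nrm (b n))\<^sup>2"
   unfolding nrm_lin_sq[OF bs(1) bL] using nrm_shift[of "b n" r] by (simp add: z)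
  have bw: "nrm (b n) \<ge> nrm w - e" using nrm_reach[OF w bL, of n] unfolding e_def nrm_minus_commute[of w] by linarith
  have t1: "nrm (%x. b n (x + r) - w (x + r)) = e" using nrm_shift[of "%x. b n x - w x" r] by (simp add: e_def)
  have "nrm (%x. b n (x + r) - b n x) \<le> nrm (%x. b n (x + r) - w (x + r)) + nrm (%x. w (x + r) - b n x)"
   by (rule nrm_triangle3[OF bs bL])
  moreover have "nrm (%x. w (x + r) - b n x) \<le> nrm (%x. w (x + r) - w x) + ndist w (b n)"
   by (rule nrm_triangle3[OF bs(2) w bL])
  ultimately have le: "nrm (%x. b n (x + r) - b n x) \<le> nrm (%x. w (x + r) - w x) + 2 * e"
   unfolding t1 using nrm_minus_commute[of w "b n"] by (simp add: e_def)
  have "(nrm w * (5 / 4))\<^sup>2 \<le> (nrm (%x. b n (x + r) - b n x))\<^sup>2"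
  proof -
   have "(nrm w * (15 / 16))\<^sup>2 \<le> (nrm (b n))\<^sup>2" using bw n pos unfolding e_def[symmetric] by (intro power_mono) auto
   then have "2 * (nrm w * (15 / 16))\<^sup>2 \<le> (nrm (%x. b n (x + r) - b n x))\<^sup>2" using eq by simp
   moreover have "(nrm w * (5 / 4))\<^sup>2 \<le> 2 * (nrm w * (15 / 16))\<^sup>2" by (simp add: power_mult_distrib power2_eq_square)
   ultimately show ?thesis by linarith
  qed
  then have "nrm w * (5 / 4) \<le> nrm (%x. b n (x + r) - b n x)" by (rule power2_le_imp_le) simp
  with le n pos show ?thesis unfolding e_def[symmetric] by linarith
 qed
 then show ?thesis by (rule that[of "2 * real n + 1", rotated]) auto
qed

text \<open>Repeating a shift k times costs at most k times a single shift. A shift of size at least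
  \<rho> repeated k >= R/\<rho> times is far, so its single cost is at least |w|/k.\<close>

lemma translation_separation:
 assumes w: "L2 w" and pos: "nrm w > 0" and r: "\<rho> > 0"
 obtains \<nu> where "\<nu> > 0" "\<And>r. nrm (%x. w (x + r) - w x) < \<nu> ==> \<bar>r\<bar> < \<rho>"
proof -
 obtain R where R: "R > 0" "\<And>r. R \<le> \<bar>r\<bar> ==> nrm w \<le> nrm (%x. w (x + r) - w x)" by (rule nrm_translation_far[OF w pos], rule that)
 define k where "k = Suc (nat \<lceil>R / \<rho>\<rceil>)"
 have k: "k > 0" "R \<le> real k * \<rho>"
 proof -
  have "R / \<rho> \<le> real k" unfolding k_def using real_nat_ceiling_ge[of "R / \<rho>"] by simp
  then show "R \<le> real k * \<rho>" using r by (simp add: pos_divide_le_eq)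
 qed (simp add: k_def)
 have sub: "nrm (%x. w (x + real j * r) - w x) \<le> real j * nrm (%x. w (x + r) - w x)" for j r
 proof (induction j)
  case (Suc j)
  have "nrm (%x. w (x + real (Suc j) * r) - w x) \<le> nrm (%x. w (x + real (Suc j) * r) - w (x + real j * r)) + nrm (%x. w (x + real j * r) - w x)"
   by (rule nrm_triangle3; intro L2_shift w)
  moreover have "nrm (%x. w (x + real (Suc j) * r) - w (x + real j * r)) = nrm (%x. w (x + r) - w x)"
   using nrm_shift[of "%x. w (x + r) - w x" "real j * r"] by (simp add: algebra_simps)
  ultimately show ?case using Suc by (simp add: algebra_simps)
 qed (simp add: nrm_def)
 show ?thesis
 proof (rule that[of "nrm w / real k"])
  show "nrm w / real k > 0" using pos k by simp
  fix r assume a: "nrm (%x. w (x + r) - w x) < nrm w / real k"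
  show "\<bar>r\<bar> < \<rho>"
  proof (rule ccontr)
   assume "\<not> \<bar>r\<bar> < \<rho>"
   then have "real k * \<rho> \<le> real k * \<bar>r\<bar>" using k(1) by simp
   then have "R \<le> real k * \<bar>r\<bar>" using k(2) by linarith
   then have "R \<le> \<bar>real k * r\<bar>" by (simp add: abs_mult)
   from order_trans[OF R(2)[OF this] sub] have "nrm w \<le> real k * nrm (%x. w (x + r) - w x)" .
   moreover have "real k * nrm (%x. w (x + r) - w x) < nrm w" using a k(1) by (simp add: pos_less_divide_eq mult.commute)
   ultimately show False by linarith
  qed
 qed
qed

section \<open>Nehari functional and the level of the wave\<close>

context nonlin begin

lemma Sf_shift: "Sf \<beta> c (%x. w (x + r)) (%x. w1 (x + r)) (%x. w2 (x + r)) (%x. z (x + r)) = Sf \<beta> c w w1 w2 z"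
 unfolding Sf_def nrm_shift LINT_shift[of "%x. F (w x)"] LINT_shift[of "%x. w x * z x"] ..

definition NN :: "real => real => (real => real) => (real => real) => (real => real) => real" where
 "NN \<beta> c w w1 w2 = II \<beta> c w w1 w2 - KK w"

lemma NN_shift: "NN \<beta> c (%x. w (x + r)) (%x. w1 (x + r)) (%x. w2 (x + r)) = NN \<beta> c w w1 w2"
 unfolding NN_def II_def KK_def nrm_shift LINT_shift[of "%x. F (w x)"] ..

lemma NN_cont:
 assumes Wy: "W2 y y1 y2" and e: "e > 0"
 obtains d where "d > 0" "\<And>u u1 u2. W2 u u1 u2 ==> ndist u y < d ==> ndist u1 y1 < d ==> ndist u2 y2 < d
  ==> \<bar>NN \<beta> c u u1 u2 - NN \<beta> c y y1 y2\<bar> < e"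
proof -
 note Ly = W2D[OF Wy]
 define A where "A = nrm y + nrm y1 + nrm y2"
 have A: "A \<ge> 0" "nrm y \<le> A" "nrm y1 \<le> A" "nrm y2 \<le> A" by (auto simp: A_def)
 define M where "M = 2 * (A + A + 2)"
 obtain C where C: "C > 0" "\<And>u. L2 u ==> AE x in lborel. \<bar>u x\<bar> \<le> M ==> integrable lborel (%x. F (u x))"
  "\<And>u w. L2 u ==> L2 w ==> AE x in lborel. \<bar>u x\<bar> \<le> M ==> AE x in lborel. \<bar>w x\<bar> \<le> M ==>
  \<bar>(LI x. F (u x)) - (LI x. F (w x))\<bar> \<le> C * (nrm u + nrm w) * ndist u w"
  by (rule F_lip[of M], rule that)
 define L where "L = (2 * A + 1) * (1 + \<bar>\<beta>\<bar> + \<bar>1 - c\<^sup>2\<bar> + (p + 1) * C)"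
 have L: "L > 0" unfolding L_def by (intro mult_pos_pos add_nonneg_pos add_nonneg_nonneg) (use A C(1) p2 in auto)
 define d where "d = min 1 (e / (2 * L))"
 have d: "d > 0" "d \<le> 1" "d * L < e"
 proof -
  show "d > 0" "d \<le> 1" using e L by (auto simp: d_def)
  have "d * L \<le> e / (2 * L) * L" using L by (intro mult_right_mono) (auto simp: d_def)
  also have "\<dots> = e / 2" using L by simp
  finally show "d * L < e" using e by linarith
 qed
 show ?thesis
 proof (rule that[OF d(1)])
  fix u u1 u2 assume W: "W2 u u1 u2" and n: "ndist u y < d" "ndist u1 y1 < d" "ndist u2 y2 < d"
  note Lu = W2D[OF W]
  have dn: "\<bar>nrm u - nrm y\<bar> \<le> d" "\<bar>nrm u1 - nrm y1\<bar> \<le> d" "\<bar>nrm u2 - nrm y2\<bar> \<le> d"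
   by (rule order_trans[OF nrm_diff_ge less_imp_le]; (rule Lu Ly n))+
  have sq: "\<bar>(nrm u)\<^sup>2 - (nrm y)\<^sup>2\<bar> \<le> d * (2 * A + 1)" "\<bar>(nrm u1)\<^sup>2 - (nrm y1)\<^sup>2\<bar> \<le> d * (2 * A + 1)" "\<bar>(nrm u2)\<^sup>2 - (nrm y2)\<^sup>2\<bar> \<le> d * (2 * A + 1)"
   by (rule square_diff_le[OF _ nrm_nonneg nrm_nonneg _ d(2)]; (rule dn A))+
  have bu: "AE x in lborel. \<bar>u x\<bar> \<le> M" using W2_bound[OF W]
  proof eventually_elim
   case (elim x) then show ?case using dn A d(2) unfolding M_def by (simp add: algebra_simps)
  qed
  have by': "AE x in lborel. \<bar>y x\<bar> \<le> M" using W2_bound[OF Wy]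
  proof eventually_elim
   case (elim x) then show ?case using A unfolding M_def by (simp add: algebra_simps)
  qed
  have K: "\<bar>KK u - KK y\<bar> \<le> (p + 1) * (C * ((2 * A + 1) * d))"
  proof -
   have "KK u - KK y = (p + 1) * ((LI x. F (u x)) - (LI x. F (y x)))" by (simp add: KK_def right_diff_distrib)
   then have "\<bar>KK u - KK y\<bar> = (p + 1) * \<bar>(LI x. F (u x)) - (LI x. F (y x))\<bar>" using p2 by (simp add: abs_mult)
   also have "\<dots> \<le> (p + 1) * (C * (nrm u + nrm y) * ndist u y)" using p2 by (intro mult_left_mono C(3) Lu Ly bu by') auto
   also have "\<dots> \<le> (p + 1) * (C * ((2 * A + 1) * d))" unfolding mult.assoc[of C]
    by (intro mult_left_mono mult_mono) (use p2 C(1) A n dn d in auto)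
   finally show ?thesis .
  qed
  define K0 where "K0 = d * (2 * A + 1)"
  have b1: "\<bar>\<beta> * ((nrm u1)\<^sup>2 - (nrm y1)\<^sup>2)\<bar> \<le> \<bar>\<beta>\<bar> * K0" unfolding abs_mult K0_def by (intro mult_left_mono sq) simp
  have b0: "\<bar>(1 - c\<^sup>2) * ((nrm u)\<^sup>2 - (nrm y)\<^sup>2)\<bar> \<le> \<bar>1 - c\<^sup>2\<bar> * K0" unfolding abs_mult K0_def by (intro mult_left_mono sq) simp
  have "NN \<beta> c u u1 u2 - NN \<beta> c y y1 y2 = ((nrm u2)\<^sup>2 - (nrm y2)\<^sup>2) - \<beta> * ((nrm u1)\<^sup>2 - (nrm y1)\<^sup>2) + (1 - c\<^sup>2) * ((nrm u)\<^sup>2 - (nrm y)\<^sup>2) - (KK u - KK y)"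
   unfolding NN_def II_def by (simp add: right_diff_distrib)
  then have "\<bar>NN \<beta> c u u1 u2 - NN \<beta> c y y1 y2\<bar> \<le> K0 + \<bar>\<beta>\<bar> * K0 + \<bar>1 - c\<^sup>2\<bar> * K0 + (p + 1) * (C * ((2 * A + 1) * d))"
   using sq(3) b1 b0 K unfolding K0_def[symmetric] by linarith
  also have "\<dots> = d * L" unfolding L_def K0_def by (simp add: algebra_simps)
  finally show "\<bar>NN \<beta> c u u1 u2 - NN \<beta> c y y1 y2\<bar> < e" using d(3) by linarith
 qed
qed

end

context gstate begin

text \<open>The value of S at the wave: there I = K and the completed square vanishes.\<close>

definition "dd = (1 / 2 - 1 / (p + 1)) * Iphi"

text \<open>Coercivity makes I positive for u of positive norm, hence K = I > 0 and
  \<open>nehari\<close> applies. On N = 0 the profile part of S is the positive multiple 1/2 -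
  1/(p+1) of I, and the completed square only adds.\<close>

lemma Sf_ge_dd:
 assumes W: "W2 u u1 u2" and v: "L2 v" and u: "nrm u > 0" and N: "NN \<beta> c u u1 u2 = 0"
 shows "dd \<le> Sf \<beta> c u u1 u2 v"
proof -
 obtain \<theta> where \<theta>: "\<theta> > 0" "\<And>w w1 w2. W2 w w1 w2 ==> II \<beta> c w w1 w2 \<ge> \<theta> * ((nrm w)\<^sup>2 + (nrm w1)\<^sup>2 + (nrm w2)\<^sup>2)"
  by (rule II_coercive, rule that)
 have "0 < \<theta> * ((nrm u)\<^sup>2 + (nrm u1)\<^sup>2 + (nrm u2)\<^sup>2)" using \<theta>(1) u by (intro mult_pos_pos add_pos_nonneg) auto
 then have pos: "II \<beta> c u u1 u2 > 0" using \<theta>(2)[OF W] by linarith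
 have e: "KK u = II \<beta> c u u1 u2" using N by (simp add: NN_def)
 have "Iphi \<le> II \<beta> c u u1 u2" by (rule nehari[OF W]) (use e pos in auto)
 moreover have "0 \<le> 1 / 2 - 1 / (p + 1)" using p2 by (simp add: field_simps)
 ultimately have "dd \<le> (1 / 2 - 1 / (p + 1)) * II \<beta> c u u1 u2" unfolding dd_def by (intro mult_left_mono)
 also have "\<dots> = II \<beta> c u u1 u2 / 2 - KK u / (p + 1)" unfolding e by (simp add: left_diff_distrib)
 also have "\<dots> \<le> Sf \<beta> c u u1 u2 v" unfolding Sf_II[OF W v] by simp
 finally show ?thesis .
qed

end

section \<open>Concavity along the direction, crossing of N = 0 and the translation window\<close>

locale direct = gstate +
 fixes g w :: "real => real"
 assumes dir: "direction g w"
begin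

definition "a = deriv g"
definition "h x = 1 * w x + (- c) * g x"
definition "JJ = (LI x. f (phi x) * a x)"
text \<open>The first variation of S at (u, v) applied to (a, h'): since h' + c a = w', the
  completed square contributes the last term.\<close>

definition "PP u u1 u2 v = (LI x. u2 x * deriv (deriv a) x) - \<beta> * (LI x. u1 x * deriv a x) + s * (LI x. u x * a x)
  - (LI x. f (u x) * a x) + (LI x. (v x + c * u x) * deriv w x)"

lemma g_test: "test_fun g" and w_test: "test_fun w" using dir by (auto simp: direction_def)
lemma a_test: "test_fun a" unfolding a_def by (rule test_deriv[OF g_test])
lemma h_test: "test_fun h" unfolding h_def[abs_def] by (intro test_add test_cmult w_test g_test)
lemma dh: "deriv h = (%x. 1 * deriv w x + (- c) * a x)" unfolding h_def[abs_def] a_def by (rule deriv_lin2[OF w_test g_test])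
lemma ddh: "deriv (deriv h) = (%x. 1 * deriv (deriv w) x + (- c) * deriv a x)" unfolding dh by (rule deriv_lin2[OF test_deriv[OF w_test] a_test])
lemma JJ0: "JJ \<noteq> 0" using dir by (simp add: direction_def JJ_def a_def)

text \<open>The second variation at the wave is -q. S is exactly quadratic except for the term with
  F, and there sup-norm closeness of u to phi and a second-order Taylor bound cost less than q for
  all small k.\<close>

lemma concavity:
 obtains \<epsilon> l where "\<epsilon> > 0" "l > 0"
  "\<And>u u1 u2 v k. W2 u u1 u2 ==> L2 v ==> ndist u phi < \<epsilon> ==> ndist u1 phi1 < \<epsilon> ==> \<bar>k\<bar> \<le> l ==>
   Sf \<beta> c (%x. u x + k * a x) (%x. u1 x + k * deriv a x) (%x. u2 x + k * deriv (deriv a) x) (%x. v x + k * deriv h x)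
   \<le> Sf \<beta> c u u1 u2 v + k * PP u u1 u2 v"
proof -
 define q where "q = - (Qf a (deriv a) (deriv (deriv a)) + (nrm (deriv w))\<^sup>2)"
 have q: "q > 0" using dir by (simp add: q_def direction_def a_def)
 have aL: "L2 a" by (rule test_L2[OF a_test])
 have wL: "L2 (deriv w)" by (rule test_L2[OF test_deriv[OF w_test]])
 have Wa: "W2 a (deriv a) (deriv (deriv a))" by (rule W2_test[OF a_test])
 \<comment> \<open>Three shares of q: one for replacing f'(u) by f'(phi), two for the Taylor
   remainder, which comes without the factor 1/2 of the quadratic terms.\<close>
 define e where "e = q / (3 * ((nrm a)\<^sup>2 + 1))"
 have n1: "(nrm a)\<^sup>2 + 1 > 0" by (simp add: add_nonneg_pos)
 have e: "e > 0" "3 * e * (nrm a)\<^sup>2 \<le> q"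
 proof -
  show "e > 0" using q n1 by (simp add: e_def)
  have "3 * e * (nrm a)\<^sup>2 \<le> 3 * e * ((nrm a)\<^sup>2 + 1)" using q n1 by (intro mult_left_mono) (auto simp: e_def)
  also have "\<dots> = q" using n1 unfolding e_def by (simp add: field_simps)
  finally show "3 * e * (nrm a)\<^sup>2 \<le> q" .
 qed
 define M where "M = 2 * (nrm phi + nrm phi1) + 1"
 obtain \<delta> where \<delta>: "\<delta> > 0" "\<And>a b. \<bar>a\<bar> \<le> M ==> \<bar>b\<bar> \<le> \<delta> ==> \<bar>F (a + b) - F a - f a * b - deriv f a * b\<^sup>2 / 2\<bar> \<le> e * b\<^sup>2"
  "\<And>a b. \<bar>a\<bar> \<le> M ==> \<bar>b\<bar> \<le> \<delta> ==> \<bar>deriv f (a + b) - deriv f a\<bar> \<le> e" by (rule F_taylor2[OF e(1), of M], rule that)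
 obtain B where B: "B > 0" "\<And>x. \<bar>a x\<bar> \<le> B" using test_bounded[OF a_test] by metis
 \<comment> \<open>The quarter comes from \<open>W2_bound\<close>, twice the sum of two norms: u -
   phi is then at most \<open>min \<delta> 1\<close> in sup norm.\<close>
 define \<epsilon> where "\<epsilon> = min \<delta> 1 / 4"
 define l where "l = \<delta> / B"
 show ?thesis
 proof (rule that)
  show "\<epsilon> > 0" "l > 0" using \<delta>(1) B(1) by (auto simp: \<epsilon>_def l_def)
  fix u u1 u2 v k assume W: "W2 u u1 u2" and v: "L2 v" and n: "ndist u phi < \<epsilon>" "ndist u1 phi1 < \<epsilon>" and k: "\<bar>k\<bar> \<le> l"
  note L = W2D[OF W]
  have dif: "AE x in lborel. \<bar>u x - phi x\<bar> \<le> min \<delta> 1" using W2_bound[OF W2_diff[OF W W2phi]]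
  proof eventually_elim
   case (elim x)
   have "2 * (ndist u phi + ndist u1 phi1) \<le> 2 * (\<epsilon> + \<epsilon>)" using n by (intro mult_left_mono add_mono) auto
   with elim show ?case by (simp add: \<epsilon>_def)
  qed
  have phib: "AE x in lborel. \<bar>phi x\<bar> \<le> M" using phi_bound by eventually_elim (simp add: M_def)
  have ub: "AE x in lborel. \<bar>u x\<bar> \<le> M" using dif phi_bound unfolding M_def by eventually_elim linarith
  have ka: "\<bar>k * a x\<bar> \<le> \<delta>" for x
  proof -
   have "\<bar>k * a x\<bar> \<le> l * B" unfolding abs_mult by (rule mult_mono[OF k B(2)]) (use k in auto)
   then show ?thesis using B(1) by (simp add: l_def)
  qed
  define X where "X = (LI x. (deriv f (u x) * a x) * a x)"
  define X0 where "X0 = (LI x. (deriv f (phi x) * a x) * a x)"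
  have iX: "integrable lborel (%x. (deriv f (u x) * a x) * a x)" "integrable lborel (%x. (deriv f (phi x) * a x) * a x)"
   by (rule L2_mult[OF chain_L2[OF aL L2_meas[OF L(1)] ub] aL], rule L2_mult[OF f'phi_L2[OF aL] aL])
  have XX: "X0 - e * (nrm a)\<^sup>2 \<le> X"
  proof -
   have "(LI x. (deriv f (phi x) * a x) * a x - e * (a x)\<^sup>2) \<le> X" unfolding X_def
   proof (rule integral_mono_AE)
    show "AE x in lborel. (deriv f (phi x) * a x) * a x - e * (a x)\<^sup>2 \<le> (deriv f (u x) * a x) * a x"
     using dif phib
    proof eventually_elim
     case (elim x)
     then have "\<bar>deriv f (phi x + (u x - phi x)) - deriv f (phi x)\<bar> \<le> e" by (intro \<delta>(3)) auto
     then have "deriv f (phi x) - e \<le> deriv f (u x)" by simp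
     from mult_right_mono[OF this, of "(a x)\<^sup>2"] show ?case by (simp add: power2_eq_square algebra_simps)
    qed
   qed (use iX L2_sq[OF aL] in auto)
   then show ?thesis unfolding X0_def nrm_sq using iX L2_sq[OF aL] by simp
  qed
  define Ja where "Ja = (LI x. f (u x) * a x)"
  have iJ: "integrable lborel (%x. f (u x) * a x)" by (rule L2_mult[OF fL2[OF L(1) ub] aL])
  have iF: "integrable lborel (%x. F (u x))" by (rule F_lip[of M]) (use ub L(1) in blast)
  have W': "W2 (%x. u x + k * a x) (%x. u1 x + k * deriv a x) (%x. u2 x + k * deriv (deriv a) x)"
   by (rule W2_add[OF W W2_cmult[OF Wa]])
  have iF': "integrable lborel (%x. F (u x + k * a x))"
   by (rule F_lip[of "2 * (nrm (%x. u x + k * a x) + nrm (%x. u1 x + k * deriv a x))"]) (use W2_bound[OF W'] W2D(1)[OF W'] in blast)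
  have Fl: "(LI x. F (u x)) + k * Ja + k\<^sup>2 / 2 * X - e * k\<^sup>2 * (nrm a)\<^sup>2 \<le> (LI x. F (u x + k * a x))"
  proof -
   have "(LI x. F (u x) + k * (f (u x) * a x) + k\<^sup>2 / 2 * ((deriv f (u x) * a x) * a x) - e * k\<^sup>2 * (a x)\<^sup>2) \<le> (LI x. F (u x + k * a x))"
   proof (rule integral_mono_AE)
    show "AE x in lborel. F (u x) + k * (f (u x) * a x) + k\<^sup>2 / 2 * ((deriv f (u x) * a x) * a x) - e * k\<^sup>2 * (a x)\<^sup>2 \<le> F (u x + k * a x)"
     using ub
    proof eventually_elim
     case (elim x)
     have E: "f (u x) * (k * a x) = k * (f (u x) * a x)" "deriv f (u x) * (k * a x)\<^sup>2 / 2 = k\<^sup>2 / 2 * ((deriv f (u x) * a x) * a x)"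
      "e * (k * a x)\<^sup>2 = e * k\<^sup>2 * (a x)\<^sup>2" by (simp_all add: power2_eq_square)
     show ?case using \<delta>(2)[OF elim ka[of x]] unfolding E by linarith
    qed
   qed (use iF iF' iJ iX L2_sq[OF aL] in auto)
   then show ?thesis unfolding X_def Ja_def nrm_sq using iF iJ iX L2_sq[OF aL] by simp
  qed
  define Bq where "Bq = (LI x. u2 x * deriv (deriv a) x) - \<beta> * (LI x. u1 x * deriv a x) + s * (LI x. u x * a x)"
  define Rq where "Rq = (LI x. (v x + c * u x) * deriv w x)"
  have Pq: "PP u u1 u2 v = Bq - Ja + Rq" by (simp add: PP_def Bq_def Rq_def Ja_def)
  have vL: "L2 (%x. v x + c * u x)" by (intro L2_add v L2_cmult L)
  have vs: "(%x. (v x + k * deriv h x) + c * (u x + k * a x)) = (%x. (v x + c * u x) + k * deriv w x)"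
   unfolding dh by (simp add: fun_eq_iff algebra_simps)
  have L': "L2 (%x. v x + k * deriv h x)" by (intro L2_add v L2_cmult test_L2 test_deriv h_test)
  have KF: "KK z / (p + 1) = (LI x. F (z x))" for z using p2 by (simp add: KK_def)
  define IA where "IA = II \<beta> c a (deriv a) (deriv (deriv a))"
  have qe: "Qf a (deriv a) (deriv (deriv a)) = IA - X0" by (simp add: Qf_def IA_def II_def s_def X0_def)
  define V where "V = (nrm (%x. v x + c * u x))\<^sup>2"
  define I0 where "I0 = II \<beta> c u u1 u2"
  define F1 where "F1 = (LI x. F (u x + k * a x))"
  define F0' where "F0' = (LI x. F (u x))"
  define nw where "nw = (nrm (deriv w))\<^sup>2"
  define na where "na = (nrm a)\<^sup>2"
  have S1: "Sf \<beta> c (%x. u x + k * a x) (%x. u1 x + k * deriv a x) (%x. u2 x + k * deriv (deriv a) x) (%x. v x + k * deriv h x)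
   = (I0 + 2 * k * Bq + k\<^sup>2 * IA) / 2 - F1 + (V + 2 * k * Rq + k\<^sup>2 * nw) / 2"
   unfolding Sf_II[OF W' L'] vs nrm_lin_sq[OF vL wL] II_lin[OF W Wa] KF Bq_def Rq_def IA_def V_def I0_def F1_def nw_def ..
  have S0: "Sf \<beta> c u u1 u2 v = I0 / 2 - F0' + V / 2" unfolding Sf_II[OF W v] KF V_def I0_def F0'_def ..
  have br: "IA + nw - X + 2 * e * na \<le> 0" using XX e(2) unfolding na_def[symmetric] using q_def[unfolded qe] by (simp add: nw_def)
  have "k\<^sup>2 / 2 * (IA + nw - X + 2 * e * na) \<le> 0" using br by (intro mult_nonneg_nonpos) auto
  moreover have "k\<^sup>2 / 2 * (IA + nw - X + 2 * e * na) = k\<^sup>2 * IA / 2 + k\<^sup>2 * nw / 2 - k\<^sup>2 / 2 * X + e * k\<^sup>2 * na"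
   by (simp add: field_simps)
  ultimately have br': "k\<^sup>2 * IA / 2 + k\<^sup>2 * nw / 2 - k\<^sup>2 / 2 * X + e * k\<^sup>2 * na \<le> 0" by simp
  have Fl': "F0' + k * Ja + k\<^sup>2 / 2 * X - e * k\<^sup>2 * na \<le> F1" using Fl unfolding F0'_def F1_def na_def .
  have D: "(I0 + 2 * k * Bq + k\<^sup>2 * IA) / 2 - F1 + (V + 2 * k * Rq + k\<^sup>2 * nw) / 2
    = (I0 / 2 + V / 2 + k * Bq + k * Rq + (k\<^sup>2 * IA / 2 + k\<^sup>2 * nw / 2)) - F1" by (simp add: add_divide_distrib)
  have P: "k * PP u u1 u2 v = k * Bq - k * Ja + k * Rq" unfolding Pq by (simp add: algebra_simps)
  show "Sf \<beta> c (%x. u x + k * a x) (%x. u1 x + k * deriv a x) (%x. u2 x + k * deriv (deriv a) x) (%x. v x + k * deriv h x)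
   \<le> Sf \<beta> c u u1 u2 v + k * PP u u1 u2 v" unfolding S1 S0 P D using br' Fl' by linarith
 qed
qed

text \<open>By the Euler-Lagrange equation the derivative of N along a is 2J - (p + 1)J = (1 - p)J;
  multiplying by J makes its sign definite.\<close>

lemma crossing: obtains l0 where "l0 > 0" "\<And>l. 0 < l ==> l < l0 ==> JJ * NN \<beta> c (%x. phi x + (- l) * a x) (%x. phi1 x + (- l) * deriv a x) (%x. phi2 x + (- l) * deriv (deriv a) x) > 0"
proof -
 define B where "B = (LI x. phi2 x * deriv (deriv a) x) - \<beta> * (LI x. phi1 x * deriv a x) + s * (LI x. phi x * a x)"
 have BJ: "B = JJ" unfolding B_def JJ_def by (rule euler_lagrange[OF a_test])
 define n where "n k = JJ * NN \<beta> c (%x. phi x + k * a x) (%x. phi1 x + k * deriv a x) (%x. phi2 x + k * deriv (deriv a) x)" for k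
 have ne: "n k = JJ * ((Iphi + 2 * k * B + k\<^sup>2 * II \<beta> c a (deriv a) (deriv (deriv a))) - KK (%x. phi x + k * a x))" for k
  unfolding n_def NN_def II_lin[OF W2phi W2_test[OF a_test]] B_def ..
 have "(n has_real_derivative JJ * (2 * B - (p + 1) * JJ)) (at 0)"
  unfolding ne[abs_def] JJ_def[symmetric]
 proof (intro DERIV_cmult DERIV_diff)
  show "((%k. Iphi + 2 * k * B + k\<^sup>2 * II \<beta> c a (deriv a) (deriv (deriv a))) has_real_derivative 2 * B) (at 0)"
   by (auto intro!: derivative_eq_intros)
  show "((%k. KK (%x. phi x + k * a x)) has_real_derivative (p + 1) * JJ) (at 0)"
   unfolding JJ_def by (rule KK_deriv[OF L2phi phi_bound a_test])
 qed
 moreover have "JJ * (2 * B - (p + 1) * JJ) = - ((p - 1) * JJ\<^sup>2)" unfolding BJ by (simp add: power2_eq_square algebra_simps)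
 moreover have "- ((p - 1) * JJ\<^sup>2) < 0" using p2 JJ0 by simp
 ultimately obtain l0 where l0: "l0 > 0" "\<And>l. l > 0 ==> l < l0 ==> n 0 < n (0 - l)" using DERIV_neg_dec_left[of n _ 0] by metis
 have "n 0 = 0" unfolding n_def NN_def using gs_facts(2) by simp
 then have "0 < n (- l)" if "0 < l" "l < l0" for l using l0(2)[OF that] by simp
 then show ?thesis using that[OF l0(1)] unfolding n_def by blast
qed

text \<open>N has opposite signs at u and at u - l a, so it vanishes at some u + k a with -l <= k <
  0. There S is at least \<open>dd\<close>, and concavity gives dd <= S(U) + k S'(U) psi; since -k
  is at most l, the lower bound for -S'(U) psi follows.\<close>

lemma static:
 obtains \<epsilon> l where "\<epsilon> > 0" "l > 0"
  "\<And>u u1 u2 v. W2 u u1 u2 ==> L2 v ==> ndist u phi < \<epsilon> ==> ndist u1 phi1 < \<epsilon> ==> ndist u2 phi2 < \<epsilon> ==>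
   JJ * NN \<beta> c u u1 u2 < 0 ==> Sf \<beta> c u u1 u2 v < dd ==> (dd - Sf \<beta> c u u1 u2 v) / l \<le> - PP u u1 u2 v"
proof -
 have aL: "L2 a" by (rule test_L2[OF a_test])
 have Wa: "W2 a (deriv a) (deriv (deriv a))" by (rule W2_test[OF a_test])
 obtain e1 l1 where 1: "e1 > 0" "l1 > 0"
  "\<And>u u1 u2 v k. W2 u u1 u2 ==> L2 v ==> ndist u phi < e1 ==> ndist u1 phi1 < e1 ==> \<bar>k\<bar> \<le> l1 ==>
   Sf \<beta> c (%x. u x + k * a x) (%x. u1 x + k * deriv a x) (%x. u2 x + k * deriv (deriv a) x) (%x. v x + k * deriv h x)
   \<le> Sf \<beta> c u u1 u2 v + k * PP u u1 u2 v" by (rule concavity, rule that)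
 obtain l2 where 2: "l2 > 0" "\<And>l. 0 < l ==> l < l2 ==> JJ * NN \<beta> c (%x. phi x + (- l) * a x) (%x. phi1 x + (- l) * deriv a x) (%x. phi2 x + (- l) * deriv (deriv a) x) > 0"
  by (rule crossing, rule that)
 \<comment> \<open>Keeps the norm of u + k a positive, so that \<open>Sf_ge_dd\<close> applies at
   the crossing.\<close>
 define l3 where "l3 = nrm phi / (4 * (nrm a + 1))"
 have a1: "nrm a + 1 > 0" using nrm_nonneg[of a] by linarith
 have l3: "l3 > 0" "l3 * nrm a \<le> nrm phi / 4"
 proof -
  show "l3 > 0" using phi1_pos(1) a1 by (simp add: l3_def)
  then have "l3 * nrm a \<le> l3 * (nrm a + 1)" by simp
  also have "\<dots> = nrm phi / 4" using a1 unfolding l3_def by (simp add: field_simps)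
  finally show "l3 * nrm a \<le> nrm phi / 4" .
 qed
 define l where "l = min (min l1 l3) (l2 / 2)"
 have l: "l > 0" "l \<le> l1" "l \<le> l3" "l < l2" using 1(2) 2(1) l3(1) by (auto simp: l_def)
 define y where "y x = phi x + (- l) * a x" for x
 define y1 where "y1 x = phi1 x + (- l) * deriv a x" for x
 define y2 where "y2 x = phi2 x + (- l) * deriv (deriv a) x" for x
 have Wy: "W2 y y1 y2" unfolding y_def y1_def y2_def by (rule W2_add[OF W2phi W2_cmult[OF Wa]])
 define n0 where "n0 = \<bar>NN \<beta> c y y1 y2\<bar>"
 have ny: "JJ * NN \<beta> c y y1 y2 > 0" unfolding y_def y1_def y2_def by (rule 2(2)[OF l(1,4)])
 then have n0: "n0 > 0" by (auto simp: n0_def)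
 obtain d where d: "d > 0" "\<And>u u1 u2. W2 u u1 u2 ==> ndist u y < d ==> ndist u1 y1 < d ==> ndist u2 y2 < d
  ==> \<bar>NN \<beta> c u u1 u2 - NN \<beta> c y y1 y2\<bar> < n0" by (rule NN_cont[OF Wy n0], rule that)
 define \<epsilon> where "\<epsilon> = min (min e1 d) (nrm phi / 4)"
 have \<epsilon>: "\<epsilon> > 0" "\<epsilon> \<le> e1" "\<epsilon> \<le> d" "\<epsilon> \<le> nrm phi / 4" using 1(1) d(1) phi1_pos(1) by (auto simp: \<epsilon>_def)
 show ?thesis
 proof (rule that[OF \<epsilon>(1) l(1)])
  fix u u1 u2 v assume W: "W2 u u1 u2" and v: "L2 v" and n: "ndist u phi < \<epsilon>" "ndist u1 phi1 < \<epsilon>" "ndist u2 phi2 < \<epsilon>"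
   and N: "JJ * NN \<beta> c u u1 u2 < 0" and S: "Sf \<beta> c u u1 u2 v < dd"
  note L = W2D[OF W]
  have Wk: "W2 (%x. u x + k * a x) (%x. u1 x + k * deriv a x) (%x. u2 x + k * deriv (deriv a) x)" for k
   by (rule W2_add[OF W W2_cmult[OF Wa]])
  define m where "m k = JJ * NN \<beta> c (%x. u x + k * a x) (%x. u1 x + k * deriv a x) (%x. u2 x + k * deriv (deriv a) x)" for k
  have mc: "isCont m k" for k
   unfolding continuous_at_eps_delta
  proof (intro allI impI)
   fix e :: real assume e: "e > 0"
   have e': "e / \<bar>JJ\<bar> > 0" using e JJ0 by simp
   obtain d where d: "d > 0" "\<And>z z1 z2. W2 z z1 z2 ==> nrm (%x. z x - (u x + k * a x)) < d ==> nrm (%x. z1 x - (u1 x + k * deriv a x)) < d ==> nrm (%x. z2 x - (u2 x + k * deriv (deriv a) x)) < d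
    ==> \<bar>NN \<beta> c z z1 z2 - NN \<beta> c (%x. u x + k * a x) (%x. u1 x + k * deriv a x) (%x. u2 x + k * deriv (deriv a) x)\<bar> < e / \<bar>JJ\<bar>"
    by (rule NN_cont[OF Wk e'], rule that)
   define b where "b = nrm a + nrm (deriv a) + nrm (deriv (deriv a)) + 1"
   have b: "b > 0" "nrm a < b" "nrm (deriv a) < b" "nrm (deriv (deriv a)) < b"
    using nrm_nonneg[of a] nrm_nonneg[of "deriv a"] nrm_nonneg[of "deriv (deriv a)"] unfolding b_def by linarith+
   have sm: "nrm (%x. (q x + j * r x) - (q x + k * r x)) < d" if j: "\<bar>j - k\<bar> < d / b" and r: "nrm r < b" for q r j
   proof -
    have "(%x. (q x + j * r x) - (q x + k * r x)) = (%x. (j - k) * r x)" by (simp add: fun_eq_iff algebra_simps)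
    then have "nrm (%x. (q x + j * r x) - (q x + k * r x)) = \<bar>j - k\<bar> * nrm r" by (simp only: nrm_cmult)
    also have "\<dots> \<le> \<bar>j - k\<bar> * b" using r by (intro mult_left_mono) auto
    also have "\<dots> < d" using j b(1) by (simp add: pos_less_divide_eq)
    finally show ?thesis .
   qed
   show "\<exists>d>0. \<forall>j. dist j k < d --> dist (m j) (m k) < e"
   proof (intro exI[of _ "d / b"] conjI allI impI)
    fix j assume "dist j k < d / b"
    then have j: "\<bar>j - k\<bar> < d / b" by (simp add: dist_real_def)
    have "\<bar>NN \<beta> c (%x. u x + j * a x) (%x. u1 x + j * deriv a x) (%x. u2 x + j * deriv (deriv a) x) - NN \<beta> c (%x. u x + k * a x) (%x. u1 x + k * deriv a x) (%x. u2 x + k * deriv (deriv a) x)\<bar> < e / \<bar>JJ\<bar>"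
     by (rule d(2)[OF Wk sm[OF j b(2)] sm[OF j b(3)] sm[OF j b(4)]])
    then show "dist (m j) (m k) < e" using JJ0 unfolding dist_real_def m_def right_diff_distrib[symmetric] abs_mult by (simp add: pos_less_divide_eq mult.commute)
   qed (use d b in auto)
  qed
  have m0: "m 0 < 0" using N by (simp add: m_def)
  have ml: "m (- l) > 0"
  proof -
   have sh: "(%x. (q x + - l * r x) - (q' x + - l * r x)) = (%x. q x - q' x)" for q q' r :: "real => real" by simp
   have "\<bar>NN \<beta> c (%x. u x + (- l) * a x) (%x. u1 x + (- l) * deriv a x) (%x. u2 x + (- l) * deriv (deriv a) x) - NN \<beta> c y y1 y2\<bar> < n0"
    by (rule d(2)[OF Wk]; unfold y_def y1_def y2_def sh; rule less_le_trans[OF _ \<epsilon>(3)]; rule n)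
   then show ?thesis using ny unfolding m_def n0_def by (auto simp: zero_less_mult_iff abs_if split: if_splits)
  qed
  obtain k where k: "- l \<le> k" "k \<le> 0" "m k = 0"
   using IVT2[of m 0 0 "- l"] m0 ml l(1) mc by (metis less_imp_le neg_le_0_iff_le)
  have k0: "k < 0" using k m0 by (cases "k = 0") auto
  have Nk: "NN \<beta> c (%x. u x + k * a x) (%x. u1 x + k * deriv a x) (%x. u2 x + k * deriv (deriv a) x) = 0" using k(3) JJ0 by (simp add: m_def)
  have pos: "nrm (%x. u x + k * a x) > 0"
  proof -
   have "nrm phi \<le> nrm u + ndist phi u" by (rule nrm_reach[OF L2phi L(1)])
   then have 1: "nrm u \<ge> nrm phi * (3 / 4)" using n(1) \<epsilon>(4) unfolding nrm_minus_commute[of phi u] by linarith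
   have "nrm u \<le> nrm (%x. u x + k * a x) + nrm (%x. u x - (u x + k * a x))" by (rule nrm_reach[OF L(1) W2D(1)[OF Wk]])
   also have "nrm (%x. u x - (u x + k * a x)) = \<bar>k\<bar> * nrm a" using nrm_cmult[of "- k" a] by simp
   finally have 2: "nrm u \<le> nrm (%x. u x + k * a x) + \<bar>k\<bar> * nrm a" .
   have "\<bar>k\<bar> * nrm a \<le> l3 * nrm a" using k l(3) by (intro mult_right_mono) auto
   then show ?thesis using 1 2 l3(2) phi1_pos(1) by linarith
  qed
  have L': "L2 (%x. v x + k * deriv h x)" by (intro L2_add v L2_cmult test_L2 test_deriv h_test)
  have "dd \<le> Sf \<beta> c (%x. u x + k * a x) (%x. u1 x + k * deriv a x) (%x. u2 x + k * deriv (deriv a) x) (%x. v x + k * deriv h x)"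
   by (rule Sf_ge_dd[OF Wk L' pos Nk])
  also have "\<dots> \<le> Sf \<beta> c u u1 u2 v + k * PP u u1 u2 v"
   by (rule 1(3)[OF W v less_le_trans[OF n(1) \<epsilon>(2)] less_le_trans[OF n(2) \<epsilon>(2)]]) (use k l in auto)
  finally have ge: "dd - Sf \<beta> c u u1 u2 v \<le> (- k) * (- PP u u1 u2 v)" by simp
  then have "0 < (- k) * (- PP u u1 u2 v)" using S by linarith
  then have Pp: "0 < - PP u u1 u2 v" using k0 by (simp add: zero_less_mult_iff mult_less_0_iff)
  have "(- k) * (- PP u u1 u2 v) \<le> l * (- PP u u1 u2 v)" using k(1) Pp by (intro mult_right_mono) auto
  then show "(dd - Sf \<beta> c u u1 u2 v) / l \<le> - PP u u1 u2 v" using ge l(1) by (simp add: pos_divide_le_eq mult.commute)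
 qed
qed

text \<open>\<open>HH\<close> pairs the state with the translated primitives and \<open>GG\<close>
  is Q'(U) on the translated psi. Their \<alpha>-derivatives are minus \<open>GG\<close> and minus
  \<open>G2\<close>, so the second derivative of \<open>HH\<close> is \<open>G2\<close>, negative
  near the wave.\<close>

definition "HH u v \<alpha> = cr h u \<alpha> + cr g v \<alpha>"
definition "GG u v \<alpha> = cr (deriv h) u \<alpha> + cr a v \<alpha>"
definition "G2 u v \<alpha> = cr (deriv (deriv h)) u \<alpha> + cr (deriv a) v \<alpha>"

lemma HH_DERIV: assumes "L2 u" "L2 v" shows "(HH u v has_real_derivative - GG u v \<alpha>) (at \<alpha>)"
 using DERIV_add[OF cr_DERIV[OF h_test assms(1)] cr_DERIV[OF g_test assms(2)], of \<alpha>] unfolding HH_def[abs_def] GG_def a_def by simp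

lemma GG_DERIV: assumes "L2 u" "L2 v" shows "(GG u v has_real_derivative - G2 u v \<alpha>) (at \<alpha>)"
 using DERIV_add[OF cr_DERIV[OF test_deriv[OF h_test] assms(1)] cr_DERIV[OF a_test assms(2)], of \<alpha>] unfolding GG_def[abs_def] G2_def by simp

lemma pr_h: "pr (deriv h) - c * pr a = 0" "pr (deriv (deriv h)) - c * pr (deriv a) < 0"
proof -
 note T = test_L2[OF test_deriv[OF w_test]] test_L2[OF a_test] test_L2[OF test_deriv[OF test_deriv[OF w_test]]] test_L2[OF test_deriv[OF a_test]]
 have d: "pr (deriv w) = 2 * c * pr a" "pr (deriv (deriv w)) - 2 * c * pr (deriv a) < 0" using dir by (auto simp: direction_def a_def)
 show "pr (deriv h) - c * pr a = 0" unfolding dh pr_lin[OF T(1,2)] using d(1) by simp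
 show "pr (deriv (deriv h)) - c * pr (deriv a) < 0" unfolding ddh pr_lin[OF T(3,4)] using d(2) by simp
qed

lemma cr_near: assumes "L2 z" "L2 y" "L2 k" "nrm (%x. z (x + \<alpha>) - y x) \<le> e"
 shows "\<bar>cr k z \<alpha> - (LI x. y x * k x)\<bar> \<le> e * nrm k"
proof -
 have "cr k z \<alpha> - (LI x. y x * k x) = (LI x. (z (x + \<alpha>) - y x) * k x)"
  unfolding cr_shift using L2_mult[OF L2_shift[OF assms(1)] assms(3), of \<alpha>] L2_mult[OF assms(2,3)] by (simp add: left_diff_distrib)
 then show ?thesis using CS_ineq[OF L2_diff[OF L2_shift[OF assms(1)] assms(2)] assms(3), of \<alpha>] mult_right_mono[OF assms(4) nrm_nonneg[of k]] by simp
qed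

text \<open>Near the wave \<open>G2\<close> is at most -\<omega>/2 on the whole window, while
  \<open>GG\<close> at 0 is small by tangency. So \<open>GG\<close> increases strictly, has a zero
  within \<rho>, and that zero maximises \<open>HH\<close> on the window of radius 2\<rho>. The
  doubled radius leaves room for a change of reference position by \<rho>.\<close>

lemma window:
 obtains \<rho>0 where "\<rho>0 > 0" "\<And>\<rho>. 0 < \<rho> ==> \<rho> \<le> \<rho>0 ==> \<exists>\<epsilon>>0. \<forall>u v. L2 u --> L2 v --> ndist u phi < \<epsilon> --> nrm (%x. v x - (- c) * phi x) < \<epsilon> -->
  (\<exists>\<alpha>. \<bar>\<alpha>\<bar> < \<rho> \<and> GG u v \<alpha> = 0 \<and> (\<forall>\<alpha>'. \<bar>\<alpha>'\<bar> \<le> 2 * \<rho> --> HH u v \<alpha>' \<le> HH u v \<alpha>))"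
proof -
 define \<omega> where "\<omega> = - (pr (deriv (deriv h)) - c * pr (deriv a))"
 have \<omega>: "\<omega> > 0" using pr_h(2) by (simp add: \<omega>_def)
 have kL: "L2 (deriv h)" "L2 (deriv (deriv h))" "L2 a" "L2 (deriv a)" using h_test a_test test_L2 test_deriv by blast+
 define C where "C = nrm (deriv (deriv h)) + nrm (deriv a) + nrm (deriv h) + nrm a + 1"
 have C: "C > 0" "nrm (deriv (deriv h)) + nrm (deriv a) \<le> C" "nrm (deriv h) + nrm a \<le> C"
  using nrm_nonneg[of "deriv (deriv h)"] nrm_nonneg[of "deriv a"] nrm_nonneg[of "deriv h"] nrm_nonneg[of a] unfolding C_def by linarith+
 \<comment> \<open>Tolerance for each of two errors, the distance to the wave and the translation of
   the wave; together they cost \<omega>/2.\<close>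
 define e0 where "e0 = \<omega> / (4 * C)"
 have e0: "e0 > 0" "2 * e0 * C = \<omega> / 2" using \<omega> C by (auto simp: e0_def)
 obtain d where d: "d > 0" "\<And>r. \<bar>r\<bar> < d ==> nrm (%x. phi (x + r) - phi x) < e0" using L2_tcont[OF L2phi] e0(1) unfolding tcont_def by blast
 have c1': "\<bar>c\<bar> \<le> 1" using c1 by (simp add: abs_square_less_1 less_imp_le)
 have gen: "x1 - c * x2 + e * C \<ge> g1 + g2" if "\<bar>g1 - x1\<bar> \<le> e * n1" "\<bar>g2 - (- c) * x2\<bar> \<le> e * n2" "n1 + n2 \<le> C" "e \<ge> 0" for x1 x2 g1 g2 n1 n2 e
 proof -
  have "e * n1 + e * n2 \<le> e * C" using mult_left_mono[OF that(3,4)] by (simp add: distrib_left)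
  then show ?thesis using that(1,2) by linarith
 qed
 have gen2: "x1 - c * x2 - e * C \<le> g1 + g2" if "\<bar>g1 - x1\<bar> \<le> e * n1" "\<bar>g2 - (- c) * x2\<bar> \<le> e * n2" "n1 + n2 \<le> C" "e \<ge> 0" for x1 x2 g1 g2 n1 n2 e
 proof -
  have "e * n1 + e * n2 \<le> e * C" using mult_left_mono[OF that(3,4)] by (simp add: distrib_left)
  then show ?thesis using that(1,2) by linarith
 qed
 have cphi: "(LI x. (- c) * phi x * k x) = (- c) * pr k" for k unfolding pr_def by (simp add: mult.assoc)
 show ?thesis
 proof (rule that[of "d / 3"])
  show "d / 3 > 0" using d by simp
  fix \<rho> assume \<rho>: "0 < \<rho>" "\<rho> \<le> d / 3"
  \<comment> \<open>\<open>GG\<close> changes by at least \<omega>\<rho>/2 over a distance \<rho>,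
    so a value of at most \<omega>\<rho>/4 at 0 leaves opposite signs at the two ends.\<close>
  define \<epsilon> where "\<epsilon> = min e0 (\<omega> * \<rho> / (4 * C))"
  have \<epsilon>: "\<epsilon> > 0" "\<epsilon> \<le> e0" "\<epsilon> * C \<le> \<omega> * \<rho> / 4"
  proof -
   show "\<epsilon> > 0" "\<epsilon> \<le> e0" using e0 \<omega> \<rho> C by (auto simp: \<epsilon>_def)
   have "\<epsilon> * C \<le> (\<omega> * \<rho> / (4 * C)) * C" using C by (intro mult_right_mono) (auto simp: \<epsilon>_def)
   then show "\<epsilon> * C \<le> \<omega> * \<rho> / 4" using C by simp
  qed
  have "\<exists>\<alpha>. \<bar>\<alpha>\<bar> < \<rho> \<and> GG u v \<alpha> = 0 \<and> (\<forall>\<alpha>'. \<bar>\<alpha>'\<bar> \<le> 2 * \<rho> --> HH u v \<alpha>' \<le> HH u v \<alpha>)"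
   if u: "L2 u" and v: "L2 v" and nu: "ndist u phi < \<epsilon>" and nv: "nrm (%x. v x - (- c) * phi x) < \<epsilon>" for u v
  proof -
   note cL = L2_cmult[OF L2phi, of "- c"]
   have G0: "\<bar>GG u v 0\<bar> \<le> \<omega> * \<rho> / 4"
   proof -
    have 1: "\<bar>cr (deriv h) u 0 - pr (deriv h)\<bar> \<le> \<epsilon> * nrm (deriv h)" unfolding pr_def by (rule cr_near[OF u L2phi kL(1)]) (use nu in simp)
    have 2: "\<bar>cr a v 0 - (- c) * pr a\<bar> \<le> \<epsilon> * nrm a" unfolding cphi[symmetric] by (rule cr_near[OF v cL kL(3)]) (use nv in simp)
    show ?thesis using gen[OF 1 2 C(3) less_imp_le[OF \<epsilon>(1)]] gen2[OF 1 2 C(3) less_imp_le[OF \<epsilon>(1)]] \<epsilon> pr_h(1) unfolding GG_def by linarith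
   qed
   have G2: "G2 u v \<alpha> \<le> - \<omega> / 2" if al: "\<bar>\<alpha>\<bar> \<le> 2 * \<rho>" for \<alpha>
   proof -
    have tr: "nrm (%x. phi (x + \<alpha>) - phi x) < e0" by (rule d(2)) (use al \<rho> d in auto)
    have "nrm (%x. u (x + \<alpha>) - phi x) \<le> ndist u phi + nrm (%x. phi (x + \<alpha>) - phi x)" by (rule nrm_shift_close[OF u L2phi])
    then have nu': "nrm (%x. u (x + \<alpha>) - phi x) \<le> 2 * e0" using nu tr \<epsilon>(2) by linarith
    have "nrm (%x. v (x + \<alpha>) - (- c) * phi x) \<le> nrm (%x. v x - (- c) * phi x) + nrm (%x. (- c) * phi (x + \<alpha>) - (- c) * phi x)" by (rule nrm_shift_close[OF v cL])
    also have "(%x. (- c) * phi (x + \<alpha>) - (- c) * phi x) = (%x. (- c) * (phi (x + \<alpha>) - phi x))" by (simp add: fun_eq_iff algebra_simps)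
    also have "nrm \<dots> = \<bar>c\<bar> * nrm (%x. phi (x + \<alpha>) - phi x)" by (simp only: nrm_cmult abs_minus)
    finally have nv': "nrm (%x. v (x + \<alpha>) - (- c) * phi x) \<le> 2 * e0" using nv tr \<epsilon>(2) mult_right_mono[OF c1' nrm_nonneg[of "%x. phi (x + \<alpha>) - phi x"]] by linarith
    have 1: "\<bar>cr (deriv (deriv h)) u \<alpha> - pr (deriv (deriv h))\<bar> \<le> 2 * e0 * nrm (deriv (deriv h))" unfolding pr_def by (rule cr_near[OF u L2phi kL(2) nu'])
    have 2: "\<bar>cr (deriv a) v \<alpha> - (- c) * pr (deriv a)\<bar> \<le> 2 * e0 * nrm (deriv a)" unfolding cphi[symmetric] by (rule cr_near[OF v cL kL(4) nv'])
    have "0 \<le> 2 * e0" using e0 by simp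
    from gen[OF 1 2 C(2) this] have "G2 u v \<alpha> \<le> (pr (deriv (deriv h)) - c * pr (deriv a)) + \<omega> / 2" unfolding e0(2) G2_def .
    also have "pr (deriv (deriv h)) - c * pr (deriv a) = - \<omega>" by (simp add: \<omega>_def)
    finally show ?thesis by simp
   qed
   have mono: "GG u v y - GG u v x \<ge> \<omega> / 2 * (y - x)" if xy: "x < y" "\<bar>x\<bar> \<le> 2 * \<rho>" "\<bar>y\<bar> \<le> 2 * \<rho>" for x y
   proof -
    obtain z where z: "x < z" "z < y" "GG u v y - GG u v x = (y - x) * - G2 u v z"
     using MVT2[OF xy(1), of "GG u v" "%z. - G2 u v z"] GG_DERIV[OF u v] by blast
    have "\<bar>z\<bar> \<le> 2 * \<rho>" using z(1,2) xy by linarith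
    from G2[OF this] have "\<omega> / 2 \<le> - G2 u v z" by simp
    then show ?thesis using mult_right_mono[of "\<omega> / 2" "- G2 u v z" "y - x"] xy unfolding z(3) by (simp add: mult.commute)
   qed
   have m1: "\<omega> * \<rho> \<le> 2 * GG u v \<rho> - 2 * GG u v 0" using mono[of 0 \<rho>] \<rho> by simp
   have m2: "\<omega> * \<rho> \<le> 2 * GG u v 0 - 2 * GG u v (- \<rho>)" using mono[of "- \<rho>" 0] \<rho> by simp
   have gp: "GG u v \<rho> > 0" "GG u v (- \<rho>) < 0" using m1 m2 G0 mult_pos_pos[OF \<omega> \<rho>(1)] by linarith+
   have "\<exists>\<alpha>. - \<rho> \<le> \<alpha> \<and> \<alpha> \<le> \<rho> \<and> GG u v \<alpha> = 0"
    by (rule IVT) (use gp \<rho> GG_DERIV[OF u v] DERIV_isCont in \<open>auto intro: less_imp_le\<close>)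
   then obtain \<alpha> where \<alpha>: "- \<rho> \<le> \<alpha>" "\<alpha> \<le> \<rho>" "GG u v \<alpha> = 0" by blast
   have ne: "\<alpha> \<noteq> \<rho>" "\<alpha> \<noteq> - \<rho>" using \<alpha>(3) gp by auto
   have "HH u v \<alpha>' \<le> HH u v \<alpha>" if al: "\<bar>\<alpha>'\<bar> \<le> 2 * \<rho>" for \<alpha>'
   proof (cases \<alpha>' \<alpha> rule: linorder_cases)
    case less
    obtain z where z: "\<alpha>' < z" "z < \<alpha>" "HH u v \<alpha> - HH u v \<alpha>' = (\<alpha> - \<alpha>') * - GG u v z"
     using MVT2[OF less, of "HH u v" "%z. - GG u v z"] HH_DERIV[OF u v] by blast
    have "0 \<le> \<omega> / 2 * (\<alpha> - z)" using \<omega> z by simp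
    moreover have "\<bar>z\<bar> \<le> 2 * \<rho>" "\<bar>\<alpha>\<bar> \<le> 2 * \<rho>" using z(1,2) \<alpha> al \<rho> by linarith+
    ultimately have "GG u v z \<le> 0" using mono[of z \<alpha>] z(2) \<alpha>(3) by simp
    then have "0 \<le> (\<alpha> - \<alpha>') * - GG u v z" using less by (intro mult_nonneg_nonneg) auto
    then show ?thesis using z(3) by linarith
   next
    case greater
    obtain z where z: "\<alpha> < z" "z < \<alpha>'" "HH u v \<alpha>' - HH u v \<alpha> = (\<alpha>' - \<alpha>) * - GG u v z"
     using MVT2[OF greater, of "HH u v" "%z. - GG u v z"] HH_DERIV[OF u v] by blast
    have "0 \<le> \<omega> / 2 * (z - \<alpha>)" using \<omega> z by simp
    moreover have "\<bar>z\<bar> \<le> 2 * \<rho>" "\<bar>\<alpha>\<bar> \<le> 2 * \<rho>" using z(1,2) \<alpha> al \<rho> by linarith+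
    ultimately have "GG u v z \<ge> 0" using mono[of \<alpha> z] z(1) \<alpha>(3) by simp
    then have "(\<alpha>' - \<alpha>) * - GG u v z \<le> 0" using greater by (intro mult_nonneg_nonpos) auto
    then show ?thesis using z(3) by linarith
   qed simp
   then show ?thesis using \<alpha> ne by (intro exI[of _ \<alpha>]) auto
  qed
  then show "\<exists>\<epsilon>>0. \<forall>u v. L2 u --> L2 v --> ndist u phi < \<epsilon> --> nrm (%x. v x - (- c) * phi x) < \<epsilon> -->
   (\<exists>\<alpha>. \<bar>\<alpha>\<bar> < \<rho> \<and> GG u v \<alpha> = 0 \<and> (\<forall>\<alpha>'. \<bar>\<alpha>'\<bar> \<le> 2 * \<rho> --> HH u v \<alpha>' \<le> HH u v \<alpha>))" using \<epsilon>(1) by blast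
 qed
qed

end

section \<open>Growth of the Lyapunov functional\<close>

text \<open>Collects a solution staying near the orbit together with all thresholds, in order to
  derive \<open>False\<close>. The fractions are bookkeeping: es/2 is shared between distance and
  translation, \<nu>/4 serves a chain of four distances, and half the norm of \<open>phi\<close>
  keeps the solution away from 0.\<close>

locale dyn = direct p f \<beta> c phi g w + sol p f \<beta> U for p f \<beta> c phi g w U +
 fixes es l \<rho> e \<nu> :: real
 assumes static: "\<And>y y1 y2 z. W2 y y1 y2 ==> L2 z ==> ndist y phi < es ==> ndist y1 phi1 < es ==> ndist y2 phi2 < es ==>
   JJ * NN \<beta> c y y1 y2 < 0 ==> Sf \<beta> c y y1 y2 z < dd ==> (dd - Sf \<beta> c y y1 y2 z) / l \<le> - PP y y1 y2 z"
  and l0: "l > 0" and e0: "e > 0" "e \<le> es / 2" "e \<le> \<nu> / 4" "e \<le> nrm phi / 2"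
  and tr: "\<And>r. \<bar>r\<bar> < \<rho> ==> nrm (%x. phi (x + r) - phi x) < es / 2" "\<And>r. \<bar>r\<bar> < \<rho> ==> nrm (%x. phi1 (x + r) - phi1 x) < es / 2"
   "\<And>r. \<bar>r\<bar> < \<rho> ==> nrm (%x. phi2 (x + r) - phi2 x) < es / 2"
  and win: "\<And>y z. L2 y ==> L2 z ==> ndist y phi < e ==> nrm (%x. z x - (- c) * phi x) < e ==>
   \<exists>\<alpha>. \<bar>\<alpha>\<bar> < \<rho> \<and> GG y z \<alpha> = 0 \<and> (\<forall>\<alpha>'. \<bar>\<alpha>'\<bar> \<le> 2 * \<rho> --> HH y z \<alpha>' \<le> HH y z \<alpha>)"
  and sep: "\<And>r. nrm (%x. phi (x + r) - phi x) < \<nu> ==> \<bar>r\<bar> < \<rho>"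
  and near: "\<And>t. t \<ge> 0 ==> \<exists>r. nrm (%x. u t (x + r) - phi x) < e \<and> nrm (%x. u1 t (x + r) - phi1 x) < e
   \<and> nrm (%x. u2 t (x + r) - phi2 x) < e \<and> nrm (%x. v t (x + r) - (- c) * phi x) < e"
  and S0: "Sf \<beta> c (u 0) (u1 0) (u2 0) (v 0) < dd" and N0: "JJ * NN \<beta> c (u 0) (u1 0) (u2 0) < 0"
begin

definition "\<kappa> = (dd - Sf \<beta> c (u 0) (u1 0) (u2 0) (v 0)) / l"

lemma \<kappa>_pos: "\<kappa> > 0" using S0 l0 by (simp add: \<kappa>_def)

lemma u_pos: assumes "t \<ge> 0" shows "nrm (u t) > 0" "nrm (u t) \<le> nrm phi + e" "nrm (v t) \<le> \<bar>c\<bar> * nrm phi + e"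
proof -
 obtain r where r: "nrm (%x. u t (x + r) - phi x) < e" "nrm (%x. v t (x + r) - (- c) * phi x) < e" using near[OF assms] by (elim exE conjE) (rule that)
 have 1: "nrm phi \<le> nrm (%x. u t (x + r)) + nrm (%x. u t (x + r) - phi x)"
  using nrm_reach[OF L2phi L2_shift[OF L2u[OF assms], of r]] by (simp only: nrm_minus_commute)
 show "nrm (u t) > 0" using 1 r(1) e0(4) phi1_pos(1) unfolding nrm_shift by linarith
 show "nrm (u t) \<le> nrm phi + e" using nrm_reach[OF L2_shift[OF L2u[OF assms], of r] L2phi] r(1) unfolding nrm_shift by linarith
 show "nrm (v t) \<le> \<bar>c\<bar> * nrm phi + e"
  using nrm_reach[OF L2_shift[OF L2v[OF assms], of r] L2_cmult[OF L2phi, of "- c"]] r(2) unfolding nrm_shift nrm_cmult by simp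
qed

text \<open>N is continuous along the solution; at a zero S would be at least \<open>dd\<close>,
  whereas S is conserved and started below.\<close>

lemma N_neg: assumes T: "T \<ge> 0" shows "JJ * NN \<beta> c (u T) (u1 T) (u2 T) < 0"
proof (rule ccontr)
 assume nT: "\<not> ?thesis"
 define n where "n t = JJ * NN \<beta> c (u t) (u1 t) (u2 t)" for t
 have "continuous_on {0..} n" unfolding continuous_on_def
 proof
  fix t :: real assume "t \<in> {0..}"
  then have t: "t \<ge> 0" by simp
  show "(n \<longlongrightarrow> n t) (at t within {0..})" unfolding tendsto_iff
  proof (intro allI impI)
   fix \<epsilon> :: real assume "\<epsilon> > 0"
   then have \<epsilon>: "\<epsilon> / \<bar>JJ\<bar> > 0" using JJ0 by simp
   obtain d where d: "d > 0" "\<And>y y1 y2. W2 y y1 y2 ==> ndist y (u t) < d ==> ndist y1 (u1 t) < d ==> ndist y2 (u2 t) < d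
    ==> \<bar>NN \<beta> c y y1 y2 - NN \<beta> c (u t) (u1 t) (u2 t)\<bar> < \<epsilon> / \<bar>JJ\<bar>" by (rule NN_cont[OF W2u[OF t] \<epsilon>], rule that)
   have ev: "\<forall>\<^sub>F r in at t within {0..}. D r t < d" by (rule order_tendstoD(2)[OF D_tendsto[OF t] d(1)])
   have ev0: "\<forall>\<^sub>F r in at t within {0..}. r \<ge> (0::real)" unfolding eventually_at by (intro exI[of _ 1]) auto
   show "\<forall>\<^sub>F r in at t within {0..}. dist (n r) (n t) < \<epsilon>"
    using ev ev0
   proof eventually_elim
    case (elim r)
    note X = D_ge[OF elim(2) t]
    have "\<bar>NN \<beta> c (u r) (u1 r) (u2 r) - NN \<beta> c (u t) (u1 t) (u2 t)\<bar> < \<epsilon> / \<bar>JJ\<bar>"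
     by (rule d(2)[OF W2u[OF elim(2)]]; rule le_less_trans[OF _ elim(1)]; rule X)
    then show ?case using JJ0 unfolding dist_real_def n_def right_diff_distrib[symmetric] abs_mult by (simp add: pos_less_divide_eq mult.commute)
   qed
  qed
 qed
 then have "continuous_on {0..T} n" by (rule continuous_on_subset) auto
 moreover have "n 0 \<le> 0" "0 \<le> n T" using N0 nT by (simp_all add: n_def)
 ultimately obtain t where t: "0 \<le> t" "t \<le> T" "n t = 0" using IVT'[of n 0 0 T] T by blast
 then have "NN \<beta> c (u t) (u1 t) (u2 t) = 0" using JJ0 by (simp add: n_def)
 from Sf_ge_dd[OF W2u[OF t(1)] L2v[OF t(1)] u_pos(1)[OF t(1)] this] show False using S0 S_conserved[OF t(1), of c] by simp
qed

text \<open>All derivatives are moved to the test functions, so that the first variation becomes a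
  sum of pairings with u, v and f(u). These are the terms of the time derivative of
  \<open>HH\<close>, up to c times the momentum pairing.\<close>

lemma PP_eq:
 assumes W: "W2 y y1 y2" and z: "L2 z"
 shows "- PP y y1 y2 z = - (LI x. z x * deriv h x) + (LI x. f (y x) * a x) - (LI x. y x * Lop a x)
  - c * ((LI x. y x * deriv h x) + (LI x. z x * a x))"
proof -
 note L = W2D[OF W]
 have ta: "test_fun ((deriv ^^ j) a)" for j by (rule test_derivs[OF a_test])
 note aL = test_L2[OF ta]
 have hL: "L2 (deriv h)" by (rule test_L2[OF test_deriv[OF h_test]])
 have q: "(deriv ^^ 2) a = deriv (deriv a)" "(deriv ^^ 4) a = deriv (deriv (deriv (deriv a)))" by (simp_all add: numeral_eq_Suc)
 have w: "(LI x. y x * deriv k x) = - (LI x. y1 x * k x)" "(LI x. y1 x * deriv k x) = - (LI x. y2 x * k x)" if "test_fun k" for k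
  using L(4,5) that by (simp_all add: weak_deriv_def)
 note t1 = test_deriv[OF a_test] note t2 = test_deriv[OF t1] note t3 = test_deriv[OF t2]
 have 2: "(LI x. y2 x * deriv (deriv a) x) = (LI x. y x * (deriv ^^ 4) a x)"
  unfolding q w(1)[OF t3] w(2)[OF t2] by simp
 have 1: "(LI x. y1 x * deriv a x) = - (LI x. y x * (deriv ^^ 2) a x)"
  unfolding q w(1)[OF t1] by simp
 have 3: "(LI x. y x * Lop a x) = (LI x. y x * a x) + \<beta> * (LI x. y x * (deriv ^^ 2) a x) + (LI x. y x * (deriv ^^ 4) a x)"
 proof -
  have "(LI x. y x * Lop a x) = (LI x. y x * a x + \<beta> * (y x * (deriv ^^ 2) a x) + y x * (deriv ^^ 4) a x)"
   by (intro Bochner_Integration.integral_cong refl) (simp add: Lop_def algebra_simps)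
  then show ?thesis using L2_mult[OF L(1) aL[of 0]] L2_mult[OF L(1) aL[of 2]] L2_mult[OF L(1) aL[of 4]] by simp
 qed
 have dw: "deriv w x = deriv h x + c * a x" for x unfolding dh by simp
 have 4: "(LI x. (z x + c * y x) * deriv w x) = (LI x. z x * deriv h x) + c * (LI x. z x * a x)
   + c * (LI x. y x * deriv h x) + c\<^sup>2 * (LI x. y x * a x)"
 proof -
  have "(LI x. (z x + c * y x) * deriv w x) = (LI x. z x * deriv h x + c * (z x * a x) + c * (y x * deriv h x) + c\<^sup>2 * (y x * a x))"
   unfolding dw by (intro Bochner_Integration.integral_cong refl) (simp add: power2_eq_square algebra_simps)
  then show ?thesis using L2_mult[OF z hL] L2_mult[OF z aL[of 0]] L2_mult[OF L(1) hL] L2_mult[OF L(1) aL[of 0]] by simp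
 qed
 show ?thesis unfolding PP_def 1 2 3 4 s_def by (simp add: algebra_simps)
qed

text \<open>Here r locates the orbit and \<alpha> maximises the pairing near r. The function
  \<open>\<alpha>\<close> of time below is a mere choice and may jump.\<close>

definition "good t r \<alpha> \<longleftrightarrow> nrm (%x. u t (x + r) - phi x) < e \<and> nrm (%x. u1 t (x + r) - phi1 x) < e \<and> nrm (%x. u2 t (x + r) - phi2 x) < e
 \<and> \<bar>\<alpha> - r\<bar> < \<rho> \<and> GG (u t) (v t) \<alpha> = 0 \<and> (\<forall>\<alpha>'. \<bar>\<alpha>' - r\<bar> \<le> 2 * \<rho> --> HH (u t) (v t) \<alpha>' \<le> HH (u t) (v t) \<alpha>)"
definition "\<alpha> t = (SOME \<alpha>. \<exists>r. good t r \<alpha>)"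
definition "A t = HH (u t) (v t) (\<alpha> t)"
text \<open>The time derivative of the pairing at a frozen translation b, see
  \<open>HH_has_integral\<close>.\<close>

definition "E r b = - cr (deriv h) (v r) b + cr a (%x. f (u r x)) b - cr (Lop a) (u r) b"

lemma good_\<alpha>: assumes t: "t \<ge> 0" shows "\<exists>r. good t r (\<alpha> t)"
proof -
 obtain r where r: "nrm (%x. u t (x + r) - phi x) < e" "nrm (%x. u1 t (x + r) - phi1 x) < e"
  "nrm (%x. u2 t (x + r) - phi2 x) < e" "nrm (%x. v t (x + r) - (- c) * phi x) < e" using near[OF t] by (elim exE conjE) (rule that)
 obtain b where b0: "\<bar>b\<bar> < \<rho> \<and> GG (%x. u t (x + r)) (%x. v t (x + r)) b = 0 \<and>
  (\<forall>b'. \<bar>b'\<bar> \<le> 2 * \<rho> --> HH (%x. u t (x + r)) (%x. v t (x + r)) b' \<le> HH (%x. u t (x + r)) (%x. v t (x + r)) b)"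
  using win[OF L2_shift[OF L2u[OF t], of r] L2_shift[OF L2v[OF t], of r] r(1,4)] by (elim exE) (rule that)
 note b = b0[THEN conjunct1] b0[THEN conjunct2, THEN conjunct1] b0[THEN conjunct2, THEN conjunct2, rule_format]
 have "good t r (b + r)" unfolding good_def
 proof (intro conjI allI impI)
  show "GG (u t) (v t) (b + r) = 0" using b(2) unfolding GG_def cr_add .
  show "\<bar>b + r - r\<bar> < \<rho>" using b(1) by simp
  fix b' assume "\<bar>b' - r\<bar> \<le> 2 * \<rho>"
  from b(3)[OF this] show "HH (u t) (v t) b' \<le> HH (u t) (v t) (b + r)" unfolding HH_def cr_add by simp
 qed (rule r)+
 then have "\<exists>\<alpha> r. good t r \<alpha>" by blast
 then show ?thesis unfolding \<alpha>_def by (rule someI_ex)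
qed

text \<open>At the maximiser \<open>GG\<close> vanishes, so the time derivative equals -S' at the
  recentred state applied to psi, which \<open>static\<close> bounds below. The bound is the same at
  all times because S is conserved.\<close>

lemma E_ge: assumes t: "t \<ge> 0" shows "\<kappa> \<le> E t (\<alpha> t)"
proof -
 obtain r where g: "good t r (\<alpha> t)" using good_\<alpha>[OF t] by blast
 define b where "b = \<alpha> t"
 have br: "\<bar>b - r\<bar> < \<rho>" and G: "GG (u t) (v t) b = 0" using g by (auto simp: good_def b_def)
 have sh: "nrm (%x. y (x + b) - z x) < es" if "L2 y" "L2 z" "nrm (%x. y (x + r) - z x) < e" "nrm (%x. z (x + (b - r)) - z x) < es / 2" for y z
 proof -
  have "nrm (%x. y (x + (b - r) + r) - z x) \<le> nrm (%x. y (x + r) - z x) + nrm (%x. z (x + (b - r)) - z x)"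
   by (rule nrm_shift_close[OF L2_shift[OF that(1)] that(2)])
  moreover have "x + (b - r) + r = x + b" for x by simp
  ultimately show ?thesis using that(3,4) e0(2) by simp
 qed
 note W = W2_shift[OF W2u[OF t], of b] and Lv = L2_shift[OF L2v[OF t], of b]
 have S: "Sf \<beta> c (%x. u t (x + b)) (%x. u1 t (x + b)) (%x. u2 t (x + b)) (%x. v t (x + b)) = Sf \<beta> c (u 0) (u1 0) (u2 0) (v 0)"
  unfolding Sf_shift by (rule S_conserved[OF t])
 have "\<kappa> \<le> - PP (%x. u t (x + b)) (%x. u1 t (x + b)) (%x. u2 t (x + b)) (%x. v t (x + b))"
  unfolding \<kappa>_def S[symmetric]
 proof (rule static[OF W Lv])
  show "nrm (%x. u t (x + b) - phi x) < es" by (rule sh[OF L2u[OF t] L2phi _ tr(1)[OF br]]) (use g in \<open>simp add: good_def\<close>)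
  show "nrm (%x. u1 t (x + b) - phi1 x) < es" by (rule sh[OF L2u1[OF t] L2phi1 _ tr(2)[OF br]]) (use g in \<open>simp add: good_def\<close>)
  show "nrm (%x. u2 t (x + b) - phi2 x) < es" by (rule sh[OF L2u2[OF t] L2phi2 _ tr(3)[OF br]]) (use g in \<open>simp add: good_def\<close>)
  show "JJ * NN \<beta> c (%x. u t (x + b)) (%x. u1 t (x + b)) (%x. u2 t (x + b)) < 0" unfolding NN_shift by (rule N_neg[OF t])
  show "Sf \<beta> c (%x. u t (x + b)) (%x. u1 t (x + b)) (%x. u2 t (x + b)) (%x. v t (x + b)) < dd" unfolding S by (rule S0)
 qed
 also have "\<dots> = E t b - c * GG (u t) (v t) b" unfolding PP_eq[OF W Lv] E_def GG_def cr_shift ..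
 finally show ?thesis unfolding G b_def[symmetric] by simp
qed

lemma HH_has_integral: assumes t: "0 \<le> t1" "t1 \<le> t2"
 shows "((%r. E r b) has_integral (HH (u t2) (v t2) b - HH (u t1) (v t1) b)) {t1..t2}"
proof -
 have aff: "(%x. k (x - b)) = (%x. k (1 * x + (- b)))" for k :: "real => real" by simp
 have T: "test_fun (%x. k (x - b))" if "test_fun k" for k unfolding aff by (rule test_affine[OF that]) simp
 have d: "deriv (%x. k (x - b)) = (%x. deriv k (x - b))" if "test_fun k" for k
  unfolding aff deriv_affine[OF test_smooth[OF that]] by simp
 have dj: "(deriv ^^ j) (%x. k (x - b)) = (%x. (deriv ^^ j) k (x - b))" if "test_fun k" for k j
  by (induction j) (simp_all add: d test_derivs[OF that])
 have Lp: "Lop (%x. a (x - b)) = (%x. Lop a (x - b))" unfolding Lop_def[abs_def] dj[OF a_test] ..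
 note 1 = sol_u[OF T[OF h_test] t] and 2 = sol_v[OF T[OF g_test] t]
 have da: "deriv (%x. g (x - b)) = (%x. a (x - b))" unfolding d[OF g_test] a_def ..
 have "((%r. - cr (deriv h) (v r) b + (cr a (%x. f (u r x)) b - cr (Lop a) (u r) b)) has_integral
   ((cr h (u t2) b - cr h (u t1) b) + (cr g (v t2) b - cr g (v t1) b))) {t1..t2}"
  using has_integral_add[OF 1 2] unfolding da Lp d[OF h_test] cr_def .
 then show ?thesis unfolding E_def HH_def by (simp add: algebra_simps)
qed

text \<open>The constant is independent of b, so one step length works whatever the current
  maximiser is.\<close>

lemma E_lip: assumes r: "0 \<le> r1" "r1 \<le> T" "0 \<le> r2" "r2 \<le> T"
 shows "\<bar>E r1 b - E r2 b\<bar> \<le> (nrm (deriv h) + Lf T * nrm a + nrm (Lop a)) * D r1 r2"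
proof -
 have cd: "\<bar>cr k y b - cr k z b\<bar> \<le> ndist y z * nrm k" if "L2 y" "L2 z" "L2 k" for k y z
  unfolding cr_def using LINT_diff_bound[OF that(1,2) L2_shift[OF that(3), of "- b"]] nrm_shift[of k "- b"] by simp
 note X = D_ge[OF r(1,3)] and t = test_L2[OF test_deriv[OF h_test]] test_L2[OF a_test] test_L2[OF Lop_test[OF a_test]]
 have 1: "\<bar>cr (deriv h) (v r1) b - cr (deriv h) (v r2) b\<bar> \<le> D r1 r2 * nrm (deriv h)"
  by (rule order_trans[OF cd[OF L2v[OF r(1)] L2v[OF r(3)] t(1)] mult_right_mono[OF X(4) nrm_nonneg]])
 have 2: "\<bar>cr a (%x. f (u r1 x)) b - cr a (%x. f (u r2 x)) b\<bar> \<le> (Lf T * D r1 r2) * nrm a"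
  by (rule order_trans[OF cd[OF fu_L2[OF r(1)] fu_L2[OF r(3)] t(2)] mult_right_mono[OF Lf(2)[OF r] nrm_nonneg]])
 have 3: "\<bar>cr (Lop a) (u r1) b - cr (Lop a) (u r2) b\<bar> \<le> D r1 r2 * nrm (Lop a)"
  by (rule order_trans[OF cd[OF L2u[OF r(1)] L2u[OF r(3)] t(3)] mult_right_mono[OF X(1) nrm_nonneg]])
 have "\<bar>E r1 b - E r2 b\<bar> \<le> D r1 r2 * nrm (deriv h) + (Lf T * D r1 r2) * nrm a + D r1 r2 * nrm (Lop a)"
  unfolding E_def using 1 2 3 by linarith
 then show ?thesis by (simp add: algebra_simps)
qed

text \<open>Freeze b at the maximiser of time t1. At t2 the maximum is at least the value at b, and
  at t1 the two agree; so A grows at least as much as the pairing at fixed b, whose time derivative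
  stays above \<kappa>/2 on a short interval.\<close>

lemma local_growth: assumes t: "t \<ge> 0"
 shows "\<exists>d>0. \<forall>t1 t2. 0 \<le> t1 --> t1 \<le> t2 --> \<bar>t1 - t\<bar> < d --> \<bar>t2 - t\<bar> < d --> \<kappa> / 2 * (t2 - t1) \<le> A t2 - A t1"
proof -
 define C where "C = nrm (deriv h) + Lf (t + 1) * nrm a + nrm (Lop a) + 1"
 have C: "C > 0" using Lf(1)[of "t + 1"] nrm_nonneg[of a] nrm_nonneg[of "deriv h"] nrm_nonneg[of "Lop a"]
  mult_nonneg_nonneg[OF less_imp_le[OF Lf(1)[of "t + 1"]] nrm_nonneg[of a]] unfolding C_def by linarith
 \<comment> \<open>Two Lipschitz errors of \<kappa>/4 each, at t1 and at the running time, still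
   leave \<kappa>/2.\<close>
 define \<eta> where "\<eta> = min e (\<kappa> / (4 * C))"
 have \<eta>: "\<eta> > 0" "\<eta> \<le> e" "C * \<eta> \<le> \<kappa> / 4"
 proof -
  show "\<eta> > 0" "\<eta> \<le> e" using e0(1) \<kappa>_pos C by (auto simp: \<eta>_def)
  have "C * \<eta> \<le> C * (\<kappa> / (4 * C))" using C by (intro mult_left_mono) (auto simp: \<eta>_def)
  then show "C * \<eta> \<le> \<kappa> / 4" using C by simp
 qed
 have "\<forall>\<^sub>F r in at t within {0..}. D r t < \<eta>" by (rule order_tendstoD(2)[OF D_tendsto[OF t] \<eta>(1)])
 then obtain d where d: "d > 0" "\<forall>r\<in>{0..}. r \<noteq> t \<and> dist r t < d --> D r t < \<eta>" unfolding eventually_at by (elim exE conjE) (rule that)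
 have z: "ndist k k = 0" for k :: "real => real" unfolding nrm_def by simp
 have "D t t = X_dist (u t, v t) (u t, v t)" unfolding D_def U_eq[of t] ..
 also have "\<dots> \<le> 0" using X_dist_le[OF W2u[OF t] W2u[OF t], of "v t" "v t"] unfolding z by linarith
 finally have Dt: "D t t = 0" using D_ge(5)[OF t t] by linarith
 have D: "D r t < \<eta>" if "r \<ge> 0" "\<bar>r - t\<bar> < d" for r
 proof (cases "r = t")
  case True then show ?thesis using Dt \<eta>(1) by simp
 next
  case False show ?thesis by (rule d(2)[THEN bspec, THEN mp]) (use that False in \<open>simp_all add: dist_real_def\<close>)
 qed
 show ?thesis
 proof (intro exI[of _ "min d 1"] conjI allI impI)
  show "min d 1 > 0" using d by simp
  fix t1 t2 :: real assume o: "0 \<le> t1" "t1 \<le> t2" and n: "\<bar>t1 - t\<bar> < min d 1" "\<bar>t2 - t\<bar> < min d 1"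
  define b where "b = \<alpha> t1"
  have t2: "0 \<le> t2" using o by simp
  have "\<exists>r. good t1 r b" unfolding b_def by (rule good_\<alpha>[OF o(1)])
  then obtain r1 where g1: "good t1 r1 b" by (elim exE) (rule that)
  obtain r2 where g2: "good t2 r2 (\<alpha> t2)" using good_\<alpha>[OF t2] by (elim exE) (rule that)
  note g = g1 g2
  have dn: "D t1 t < \<eta>" "D t2 t < \<eta>" by (rule D; use o n in simp)+
  \<comment> \<open>Both positions bring nearly the same function within e of phi, so phi is almost
    invariant under the shift r1 - r2 and separation applies.\<close>
  have rr: "\<bar>r1 - r2\<bar> < \<rho>"
  proof (rule sep)
   have L: "L2 (%x. phi (x + (r1 - r2)))" "L2 (%x. u t2 (x + r1))" "L2 (%x. u t1 (x + r1))" "L2 (%x. u t (x + r1))"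
    by (intro L2_shift L2phi L2u o t t2)+
   have 1: "nrm (%x. phi (x + (r1 - r2)) - u t2 (x + r1)) < e"
   proof -
    have "nrm (%x. phi (x + (r1 - r2)) - u t2 (x + r1)) = nrm (%x. phi x - u t2 (x + r2))"
     using nrm_shift[of "%x. phi x - u t2 (x + r2)" "r1 - r2"] by simp
    then show ?thesis using g(2) unfolding good_def nrm_minus_commute[of phi] by simp
   qed
   have 2: "nrm (%x. u t2 (x + r1) - u t (x + r1)) < \<eta>"
    using nrm_shift[of "%x. u t2 x - u t x" r1] le_less_trans[OF D_ge(1)[OF t2 t] dn(2)] by simp
   have 3: "nrm (%x. u t (x + r1) - u t1 (x + r1)) < \<eta>"
    using nrm_shift[of "%x. u t1 x - u t x" r1] le_less_trans[OF D_ge(1)[OF o(1) t] dn(1)] unfolding nrm_minus_commute[of "%x. u t (x + r1)"] by simp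
   have 4: "nrm (%x. u t1 (x + r1) - phi x) < e" using g(1) by (simp add: good_def)
   have "nrm (%x. phi (x + (r1 - r2)) - phi x) \<le> nrm (%x. phi (x + (r1 - r2)) - u t2 (x + r1)) + nrm (%x. u t2 (x + r1) - phi x)"
    by (rule nrm_triangle3[OF L(1,2) L2phi])
   moreover have "nrm (%x. u t2 (x + r1) - phi x) \<le> nrm (%x. u t2 (x + r1) - u t (x + r1)) + nrm (%x. u t (x + r1) - phi x)"
    by (rule nrm_triangle3[OF L(2,4) L2phi])
   moreover have "nrm (%x. u t (x + r1) - phi x) \<le> nrm (%x. u t (x + r1) - u t1 (x + r1)) + nrm (%x. u t1 (x + r1) - phi x)"
    by (rule nrm_triangle3[OF L(4,3) L2phi])
   ultimately show "nrm (%x. phi (x + (r1 - r2)) - phi x) < \<nu>" using 1 2 3 4 \<eta>(2) e0(3) by linarith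
  qed
  have "\<bar>b - r2\<bar> \<le> 2 * \<rho>" using g(1) rr unfolding good_def by linarith
  then have max: "HH (u t2) (v t2) b \<le> A t2" using g(2) unfolding good_def A_def by blast
  have Eb: "\<kappa> / 2 \<le> E r b" if r: "r \<in> {t1..t2}" for r
  proof -
   have rt: "0 \<le> r" "\<bar>r - t\<bar> < d" "r \<le> t + 1" "t \<le> t + 1" "t1 \<le> t + 1" using r o n by auto
   have q: "\<bar>E q b - E t b\<bar> \<le> \<kappa> / 4" if q: "0 \<le> q" "q \<le> t + 1" "\<bar>q - t\<bar> < d" for q
   proof -
    have "\<bar>E q b - E t b\<bar> \<le> (C - 1) * D q t" using E_lip[OF q(1,2) t rt(4), of b] by (simp add: C_def)
    also have "\<dots> \<le> C * D q t" by (intro mult_right_mono D_ge(5) q t) simp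
    also have "\<dots> \<le> C * \<eta>" using D[OF q(1,3)] C by simp
    finally show ?thesis using \<eta>(3) by linarith
   qed
   have "\<bar>E t1 b - E t b\<bar> \<le> \<kappa> / 4" by (rule q) (use o n rt in auto)
   moreover have "\<kappa> \<le> E t1 b" unfolding b_def by (rule E_ge[OF o(1)])
   ultimately show ?thesis using q[OF rt(1,3,2)] by linarith
  qed
  have "((%r. \<kappa> / 2) has_integral (\<kappa> / 2 * (t2 - t1))) {t1..t2}" using has_integral_const_real[of "\<kappa> / 2" t1 t2] o by (simp add: mult.commute)
  from has_integral_le[OF this HH_has_integral[OF o, of b]] Eb have "\<kappa> / 2 * (t2 - t1) \<le> HH (u t2) (v t2) b - HH (u t1) (v t1) b" by simp
  then show "\<kappa> / 2 * (t2 - t1) \<le> A t2 - A t1" using max unfolding A_def[of t1] b_def[symmetric] by linarith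
 qed
qed

lemma contradiction: False
proof -
 have growth: "\<kappa> / 2 * T \<le> A T - A 0" if T: "T \<ge> 0" for T
 proof -
  \<comment> \<open>Subdivision by \<open>Bolzano\<close>: growth adds up over adjacent intervals
    and holds on short ones. The premise \<open>0 \<le> a\<close> restricts the property to times
    where the solution lives.\<close>
  have "0 \<le> (0::real) --> \<kappa> / 2 * (T - 0) \<le> A T - A 0"
  proof (rule Bolzano[where P="%a b. 0 \<le> a --> \<kappa> / 2 * (b - a) \<le> A b - A a", OF T])
   fix x y z :: real
   assume "0 \<le> x --> \<kappa> / 2 * (y - x) \<le> A y - A x" "0 \<le> y --> \<kappa> / 2 * (z - y) \<le> A z - A y" "x \<le> y" "y \<le> z"
   moreover have "\<kappa> / 2 * (y - x) + \<kappa> / 2 * (z - y) = \<kappa> / 2 * (z - x)" by (simp add: right_diff_distrib)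
   ultimately show "0 \<le> x --> \<kappa> / 2 * (z - x) \<le> A z - A x" by linarith
  next
   fix t :: real assume "0 \<le> t"
   from local_growth[OF this] obtain d where d: "d > 0" "\<And>t1 t2. 0 \<le> t1 ==> t1 \<le> t2 ==> \<bar>t1 - t\<bar> < d ==> \<bar>t2 - t\<bar> < d ==> \<kappa> / 2 * (t2 - t1) \<le> A t2 - A t1" by blast
   show "\<exists>d>0. \<forall>a b. a \<le> t \<and> t \<le> b \<and> b - a < d --> 0 \<le> a --> \<kappa> / 2 * (b - a) \<le> A b - A a"
    by (rule exI[of _ d]) (use d in auto)
  qed
  then show ?thesis by simp
 qed
 define B where "B = (nrm phi + e) * nrm h + (\<bar>c\<bar> * nrm phi + e) * nrm g"
 have Ab: "\<bar>A t\<bar> \<le> B" if t: "t \<ge> 0" for t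
 proof -
  have cb: "\<bar>cr k y b\<bar> \<le> nrm y * nrm k" if "L2 y" "L2 k" for k y b
   unfolding cr_def using CS_ineq[OF that(1) L2_shift[OF that(2), of "- b"]] nrm_shift[of k "- b"] by simp
  have "\<bar>cr h (u t) (\<alpha> t)\<bar> \<le> (nrm phi + e) * nrm h"
   by (rule order_trans[OF cb[OF L2u[OF t] test_L2[OF h_test]] mult_right_mono[OF u_pos(2)[OF t] nrm_nonneg]])
  moreover have "\<bar>cr g (v t) (\<alpha> t)\<bar> \<le> (\<bar>c\<bar> * nrm phi + e) * nrm g"
   by (rule order_trans[OF cb[OF L2v[OF t] test_L2[OF g_test]] mult_right_mono[OF u_pos(3)[OF t] nrm_nonneg]])
  ultimately show ?thesis unfolding A_def HH_def B_def by linarith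
 qed
 \<comment> \<open>By this time linear growth exceeds 2B, the largest possible increase of a
   quantity bounded by B.\<close>
 define T where "T = (2 * B + 1) * 2 / \<kappa>"
 have B0: "B \<ge> 0" using Ab[of 0] by simp
 have T: "T \<ge> 0" "\<kappa> / 2 * T = 2 * B + 1" using B0 \<kappa>_pos by (auto simp: T_def)
 show False using growth[OF T(1)] Ab[of 0] Ab[OF T(1)] unfolding T(2) by simp
qed

end

section \<open>Initial data below the level of the wave, and conclusion\<close>

context nonlin begin

text \<open>A solution attains its data only up to X-distance 0, that is almost everywhere; S and N
  have to be transferred along that equality.\<close>

lemma SN_cong:
 assumes "W2 y y1 y2" "W2 w w1 w2" "L2 z" "L2 q"
  and n: "ndist y w = 0" "ndist y1 w1 = 0" "ndist y2 w2 = 0" "ndist z q = 0"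
 shows "Sf \<beta> c y y1 y2 z = Sf \<beta> c w w1 w2 q" "NN \<beta> c y y1 y2 = NN \<beta> c w w1 w2"
proof -
 note L = W2D[OF assms(1)] and L' = W2D[OF assms(2)]
 note [measurable] = L2_meas[OF L(1)] L2_meas[OF L'(1)] L2_meas[OF assms(3)] L2_meas[OF assms(4)]
 have e: "nrm y = nrm w" "nrm y1 = nrm w1" "nrm y2 = nrm w2" "nrm z = nrm q"
  using nrm_diff_ge[OF L(1) L'(1)] nrm_diff_ge[OF L(2) L'(2)] nrm_diff_ge[OF L(3) L'(3)] nrm_diff_ge[OF assms(3,4)] unfolding n by auto
 have a: "AE x in lborel. y x = w x" "AE x in lborel. z x = q x"
  using nrm_zero_AE[OF L2_diff[OF L(1) L'(1)] n(1)] nrm_zero_AE[OF L2_diff[OF assms(3,4)] n(4)] by auto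
 have F: "(LI x. F (y x)) = (LI x. F (w x))" by (rule integral_cong_AE) (use a in auto)
 have "(LI x. y x * z x) = (LI x. w x * q x)" by (rule integral_cong_AE) (use a in auto)
 then show "Sf \<beta> c y y1 y2 z = Sf \<beta> c w w1 w2 q" by (simp add: Sf_def e F)
 show "NN \<beta> c y y1 y2 = NN \<beta> c w w1 w2" by (simp add: NN_def II_def KK_def e F)
qed

end

context gstate begin

text \<open>On the ray of multiples S equals q(k) I with q(k) = k^2/2 - k^(p+1)/(p+1), strictly
  maximal at k = 1, so both sides of the wave lie below \<open>dd\<close>; the sign of N tells the
  sides apart.\<close>

lemma scaled_state:
 assumes k: "k > 0" "k \<noteq> 1"
 shows "Sf \<beta> c (%x. k * phi x) (%x. k * phi1 x) (%x. k * phi2 x) (%x. - c * (k * phi x)) < dd"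
  and "NN \<beta> c (%x. k * phi x) (%x. k * phi1 x) (%x. k * phi2 x) = (k\<^sup>2 - k powr (p + 1)) * Iphi"
proof -
 note W = W2_cmult[OF W2phi, of k]
 have K: "KK (%x. k * phi x) = k powr (p + 1) * Iphi"
 proof -
  have "KK (%x. k * phi x) = k powr (p + 1) * KK phi" unfolding KK_def F_hom[OF k(1)] by simp
  then show ?thesis using gs_facts(2) by simp
 qed
 have I: "II \<beta> c (%x. k * phi x) (%x. k * phi1 x) (%x. k * phi2 x) = k\<^sup>2 * Iphi"
  unfolding II_def nrm_cmult by (simp add: power_mult_distrib algebra_simps)
 show "NN \<beta> c (%x. k * phi x) (%x. k * phi1 x) (%x. k * phi2 x) = (k\<^sup>2 - k powr (p + 1)) * Iphi"
  unfolding NN_def K I by (simp add: left_diff_distrib)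
 define q where "q x = x\<^sup>2 / 2 - x powr (p + 1) / (p + 1)" for x :: real
 have qd: "(q has_real_derivative x - x powr p) (at x)" if "x > 0" for x
  unfolding q_def using that p2 by (auto intro!: derivative_eq_intros)
 have "q k < q 1"
 proof (cases "k < 1")
  case True
  obtain z where z: "k < z" "z < 1" "q 1 - q k = (1 - k) * (z - z powr p)"
   using MVT2[OF True, of q "%x. x - x powr p"] qd k(1) by (metis less_le_trans)
  have "z powr p < z powr 1" by (rule powr_less_mono') (use z k p2 in auto)
  then have "0 < (1 - k) * (z - z powr p)" using z k True by simp
  then show ?thesis using z(3) by linarith
 next
  case False
  then have k1: "1 < k" using k(2) by simp
  obtain z where z: "1 < z" "z < k" "q k - q 1 = (k - 1) * (z - z powr p)"
   using MVT2[OF k1, of q "%x. x - x powr p"] qd by (metis less_le_trans zero_less_one)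
  have "z powr 1 < z powr p" by (rule powr_less_mono) (use z p2 in auto)
  then have "(k - 1) * (z - z powr p) < 0" using z k1 by (intro mult_pos_neg) auto
  then show ?thesis using z(3) by linarith
 qed
 then have "q k * Iphi < q 1 * Iphi" using gs_facts(3) by (rule mult_strict_right_mono)
 moreover have "Sf \<beta> c (%x. k * phi x) (%x. k * phi1 x) (%x. k * phi2 x) (%x. - c * (k * phi x)) = q k * Iphi"
  unfolding Sf_II[OF W L2_cmult[OF W2D(1)[OF W]]] K I q_def by (simp add: nrm_def left_diff_distrib)
 moreover have "q 1 * Iphi = dd" by (simp add: q_def dd_def)
 ultimately show "Sf \<beta> c (%x. k * phi x) (%x. k * phi1 x) (%x. k * phi2 x) (%x. - c * (k * phi x)) < dd" by simp
qed

end

lemma X_norm_nonneg: "0 \<le> X_norm V" unfolding X_norm_def by (intro real_sqrt_ge_zero add_nonneg_nonneg Bochner_Integration.integral_nonneg) auto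

lemma (in direct) orbit_unstable: "X_unstable \<beta> f (orbit (phi, %x. - c * phi x))"
 unfolding X_unstable_def
proof
 define \<O> where "\<O> = orbit (phi, %x. - c * phi x)"
 assume "X_stable \<beta> f (orbit (phi, %x. - c * phi x))"
 then have stab: "X_stable \<beta> f \<O>" by (simp add: \<O>_def)
 obtain es l where es: "es > 0" "l > 0"
  "\<And>y y1 y2 z. W2 y y1 y2 ==> L2 z ==> ndist y phi < es ==> ndist y1 phi1 < es ==> ndist y2 phi2 < es ==>
   JJ * NN \<beta> c y y1 y2 < 0 ==> Sf \<beta> c y y1 y2 z < dd ==> (dd - Sf \<beta> c y y1 y2 z) / l \<le> - PP y y1 y2 z"
  by (rule static, rule that)
 obtain \<rho>0 where \<rho>0: "\<rho>0 > 0" "\<And>\<rho>. 0 < \<rho> ==> \<rho> \<le> \<rho>0 ==> \<exists>\<epsilon>>0. \<forall>u v. L2 u --> L2 v --> ndist u phi < \<epsilon> --> nrm (%x. v x - (- c) * phi x) < \<epsilon> -->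
  (\<exists>\<alpha>. \<bar>\<alpha>\<bar> < \<rho> \<and> GG u v \<alpha> = 0 \<and> (\<forall>\<alpha>'. \<bar>\<alpha>'\<bar> \<le> 2 * \<rho> --> HH u v \<alpha>' \<le> HH u v \<alpha>))" by (rule window, rule that)
 have es2: "es / 2 > 0" using es(1) by simp
 obtain a0 where a0: "a0 > 0" "\<And>r. \<bar>r\<bar> < a0 ==> nrm (%x. phi (x + r) - phi x) < es / 2" using L2_tcont[OF L2phi] es2 unfolding tcont_def by blast
 obtain a1 where a1: "a1 > 0" "\<And>r. \<bar>r\<bar> < a1 ==> nrm (%x. phi1 (x + r) - phi1 x) < es / 2" using L2_tcont[OF L2phi1] es2 unfolding tcont_def by blast
 obtain a2 where a2: "a2 > 0" "\<And>r. \<bar>r\<bar> < a2 ==> nrm (%x. phi2 (x + r) - phi2 x) < es / 2" using L2_tcont[OF L2phi2] es2 unfolding tcont_def by blast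
 \<comment> \<open>Small enough for the window, and for translations below \<rho> to move phi, phi'
   and phi'' by less than es/2.\<close>
 define \<rho> where "\<rho> = min (min \<rho>0 a0) (min a1 a2)"
 have \<rho>: "\<rho> > 0" "\<rho> \<le> \<rho>0" "\<rho> \<le> a0" "\<rho> \<le> a1" "\<rho> \<le> a2" using \<rho>0(1) a0(1) a1(1) a2(1) by (auto simp: \<rho>_def)
 obtain e1 where e1: "e1 > 0" "\<forall>y z. L2 y --> L2 z --> ndist y phi < e1 --> nrm (%x. z x - (- c) * phi x) < e1 -->
   (\<exists>\<alpha>. \<bar>\<alpha>\<bar> < \<rho> \<and> GG y z \<alpha> = 0 \<and> (\<forall>\<alpha>'. \<bar>\<alpha>'\<bar> \<le> 2 * \<rho> --> HH y z \<alpha>' \<le> HH y z \<alpha>))"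
  using \<rho>0(2)[OF \<rho>(1,2)] by (elim exE conjE) (rule that)
 have "\<And>y z. L2 y ==> L2 z ==> ndist y phi < e1 ==> nrm (%x. z x - (- c) * phi x) < e1 ==>
   \<exists>\<alpha>. \<bar>\<alpha>\<bar> < \<rho> \<and> GG y z \<alpha> = 0 \<and> (\<forall>\<alpha>'. \<bar>\<alpha>'\<bar> \<le> 2 * \<rho> --> HH y z \<alpha>' \<le> HH y z \<alpha>)"
  using e1(2)[THEN spec, THEN spec, THEN mp, THEN mp, THEN mp, THEN mp] .
 note e1 = e1(1) this
 obtain \<nu> where \<nu>: "\<nu> > 0" "\<And>r. nrm (%x. phi (x + r) - phi x) < \<nu> ==> \<bar>r\<bar> < \<rho>" by (rule translation_separation[OF L2phi phi1_pos(1) \<rho>(1)], rule that)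
 define e where "e = min (min e1 (es / 2)) (min (\<nu> / 4) (nrm phi / 2))"
 have e: "e > 0" "e \<le> e1" "e \<le> es / 2" "e \<le> \<nu> / 4" "e \<le> nrm phi / 2" using e1(1) es2 \<nu>(1) phi1_pos(1) by (auto simp: e_def)
 obtain \<delta> where \<delta>: "\<delta> > 0" "\<forall>V. in_X V \<and> X_dist_set V \<O> < \<delta> -->
    (\<exists>U. is_solution \<beta> f \<infinity> U \<and> X_dist (U 0) V = 0) \<and>
    (\<forall>T U. is_solution \<beta> f T U \<and> X_dist (U 0) V = 0 --> (\<forall>t. 0 \<le> t \<and> ereal t < T --> X_dist_set (U t) \<O> < e))"
  using stab[unfolded X_stable_def, THEN spec, THEN mp, OF e(1)] by (elim exE conjE) (rule that)
 define B where "B = nrm phi + nrm phi1 + nrm phi2 + \<bar>c\<bar> * nrm phi"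
 have B: "B \<ge> 0" by (simp add: B_def)
 \<comment> \<open>The multiple of the wave by 1 + \<tau> or 1 - \<tau> lies within X-distance
   \<tau> B of it; this choice brings it below \<delta>.\<close>
 define \<tau> where "\<tau> = min (1 / 2) (\<delta> / (2 * (B + 1)))"
 have \<tau>: "\<tau> > 0" "\<tau> < 1" "\<tau> * B < \<delta>"
 proof -
  show "\<tau> > 0" "\<tau> < 1" using \<delta>(1) B by (auto simp: \<tau>_def)
  then have "\<tau> * B \<le> \<tau> * (B + 1)" by simp
  also have "\<dots> \<le> \<delta> / (2 * (B + 1)) * (B + 1)" using B by (intro mult_right_mono) (auto simp: \<tau>_def)
  also have "\<dots> = \<delta> / 2"
  proof -
   have gen: "x / (2 * b) * b = x / 2" if "b > 0" for x b :: real using that by simp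
   show ?thesis by (rule gen) (use B in simp)
  qed
  finally show "\<tau> * B < \<delta>" using \<delta>(1) by simp
 qed
 \<comment> \<open>Scaling up makes N negative and scaling down makes it positive; following the
   sign of \<open>JJ\<close> gives J N < 0, the side on which \<open>static\<close> applies.\<close>
 define k where "k = 1 + sgn JJ * \<tau>"
 have sg: "JJ > 0 \<and> k = 1 + \<tau> \<or> JJ < 0 \<and> k = 1 - \<tau>" using JJ0 by (auto simp: k_def sgn_if)
 then have k: "k > 0" "k \<noteq> 1" "\<bar>k - 1\<bar> = \<tau>" using \<tau> by auto
 define w0 where "w0 x = k * phi x" for x
 define z0 where "z0 x = - c * w0 x" for x
 have W0: "W2 w0 (%x. k * phi1 x) (%x. k * phi2 x)" unfolding w0_def by (rule W2_cmult[OF W2phi])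
 have z0: "L2 z0" unfolding z0_def by (rule L2_cmult[OF W2D(1)[OF W0]])
 have S0: "Sf \<beta> c w0 (%x. k * phi1 x) (%x. k * phi2 x) z0 < dd" unfolding z0_def w0_def by (rule scaled_state(1)[OF k(1,2)])
 have N0: "JJ * NN \<beta> c w0 (%x. k * phi1 x) (%x. k * phi2 x) < 0"
 proof -
  have e2: "k\<^sup>2 = k powr 2" using k(1) by (simp add: powr_numeral)
  have "JJ * (k\<^sup>2 - k powr (p + 1)) < 0" using sg
  proof
   assume a: "JJ > 0 \<and> k = 1 + \<tau>"
   then have "k powr 2 < k powr (p + 1)" by (intro powr_less_mono) (use p2 \<tau> in auto)
   then show ?thesis using a unfolding e2 by (simp add: mult_pos_neg)
  next
   assume a: "JJ < 0 \<and> k = 1 - \<tau>"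
   then have "k powr (p + 1) < k powr 2" by (intro powr_less_mono') (use p2 \<tau> in auto)
   then show ?thesis using a unfolding e2 by (simp add: mult_neg_pos)
  qed
  then have "(JJ * (k\<^sup>2 - k powr (p + 1))) * Iphi < 0" using gs_facts(3) by (rule mult_neg_pos)
  then show ?thesis unfolding w0_def scaled_state(2)[OF k(1,2)] by (simp add: mult.assoc)
 qed
 have mem: "(%x. phi (x + r), %x. - c * phi (x + r)) \<in> \<O>" for r unfolding \<O>_def orbit_def by auto
 have "X_dist_set (w0, z0) \<O> \<le> X_dist (w0, z0) (phi, %x. - c * phi x)"
  unfolding X_dist_set_def
 proof (rule cInf_lower)
  show "X_dist (w0, z0) (phi, %x. - c * phi x) \<in> X_dist (w0, z0) ` \<O>" using mem[of 0] by simp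
  show "bdd_below (X_dist (w0, z0) ` \<O>)" by (rule bdd_belowI[of _ 0]) (auto simp: X_dist_def X_norm_nonneg)
 qed
 also have "\<dots> \<le> ndist w0 phi + nrm (%x. k * phi1 x - phi1 x) + nrm (%x. k * phi2 x - phi2 x) + nrm (%x. z0 x - - c * phi x)"
  by (rule X_dist_le[OF W0 W2phi])
 also have "\<dots> = \<tau> * B"
 proof -
  have d: "(%x. k * q x - q x) = (%x. (k - 1) * q x)" "(%x. - c * (k * phi x) - - c * phi x) = (%x. ((k - 1) * - c) * phi x)" for q :: "real => real"
   by (simp_all add: fun_eq_iff algebra_simps)
  show ?thesis unfolding w0_def z0_def d nrm_cmult abs_mult k(3) B_def by (simp add: algebra_simps)
 qed
 finally have dl: "X_dist_set (w0, z0) \<O> < \<delta>" using \<tau>(3) by simp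
 have ix: "in_X (w0, z0)" using W2_H2[OF W0] z0 by (simp add: in_X_def)
 have ex: "(\<exists>U. is_solution \<beta> f \<infinity> U \<and> X_dist (U 0) (w0, z0) = 0) \<and>
   (\<forall>T U. is_solution \<beta> f T U \<and> X_dist (U 0) (w0, z0) = 0 --> (\<forall>t. 0 \<le> t \<and> ereal t < T --> X_dist_set (U t) \<O> < e))"
  by (rule \<delta>(2)[THEN spec, THEN mp, OF conjI[OF ix dl]])
 obtain U where U0: "is_solution \<beta> f \<infinity> U" "X_dist (U 0) (w0, z0) = 0" using ex[THEN conjunct1] by (elim exE conjE) (rule that)
 have "X_dist_set (U t) \<O> < e" if "t \<ge> 0" for t
  using ex[THEN conjunct2, THEN spec, THEN spec, THEN mp, OF conjI[OF U0], THEN spec, THEN mp] that by simp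
 note U = U0 this
 interpret S: sol p f \<beta> U by unfold_locales (rule U(1))
 have near: "\<exists>r. nrm (%x. S.u t (x + r) - phi x) < e \<and> nrm (%x. S.u1 t (x + r) - phi1 x) < e
   \<and> nrm (%x. S.u2 t (x + r) - phi2 x) < e \<and> nrm (%x. S.v t (x + r) - (- c) * phi x) < e" if t: "t \<ge> 0" for t
 proof -
  \<comment> \<open>The infimum over the orbit need not be attained, but being below e it is
    undercut by some translate; the shift changes sign when it is moved from the wave to the
    solution.\<close>
  have "\<exists>y \<in> X_dist (U t) ` \<O>. y < e"
   by (rule cInf_lessD) (use U(3)[OF t] mem[of 0] in \<open>auto simp: X_dist_set_def\<close>)
  then obtain r where r: "X_dist (S.u t, S.v t) (%x. phi (x + r), %x. - c * phi (x + r)) < e" unfolding \<O>_def orbit_def S.U_eq[of t] by auto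
  note X = X_dist_ge[OF S.W2u[OF t] W2_shift[OF W2phi, of r], of "S.v t" "%x. - c * phi (x + r)"]
  have s: "nrm (%x. y (x + - r) - z x) = nrm (%x. y x - z (x + r))" for y z :: "real => real"
   using nrm_shift[of "%x. y x - z (x + r)" "- r"] by simp
  have "nrm (%x. S.v t (x + - r) - (- c) * phi x) = nrm (%x. S.v t x - (- c) * phi (x + r))" by (rule s)
  then show ?thesis using le_less_trans[OF X(1) r] le_less_trans[OF X(2) r] le_less_trans[OF X(3) r] le_less_trans[OF X(4) r]
   by (intro exI[of _ "- r"]) (simp only: s)
 qed
 have z: "nrm (%x. S.u 0 x - w0 x) = 0" "nrm (%x. S.u1 0 x - k * phi1 x) = 0" "nrm (%x. S.u2 0 x - k * phi2 x) = 0" "nrm (%x. S.v 0 x - z0 x) = 0"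
 proof -
  note X = X_dist_ge[OF S.W2u[OF order_refl] W0, of "S.v 0" z0]
  have x: "X_dist (S.u 0, S.v 0) (w0, z0) = 0" using U(2) unfolding S.U_eq[of 0] .
  show "nrm (%x. S.u 0 x - w0 x) = 0" "nrm (%x. S.u1 0 x - k * phi1 x) = 0" "nrm (%x. S.u2 0 x - k * phi2 x) = 0" "nrm (%x. S.v 0 x - z0 x) = 0"
   by (rule antisym[OF _ nrm_nonneg]; insert X x; simp)+
 qed
 note SN = SN_cong[OF S.W2u[OF order_refl] W0 S.L2v[OF order_refl] z0 z]
 interpret dyn p f \<beta> c phi g w U es l \<rho> e \<nu>
 proof unfold_locales
  show "Sf \<beta> c (S.u 0) (S.u1 0) (S.u2 0) (S.v 0) < dd" unfolding SN(1) by (rule S0)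
  show "JJ * NN \<beta> c (S.u 0) (S.u1 0) (S.u2 0) < 0" unfolding SN(2) by (rule N0)
  show "\<exists>\<alpha>. \<bar>\<alpha>\<bar> < \<rho> \<and> GG y z \<alpha> = 0 \<and> (\<forall>\<alpha>'. \<bar>\<alpha>'\<bar> \<le> 2 * \<rho> --> HH y z \<alpha>' \<le> HH y z \<alpha>)"
   if "L2 y" "L2 z" "ndist y phi < e" "nrm (%x. z x - (- c) * phi x) < e" for y z
   by (rule e1(2)[OF that(1,2) less_le_trans[OF that(3) e(2)] less_le_trans[OF that(4) e(2)]])
  show "nrm (%x. phi (x + r) - phi x) < es / 2" if "\<bar>r\<bar> < \<rho>" for r by (rule a0(2)) (use that \<rho> in simp)
  show "nrm (%x. phi1 (x + r) - phi1 x) < es / 2" if "\<bar>r\<bar> < \<rho>" for r by (rule a1(2)) (use that \<rho> in simp)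
  show "nrm (%x. phi2 (x + r) - phi2 x) < es / 2" if "\<bar>r\<bar> < \<rho>" for r by (rule a2(2)) (use that \<rho> in simp)
 qed (fact es(3) es(2) e \<nu>(2) near)+
 show False by (rule contradiction)
qed

theorem mainTheorem14:
  fixes p \<beta> c :: real and f :: "real \<Rightarrow> real" and \<phi> :: "real \<Rightarrow> real"
  assumes p: "p \<ge> 2"
    and f_C2: "f differentiable_on UNIV" "deriv f differentiable_on UNIV"
              "continuous_on UNIV (deriv (deriv f))"
    and f_hom: "\<forall>l>0. \<forall>s. f (l * s) = l powr p * f s"
    and F_pos: "\<exists>s. Fprim f s > 0"
    and c: "c\<^sup>2 < 1"
    and \<beta>: "\<beta> < 2 * sqrt (1 - c\<^sup>2)"
    and gs: "\<phi> \<in> ground_states p f \<beta> c"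
    and cases: "c\<^sup>2 < (p - 1) / (p + 3) * (sqrt (1 - (max \<beta> 0)\<^sup>2 / 4))\<^sup>2
             \<or> (p \<ge> 9 \<and> \<beta> < (p - 1) * (p - 9) / ((p - 1)\<^sup>2 + 16) * (2 * sqrt (1 - c\<^sup>2)))"
  shows "X_unstable \<beta> f (orbit (\<phi>, \<lambda>x. - c * \<phi> x))"
proof -
 interpret gstate p f \<beta> c \<phi>
 proof unfold_locales
  show "(f has_real_derivative deriv f x) (at x)" for x
   using f_C2(1) by (simp add: differentiable_on_def DERIV_deriv_iff_real_differentiable)
  show "continuous_on UNIV (deriv f)" by (rule differentiable_imp_continuous_on[OF f_C2(2)])
  show "f (l * s) = l powr p * f s" if "l > 0" for l s using f_hom that by blast
 qed (fact p F_pos c \<beta> gs)+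
 have "\<exists>g w. direction g w" using cases
 proof
  assume i: "c\<^sup>2 < (p - 1) / (p + 3) * (sqrt (1 - (max \<beta> 0)\<^sup>2 / 4))\<^sup>2"
  define B where "B = (max \<beta> 0)\<^sup>2 / 4"
  \<comment> \<open>From \<beta> < 2 sqrt(1 - c^2) <= 2 the radicand of c_* is nonnegative, so
    squaring the root returns it.\<close>
  have "sqrt (1 - c\<^sup>2) \<le> 1" by simp
  then have "\<beta> \<le> 2" using \<beta> by linarith
  then have "max \<beta> 0 \<le> 2" by simp
  then have "(max \<beta> 0)\<^sup>2 \<le> 2\<^sup>2" by (intro power_mono) auto
  then have "(sqrt (1 - (max \<beta> 0)\<^sup>2 / 4))\<^sup>2 = 1 - B" by (simp add: B_def)
  then have "c\<^sup>2 < (p - 1) / (p + 3) * (1 - B)" using i by simp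
  then have "c\<^sup>2 * (p + 3) < (p - 1) * (1 - B)" using p by (simp add: pos_less_divide_eq)
  \<comment> \<open>Subtracting (p - 1) c^2 on both sides turns p + 3 into 4 and 1 into s = 1 -
    c^2.\<close>
  then have "4 * c\<^sup>2 < (p - 1) * (s - B)" by (simp add: s_def algebra_simps)
  then show ?thesis unfolding B_def by (rule direction_case_i)
 next
  assume ii: "p \<ge> 9 \<and> \<beta> < (p - 1) * (p - 9) / ((p - 1)\<^sup>2 + 16) * (2 * sqrt (1 - c\<^sup>2))"
  then show ?thesis by (intro direction_case_ii) (auto simp: s_def)
 qed
 then obtain g w where d: "direction g w" by blast
 interpret direct p f \<beta> c \<phi> g w by unfold_locales (rule d)
 show ?thesis by (rule orbit_unstable)
qed

end
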